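(* Let $F$ be a finite group with $\mathrm{Irr}\,F=\{U_1,\ldots,U_l\}$. Let ${\bf k}=(k_1,\ldots,k_l)$ and ${\bf r}=(r_1,\ldots,r_l)$ be integer compositions of $k$ and $r$ respectively, and put ${\bf k}+{\bf r}=(k_1+r_1,\ldots,k_l+r_l)$. Let $\Lambda=(\lambda_1,\ldots,\lambda_l)\Vdash{\bf k}$ and $\Delta=(\delta_1,\ldots,\delta_l)\Vdash{\bf r}$ be multipartitions. Then $$\mathrm{Ind}_{F\wr S_k\times F\wr S_r}^{F\wr S_{k+r}}(\Phi_\Lambda\boxtimes\Phi_\Delta)\cong\bigoplus_{\Gamma\Vdash({\bf k}+{\bf r})}C_{\Lambda,\Delta}^{\Gamma}\,\Phi_\Gamma,$$ where, for $\Gamma=(\gamma_1,\ldots,\gamma_l)$, $$C_{\Lambda,\Delta}^{\Gamma}=\prod_{i=1}^{l}c_{\lambda_i,\delta_i}^{\gamma_i}$$ and $c_{\lambda_i,\delta_i}^{\gamma_i}$ are the Littlewood-Richardson coefficients.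
   Context: All representations are finite dimensional over $\mathbb{C}$; $\mathrm{Irr}\,G$ is the set of irreducible representations of $G$ up to isomorphism; $\boxtimes$ is the outer tensor product and $\otimes$ the inner tensor product; $mV$ means the direct sum of $m$ copies of $V$. Wreath product: if a group $G$ acts on the left on a finite set $X$, $F\wr_X G$ is the set $F^X\times G$ with $(f,g)(f',g')=(f\cdot(g\ast f'),gg')$, where $(g\ast f)(x)=f(g^{-1}x)$ and $\cdot$ is pointwise multiplication. $F\wr S_n$ is the case $G=S_n$, $X=\{1,\ldots,n\}$; for $H\le S_n$, $F\wr H=F\wr_{\{1,\ldots,n\}}H\le F\wr S_n$. ($F\wr S_0$ is trivial.) $S_k\times S_r$ is the subgroup of $S_{k+r}$ in which $S_k$ permutes $\{1,\ldots,k\}$ and $S_r$ permutes $\{k+1,\ldots,k+r\}$, and $F\wr S_k\times F\wr S_r\cong F\wr(S_k\times S_r)\le F\wr S_{k+r}$; similarly for more factors. An integer composition of $n$ is a tuple of non-negative integers with sum $n$. A multipartition $\Lambda=(\lambda_1,\ldots,\lambda_l)$ of a composition ${\bf n}=(n_1,\ldots,n_l)$, written $\Lambda\Vdash{\bf n}$, is a tuple with $\lambda_i\vdash n_i$ for all $i$ (the empty partition $\varnothing$ is the only partition of $0$). $S^\lambda$ is the Specht module of $\lambda$. Irreducible representations of $F\wr S_n$: fix an indexing $\mathrm{Irr}\,F=\{U_1,\ldots,U_l\}$. Let ${\bf n}=(n_1,\ldots,n_l)$ be a composition of $n$ and $\Lambda\Vdash{\bf n}$. Let $U_{\bf n}=U_1^{\boxtimes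 n_1}\boxtimes\cdots\boxtimes U_l^{\boxtimes n_l}$ and let $\widetilde{U_{\bf n}}$ be the $F\wr(S_{n_1}\times\cdots\times S_{n_l})$-representation on the space $U_{\bf n}$ with $(f,h)\cdot(u_1\boxtimes\cdots\boxtimes u_n)=\boxtimes_{x=1}^n f(x)u_{h^{-1}x}$. Let $S^\Lambda=S^{\lambda_1}\boxtimes\cdots\boxtimes S^{\lambda_l}$ and let $\overline{S^\Lambda}$ be its inflation: the same space with $(f,h)\cdot v=h\cdot v$. Define $$\Phi_\Lambda=\mathrm{Ind}_{F\wr(S_{n_1}\times\cdots\times S_{n_l})}^{F\wr S_n}(\widetilde{U_{\bf n}}\otimes\overline{S^\Lambda}).$$ The $\Phi_\Lambda$ form a complete list of pairwise non-isomorphic irreducible representations of $F\wr S_n$. For $\lambda\vdash a$, $\delta\vdash b$, $\gamma\vdash a+b$, the Littlewood-Richardson coefficient $c_{\lambda,\delta}^\gamma$ is the multiplicity of $S^\gamma$ in $\mathrm{Ind}_{S_a\times S_b}^{S_{a+b}}(S^\lambda\boxtimes S^\delta)$. *)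

theory Defs
  imports Complex_Main "HOL-Library.Function_Algebras" "HOL-Library.FuncSet"
    "HOL-Combinatorics.Permutations" "HOL-Algebra.Sym_Groups"
begin

section \<open>Finite dimensional complex representations\<close>

text \<open>
  Vector spaces are realised as finite dimensional subspaces of a coordinate space
  \<^typ>\<open>'x \<Rightarrow> complex\<close>, so every finite dimensional complex vector space occurs, up to
  isomorphism, as soon as \<^typ>\<open>'x\<close> is infinite.
\<close>

definition cscale :: "complex \<Rightarrow> ('x \<Rightarrow> complex) \<Rightarrow> 'x \<Rightarrow> complex" where
  "cscale c f = (\<lambda>x. c * f x)"

interpretation cfun: vector_space cscale
  by unfold_locales (auto simp: cscale_def fun_eq_iff algebra_simps)

definition lin_on :: "('x \<Rightarrow> complex) set \<Rightarrow> (('x \<Rightarrow> complex) \<Rightarrow> 'y \<Rightarrow> complex) \<Rightarrow> bool" where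
  "lin_on V T \<longleftrightarrow> (\<forall>u\<in>V. \<forall>v\<in>V. T (u + v) = T u + T v) \<and>
                 (\<forall>c. \<forall>v\<in>V. T (cscale c v) = cscale c (T v))"

text \<open>The values of \<^term>\<open>act R g\<close> outside \<^term>\<open>vspace R\<close> are irrelevant.\<close>

record ('g, 'x) rep =
  vspace :: "('x \<Rightarrow> complex) set"
  act :: "'g \<Rightarrow> ('x \<Rightarrow> complex) \<Rightarrow> 'x \<Rightarrow> complex"

definition representation :: "('g, 'm) monoid_scheme \<Rightarrow> ('g, 'x) rep \<Rightarrow> bool" where
  "representation G R \<longleftrightarrow>
     (\<exists>B. finite B \<and> vspace R = cfun.span B) \<and>
     (\<forall>g\<in>carrier G. lin_on (vspace R) (act R g) \<and> act R g ` vspace R \<subseteq> vspace R) \<and>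
     (\<forall>v\<in>vspace R. act R \<one>\<^bsub>G\<^esub> v = v) \<and>
     (\<forall>g\<in>carrier G. \<forall>h\<in>carrier G. \<forall>v\<in>vspace R.
        act R (g \<otimes>\<^bsub>G\<^esub> h) v = act R g (act R h v))"

definition rep_iso :: "('g, 'm) monoid_scheme \<Rightarrow> ('g, 'x) rep \<Rightarrow> ('g, 'y) rep \<Rightarrow> bool" where
  "rep_iso G R S \<longleftrightarrow>
     (\<exists>T. lin_on (vspace R) T \<and> bij_betw T (vspace R) (vspace S) \<and>
          (\<forall>g\<in>carrier G. \<forall>v\<in>vspace R. T (act R g v) = act S g (T v)))"

definition invariant_subspace ::
  "('g, 'm) monoid_scheme \<Rightarrow> ('g, 'x) rep \<Rightarrow> ('x \<Rightarrow> complex) set \<Rightarrow> bool" where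
  "invariant_subspace G R W \<longleftrightarrow>
     cfun.subspace W \<and> W \<subseteq> vspace R \<and> (\<forall>g\<in>carrier G. act R g ` W \<subseteq> W)"

definition irreducible_rep :: "('g, 'm) monoid_scheme \<Rightarrow> ('g, 'x) rep \<Rightarrow> bool" where
  "irreducible_rep G R \<longleftrightarrow>
     representation G R \<and> vspace R \<noteq> {0} \<and>
     (\<forall>W. invariant_subspace G R W \<longrightarrow> W = {0} \<or> W = vspace R)"

text \<open>
  \<^term>\<open>irr_list G Us\<close>: the list indexes the isomorphism classes of irreducible representations
  of \<^term>\<open>G\<close>.  Completeness is tested on representations inside \<^typ>\<open>nat \<Rightarrow> complex\<close>, where
  every finite dimensional representation has an isomorphic copy.
\<close>

definition irr_list :: "('g, 'm) monoid_scheme \<Rightarrow> ('g, 'x) rep list \<Rightarrow> bool" where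
  "irr_list G Us \<longleftrightarrow>
     (\<forall>i<length Us. irreducible_rep G (Us ! i)) \<and>
     (\<forall>i<length Us. \<forall>j<length Us. i \<noteq> j \<longrightarrow> \<not> rep_iso G (Us ! i) (Us ! j)) \<and>
     (\<forall>R :: ('g, nat) rep. irreducible_rep G R \<longrightarrow> (\<exists>i<length Us. rep_iso G R (Us ! i)))"

section \<open>Constructions of representations\<close>

definition pullback :: "('h \<Rightarrow> 'g) \<Rightarrow> ('g, 'x) rep \<Rightarrow> ('h, 'x) rep" where
  "pullback \<phi> R = \<lparr>vspace = vspace R, act = (\<lambda>h. act R (\<phi> h))\<rparr>"

text \<open>
  Linear extension: the map, linear on the span of all \<^term>\<open>p u\<close> with \<^term>\<open>u \<in> P\<close>, which
  sends \<^term>\<open>p u\<close> to \<^term>\<open>q u\<close>.  It is unique on this span if it exists.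
\<close>

definition lin_ext ::
  "'u set \<Rightarrow> ('u \<Rightarrow> 'x \<Rightarrow> complex) \<Rightarrow> ('u \<Rightarrow> 'y \<Rightarrow> complex) \<Rightarrow> ('x \<Rightarrow> complex) \<Rightarrow> 'y \<Rightarrow> complex" where
  "lin_ext P p q = (SOME T. lin_on (cfun.span (p ` P)) T \<and> (\<forall>u\<in>P. T (p u) = q u))"

definition pure2 :: "('x \<Rightarrow> complex) \<times> ('y \<Rightarrow> complex) \<Rightarrow> 'x \<times> 'y \<Rightarrow> complex" where
  "pure2 = (\<lambda>(v, w) (x, y). v x * w y)"

definition outer_tensor :: "('g, 'x) rep \<Rightarrow> ('h, 'y) rep \<Rightarrow> ('g \<times> 'h, 'x \<times> 'y) rep"
    (infixr \<open>\<boxtimes>\<close> 70) where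
  "R \<boxtimes> S =
     \<lparr>vspace = cfun.span (pure2 ` (vspace R \<times> vspace S)),
      act = (\<lambda>(g, h). lin_ext (vspace R \<times> vspace S) pure2
                        (\<lambda>(v, w). pure2 (act R g v, act S h w)))\<rparr>"

definition inner_tensor :: "('g, 'x) rep \<Rightarrow> ('g, 'y) rep \<Rightarrow> ('g, 'x \<times> 'y) rep" where
  "inner_tensor R S = pullback (\<lambda>g. (g, g)) (R \<boxtimes> S)"

text \<open>
  The pure tensor of a family of vectors indexed by the finite set \<^term>\<open>I\<close>.  Only the
  coordinates in \<^term>\<open>I\<close> of the argument \<^term>\<open>\<phi>\<close> matter, so these functions span a copy of
  the tensor product.
\<close>

definition pure_tensor :: "'i set \<Rightarrow> ('i \<Rightarrow> 'x \<Rightarrow> complex) \<Rightarrow> ('i \<Rightarrow> 'x) \<Rightarrow> complex" where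
  "pure_tensor I u = (\<lambda>\<phi>. \<Prod>i\<in>I. u i (\<phi> i))"

definition tensor_space :: "'i set \<Rightarrow> ('i \<Rightarrow> ('x \<Rightarrow> complex) set) \<Rightarrow> (('i \<Rightarrow> 'x) \<Rightarrow> complex) set" where
  "tensor_space I V = cfun.span (pure_tensor I ` (\<Pi>\<^sub>E i\<in>I. V i))"

text \<open>Iterated outer tensor product, a representation of the product of the groups.\<close>

definition outer_tensor_family :: "'i set \<Rightarrow> ('i \<Rightarrow> ('g, 'x) rep) \<Rightarrow> ('i \<Rightarrow> 'g, 'i \<Rightarrow> 'x) rep" where
  "outer_tensor_family I R =
     \<lparr>vspace = tensor_space I (\<lambda>i. vspace (R i)),
      act = (\<lambda>g. lin_ext (\<Pi>\<^sub>E i\<in>I. vspace (R i)) (pure_tensor I)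
                   (\<lambda>u. pure_tensor I (\<lambda>i. act (R i) (g i) (u i))))\<rparr>"

definition direct_sum :: "'j set \<Rightarrow> ('j \<Rightarrow> ('g, 'x) rep) \<Rightarrow> ('g, 'j \<times> 'x) rep" where
  "direct_sum J R =
     \<lparr>vspace = {f. \<forall>j. if j \<in> J then (\<lambda>x. f (j, x)) \<in> vspace (R j) else (\<forall>x. f (j, x) = 0)},
      act = (\<lambda>g f (j, x). if j \<in> J then act (R j) g (\<lambda>y. f (j, y)) x else 0)\<rparr>"

definition copies :: "nat \<Rightarrow> ('g, 'x) rep \<Rightarrow> ('g, nat \<times> 'x) rep" where
  "copies m R = direct_sum {..<m} (\<lambda>_. R)"

text \<open>
  Induction from a subgroup with carrier \<^term>\<open>H\<close> to \<^term>\<open>G\<close>, in the function model: maps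
  \<open>f : G \<rightarrow> V\<close> with \<open>f (x h) = h\<^sup>-\<^sup>1 f x\<close> and action \<open>(g f) x = f (g\<^sup>-\<^sup>1 x)\<close>.  The maps supported on
  \<^term>\<open>H\<close> form a copy of \<open>V\<close>, and the whole space is the direct sum of the
  translates of this copy over the left cosets of \<^term>\<open>H\<close>.
\<close>

definition Ind :: "('g, 'm) monoid_scheme \<Rightarrow> 'g set \<Rightarrow> ('g, 'x) rep \<Rightarrow> ('g, 'g \<times> 'x) rep" where
  "Ind G H R =
     \<lparr>vspace = {f. (\<forall>x\<in>carrier G. (\<lambda>y. f (x, y)) \<in> vspace R) \<and>
                   (\<forall>x. x \<notin> carrier G \<longrightarrow> (\<forall>y. f (x, y) = 0)) \<and>
                   (\<forall>x\<in>carrier G. \<forall>h\<in>H.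
                      (\<lambda>y. f (x \<otimes>\<^bsub>G\<^esub> h, y)) = act R (inv\<^bsub>G\<^esub> h) (\<lambda>y. f (x, y)))},
      act = (\<lambda>g f (x, y). if x \<in> carrier G then f (inv\<^bsub>G\<^esub> g \<otimes>\<^bsub>G\<^esub> x, y) else 0)\<rparr>"

text \<open>
  \<^term>\<open>irr_decomposition G R WW\<close>: the space of \<^term>\<open>R\<close> is the internal direct sum of the
  irreducible subrepresentations in \<^term>\<open>WW\<close>.
\<close>

definition irr_decomposition ::
  "('g, 'm) monoid_scheme \<Rightarrow> ('g, 'x) rep \<Rightarrow> ('x \<Rightarrow> complex) set set \<Rightarrow> bool" where
  "irr_decomposition G R WW \<longleftrightarrow>
     finite WW \<and>
     (\<forall>W\<in>WW. invariant_subspace G R W \<and> irreducible_rep G (R\<lparr>vspace := W\<rparr>)) \<and>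
     bij_betw (\<lambda>w. \<Sum>W\<in>WW. w W) (\<Pi>\<^sub>E W\<in>WW. W) (vspace R)"

definition multiplicity ::
  "('g, 'm) monoid_scheme \<Rightarrow> ('g, 'y) rep \<Rightarrow> ('g, 'x) rep \<Rightarrow> nat" where
  "multiplicity G S R =
     (THE m. \<exists>WW. irr_decomposition G R WW \<and>
                  m = card {W \<in> WW. rep_iso G (R\<lparr>vspace := W\<rparr>) S})"

section \<open>Wreath products and Young subgroups\<close>

definition wreath ::
  "('f, 'm) monoid_scheme \<Rightarrow> 'x set \<Rightarrow> ('g \<Rightarrow> 'x \<Rightarrow> 'x) \<Rightarrow> ('g, 'n) monoid_scheme
     \<Rightarrow> (('x \<Rightarrow> 'f) \<times> 'g) monoid" where
  "wreath F X a G =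
     \<lparr>carrier = (X \<rightarrow>\<^sub>E carrier F) \<times> carrier G,
      mult = (\<lambda>(f, g) (f', g'). (\<lambda>x\<in>X. f x \<otimes>\<^bsub>F\<^esub> f' (a (inv\<^bsub>G\<^esub> g) x), g \<otimes>\<^bsub>G\<^esub> g')),
      one = (\<lambda>x\<in>X. \<one>\<^bsub>F\<^esub>, \<one>\<^bsub>G\<^esub>)\<rparr>"

definition wreath_sym :: "('f, 'm) monoid_scheme \<Rightarrow> nat \<Rightarrow> ((nat \<Rightarrow> 'f) \<times> (nat \<Rightarrow> nat)) monoid" where
  "wreath_sym F n = wreath F {1..n} (\<lambda>p. p) (sym_group n)"

definition wreath_sub ::
  "('f, 'm) monoid_scheme \<Rightarrow> nat \<Rightarrow> (nat \<Rightarrow> nat) set \<Rightarrow> ((nat \<Rightarrow> 'f) \<times> (nat \<Rightarrow> nat)) set" where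
  "wreath_sub F n H = ({1..n} \<rightarrow>\<^sub>E carrier F) \<times> H"

text \<open>
  A composition \<^term>\<open>ns\<close> of \<^term>\<open>n\<close> cuts \<open>{1..n}\<close> into consecutive blocks; lists are indexed
  from 0.
\<close>

definition offset :: "nat list \<Rightarrow> nat \<Rightarrow> nat" where
  "offset ns i = sum_list (take i ns)"

definition block :: "nat list \<Rightarrow> nat \<Rightarrow> nat set" where
  "block ns i = {offset ns i <.. offset ns i + ns ! i}"

definition block_index :: "nat list \<Rightarrow> nat \<Rightarrow> nat" where
  "block_index ns x = (THE i. i < length ns \<and> x \<in> block ns i)"

definition young :: "nat list \<Rightarrow> (nat \<Rightarrow> nat) set" where
  "young ns = {p. p permutes {1..sum_list ns} \<and> (\<forall>i<length ns. p ` block ns i = block ns i)}"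

text \<open>
  The component in \<open>S\<^bsub>ns ! i\<^esub>\<close> of an element of \<open>S\<^bsub>ns ! 0\<^esub> \<times> S\<^bsub>ns ! 1\<^esub> \<times> \<dots>\<close>, shifted so that it
  permutes \<open>{1..ns ! i}\<close>.
\<close>

definition young_component :: "nat list \<Rightarrow> nat \<Rightarrow> (nat \<Rightarrow> nat) \<Rightarrow> nat \<Rightarrow> nat" where
  "young_component ns i p =
     (\<lambda>x. if x \<in> {1..ns ! i} then p (offset ns i + x) - offset ns i else x)"

text \<open>The identifications of \<open>S\<^bsub>k\<^esub> \<times> S\<^bsub>r\<^esub>\<close> and \<open>F \<wr> (S\<^bsub>k\<^esub> \<times> S\<^bsub>r\<^esub>)\<close> with direct products.\<close>

definition sym_split :: "nat \<Rightarrow> nat \<Rightarrow> (nat \<Rightarrow> nat) \<Rightarrow> (nat \<Rightarrow> nat) \<times> (nat \<Rightarrow> nat)" where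
  "sym_split k r p = (young_component [k, r] 0 p, young_component [k, r] 1 p)"

definition wreath_split :: "nat \<Rightarrow> nat \<Rightarrow> (nat \<Rightarrow> 'f) \<times> (nat \<Rightarrow> nat) \<Rightarrow>
    ((nat \<Rightarrow> 'f) \<times> (nat \<Rightarrow> nat)) \<times> ((nat \<Rightarrow> 'f) \<times> (nat \<Rightarrow> nat))" where
  "wreath_split k r = (\<lambda>(f, p).
     ((\<lambda>x\<in>{1..k}. f x, young_component [k, r] 0 p),
      (\<lambda>x\<in>{1..r}. f (k + x), young_component [k, r] 1 p)))"

section \<open>Partitions, Specht modules and Littlewood-Richardson coefficients\<close>

definition partition_of :: "nat list \<Rightarrow> nat \<Rightarrow> bool" where
  "partition_of \<mu> n \<longleftrightarrow> sorted_wrt (\<ge>) \<mu> \<and> 0 \<notin> set \<mu> \<and> sum_list \<mu> = n"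

definition multipartition_of :: "nat list list \<Rightarrow> nat list \<Rightarrow> bool" (infix \<open>\<tturnstile>\<close> 50) where
  "\<Lambda> \<tturnstile> ns \<longleftrightarrow> length \<Lambda> = length ns \<and> (\<forall>i<length ns. partition_of (\<Lambda> ! i) (ns ! i))"

definition diagram :: "nat list \<Rightarrow> (nat \<times> nat) set" where
  "diagram \<mu> = {(i, j). i < length \<mu> \<and> j < \<mu> ! i}"

definition tableau :: "nat list \<Rightarrow> (nat \<times> nat \<Rightarrow> nat) \<Rightarrow> bool" where
  "tableau \<mu> t \<longleftrightarrow> bij_betw t (diagram \<mu>) {1..sum_list \<mu>}"

text \<open>
  Tabloids are represented by the list of their rows, as sets of entries.  The permutation module
  is the space of functions on tabloids, with basis the indicator functions.
\<close>

definition tabloid :: "nat list \<Rightarrow> (nat \<times> nat \<Rightarrow> nat) \<Rightarrow> nat set list" where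
  "tabloid \<mu> t = map (\<lambda>i. t ` {(i, j) | j. j < \<mu> ! i}) [0..<length \<mu>]"

definition column_stabilizer :: "nat list \<Rightarrow> (nat \<times> nat \<Rightarrow> nat) \<Rightarrow> (nat \<Rightarrow> nat) set" where
  "column_stabilizer \<mu> t =
     {p. p permutes {1..sum_list \<mu>} \<and>
         (\<forall>j. p ` t ` {c \<in> diagram \<mu>. snd c = j} = t ` {c \<in> diagram \<mu>. snd c = j})}"

definition polytabloid :: "nat list \<Rightarrow> (nat \<times> nat \<Rightarrow> nat) \<Rightarrow> nat set list \<Rightarrow> complex" where
  "polytabloid \<mu> t =
     (\<lambda>T. \<Sum>p\<in>column_stabilizer \<mu> t.
            of_int (sign p) * (if T = map (image p) (tabloid \<mu> t) then 1 else 0))"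

definition specht :: "nat list \<Rightarrow> (nat \<Rightarrow> nat, nat set list) rep" where
  "specht \<mu> =
     \<lparr>vspace = cfun.span (polytabloid \<mu> ` {t. tableau \<mu> t}),
      act = (\<lambda>p v T. v (map (image (Hilbert_Choice.inv p)) T))\<rparr>"

definition lr_coeff :: "nat list \<Rightarrow> nat list \<Rightarrow> nat list \<Rightarrow> nat" where
  "lr_coeff \<mu> \<delta> \<gamma> =
     (let a = sum_list \<mu>; b = sum_list \<delta> in
      multiplicity (sym_group (a + b)) (specht \<gamma>)
        (Ind (sym_group (a + b)) (young [a, b])
          (pullback (sym_split a b) (specht \<mu> \<boxtimes> specht \<delta>))))"

section \<open>The irreducible representations of \<open>F \<wr> S\<^bsub>n\<^esub>\<close>\<close>

definition U_tilde :: "('f, 'u) rep list \<Rightarrow> nat list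
    \<Rightarrow> ((nat \<Rightarrow> 'f) \<times> (nat \<Rightarrow> nat), nat \<Rightarrow> 'u) rep" where
  "U_tilde Us ns =
     (let I = {1..sum_list ns}; U = (\<lambda>x. Us ! block_index ns x) in
      \<lparr>vspace = tensor_space I (\<lambda>x. vspace (U x)),
       act = (\<lambda>(f, h). lin_ext (\<Pi>\<^sub>E x\<in>I. vspace (U x)) (pure_tensor I)
                (\<lambda>u. pure_tensor I (\<lambda>x. act (U x) (f x) (u (Hilbert_Choice.inv h x)))))\<rparr>)"

definition specht_multi :: "nat list list \<Rightarrow> (nat \<Rightarrow> nat, nat \<Rightarrow> nat set list) rep" where
  "specht_multi \<Lambda> =
     pullback (\<lambda>p i. young_component (map sum_list \<Lambda>) i p)
       (outer_tensor_family {..<length \<Lambda>} (\<lambda>i. specht (\<Lambda> ! i)))"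

definition Phi :: "('f, 'm) monoid_scheme \<Rightarrow> ('f, 'u) rep list \<Rightarrow> nat list list
    \<Rightarrow> ((nat \<Rightarrow> 'f) \<times> (nat \<Rightarrow> nat),
        ((nat \<Rightarrow> 'f) \<times> (nat \<Rightarrow> nat)) \<times> ((nat \<Rightarrow> 'u) \<times> (nat \<Rightarrow> nat set list))) rep" where
  "Phi F Us \<Lambda> =
     (let ns = map sum_list \<Lambda>; n = sum_list ns in
      Ind (wreath_sym F n) (wreath_sub F n (young ns))
        (inner_tensor (U_tilde Us ns) (pullback snd (specht_multi \<Lambda>))))"

end

theory Submission
  imports Defs
begin

text \<open>
  Representations of a finite group with equal characters are isomorphic, so it suffices to compare
  characters at an element \<open>(f, p)\<close>.  Left cosets of the Young subgroup of a composition correspond to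
  colourings of \<open>{1..n}\<close> with prescribed class sizes, and the fixed cosets to the colourings constant
  on the cycles of \<open>p\<close>; hence the character of an induced representation is a sum over invariant
  colourings.  For the left-hand side this gives a sum over pairs of colourings, one by the two
  factors and one by the irreducible representations of \<open>F\<close>.  Summing first over the colouring by the
  two factors, class by class, produces the induced characters of the symmetric groups, which expand
  into Specht characters with the Littlewood-Richardson coefficients; the result is the character of
  the right-hand side.  For the expansion one needs that the Specht modules are irreducible, pairwise
  non-isomorphic and exhaust the irreducible representations of the symmetric group.
\<close>

section \<open>Coordinates and traces\<close>

text \<open>An explicit isomorphism would have to follow chosen coset representatives through nested
  inductions; characters forget these choices. Everything rests on one elementary device: a finite
  dimensional space of functions has finitely many evaluation points with a dual basis. Each trace
  is then a sum of values at points, and each construction (tensor product, direct sum, induction)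
  supplies its own dual basis. The pairing of characters uses \<open>inv g\<close> where complex
  conjugation is customary; its value is |G| times the dimension of a space of intertwiners, hence
  visibly a natural multiple of |G|.

  The obstacle in the combinatorics is that a colour class is an arbitrary subset of
  \<open>{1..n}\<close>, whereas Specht modules know only permutations of \<open>{1..a}\<close>.
  Hence Specht characters, traces of tensor powers and characters of \<open>Phi\<close> are
  rewritten as quantities attached to any finite set with a permutation; conjugation invariance
  makes them independent of an enumeration. After that both sides are sums over the same pairs of
  colourings, taken in two orders.\<close>

lemma cscale_apply [simp]: "cscale c f x = c * f x"
  by (simp add: cscale_def)

lemma sum_fun_apply: "(\<Sum>i\<in>I. F i) x = (\<Sum>i\<in>I. F i x)" for F :: "'i \<Rightarrow> 'x \<Rightarrow> complex"
  by (induction I rule: infinite_finite_induct) auto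

section \<open>Maps that are linear on a subspace\<close>

lemma lin_onI:
  assumes "\<And>u v. u \<in> V \<Longrightarrow> v \<in> V \<Longrightarrow> T (u + v) = T u + T v"
    and "\<And>c v. v \<in> V \<Longrightarrow> T (cscale c v) = cscale c (T v)"
  shows "lin_on V T"
  using assms by (auto simp: lin_on_def)

lemma lin_on_add: "lin_on V T \<Longrightarrow> u \<in> V \<Longrightarrow> v \<in> V \<Longrightarrow> T (u + v) = T u + T v"
  by (simp add: lin_on_def)

lemma lin_on_scale: "lin_on V T \<Longrightarrow> v \<in> V \<Longrightarrow> T (cscale c v) = cscale c (T v)"
  by (simp add: lin_on_def)

lemma lin_on_zero: "lin_on V T \<Longrightarrow> 0 \<in> V \<Longrightarrow> T 0 = 0"
  by (metis cfun.scale_zero_left lin_on_scale)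

lemma lin_on_diff:
  assumes "lin_on V T" "cfun.subspace V" "u \<in> V" "v \<in> V"
  shows "T (u - v) = T u - T v"
proof -
  have "T (u - v) + T v = T u"
    using assms lin_on_add[OF assms(1), of "u - v" v] cfun.subspace_diff[of V u v] by auto
  then show ?thesis by (simp add: algebra_simps)
qed

lemma lin_on_sum:
  assumes "lin_on V T" "cfun.subspace V" "\<And>i. i \<in> I \<Longrightarrow> f i \<in> V"
  shows "T (\<Sum>i\<in>I. f i) = (\<Sum>i\<in>I. T (f i))"
  using assms(3)
proof (induction I rule: infinite_finite_induct)
  case (insert i I)
  have "T (sum f (insert i I)) = T (f i + sum f I)" using insert by simp
  also have "\<dots> = T (f i) + T (sum f I)"
    using insert cfun.subspace_sum[OF assms(2), of I f] by (intro lin_on_add[OF assms(1)]) auto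
  also have "T (sum f I) = (\<Sum>i\<in>I. T (f i))" using insert by blast
  also have "T (f i) + (\<Sum>i\<in>I. T (f i)) = (\<Sum>i\<in>insert i I. T (f i))"
    by (rule sum.insert[OF insert(1,2), symmetric])
  finally show ?case .
qed (use lin_on_zero[OF assms(1) cfun.subspace_0[OF assms(2)]] in auto)

lemma lin_on_lincomb:
  assumes "lin_on V T" "cfun.subspace V" "\<And>i. i \<in> I \<Longrightarrow> f i \<in> V"
  shows "T (\<Sum>i\<in>I. cscale (a i) (f i)) = (\<Sum>i\<in>I. cscale (a i) (T (f i)))"
proof -
  have "T (\<Sum>i\<in>I. cscale (a i) (f i)) = (\<Sum>i\<in>I. T (cscale (a i) (f i)))"
    by (intro lin_on_sum[OF assms(1,2)] cfun.subspace_scale[OF assms(2)] assms(3))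
  also have "\<dots> = (\<Sum>i\<in>I. cscale (a i) (T (f i)))"
    using assms by (intro sum.cong refl lin_on_scale[OF assms(1)])
  finally show ?thesis .
qed

lemma lin_on_subset: "lin_on V T \<Longrightarrow> W \<subseteq> V \<Longrightarrow> lin_on W T"
  by (simp add: lin_on_def subset_iff)

lemma lin_on_comp: "lin_on V S \<Longrightarrow> S ` V \<subseteq> W \<Longrightarrow> lin_on W T \<Longrightarrow> lin_on V (\<lambda>v. T (S v))"
  by (simp add: lin_on_def image_subset_iff)

lemma lin_on_id: "lin_on V (\<lambda>v. v)"
  by (simp add: lin_on_def)

lemma lin_on_sum_fun:
  "(\<And>i. i \<in> I \<Longrightarrow> lin_on V (T i)) \<Longrightarrow> lin_on V (\<lambda>v. \<Sum>i\<in>I. T i v)"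
  by (auto simp: lin_on_def sum.distrib cfun.scale_sum_right)

lemma lin_on_eq_span:
  assumes "lin_on (cfun.span B) S" "lin_on (cfun.span B) T" "\<And>b. b \<in> B \<Longrightarrow> S b = T b"
    "v \<in> cfun.span B"
  shows "S v = T v"
proof -
  have "cfun.subspace {v \<in> cfun.span B. S v = T v}"
    unfolding cfun.subspace_def using assms(1,2) lin_on_zero[OF assms(1) cfun.span_zero]
      lin_on_zero[OF assms(2) cfun.span_zero]
    by (simp add: lin_on_def cfun.span_zero cfun.span_add cfun.span_scale)
  then have "cfun.span B \<subseteq> {v \<in> cfun.span B. S v = T v}"
    using assms(3) by (intro cfun.span_minimal) (auto intro: cfun.span_base)
  then show ?thesis using assms(4) by blast
qed

lemma lin_on_span_closed:
  assumes "lin_on (cfun.span B) T" "\<And>b. b \<in> B \<Longrightarrow> T b \<in> W" "cfun.subspace W" "v \<in> cfun.span B"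
  shows "T v \<in> W"
proof -
  have "cfun.subspace {v \<in> cfun.span B. T v \<in> W}"
    unfolding cfun.subspace_def using assms(1,3) lin_on_zero[OF assms(1) cfun.span_zero]
    by (simp add: lin_on_def cfun.span_zero cfun.span_add cfun.span_scale cfun.subspace_0
        cfun.subspace_add cfun.subspace_scale)
  then have "cfun.span B \<subseteq> {v \<in> cfun.span B. T v \<in> W}"
    using assms(2) by (intro cfun.span_minimal) (auto intro: cfun.span_base)
  then show ?thesis using assms(4) by blast
qed

text \<open>
  A finite dimensional space of functions is determined by its values at suitable finitely many
  points; a basis dual to these points turns traces into explicit sums.
\<close>

definition coords :: "('x \<Rightarrow> complex) set \<Rightarrow> 'x set \<Rightarrow> ('x \<Rightarrow> 'x \<Rightarrow> complex) \<Rightarrow> bool" where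
  "coords V P b \<longleftrightarrow> finite P \<and> cfun.subspace V \<and> (\<forall>p\<in>P. b p \<in> V) \<and>
     (\<forall>p\<in>P. \<forall>q\<in>P. b p q = (if p = q then 1 else 0)) \<and>
     (\<forall>v\<in>V. v = (\<Sum>p\<in>P. cscale (v p) (b p)))"

definition fdim :: "('x \<Rightarrow> complex) set \<Rightarrow> bool" where
  "fdim V \<longleftrightarrow> (\<exists>B. finite B \<and> V = cfun.span B)"

lemma coordsD:
  assumes "coords V P b"
  shows "finite P" "cfun.subspace V" "p \<in> P \<Longrightarrow> b p \<in> V"
    "p \<in> P \<Longrightarrow> q \<in> P \<Longrightarrow> b p q = (if p = q then 1 else 0)"
    "v \<in> V \<Longrightarrow> (\<Sum>p\<in>P. cscale (v p) (b p)) = v"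
    "v \<in> V \<Longrightarrow> v x = (\<Sum>p\<in>P. v p * b p x)"
proof -
  show 5: "v \<in> V \<Longrightarrow> (\<Sum>p\<in>P. cscale (v p) (b p)) = v" for v
    using assms by (auto simp: coords_def)
  show "v \<in> V \<Longrightarrow> v x = (\<Sum>p\<in>P. v p * b p x)"
    using arg_cong[OF 5, of v "\<lambda>f. f x"] by (simp add: sum_fun_apply)
qed (use assms in \<open>auto simp: coords_def\<close>)

lemma coords_lin:
  assumes "coords V P b" "lin_on V T" "v \<in> V"
  shows "T v x = (\<Sum>p\<in>P. v p * T (b p) x)"
proof -
  have "T v = T (\<Sum>p\<in>P. cscale (v p) (b p))" using coordsD(5)[OF assms(1,3)] by simp
  also have "\<dots> = (\<Sum>p\<in>P. cscale (v p) (T (b p)))"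
    using assms coordsD by (intro lin_on_lincomb) auto
  finally show ?thesis by (simp add: sum_fun_apply)
qed

lemma coords_span: "coords V P b \<Longrightarrow> cfun.span (b ` P) = V"
proof
  assume c: "coords V P b"
  show "cfun.span (b ` P) \<subseteq> V"
    using coordsD[OF c] by (intro cfun.span_minimal) auto
  show "V \<subseteq> cfun.span (b ` P)"
  proof
    fix v assume "v \<in> V"
    then have "v = (\<Sum>p\<in>P. cscale (v p) (b p))" using coordsD(5)[OF c] by simp
    also have "\<dots> \<in> cfun.span (b ` P)"
      by (intro cfun.span_sum cfun.span_scale cfun.span_base) auto
    finally show "v \<in> cfun.span (b ` P)" .
  qed
qed

lemma coords_fdim: "coords V P b \<Longrightarrow> fdim V"
  unfolding fdim_def using coords_span coordsD(1) by (metis finite_imageI)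

lemma coordsI:
  assumes "finite P" "cfun.subspace V" "\<And>p. p \<in> P \<Longrightarrow> b p \<in> V"
    "\<And>p q. p \<in> P \<Longrightarrow> q \<in> P \<Longrightarrow> b p q = (if p = q then 1 else 0)"
    "\<And>v x. v \<in> V \<Longrightarrow> v x = (\<Sum>p\<in>P. v p * b p x)"
  shows "coords V P b"
  unfolding coords_def using assms by (auto simp: fun_eq_iff sum_fun_apply)

text \<open>Gaussian elimination, one generator at a time. Subtracting from \<open>u\<close> its
  interpolation at the old points leaves \<open>w\<close>, which vanishes at all of them. If
  \<open>w\<close> is zero the span has not grown; otherwise any point \<open>q\<close> with
  \<open>w q \<noteq> 0\<close> becomes a new evaluation point.\<close>

lemma coords_span_exists:
  assumes "finite B"
  shows "\<exists>P b. coords (cfun.span B) P b"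
  using assms
proof (induction B)
  case empty
  have "coords (cfun.span {}) {} (\<lambda>_ _. 0)"
    by (rule coordsI) auto
  then show ?case by blast
next
  case (insert u B)
  then obtain P b where c: "coords (cfun.span B) P b" by blast
  define w where "w = u - (\<Sum>p\<in>P. cscale (u p) (b p))"
  have s: "(\<Sum>p\<in>P. cscale (u p) (b p)) \<in> cfun.span B"
    using coordsD(3)[OF c] by (intro cfun.span_sum cfun.span_scale) auto
  have wP: "w p = 0" if "p \<in> P" for p
  proof -
    have "(\<Sum>q\<in>P. u q * b q p) = (\<Sum>q\<in>P. if q = p then u q else 0)"
      using that coordsD(4)[OF c] by (intro sum.cong) auto
    then show ?thesis using that coordsD(1)[OF c] by (simp add: w_def sum_fun_apply)
  qed
  have sp: "cfun.span (insert u B) = {v + cscale a w | v a. v \<in> cfun.span B}" (is "_ = ?R")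
  proof (intro equalityI subsetI)
    fix x assume "x \<in> cfun.span (insert u B)"
    then obtain a where a: "x - cscale a u \<in> cfun.span B" by (auto simp: cfun.span_insert)
    have "x = ((x - cscale a u) + cscale a (\<Sum>p\<in>P. cscale (u p) (b p))) + cscale a w"
      by (simp add: w_def cfun.scale_right_diff_distrib)
    moreover have "(x - cscale a u) + cscale a (\<Sum>p\<in>P. cscale (u p) (b p)) \<in> cfun.span B"
      using a s by (intro cfun.span_add cfun.span_scale)
    ultimately show "x \<in> ?R" by blast
  next
    fix x assume "x \<in> ?R"
    then obtain v a where v: "x = v + cscale a w" "v \<in> cfun.span B" by blast
    have "cfun.span B \<subseteq> cfun.span (insert u B)" by (rule cfun.span_mono) auto
    moreover have "u \<in> cfun.span (insert u B)" by (rule cfun.span_base) auto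
    ultimately show "x \<in> cfun.span (insert u B)"
      using v s unfolding w_def by (auto intro!: cfun.span_add cfun.span_scale cfun.span_diff)
  qed
  show ?case
  proof (cases "w = 0")
    case True
    then have "cfun.span (insert u B) = cfun.span B" by (auto simp: sp)
    then show ?thesis using c by metis
  next
    case False
    then obtain q where q: "w q \<noteq> 0" by (auto simp: fun_eq_iff)
    with wP have qP: "q \<notin> P" by auto
    \<comment> \<open>\<open>e\<close> is \<open>w\<close> normalised to take the value 1 at
      \<open>q\<close>. The old basis vectors are corrected by multiples of \<open>e\<close> so as
      to vanish at \<open>q\<close>; their values at the old points stay, because \<open>e\<close>
      vanishes there.\<close>
    define e where "e = cscale (1 / w q) w"
    define b' where "b' = (\<lambda>p. if p = q then e else b p - cscale (b p q) e)"
    have eq: "e q = 1" "\<And>p. p \<in> P \<Longrightarrow> e p = 0" using q wP by (auto simp: e_def)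
    have mem: "v + cscale a w \<in> cfun.span (insert u B)" if "v \<in> cfun.span B" for v a
      using that sp by blast
    have eS: "e \<in> cfun.span (insert u B)"
      using mem[OF cfun.span_zero, of "1 / w q"] by (simp add: e_def)
    have bS: "b p \<in> cfun.span (insert u B)" if "p \<in> P" for p
      using mem[of "b p" 0] that coordsD(3)[OF c] by simp
    have "coords (cfun.span (insert u B)) (insert q P) b'"
    proof (rule coordsI)
      show "finite (insert q P)" using coordsD(1)[OF c] by simp
      show "b' p \<in> cfun.span (insert u B)" if "p \<in> insert q P" for p
        using that eS bS by (auto simp: b'_def intro!: cfun.span_diff cfun.span_scale)
      show "b' p r = (if p = r then 1 else 0)" if "p \<in> insert q P" "r \<in> insert q P" for p r
        using that eq qP coordsD(4)[OF c] by (auto simp: b'_def)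
      fix v x assume "v \<in> cfun.span (insert u B)"
      then obtain y a where y: "v = y + cscale a w" "y \<in> cfun.span B" using sp by blast
      have vP: "v p = y p" if "p \<in> P" for p using y wP that by simp
      have yq: "y t = (\<Sum>p\<in>P. y p * b p t)" for t using coordsD(6)[OF c y(2)] .
      have "(\<Sum>p\<in>P. v p * b' p x) = (\<Sum>p\<in>P. y p * b p x - y p * b p q * e x)"
        using qP vP by (intro sum.cong refl) (auto simp: b'_def algebra_simps)
      also have "\<dots> = (\<Sum>p\<in>P. y p * b p x) - (\<Sum>p\<in>P. y p * b p q) * e x"
        by (simp add: sum_subtractf sum_distrib_right)
      also have "\<dots> = y x - y q * e x" using yq by metis
      finally have "(\<Sum>p\<in>insert q P. v p * b' p x) = v q * e x + (y x - y q * e x)"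
        using qP coordsD(1)[OF c] by (simp add: b'_def)
      also have "\<dots> = v x" using q y by (simp add: e_def field_simps)
      finally show "v x = (\<Sum>p\<in>insert q P. v p * b' p x)" by simp
    qed simp
    then show ?thesis by blast
  qed
qed

lemma fdim_coords: "fdim V \<Longrightarrow> \<exists>P b. coords V P b"
  using coords_span_exists by (auto simp: fdim_def)

lemma fdim_subspace: "fdim V \<Longrightarrow> cfun.subspace V"
  by (auto simp: fdim_def)

lemma fdim_subset:
  assumes "fdim V" "cfun.subspace W" "W \<subseteq> V"
  shows "fdim W"
proof -
  obtain B where B: "finite B" "V = cfun.span B" using assms(1) by (auto simp: fdim_def)
  obtain C where C: "C \<subseteq> W" "cfun.independent C" "W \<subseteq> cfun.span C"
    using cfun.maximal_independent_subset[of W] by blast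
  have "finite C"
    using cfun.independent_span_bound[OF B(1) C(2)] C(1) assms(3) B(2) by blast
  moreover have "cfun.span C = W"
    using C assms(2) cfun.span_minimal by blast
  ultimately show ?thesis by (auto simp: fdim_def)
qed

section \<open>Traces of linear maps\<close>

definition ltrace :: "('x \<Rightarrow> complex) set \<Rightarrow> (('x \<Rightarrow> complex) \<Rightarrow> 'x \<Rightarrow> complex) \<Rightarrow> complex" where
  "ltrace V T = (case (SOME (P, b). coords V P b) of (P, b) \<Rightarrow> \<Sum>p\<in>P. T (b p) p)"

text \<open>Both sides are the same double sum over pairs of points. With the identity in the role
  of one map it also compares two coordinate systems of one space, which is how the trace becomes
  well defined.\<close>

lemma trace_comm_coords:
  assumes "coords V P b" "coords W Q c"
    and "lin_on V X" "X ` V \<subseteq> W" "lin_on W Y" "Y ` W \<subseteq> V"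
  shows "(\<Sum>p\<in>P. Y (X (b p)) p) = (\<Sum>q\<in>Q. X (Y (c q)) q)"
proof -
  have "(\<Sum>p\<in>P. Y (X (b p)) p) = (\<Sum>p\<in>P. \<Sum>q\<in>Q. X (b p) q * Y (c q) p)"
    using assms coordsD(3)[OF assms(1)] by (intro sum.cong refl coords_lin) auto
  also have "\<dots> = (\<Sum>q\<in>Q. \<Sum>p\<in>P. Y (c q) p * X (b p) q)"
    by (subst sum.swap) (simp add: mult.commute)
  also have "\<dots> = (\<Sum>q\<in>Q. X (Y (c q)) q)"
    using assms coordsD(3)[OF assms(2)] by (intro sum.cong refl coords_lin[symmetric]) auto
  finally show ?thesis .
qed

text \<open>Independence of the coordinates picked by \<open>SOME\<close>: the chosen system and the
  given one are compared by \<open>trace_comm_coords\<close> with the identity.\<close>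

lemma ltrace_coords:
  assumes "coords V P b" "lin_on V T" "T ` V \<subseteq> V"
  shows "ltrace V T = (\<Sum>p\<in>P. T (b p) p)"
proof -
  obtain Q c where Q: "(SOME (P, b). coords V P b) = (Q, c)" by fastforce
  have "case (Q, c) of (P, b) \<Rightarrow> coords V P b"
    unfolding Q[symmetric] by (rule someI[of _ "(P, b)"]) (use assms in auto)
  then have "coords V Q c" by simp
  from trace_comm_coords[OF this assms(1) assms(2,3) lin_on_id] show ?thesis
    by (simp add: ltrace_def Q)
qed

lemma ltrace_comm:
  assumes "fdim V" "fdim W" "lin_on V X" "X ` V \<subseteq> W" "lin_on W Y" "Y ` W \<subseteq> V"
  shows "ltrace V (\<lambda>v. Y (X v)) = ltrace W (\<lambda>w. X (Y w))"
proof -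
  obtain P b Q c where c: "coords V P b" "coords W Q c"
    using assms(1,2) fdim_coords by metis
  show ?thesis
    using trace_comm_coords[OF c assms(3-)] ltrace_coords[OF c(1) lin_on_comp[OF assms(3-5)]]
      ltrace_coords[OF c(2) lin_on_comp[OF assms(5,6,3)]] assms(4,6)
    by (simp add: image_subset_iff)
qed

text \<open>Actions are unspecified off their space, so only the values on \<open>V\<close> may
  count. Both traces use the same chosen basis, which lies in \<open>V\<close>.\<close>

lemma ltrace_cong:
  assumes "fdim V" "\<And>v. v \<in> V \<Longrightarrow> S v = T v"
  shows "ltrace V S = ltrace V T"
proof -
  obtain P b where c: "coords V P b" using assms fdim_coords by metis
  obtain Q c where Q: "(SOME (P, b). coords V P b) = (Q, c)" by fastforce
  have "case (Q, c) of (P, b) \<Rightarrow> coords V P b"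
    unfolding Q[symmetric] by (rule someI[of _ "(P, b)"]) (use c in auto)
  then have "coords V Q c" by simp
  then show ?thesis using assms(2) coordsD(3) by (fastforce simp: ltrace_def Q intro: sum.cong)
qed

lemma ltrace_sum:
  assumes "fdim V" "finite I" "\<And>i. i \<in> I \<Longrightarrow> lin_on V (T i)" "\<And>i. i \<in> I \<Longrightarrow> T i ` V \<subseteq> V"
  shows "ltrace V (\<lambda>v. \<Sum>i\<in>I. T i v) = (\<Sum>i\<in>I. ltrace V (T i))"
proof -
  obtain P b where c: "coords V P b" using assms fdim_coords by metis
  have "ltrace V (\<lambda>v. \<Sum>i\<in>I. T i v) = (\<Sum>p\<in>P. \<Sum>i\<in>I. T i (b p) p)"
    using assms(3,4)
    by (subst ltrace_coords[OF c])
      (auto simp: sum_fun_apply intro!: lin_on_sum_fun cfun.subspace_sum[OF coordsD(2)[OF c]])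
  also have "\<dots> = (\<Sum>i\<in>I. \<Sum>p\<in>P. T i (b p) p)" by (rule sum.swap)
  also have "\<dots> = (\<Sum>i\<in>I. ltrace V (T i))"
    using assms by (intro sum.cong refl ltrace_coords[OF c, symmetric]) auto
  finally show ?thesis .
qed

lemma ltrace_id: "coords V P b \<Longrightarrow> ltrace V (\<lambda>v. v) = of_nat (card P)"
  by (subst ltrace_coords) (auto simp: lin_on_id coordsD)

text \<open>The trace of the identity serves as the dimension, both as an induction measure for
  decompositions and as the number of independent intertwiners.\<close>

lemma ltrace_id_pos:
  assumes "fdim V"
  obtains d :: nat where "ltrace V (\<lambda>v. v) = of_nat d" "d > 0 \<longleftrightarrow> V \<noteq> {0}"
proof -
  obtain P b where c: "coords V P b" using assms fdim_coords by metis
  have "P = {} \<longleftrightarrow> V = {0}"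
  proof
    assume "P = {}"
    then show "V = {0}" using coordsD[OF c] cfun.subspace_0 coords_span[OF c] by auto
  next
    assume V: "V = {0}"
    show "P = {}"
    proof (rule ccontr)
      assume "P \<noteq> {}"
      then obtain p where p: "p \<in> P" by auto
      then show False using V coordsD(3)[OF c p] coordsD(4)[OF c p p] by auto
    qed
  qed
  then show ?thesis using that[of "card P"] ltrace_id[OF c] coordsD(1)[OF c] by (auto simp: card_gt_0_iff)
qed

text \<open>Split \<open>T\<close> into the maps \<open>T (\<pi> i v)\<close> and rotate the
  projection to the left with \<open>ltrace_comm\<close>; on \<open>W i\<close> the composite
  \<open>\<pi> i (T w)\<close> is just \<open>T w\<close>.\<close>

lemma ltrace_decomp:
  assumes "fdim V" "finite I" "lin_on V T"
    and "\<And>i. i \<in> I \<Longrightarrow> cfun.subspace (W i)" "\<And>i. i \<in> I \<Longrightarrow> W i \<subseteq> V"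
    and "\<And>i. i \<in> I \<Longrightarrow> lin_on V (\<pi> i)" "\<And>i. i \<in> I \<Longrightarrow> \<pi> i ` V \<subseteq> W i"
    and "\<And>i w. i \<in> I \<Longrightarrow> w \<in> W i \<Longrightarrow> \<pi> i w = w"
    and "\<And>v. v \<in> V \<Longrightarrow> (\<Sum>i\<in>I. \<pi> i v) = v"
    and "\<And>i. i \<in> I \<Longrightarrow> T ` W i \<subseteq> W i"
  shows "ltrace V T = (\<Sum>i\<in>I. ltrace (W i) T)"
proof -
  have T: "lin_on V (\<lambda>v. T (\<pi> i v))" if "i \<in> I" for i
    using lin_on_comp[OF assms(6)[OF that] _ assms(3)] assms(5,7)[OF that] by blast
  have TV: "(\<lambda>v. T (\<pi> i v)) ` V \<subseteq> V" if "i \<in> I" for i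
    using assms(5,7,10)[OF that] by blast
  have fW: "fdim (W i)" if "i \<in> I" for i
    using fdim_subset[OF assms(1) assms(4,5)] that by blast
  have "ltrace V T = ltrace V (\<lambda>v. \<Sum>i\<in>I. T (\<pi> i v))"
  proof (rule ltrace_cong[OF assms(1)])
    fix v assume v: "v \<in> V"
    have "T v = T (\<Sum>i\<in>I. \<pi> i v)" using assms v by simp
    also have "\<dots> = (\<Sum>i\<in>I. T (\<pi> i v))"
      using assms(5,7) v by (intro lin_on_sum[OF assms(3) fdim_subspace[OF assms(1)]]) blast
    finally show "T v = (\<Sum>i\<in>I. T (\<pi> i v))" .
  qed
  also have "\<dots> = (\<Sum>i\<in>I. ltrace V (\<lambda>v. T (\<pi> i v)))"
    by (intro ltrace_sum[OF assms(1,2)] T TV)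
  also have "\<dots> = (\<Sum>i\<in>I. ltrace (W i) T)"
  proof (rule sum.cong[OF refl])
    fix i assume i: "i \<in> I"
    have "ltrace V (\<lambda>v. T (\<pi> i v)) = ltrace (W i) (\<lambda>w. \<pi> i (T w))"
      using assms(5,10)[OF i]
      by (intro ltrace_comm assms(1,6,7) fW i lin_on_subset[OF assms(3)]) auto
    also have "\<dots> = ltrace (W i) T"
      using assms(8,10)[OF i] by (intro ltrace_cong fW[OF i]) blast
    finally show "ltrace V (\<lambda>v. T (\<pi> i v)) = ltrace (W i) T" .
  qed
  finally show ?thesis .
qed

section \<open>Characters of finite groups\<close>

lemma repD:
  assumes "representation G R"
  shows "fdim (vspace R)" "cfun.subspace (vspace R)"
    "g \<in> carrier G \<Longrightarrow> lin_on (vspace R) (act R g)"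
    "g \<in> carrier G \<Longrightarrow> v \<in> vspace R \<Longrightarrow> act R g v \<in> vspace R"
    "v \<in> vspace R \<Longrightarrow> act R \<one>\<^bsub>G\<^esub> v = v"
    "g \<in> carrier G \<Longrightarrow> h \<in> carrier G \<Longrightarrow> v \<in> vspace R \<Longrightarrow>
      act R (g \<otimes>\<^bsub>G\<^esub> h) v = act R g (act R h v)"
  using assms fdim_subspace by (auto simp: representation_def fdim_def image_subset_iff)

lemma repI:
  assumes "fdim (vspace R)" "\<And>g. g \<in> carrier G \<Longrightarrow> lin_on (vspace R) (act R g)"
    "\<And>g v. g \<in> carrier G \<Longrightarrow> v \<in> vspace R \<Longrightarrow> act R g v \<in> vspace R"
    "\<And>v. v \<in> vspace R \<Longrightarrow> act R \<one>\<^bsub>G\<^esub> v = v"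
    "\<And>g h v. g \<in> carrier G \<Longrightarrow> h \<in> carrier G \<Longrightarrow> v \<in> vspace R \<Longrightarrow>
      act R (g \<otimes>\<^bsub>G\<^esub> h) v = act R g (act R h v)"
  shows "representation G R"
  using assms by (auto simp: representation_def fdim_def)

definition character :: "('g, 'x) rep \<Rightarrow> 'g \<Rightarrow> complex" where
  "character R g = ltrace (vspace R) (act R g)"

definition intertwiner ::
  "('g, 'm) monoid_scheme \<Rightarrow> ('g, 'x) rep \<Rightarrow> ('g, 'y) rep \<Rightarrow> (('x \<Rightarrow> complex) \<Rightarrow> 'y \<Rightarrow> complex) \<Rightarrow> bool" where
  "intertwiner G R S T \<longleftrightarrow> lin_on (vspace R) T \<and> T ` vspace R \<subseteq> vspace S \<and>
     (\<forall>g\<in>carrier G. \<forall>v\<in>vspace R. T (act R g v) = act S g (T v))"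

lemma rep_iso_iff: "rep_iso G R S \<longleftrightarrow> (\<exists>T. intertwiner G R S T \<and> bij_betw T (vspace R) (vspace S))"
  by (auto simp: rep_iso_def intertwiner_def bij_betw_def)

lemma character_coords:
  assumes "representation G R" "coords (vspace R) P b" "g \<in> carrier G"
  shows "character R g = (\<Sum>p\<in>P. act R g (b p) p)"
  unfolding character_def using assms repD(3,4)[OF assms(1,3)] by (intro ltrace_coords) auto

lemma lin_on_inv_into:
  assumes "lin_on V T" "bij_betw T V W" "cfun.subspace V"
  shows "lin_on W (inv_into V T)"
proof -
  let ?S = "inv_into V T"
  have inj: "inj_on T V" and im: "T ` V = W" using assms(2) by (auto simp: bij_betw_def)
  have S: "?S w \<in> V" "T (?S w) = w" if "w \<in> W" for w
    using that im by (auto simp: inv_into_into f_inv_into_f)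
  show ?thesis
  proof (rule lin_onI)
    fix u v assume uv: "u \<in> W" "v \<in> W"
    have m: "?S u + ?S v \<in> V" using S uv assms(3) by (simp add: cfun.subspace_add)
    have "T (?S u + ?S v) = u + v"
      unfolding lin_on_add[OF assms(1) S(1)[OF uv(1)] S(1)[OF uv(2)]] S(2)[OF uv(1)] S(2)[OF uv(2)] ..
    then show "?S (u + v) = ?S u + ?S v" using inv_into_f_f[OF inj m] by metis
  next
    fix c v assume v: "v \<in> W"
    have m: "cscale c (?S v) \<in> V" using S v assms(3) by (intro cfun.subspace_scale)
    have "T (cscale c (?S v)) = cscale c v"
      unfolding lin_on_scale[OF assms(1) S(1)[OF v]] S(2)[OF v] ..
    then show "?S (cscale c v) = cscale c (?S v)" using inv_into_f_f[OF inj m] by metis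
  qed
qed

lemma rep_iso_sym:
  assumes "representation G R" "rep_iso G R S"
  shows "rep_iso G S R"
proof -
  obtain T where T: "lin_on (vspace R) T" "bij_betw T (vspace R) (vspace S)"
    "\<And>g v. g \<in> carrier G \<Longrightarrow> v \<in> vspace R \<Longrightarrow> T (act R g v) = act S g (T v)"
    using assms by (auto simp: rep_iso_def)
  let ?S = "inv_into (vspace R) T"
  have b: "bij_betw ?S (vspace S) (vspace R)" by (rule bij_betw_inv_into[OF T(2)])
  have "?S (act S g v) = act R g (?S v)" if g: "g \<in> carrier G" and v: "v \<in> vspace S" for g v
  proof -
    have m: "?S v \<in> vspace R" using b v by (auto simp: bij_betw_def)
    have "T (act R g (?S v)) = act S g v"
      using T(3)[OF g m] bij_betw_inv_into_right[OF T(2) v] by simp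
    then show ?thesis
      using bij_betw_inv_into_left[OF T(2) repD(4)[OF assms(1) g m]] by simp
  qed
  then show ?thesis
    unfolding rep_iso_def using b lin_on_inv_into[OF T(1,2) repD(2)[OF assms(1)]] by blast
qed

lemma rep_iso_trans:
  assumes "rep_iso G R S" "rep_iso G S U"
  shows "rep_iso G R U"
proof -
  obtain T where T: "lin_on (vspace R) T" "bij_betw T (vspace R) (vspace S)"
    "\<And>g v. g \<in> carrier G \<Longrightarrow> v \<in> vspace R \<Longrightarrow> T (act R g v) = act S g (T v)"
    using assms(1) by (auto simp: rep_iso_def)
  obtain T' where T': "lin_on (vspace S) T'" "bij_betw T' (vspace S) (vspace U)"
    "\<And>g v. g \<in> carrier G \<Longrightarrow> v \<in> vspace S \<Longrightarrow> T' (act S g v) = act U g (T' v)"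
    using assms(2) by (auto simp: rep_iso_def)
  have TS: "T v \<in> vspace S" if "v \<in> vspace R" for v using that T(2) by (auto simp: bij_betw_def)
  have "lin_on (vspace R) (\<lambda>v. T' (T v))"
    using TS by (intro lin_on_comp[OF T(1) _ T'(1)]) auto
  moreover have "bij_betw (\<lambda>v. T' (T v)) (vspace R) (vspace U)"
    using bij_betw_trans[OF T(2) T'(2)] by (simp add: comp_def)
  ultimately show ?thesis
    unfolding rep_iso_def using T(3) T'(3) TS by (intro exI[of _ "\<lambda>v. T' (T v)"]) simp
qed

lemma rep_iso_refl: "rep_iso G R R"
  unfolding rep_iso_def by (intro exI[of _ "\<lambda>v. v"]) (auto simp: lin_on_id bij_betw_def)

text \<open>Insert the inverse of \<open>T\<close> followed by \<open>T\<close> in front of the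
  action and rotate the inverse to the other end: the action on \<open>R\<close> becomes its
  conjugate by \<open>T\<close>, which is the action on \<open>S\<close>.\<close>

lemma rep_iso_character:
  assumes "representation G R" "representation G S" "rep_iso G R S" "g \<in> carrier G"
  shows "character R g = character S g"
proof -
  obtain T where T: "lin_on (vspace R) T" "bij_betw T (vspace R) (vspace S)"
    "\<And>g v. g \<in> carrier G \<Longrightarrow> v \<in> vspace R \<Longrightarrow> T (act R g v) = act S g (T v)"
    using assms by (auto simp: rep_iso_def)
  let ?S = "inv_into (vspace R) T"
  let ?X = "\<lambda>v. T (act R g v)"
  have TS: "T v \<in> vspace S" if "v \<in> vspace R" for v using that T(2) by (auto simp: bij_betw_def)
  have SR: "?S v \<in> vspace R" if "v \<in> vspace S" for v
    using that bij_betw_inv_into[OF T(2)] by (auto simp: bij_betw_def)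
  note R = repD[OF assms(1)] and S = repD[OF assms(2)]
  have X: "lin_on (vspace R) ?X"
    using R(4)[OF assms(4)] by (intro lin_on_comp[OF R(3)[OF assms(4)] _ T(1)]) auto
  have "character R g = ltrace (vspace R) (\<lambda>v. ?S (?X v))"
    unfolding character_def
    using R(4)[OF assms(4)] bij_betw_inv_into_left[OF T(2)] by (intro ltrace_cong R(1)) simp
  also have "\<dots> = ltrace (vspace S) (\<lambda>v. ?X (?S v))"
    using TS SR R(4)[OF assms(4)]
    by (intro ltrace_comm R(1) S(1) X lin_on_inv_into T R(2)) auto
  also have "\<dots> = character S g"
    unfolding character_def
    using T(3)[OF assms(4)] SR bij_betw_inv_into_right[OF T(2)] by (intro ltrace_cong S(1)) simp
  finally show ?thesis .
qed

lemma invariant_rep: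
  assumes "representation G R" "invariant_subspace G R W"
  shows "representation G (R\<lparr>vspace := W\<rparr>)"
proof (rule repI)
  have W: "cfun.subspace W" "W \<subseteq> vspace R" "\<And>g. g \<in> carrier G \<Longrightarrow> act R g ` W \<subseteq> W"
    using assms(2) by (auto simp: invariant_subspace_def)
  note R = repD[OF assms(1)]
  show "fdim (vspace (R\<lparr>vspace := W\<rparr>))" using fdim_subset[OF R(1) W(1,2)] by simp
  show "lin_on (vspace (R\<lparr>vspace := W\<rparr>)) (act (R\<lparr>vspace := W\<rparr>) g)" if "g \<in> carrier G" for g
    using lin_on_subset[OF R(3)[OF that] W(2)] by simp
  show "act (R\<lparr>vspace := W\<rparr>) g v \<in> vspace (R\<lparr>vspace := W\<rparr>)"
    if "g \<in> carrier G" "v \<in> vspace (R\<lparr>vspace := W\<rparr>)" for g v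
    using W(3)[OF that(1)] that(2) by auto
  show "act (R\<lparr>vspace := W\<rparr>) \<one>\<^bsub>G\<^esub> v = v" if "v \<in> vspace (R\<lparr>vspace := W\<rparr>)" for v
    using R(5)[of v] W(2) that by auto
  show "act (R\<lparr>vspace := W\<rparr>) (g \<otimes>\<^bsub>G\<^esub> h) v = act (R\<lparr>vspace := W\<rparr>) g (act (R\<lparr>vspace := W\<rparr>) h v)"
    if "g \<in> carrier G" "h \<in> carrier G" "v \<in> vspace (R\<lparr>vspace := W\<rparr>)" for g h v
    using R(6)[OF that(1,2), of v] W(2) that(3) by auto
qed

section \<open>Averaging over the group and complete reducibility\<close>

locale fin_group = group + assumes fin: "finite (carrier G)"
begin

lemma card_pos: "card (carrier G) > 0"
  using fin one_closed card_gt_0_iff by blast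

lemma sum_left_translate:
  assumes "h \<in> carrier G"
  shows "(\<Sum>g\<in>carrier G. f (h \<otimes> g)) = (\<Sum>g\<in>carrier G. f g)"
  by (rule sum.reindex_bij_witness[where i = "\<lambda>g. inv h \<otimes> g" and j = "\<lambda>g. h \<otimes> g"])
    (use assms in \<open>auto simp: m_assoc[symmetric]\<close>)

text \<open>The Reynolds operator, which projects the linear maps from \<open>R\<close> to
  \<open>S\<close> onto the intertwiners.\<close>

definition average ::
  "('a, 'x) rep \<Rightarrow> ('a, 'y) rep \<Rightarrow> (('x \<Rightarrow> complex) \<Rightarrow> 'y \<Rightarrow> complex) \<Rightarrow> ('x \<Rightarrow> complex) \<Rightarrow> 'y \<Rightarrow> complex"
  where "average R S T v =
    cscale (1 / of_nat (card (carrier G))) (\<Sum>g\<in>carrier G. act S g (T (act R (inv g) v)))"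

text \<open>Replacing the summation variable \<open>g\<close> by \<open>h \<otimes> g\<close>
  cancels the \<open>h\<close> inside the argument and brings it out as an action on the
  left.\<close>

lemma average_intertwiner:
  assumes R: "representation G R" and S: "representation G S"
    and T: "lin_on (vspace R) T" "\<And>v. v \<in> vspace R \<Longrightarrow> T v \<in> vspace S"
  shows "intertwiner G R S (average R S T)"
proof -
  note R = repD[OF R] and S = repD[OF S]
  have TS: "act S g (T (act R (inv g) v)) \<in> vspace S" if "g \<in> carrier G" "v \<in> vspace R" for g v
    using that R S T by simp
  have l: "lin_on (vspace R) (\<lambda>v. act S g (T (act R (inv g) v)))" if g: "g \<in> carrier G" for g
    by (rule lin_on_comp[of _ "\<lambda>v. T (act R (inv g) v)" "vspace S"],
        rule lin_on_comp[OF R(3) _ T(1)]) (use g R(3,4) S(3) T(2) in auto)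
  have L: "lin_on (vspace R) (average R S T)"
    unfolding average_def
    by (rule lin_on_comp[where T = "cscale _" and W = UNIV, OF lin_on_sum_fun[OF l]])
      (auto simp: lin_on_def cfun.scale_right_distrib mult.commute)
  have I: "average R S T ` vspace R \<subseteq> vspace S"
    unfolding average_def using TS S(2)
    by (auto intro!: cfun.subspace_scale cfun.subspace_sum)
  have "average R S T (act R h v) = act S h (average R S T v)"
    if h: "h \<in> carrier G" and v: "v \<in> vspace R" for h v
  proof -
    have "(\<Sum>g\<in>carrier G. act S g (T (act R (inv g) (act R h v))))
        = (\<Sum>g\<in>carrier G. act S (h \<otimes> g) (T (act R (inv (h \<otimes> g)) (act R h v))))"
      by (rule sum_left_translate[OF h, symmetric])
    also have "\<dots> = (\<Sum>g\<in>carrier G. act S h (act S g (T (act R (inv g) v))))"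
    proof (rule sum.cong[OF refl])
      fix g assume g: "g \<in> carrier G"
      have "act R (inv (h \<otimes> g)) (act R h v) = act R (inv g) v"
        using g h v R(4) by (simp add: R(6)[symmetric] inv_mult_group m_assoc)
      then show "act S (h \<otimes> g) (T (act R (inv (h \<otimes> g)) (act R h v)))
          = act S h (act S g (T (act R (inv g) v)))"
        using g h v T R(4) by (simp add: S(6))
    qed
    also have "\<dots> = act S h (\<Sum>g\<in>carrier G. act S g (T (act R (inv g) v)))"
      using TS v by (intro lin_on_sum[OF S(3)[OF h] S(2), symmetric]) auto
    finally have e: "(\<Sum>g\<in>carrier G. act S g (T (act R (inv g) (act R h v)))) =
      act S h (\<Sum>g\<in>carrier G. act S g (T (act R (inv g) v)))" .
    show ?thesis
      unfolding average_def e
      using TS v by (intro lin_on_scale[OF S(3)[OF h], symmetric] cfun.subspace_sum[OF S(2)]) auto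
  qed
  with L I show ?thesis by (auto simp: intertwiner_def)
qed

text \<open>Stated at a single vector because the projection behind Maschke's theorem commutes with
  the group only on the subspace onto which it projects.\<close>

lemma average_fixed:
  assumes R: "representation G R" and S: "representation G S" and v: "v \<in> vspace R"
    and T: "T v \<in> vspace S" "\<And>g. g \<in> carrier G \<Longrightarrow> T (act R (inv g) v) = act S (inv g) (T v)"
  shows "average R S T v = T v"
proof -
  note S = repD[OF S]
  have "(\<Sum>g\<in>carrier G. act S g (T (act R (inv g) v))) = (\<Sum>g\<in>carrier G. T v)"
    using T v by (intro sum.cong refl) (simp add: S(6)[symmetric] S(5))
  then show ?thesis using card_pos by (auto simp: average_def fun_eq_iff sum_fun_apply)
qed

text \<open>
  Evaluation at the dual points of a subspace is a projection onto it; averaging makes it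
  equivariant.
\<close>

lemma maschke_projection:
  assumes R: "representation G R" and W: "invariant_subspace G R W"
  obtains T where "intertwiner G R (R\<lparr>vspace := W\<rparr>) T" "\<And>w. w \<in> W \<Longrightarrow> T w = w"
proof -
  have W': "cfun.subspace W" "W \<subseteq> vspace R" "\<And>g w. g \<in> carrier G \<Longrightarrow> w \<in> W \<Longrightarrow> act R g w \<in> W"
    using W by (auto simp: invariant_subspace_def)
  note rW = invariant_rep[OF R W]
  obtain Q c where c: "coords W Q c"
    using fdim_coords fdim_subset[OF repD(1)[OF R] W'(1,2)] by blast
  define T where "T = (\<lambda>v. \<Sum>q\<in>Q. cscale (v q) (c q))"
  have T: "lin_on (vspace R) T"
    by (auto simp: T_def lin_on_def fun_eq_iff sum_fun_apply algebra_simps sum.distrib sum_distrib_left)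
  have TW: "T v \<in> W" for v
    unfolding T_def using coordsD(3)[OF c] by (intro cfun.subspace_sum cfun.subspace_scale W'(1))
  have id: "T w = w" if "w \<in> W" for w using coordsD(5)[OF c that] by (simp add: T_def)
  have "average R (R\<lparr>vspace := W\<rparr>) T w = w" if w: "w \<in> W" for w
  proof -
    have "average R (R\<lparr>vspace := W\<rparr>) T w = T w"
      by (rule average_fixed[OF R rW]) (use w id W' in auto)
    then show ?thesis using id w by simp
  qed
  then show ?thesis
    using average_intertwiner[OF R rW T] TW that[of "average R (R\<lparr>vspace := W\<rparr>) T"] by simp
qed

text \<open>The complement is the kernel of an equivariant projection onto \<open>W\<close>. The
  equation of traces says that dimensions add up, which drives the induction in
  \<open>irr_decomposition_exists\<close>.\<close>

lemma maschke:
  assumes R: "representation G R" and W: "invariant_subspace G R W"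
  obtains W' where "invariant_subspace G R W'" "W \<inter> W' = {0}"
    "\<And>v. v \<in> vspace R \<Longrightarrow> \<exists>w\<in>W. \<exists>w'\<in>W'. v = w + w'"
    "ltrace (vspace R) (\<lambda>v. v) = ltrace W (\<lambda>v. v) + ltrace W' (\<lambda>v. v)"
proof -
  obtain T where T: "intertwiner G R (R\<lparr>vspace := W\<rparr>) T" "\<And>w. w \<in> W \<Longrightarrow> T w = w"
    using maschke_projection[OF R W] by blast
  then have T': "lin_on (vspace R) T" "\<And>v. v \<in> vspace R \<Longrightarrow> T v \<in> W"
    "\<And>g v. g \<in> carrier G \<Longrightarrow> v \<in> vspace R \<Longrightarrow> T (act R g v) = act R g (T v)"
    by (auto simp: intertwiner_def)
  have W': "cfun.subspace W" "W \<subseteq> vspace R"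
    using W by (auto simp: invariant_subspace_def)
  note R' = repD[OF R]
  define K where "K = {v \<in> vspace R. T v = 0}"
  have z: "T 0 = 0" by (rule lin_on_zero[OF T'(1) cfun.subspace_0[OF R'(2)]])
  have sK: "cfun.subspace K"
    unfolding K_def cfun.subspace_def
    using T'(1) z R'(2) cfun.subspace_0[OF R'(2)] cfun.subspace_add[OF R'(2)] cfun.subspace_scale[OF R'(2)]
    by (simp add: lin_on_def)
  have K: "invariant_subspace G R K"
    unfolding invariant_subspace_def
  proof (intro conjI ballI sK)
    fix g assume g: "g \<in> carrier G"
    have "act R g 0 = 0" by (rule lin_on_zero[OF R'(3)[OF g] cfun.subspace_0[OF R'(2)]])
    then show "act R g ` K \<subseteq> K" using T'(3)[OF g] R'(4)[OF g] by (auto simp: K_def)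
  qed (auto simp: K_def)
  have int: "W \<inter> K = {0}"
    using T(2) W'(1) z cfun.subspace_0[OF W'(1)] cfun.subspace_0[OF R'(2)] by (auto simp: K_def)
  have dK: "v - T v \<in> K" if v: "v \<in> vspace R" for v
  proof -
    have "T (v - T v) = T v - T (T v)"
      using T'(2)[OF v] W'(2) by (intro lin_on_diff[OF T'(1) R'(2) v]) auto
    then show ?thesis
      using T(2)[OF T'(2)[OF v]] cfun.subspace_diff[OF R'(2) v, of "T v"] T'(2)[OF v] W'(2)
      by (auto simp: K_def)
  qed
  have dec: "\<exists>w\<in>W. \<exists>w'\<in>K. v = w + w'" if "v \<in> vspace R" for v
    using T'(2)[OF that] dK[OF that] by (intro bexI[of _ "T v"] bexI[of _ "v - T v"]) auto
  \<comment> \<open>The projection \<open>T\<close> and its complement \<open>v - T v\<close>,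
    indexed by truth values to fit the shape of \<open>ltrace_decomp\<close>.\<close>
  define X where "X = (\<lambda>i. if i then W else K)"
  define \<pi> where "\<pi> = (\<lambda>i. if i then T else (\<lambda>v. v - T v))"
  have "ltrace (vspace R) (\<lambda>v. v) = (\<Sum>i\<in>UNIV. ltrace (X i) (\<lambda>v. v))"
  proof (rule ltrace_decomp[where \<pi> = \<pi>])
    show "lin_on (vspace R) (\<pi> i)" for i
      using T'(1) by (auto simp: \<pi>_def lin_on_def algebra_simps fun_eq_iff)
  qed (use T T' W' sK dK R'(1) in \<open>auto simp: X_def \<pi>_def K_def UNIV_bool lin_on_id\<close>)
  then have "ltrace (vspace R) (\<lambda>v. v) = ltrace W (\<lambda>v. v) + ltrace K (\<lambda>v. v)"
    by (simp add: UNIV_bool X_def)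
  then show ?thesis using that[OF K int] dec by blast
qed

end

lemma add_eq_add_imp_diff_eq: "a + b = c + d \<Longrightarrow> a - c = d - b" for a :: "'a :: ab_group_add"
  by (simp add: algebra_simps)

text \<open>All pieces carry the action of one fixed \<open>R\<close>, so gluing two decompositions
  only concerns the subspaces: unique sums over \<open>A\<close> and over \<open>B\<close> combine
  to unique sums over the union because \<open>W\<close> and \<open>W'\<close> meet
  trivially.\<close>

lemma irr_decomposition_union:
  fixes R :: "('g, 'x) rep"
  assumes 1: "irr_decomposition G (R\<lparr>vspace := W\<rparr>) A" and 2: "irr_decomposition G (R\<lparr>vspace := W'\<rparr>) B"
    and sub: "cfun.subspace W" "cfun.subspace W'" "cfun.subspace V" "W \<subseteq> V" "W' \<subseteq> V"
    and int: "W \<inter> W' = {0}" and V: "\<And>v. v \<in> V \<Longrightarrow> \<exists>w\<in>W. \<exists>w'\<in>W'. v = w + w'"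
  shows "irr_decomposition G (R\<lparr>vspace := V\<rparr>) (A \<union> B)"
proof -
  have fin: "finite A" "finite B"
    and A: "\<And>X. X \<in> A \<Longrightarrow> invariant_subspace G (R\<lparr>vspace := W\<rparr>) X \<and> irreducible_rep G (R\<lparr>vspace := X\<rparr>)"
    and B: "\<And>X. X \<in> B \<Longrightarrow> invariant_subspace G (R\<lparr>vspace := W'\<rparr>) X \<and> irreducible_rep G (R\<lparr>vspace := X\<rparr>)"
    and bA: "bij_betw (\<lambda>w. \<Sum>X\<in>A. w X) (\<Pi>\<^sub>E X\<in>A. X) W"
    and bB: "bij_betw (\<lambda>w. \<Sum>X\<in>B. w X) (\<Pi>\<^sub>E X\<in>B. X) W'"
    using 1 2 by (auto simp: irr_decomposition_def)
  \<comment> \<open>A common member would lie in the zero space \<open>W \<inter> W'\<close>, but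
    irreducible pieces are nonzero. Without this the set union would merge two summands into
    one.\<close>
  have disj: "A \<inter> B = {}"
  proof (rule ccontr)
    assume "A \<inter> B \<noteq> {}"
    then obtain X where X: "X \<in> A" "X \<in> B" by auto
    then have "X \<subseteq> W \<inter> W'" "cfun.subspace X" "X \<noteq> {0}"
      using A[OF X(1)] B[OF X(2)] by (auto simp: invariant_subspace_def irreducible_rep_def)
    then show False using int cfun.subspace_0 by blast
  qed
  have split: "(\<Sum>X\<in>A \<union> B. w X) = (\<Sum>X\<in>A. restrict w A X) + (\<Sum>X\<in>B. restrict w B X)"
    for w :: "('x \<Rightarrow> complex) set \<Rightarrow> 'x \<Rightarrow> complex"
    using fin disj by (simp add: sum.union_disjoint)
  have rA: "restrict w A \<in> (\<Pi>\<^sub>E X\<in>A. X)" and rB: "restrict w B \<in> (\<Pi>\<^sub>E X\<in>B. X)"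
    if "w \<in> (\<Pi>\<^sub>E X\<in>A \<union> B. X)" for w
    using that by (simp_all add: PiE_iff)
  have sA: "(\<Sum>X\<in>A. restrict w A X) \<in> W" and sB: "(\<Sum>X\<in>B. restrict w B X) \<in> W'"
    if "w \<in> (\<Pi>\<^sub>E X\<in>A \<union> B. X)" for w
    using bij_betw_imp_surj_on[OF bA] bij_betw_imp_surj_on[OF bB] rA[OF that] rB[OF that] by blast+
  have "bij_betw (\<lambda>w. \<Sum>X\<in>A \<union> B. w X) (\<Pi>\<^sub>E X\<in>A \<union> B. X) V"
    unfolding bij_betw_def
  proof
    show "inj_on (\<lambda>w. \<Sum>X\<in>A \<union> B. w X) (\<Pi>\<^sub>E X\<in>A \<union> B. X)"
    proof (rule inj_onI)
      fix w w' assume w: "w \<in> (\<Pi>\<^sub>E X\<in>A \<union> B. X)" "w' \<in> (\<Pi>\<^sub>E X\<in>A \<union> B. X)"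
        and eq: "(\<Sum>X\<in>A \<union> B. w X) = (\<Sum>X\<in>A \<union> B. w' X)"
      let ?a = "\<lambda>w. \<Sum>X\<in>A. restrict w A X" and ?b = "\<lambda>w. \<Sum>X\<in>B. restrict w B X"
      have z: "x = 0" if "x \<in> W" "x \<in> W'" for x using int that by blast
      \<comment> \<open>The two sides lie in \<open>W\<close> and in \<open>W'\<close> respectively,
        so both vanish.\<close>
      have e: "?a w - ?a w' = ?b w' - ?b w"
        by (rule add_eq_add_imp_diff_eq) (use eq in \<open>simp only: split\<close>)
      have mA: "?a w - ?a w' \<in> W" by (intro cfun.subspace_diff sub sA w)
      have mB: "?b w' - ?b w \<in> W'" by (intro cfun.subspace_diff sub sB w)
      have "?b w' - ?b w = 0" by (rule z[OF mA[unfolded e] mB])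
      moreover from this have "?a w - ?a w' = 0" by (simp only: e)
      ultimately have "?a w - ?a w' = 0" "?b w' - ?b w = 0" by blast+
      then have ab: "?a w = ?a w'" "?b w' = ?b w" by (simp_all only: right_minus_eq)
      have "restrict w A = restrict w' A"
        by (rule inj_onD[OF bij_betw_imp_inj_on[OF bA] ab(1) rA[OF w(1)] rA[OF w(2)]])
      moreover have "restrict w' B = restrict w B"
        by (rule inj_onD[OF bij_betw_imp_inj_on[OF bB] ab(2) rB[OF w(2)] rB[OF w(1)]])
      ultimately have "w X = w' X" if "X \<in> A \<union> B" for X
        using that by (metis Un_iff restrict_apply')
      then show "w = w'" using w by (intro PiE_ext[OF w]) auto
    qed
    show "(\<lambda>w. \<Sum>X\<in>A \<union> B. w X) ` (\<Pi>\<^sub>E X\<in>A \<union> B. X) = V"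
    proof (intro equalityI subsetI)
      fix v assume "v \<in> (\<lambda>w. \<Sum>X\<in>A \<union> B. w X) ` (\<Pi>\<^sub>E X\<in>A \<union> B. X)"
      then obtain w where w: "w \<in> (\<Pi>\<^sub>E X\<in>A \<union> B. X)" "v = (\<Sum>X\<in>A \<union> B. w X)" by blast
      show "v \<in> V" unfolding w(2) split using sA[OF w(1)] sB[OF w(1)] sub(4,5)
        by (intro cfun.subspace_add sub(3)) blast+
    next
      fix v assume "v \<in> V"
      then obtain x y where v: "v = x + y" "x \<in> W" "y \<in> W'" using V by blast
      obtain a where a: "a \<in> (\<Pi>\<^sub>E X\<in>A. X)" "x = (\<Sum>X\<in>A. a X)"
        using v(2) bA unfolding bij_betw_def by blast
      obtain b where b: "b \<in> (\<Pi>\<^sub>E X\<in>B. X)" "y = (\<Sum>X\<in>B. b X)"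
        using v(3) bB unfolding bij_betw_def by blast
      let ?w = "\<lambda>X. if X \<in> A then a X else if X \<in> B then b X else undefined"
      have m: "?w \<in> (\<Pi>\<^sub>E X\<in>A \<union> B. X)" using a b by (auto simp: PiE_iff extensional_def)
      have "(\<Sum>X\<in>A \<union> B. ?w X) = (\<Sum>X\<in>A. ?w X) + (\<Sum>X\<in>B. ?w X)"
        using fin disj by (intro sum.union_disjoint)
      also have "(\<Sum>X\<in>A. ?w X) = x" unfolding a(2) by (rule sum.cong) auto
      also have "(\<Sum>X\<in>B. ?w X) = y" unfolding b(2) using disj by (intro sum.cong) auto
      finally have "v = (\<Sum>X\<in>A \<union> B. ?w X)" unfolding v(1) by (rule sym)
      then show "v \<in> (\<lambda>w. \<Sum>X\<in>A \<union> B. w X) ` (\<Pi>\<^sub>E X\<in>A \<union> B. X)"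
        using m by (rule image_eqI)
    qed
  qed
  moreover have "invariant_subspace G (R\<lparr>vspace := V\<rparr>) X \<and> irreducible_rep G (R\<lparr>vspace := V\<rparr>\<lparr>vspace := X\<rparr>)"
    if "X \<in> A \<union> B" for X
  proof (cases "X \<in> A")
    case True
    then show ?thesis using A[of X] subset_trans[OF _ sub(4)] by (simp add: invariant_subspace_def)
  next
    case False
    then show ?thesis
      using that B[of X] subset_trans[OF _ sub(5)] by (simp add: invariant_subspace_def)
  qed
  ultimately show ?thesis using fin by (auto simp: irr_decomposition_def)
qed

context fin_group
begin

text \<open>Strong induction on the dimension. It ranges over the invariant subspaces of one
  \<open>R\<close>, so that all summands are subspaces of the same coordinate space and the action
  never changes.\<close>

lemma irr_decomposition_exists:
  fixes R :: "('a, 'x) rep"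
  assumes R: "representation G R"
  shows "\<exists>A. irr_decomposition G R A"
proof -
  have "\<exists>A. irr_decomposition G (R\<lparr>vspace := V\<rparr>) A"
    if "invariant_subspace G R V" "ltrace V (\<lambda>v. v) = of_nat n" for V n
    using that
  proof (induction n arbitrary: V rule: less_induct)
    case (less n)
    have V: "cfun.subspace V" and rV: "representation G (R\<lparr>vspace := V\<rparr>)"
      using less.prems(1) invariant_rep[OF R] by (auto simp: invariant_subspace_def)
    show ?case
    proof (cases "V = {0}")
      case True
      have "irr_decomposition G (R\<lparr>vspace := V\<rparr>) {}"
        by (auto simp: irr_decomposition_def True bij_betw_def)
      then show ?thesis by blast
    next
      case nz: False
      show ?thesis
      proof (cases "irreducible_rep G (R\<lparr>vspace := V\<rparr>)")
        case True
        have b: "bij_betw (\<lambda>w. \<Sum>W\<in>{V}. w W) (\<Pi>\<^sub>E W\<in>{V}. W) V"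
          unfolding bij_betw_def
        proof
          show "inj_on (\<lambda>w. \<Sum>W\<in>{V}. w W) (\<Pi>\<^sub>E W\<in>{V}. W)"
          proof (rule inj_onI)
            fix f g assume fg: "f \<in> (\<Pi>\<^sub>E W\<in>{V}. W)" "g \<in> (\<Pi>\<^sub>E W\<in>{V}. W)"
              and "(\<Sum>W\<in>{V}. f W) = (\<Sum>W\<in>{V}. g W)"
            then have "f V = g V" by simp
            then show "f = g" by (intro PiE_ext[OF fg]) simp
          qed
          show "(\<lambda>w. \<Sum>W\<in>{V}. w W) ` (\<Pi>\<^sub>E W\<in>{V}. W) = V"
          proof (intro equalityI subsetI)
            fix v assume "v \<in> V"
            then show "v \<in> (\<lambda>w. \<Sum>W\<in>{V}. w W) ` (\<Pi>\<^sub>E W\<in>{V}. W)"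
              by (intro image_eqI[of _ _ "restrict (\<lambda>_. v) {V}"]) (auto simp: PiE_iff)
          qed auto
        qed
        have "invariant_subspace G (R\<lparr>vspace := V\<rparr>) V"
          using less.prems(1) by (auto simp: invariant_subspace_def)
        then have "irr_decomposition G (R\<lparr>vspace := V\<rparr>) {V}"
          using True b by (simp add: irr_decomposition_def)
        then show ?thesis by blast
      next
        case False
        then obtain W where W: "invariant_subspace G (R\<lparr>vspace := V\<rparr>) W" "W \<noteq> {0}" "W \<noteq> V"
          using rV nz by (auto simp: irreducible_rep_def)
        obtain W' where W': "invariant_subspace G (R\<lparr>vspace := V\<rparr>) W'" "W \<inter> W' = {0}"
          "\<And>v. v \<in> V \<Longrightarrow> \<exists>w\<in>W. \<exists>w'\<in>W'. v = w + w'"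
          "ltrace V (\<lambda>v. v) = ltrace W (\<lambda>v. v) + ltrace W' (\<lambda>v. v)"
          using maschke[OF rV W(1)] by (metis (no_types, lifting) rep.select_convs(1) rep.surjective rep.update_convs(1))
        have sub: "cfun.subspace W" "cfun.subspace W'" "W \<subseteq> V" "W' \<subseteq> V"
          and inv: "invariant_subspace G R W" "invariant_subspace G R W'"
          using W(1) W'(1) less.prems(1) by (auto simp: invariant_subspace_def)
        have fV: "fdim V" using repD(1)[OF rV] by simp
        obtain d where d: "ltrace W (\<lambda>v. v) = of_nat d" "d > 0"
          using ltrace_id_pos[OF fdim_subset[OF fV sub(1,3)]] W(2) by metis
        obtain d' where d': "ltrace W' (\<lambda>v. v) = of_nat d'" "d' > 0 \<longleftrightarrow> W' \<noteq> {0}"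
          using ltrace_id_pos[OF fdim_subset[OF fV sub(2,4)]] by metis
        have "W' \<noteq> {0}"
        proof
          assume "W' = {0}"
          then have "V \<subseteq> W" using W'(3) by auto
          then show False using W(3) sub(3) by blast
        qed
        moreover have "n = d + d'"
          using W'(4) less.prems(2) d(1) d'(1) by (metis of_nat_add of_nat_eq_iff)
        ultimately have "d < n" "d' < n" using d d' by auto
        then obtain A B where "irr_decomposition G (R\<lparr>vspace := W\<rparr>) A" "irr_decomposition G (R\<lparr>vspace := W'\<rparr>) B"
          using less.IH inv d(1) d'(1) by meson
        then have "irr_decomposition G (R\<lparr>vspace := V\<rparr>) (A \<union> B)"
          using irr_decomposition_union sub V W'(2,3) by metis
        then show ?thesis by blast
      qed
    qed
  qed
  moreover have "invariant_subspace G R (vspace R)"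
    using repD(2,4)[OF R] by (auto simp: invariant_subspace_def)
  moreover obtain n where "ltrace (vspace R) (\<lambda>v. v) = of_nat n"
    using ltrace_id_pos[OF repD(1)[OF R]] by metis
  ultimately have "\<exists>A. irr_decomposition G (R\<lparr>vspace := vspace R\<rparr>) A" by blast
  then show ?thesis by simp
qed

text \<open>The kernel of \<open>T\<close> is invariant and misses \<open>v\<close>, hence is zero;
  the image is invariant and contains \<open>T v\<close>, hence is everything.\<close>

lemma schur:
  assumes R: "irreducible_rep G R" and S: "irreducible_rep G S" and T: "intertwiner G R S T"
    and nz: "v \<in> vspace R" "T v \<noteq> 0"
  shows "bij_betw T (vspace R) (vspace S)"
proof -
  have T': "lin_on (vspace R) T" "\<And>v. v \<in> vspace R \<Longrightarrow> T v \<in> vspace S"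
    "\<And>g v. g \<in> carrier G \<Longrightarrow> v \<in> vspace R \<Longrightarrow> T (act R g v) = act S g (T v)"
    using T by (auto simp: intertwiner_def)
  have R': "representation G R" and S': "representation G S"
    using R S by (auto simp: irreducible_rep_def)
  note R' = repD[OF R'] and S' = repD[OF S']
  have z: "T 0 = 0" by (rule lin_on_zero[OF T'(1) cfun.subspace_0[OF R'(2)]])
  define K where "K = {v \<in> vspace R. T v = 0}"
  have "cfun.subspace K"
    unfolding K_def cfun.subspace_def
    using T'(1) z R'(2) cfun.subspace_0[OF R'(2)] cfun.subspace_add[OF R'(2)] cfun.subspace_scale[OF R'(2)]
    by (simp add: lin_on_def)
  moreover have "act R g ` K \<subseteq> K" if g: "g \<in> carrier G" for g
  proof -
    have "act S g 0 = 0" by (rule lin_on_zero[OF S'(3)[OF g] cfun.subspace_0[OF S'(2)]])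
    then show ?thesis using T'(3)[OF g] R'(4)[OF g] by (auto simp: K_def)
  qed
  ultimately have "invariant_subspace G R K" by (auto simp: invariant_subspace_def K_def)
  then have K: "K = {0}" using R nz by (auto simp: irreducible_rep_def K_def)
  have inj: "inj_on T (vspace R)"
  proof (rule inj_onI)
    fix x y assume xy: "x \<in> vspace R" "y \<in> vspace R" "T x = T y"
    have "T (x - y) = T x - T y" by (rule lin_on_diff[OF T'(1) R'(2) xy(1,2)])
    then have "x - y \<in> K" using xy cfun.subspace_diff[OF R'(2) xy(1,2)] by (simp add: K_def)
    then show "x = y" using K by simp
  qed
  have "cfun.subspace (T ` vspace R)"
    unfolding cfun.subspace_def
  proof (intro conjI ballI allI)
    show "0 \<in> T ` vspace R" using z cfun.subspace_0[OF R'(2)] by (metis image_eqI)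
    fix x y assume "x \<in> T ` vspace R" "y \<in> T ` vspace R"
    then obtain u w where u: "x = T u" "u \<in> vspace R" "y = T w" "w \<in> vspace R" by blast
    show "x + y \<in> T ` vspace R"
      by (rule image_eqI[of _ _ "u + w"])
        (simp_all only: u lin_on_add[OF T'(1) u(2,4)] cfun.subspace_add[OF R'(2) u(2,4)])
  next
    fix c x assume "x \<in> T ` vspace R"
    then obtain u where u: "x = T u" "u \<in> vspace R" by blast
    show "cscale c x \<in> T ` vspace R"
      by (rule image_eqI[of _ _ "cscale c u"])
        (simp_all only: u lin_on_scale[OF T'(1) u(2)] cfun.subspace_scale[OF R'(2) u(2)])
  qed
  then have "invariant_subspace G S (T ` vspace R)"
    unfolding invariant_subspace_def using T'(2) T'(3)[symmetric] R'(4) by auto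
  then have "T ` vspace R = vspace S" using S nz by (auto simp: irreducible_rep_def)
  with inj show ?thesis by (simp add: bij_betw_def)
qed

end

text \<open>The matching is made fibre by fibre. It pairs isomorphic summands of two decompositions,
  cycles of equal length, tableau entries by row and column, and points of a colour class with those
  of a block.\<close>

lemma bij_betw_of_fibre_cards:
  assumes fin: "finite A" "finite B" and card: "\<And>k. card {a \<in> A. f a = k} = card {b \<in> B. g b = k}"
  obtains h where "bij_betw h A B" "\<And>a. a \<in> A \<Longrightarrow> g (h a) = f a"
proof -
  have "\<exists>h. bij_betw h {a \<in> A. f a = k} {b \<in> B. g b = k}" for k
    using fin card by (intro finite_same_card_bij) auto
  then obtain h where h: "\<And>k. bij_betw (h k) {a \<in> A. f a = k} {b \<in> B. g b = k}" by metis
  have m: "h (f a) a \<in> B" "g (h (f a) a) = f a" if "a \<in> A" for a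
    using bij_betwE[OF h[of "f a"]] that by auto
  have "bij_betw (\<lambda>a. h (f a) a) A B"
    unfolding bij_betw_def
  proof
    show "inj_on (\<lambda>a. h (f a) a) A"
    proof (rule inj_onI)
      fix x y assume xy: "x \<in> A" "y \<in> A" "h (f x) x = h (f y) y"
      then have "f x = f y" using m(2) by metis
      then show "x = y" using xy bij_betw_imp_inj_on[OF h[of "f x"]] by (auto dest: inj_onD)
    qed
    show "(\<lambda>a. h (f a) a) ` A = B"
    proof (intro equalityI subsetI)
      fix b assume "b \<in> B"
      then have "b \<in> h (g b) ` {a \<in> A. f a = g b}"
        using bij_betw_imp_surj_on[OF h[of "g b"]] by auto
      then obtain a where "b = h (g b) a" "a \<in> A" "f a = g b" by blast
      then show "b \<in> (\<lambda>a. h (f a) a) ` A" by (intro image_eqI[of _ _ a]) auto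
    qed (use m in auto)
  qed
  then show ?thesis using that m(2) by blast
qed

lemma rep_iso_cong_right:
  assumes "representation G R" "rep_iso G R S"
  shows "rep_iso G X R \<longleftrightarrow> rep_iso G X S"
  using rep_iso_trans[OF _ assms(2)] rep_iso_trans[OF _ rep_iso_sym[OF assms]] by blast

section \<open>Orthogonality of characters\<close>

context fin_group
begin

text \<open>
  The average over the group is a projection of the space of matrices onto the space of intertwining
  operators, so its trace is the dimension of the latter.
\<close>

lemma hom_dimension:
  fixes R :: "('a, 'x) rep" and S :: "('a, 'y) rep"
  assumes R: "representation G R" and S: "representation G S"
  obtains d :: nat where
    "(\<Sum>g\<in>carrier G. character R (inv g) * character S g) = of_nat (card (carrier G)) * of_nat d"
    "d > 0 \<longleftrightarrow> (\<exists>T v. intertwiner G R S T \<and> v \<in> vspace R \<and> T v \<noteq> 0)"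
proof -
  note R' = repD[OF R] and S' = repD[OF S]
  obtain P b where P: "coords (vspace R) P b" using fdim_coords R'(1) by blast
  obtain Q c where Q: "coords (vspace S) Q c" using fdim_coords S'(1) by blast
  note P' = coordsD[OF P] and Q' = coordsD[OF Q]
  let ?n = "of_nat (card (carrier G)) :: complex"
  have n0: "?n \<noteq> 0" using card_pos by simp
  \<comment> \<open>Matrices are functions on pairs of evaluation points, extended by zero; the
    functions \<open>u z\<close> are the matrix units.\<close>
  define E :: "('x \<times> 'y \<Rightarrow> complex) set" where "E = {e. \<forall>z. z \<notin> P \<times> Q \<longrightarrow> e z = 0}"
  define u :: "'x \<times> 'y \<Rightarrow> 'x \<times> 'y \<Rightarrow> complex" where "u = (\<lambda>z w. if w = z then 1 else 0)"
  have cE: "coords E (P \<times> Q) u"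
  proof (rule coordsI)
    fix v x assume "v \<in> E"
    then have "x \<notin> P \<times> Q \<Longrightarrow> v x = 0" unfolding E_def by blast
    moreover have "(\<Sum>p\<in>P \<times> Q. v p * u p x) = (\<Sum>p\<in>P \<times> Q. if p = x then v p else 0)"
      by (intro sum.cong) (auto simp: u_def)
    ultimately show "v x = (\<Sum>p\<in>P \<times> Q. v p * u p x)"
      using P'(1) Q'(1) by simp
  qed (use P'(1) Q'(1) in \<open>auto simp: E_def u_def cfun.subspace_def\<close>)
  \<comment> \<open>\<open>L\<close> turns a matrix into a linear map from \<open>R\<close> to
    \<open>S\<close>, and \<open>M\<close> reads the matrix off a map; \<open>LM\<close> below is
    one half of their being inverse to each other.\<close>
  define L where "L = (\<lambda>e v. \<Sum>z\<in>P \<times> Q. cscale (v (fst z) * e z) (c (snd z)))"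
  define M where "M = (\<lambda>T z. if z \<in> P \<times> Q then T (b (fst z)) (snd z) else (0::complex))"
  have L_apply: "L e v y = (\<Sum>p\<in>P. v p * (\<Sum>q\<in>Q. e (p, q) * c q y))" for e v y
    by (simp add: L_def sum_fun_apply sum_distrib_left mult.assoc sum.cartesian_product case_prod_unfold)
  have LM: "L (M T) v = T v"
    if T: "lin_on (vspace R) T" "\<And>v. v \<in> vspace R \<Longrightarrow> T v \<in> vspace S" and v: "v \<in> vspace R" for T v
  proof
    fix y
    have "L (M T) v y = (\<Sum>p\<in>P. v p * (\<Sum>q\<in>Q. T (b p) q * c q y))"
      unfolding L_apply by (intro sum.cong refl arg_cong2[of _ _ _ _ times]) (auto simp: M_def)
    also have "\<dots> = (\<Sum>p\<in>P. v p * T (b p) y)"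
      using Q'(6)[OF T(2)[OF P'(3)]] by (intro sum.cong refl) simp
    finally show "L (M T) v y = T v y" using coords_lin[OF P T(1) v] by simp
  qed
  have L_lin: "lin_on (vspace R) (L e)" for e
    by (auto simp: lin_on_def fun_eq_iff L_apply algebra_simps sum.distrib sum_distrib_left)
  have L_S: "L e v \<in> vspace S" for e v
    unfolding L_def using Q'(3) by (intro cfun.subspace_sum cfun.subspace_scale S'(2)) auto
  define A where "A = (\<lambda>e. average R S (L e))"
  have A: "intertwiner G R S (A e)" for e
    unfolding A_def by (rule average_intertwiner[OF R S L_lin L_S])
  then have A': "lin_on (vspace R) (A e)" "\<And>v. v \<in> vspace R \<Longrightarrow> A e v \<in> vspace S" for e
    by (auto simp: intertwiner_def)
  have A_fixed: "average R S T v = T v"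
    if T: "intertwiner G R S T" and v: "v \<in> vspace R" for T v
    using T v by (intro average_fixed[OF R S]) (auto simp: intertwiner_def)
  have A_cong: "average R S T v = average R S T' v"
    if "\<And>v. v \<in> vspace R \<Longrightarrow> T v = T' v" "v \<in> vspace R" for T T' v
    unfolding average_def using that R'(4) by (intro arg_cong2[of _ _ _ _ cscale] sum.cong refl) simp
  define N where "N = (\<lambda>e. M (A e))"
  \<comment> \<open>\<open>K g z' z\<close> is the coefficient of \<open>e z'\<close> in entry
    \<open>z\<close> of the matrix of \<open>L e\<close> conjugated by \<open>g\<close>. On the
    diagonal it is a product of diagonal entries of the two actions, so that the trace becomes a
    product of characters.\<close>
  define K where "K = (\<lambda>g z' z. act R (inv g) (b (fst z)) (fst z') * act S g (c (snd z')) (snd z))"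
  have N: "N e z = (if z \<in> P \<times> Q then (\<Sum>g\<in>carrier G. \<Sum>z'\<in>P \<times> Q. e z' * K g z' z) / ?n else 0)"
    for e z
  proof -
    have "act S g (L e v) q = (\<Sum>z'\<in>P \<times> Q. e z' * (v (fst z') * act S g (c (snd z')) q))"
      if g: "g \<in> carrier G" for g v q
    proof -
      have "act S g (L e v) = (\<Sum>z'\<in>P \<times> Q. cscale (v (fst z') * e z') (act S g (c (snd z'))))"
        unfolding L_def using Q'(3) by (intro lin_on_lincomb[OF S'(3)[OF g] S'(2)]) auto
      then show ?thesis by (simp add: sum_fun_apply ac_simps)
    qed
    then show ?thesis
      by (auto simp: N_def M_def A_def average_def sum_fun_apply K_def sum_divide_distrib)
  qed
  have N_lin: "lin_on E N"
    by (auto simp: lin_on_def fun_eq_iff N sum.distrib ring_distribs add_divide_distrib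
        sum_distrib_left mult.assoc)
  have N_E: "N e \<in> E" for e by (auto simp: E_def N)
  \<comment> \<open>Averaging produces intertwiners, and averaging leaves these unchanged.\<close>
  have N_idem: "N (N e) = N e" for e
  proof -
    have "A (N e) v = A e v" if v: "v \<in> vspace R" for v
    proof -
      have "average R S (L (N e)) v = average R S (A e) v"
        using LM[OF A'] v unfolding N_def by (intro A_cong) auto
      then show ?thesis using A_fixed[OF A v] by (simp add: A_def)
    qed
    then have "M (A (N e)) = M (A e)" using P'(3) by (auto simp: M_def fun_eq_iff)
    then show ?thesis unfolding N_def .
  qed
  \<comment> \<open>The fixed space of the idempotent \<open>N\<close>: the matrices of the
    intertwiners.\<close>
  define Z where "Z = {e \<in> E. N e = e}"
  have "cfun.subspace Z"
    unfolding cfun.subspace_def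
  proof (intro conjI ballI allI)
    have "N 0 = 0" using coordsD(2)[OF cE] by (intro lin_on_zero[OF N_lin] cfun.subspace_0)
    then show "0 \<in> Z" using coordsD(2)[OF cE] cfun.subspace_0 by (auto simp: Z_def)
    fix x y assume "x \<in> Z" "y \<in> Z"
    then have xy: "x \<in> E" "y \<in> E" "N x = x" "N y = y" by (auto simp: Z_def)
    have "N (x + y) = x + y" unfolding lin_on_add[OF N_lin xy(1,2)] xy(3,4) ..
    then show "x + y \<in> Z" using xy cfun.subspace_add[OF coordsD(2)[OF cE]] unfolding Z_def by blast
  next
    fix k x assume "x \<in> Z"
    then have x: "x \<in> E" "N x = x" by (auto simp: Z_def)
    have "N (cscale k x) = cscale k x" unfolding lin_on_scale[OF N_lin x(1)] x(2) ..
    then show "cscale k x \<in> Z" using x cfun.subspace_scale[OF coordsD(2)[OF cE]] unfolding Z_def by blast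
  qed
  then have fZ: "fdim Z" using fdim_subset[OF coords_fdim[OF cE]] by (auto simp: Z_def)
  obtain d where d: "ltrace Z (\<lambda>v. v) = of_nat d" "d > 0 \<longleftrightarrow> Z \<noteq> {0}"
    using ltrace_id_pos[OF fZ] by metis
  \<comment> \<open>\<open>N\<close> is factored as a map from \<open>E\<close> onto
    \<open>Z\<close> followed by the inclusion, and the factors are exchanged. On \<open>Z\<close>
    the result is the identity, so the trace is the dimension of \<open>Z\<close>.\<close>
  have "ltrace E N = ltrace Z N"
    using N_idem N_E by (intro ltrace_comm[OF coords_fdim[OF cE] fZ N_lin _ lin_on_id]) (auto simp: Z_def)
  also have "\<dots> = of_nat d" unfolding d(1)[symmetric] by (intro ltrace_cong fZ) (auto simp: Z_def)
  finally have "of_nat d = (\<Sum>z\<in>P \<times> Q. N (u z) z)"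
    using ltrace_coords[OF cE N_lin] N_E by auto
  also have "\<dots> = (\<Sum>z\<in>P \<times> Q. (\<Sum>g\<in>carrier G. K g z z) / ?n)"
  proof (rule sum.cong[OF refl])
    fix z assume z: "z \<in> P \<times> Q"
    have "(\<Sum>z'\<in>P \<times> Q. u z z' * K g z' z) = K g z z" for g
    proof -
      have "(\<Sum>z'\<in>P \<times> Q. u z z' * K g z' z) = (\<Sum>z'\<in>P \<times> Q. if z' = z then K g z' z else 0)"
        by (intro sum.cong) (auto simp: u_def)
      then show ?thesis using z P'(1) Q'(1) by simp
    qed
    then show "N (u z) z = (\<Sum>g\<in>carrier G. K g z z) / ?n" using z by (simp add: N)
  qed
  also have "\<dots> = (\<Sum>g\<in>carrier G. \<Sum>z\<in>P \<times> Q. K g z z) / ?n"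
    by (simp add: sum_divide_distrib[symmetric] sum.swap[of _ "carrier G"])
  also have "(\<Sum>g\<in>carrier G. \<Sum>z\<in>P \<times> Q. K g z z) = (\<Sum>g\<in>carrier G. character R (inv g) * character S g)"
    by (intro sum.cong refl)
      (simp add: character_coords[OF R P] character_coords[OF S Q] sum_product
        sum.cartesian_product K_def case_prod_unfold)
  finally have 1: "(\<Sum>g\<in>carrier G. character R (inv g) * character S g) = ?n * of_nat d"
    using n0 by (simp add: field_simps)
  have 2: "Z \<noteq> {0} \<longleftrightarrow> (\<exists>T v. intertwiner G R S T \<and> v \<in> vspace R \<and> T v \<noteq> 0)"
  proof
    assume "Z \<noteq> {0}"
    moreover have "0 \<in> Z" using cfun.subspace_0[OF fdim_subspace[OF fZ]] .
    ultimately obtain e where e: "e \<in> Z" "e \<noteq> 0" by blast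
    then obtain z where z: "e z \<noteq> 0" by (auto simp: fun_eq_iff)
    have "z \<in> P \<times> Q" using z e(1) unfolding Z_def E_def by blast
    moreover have "N e z = e z" using e(1) by (simp add: Z_def)
    ultimately have "A e (b (fst z)) (snd z) \<noteq> 0" "b (fst z) \<in> vspace R"
      using z P'(3) by (auto simp: N_def M_def)
    then show "\<exists>T v. intertwiner G R S T \<and> v \<in> vspace R \<and> T v \<noteq> 0"
      using A by (metis zero_fun_apply)
  next
    assume "\<exists>T v. intertwiner G R S T \<and> v \<in> vspace R \<and> T v \<noteq> 0"
    then obtain T v where T: "intertwiner G R S T" and v: "v \<in> vspace R" "T v \<noteq> 0" by blast
    have T': "lin_on (vspace R) T" "\<And>v. v \<in> vspace R \<Longrightarrow> T v \<in> vspace S"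
      using T by (auto simp: intertwiner_def)
    have "A (M T) v = T v" if "v \<in> vspace R" for v
      using A_cong[OF LM[OF T'] that] A_fixed[OF T that] by (simp add: A_def)
    then have "N (M T) = M T" using P'(3) by (auto simp: N_def M_def fun_eq_iff)
    then have "M T \<in> Z" by (auto simp: Z_def E_def M_def)
    moreover have "M T \<noteq> 0"
    proof
      assume "M T = 0"
      then have "L (M T) v = 0" by (auto simp: L_apply fun_eq_iff)
      then show False using LM[OF T' v(1)] v(2) by simp
    qed
    ultimately show "Z \<noteq> {0}" by blast
  qed
  show ?thesis using that[OF 1] d(2) 2 by simp
qed

text \<open>The unnormalised pairing of a character with itself. Multiplicities are compared by
  cancelling this factor, which is nonzero because the identity is a nonzero intertwiner.\<close>

definition irr_norm :: "('a, 'x) rep \<Rightarrow> complex" where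
  "irr_norm S = (\<Sum>g\<in>carrier G. character S (inv g) * character S g)"

lemma irr_norm_nonzero:
  assumes "irreducible_rep G S"
  shows "irr_norm S \<noteq> 0"
proof -
  have S: "representation G S" "vspace S \<noteq> {0}" using assms by (auto simp: irreducible_rep_def)
  have "0 \<in> vspace S" using cfun.subspace_0[OF repD(2)[OF S(1)]] .
  then obtain v where v: "v \<in> vspace S" "v \<noteq> 0" using S(2) by blast
  obtain d :: nat where d: "irr_norm S = of_nat (card (carrier G)) * of_nat d"
    "d > 0 \<longleftrightarrow> (\<exists>T v. intertwiner G S S T \<and> v \<in> vspace S \<and> T v \<noteq> 0)"
    by (rule hom_dimension[OF S(1) S(1), folded irr_norm_def])
  have "intertwiner G S S (\<lambda>v. v)" by (auto simp: intertwiner_def lin_on_id)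
  then have "d > 0" using d(2) v by metis
  then show ?thesis using d(1) card_pos by simp
qed

lemma irr_orthogonal:
  assumes R: "irreducible_rep G R" and S: "irreducible_rep G S" and "\<not> rep_iso G R S"
  shows "(\<Sum>g\<in>carrier G. character R (inv g) * character S g) = 0"
proof -
  have RS: "representation G R" "representation G S" using R S by (auto simp: irreducible_rep_def)
  obtain d :: nat where d:
    "(\<Sum>g\<in>carrier G. character R (inv g) * character S g) = of_nat (card (carrier G)) * of_nat d"
    "d > 0 \<longleftrightarrow> (\<exists>T v. intertwiner G R S T \<and> v \<in> vspace R \<and> T v \<noteq> 0)"
    by (rule hom_dimension[OF RS])
  have "\<not> d > 0" using d(2) schur[OF R S] assms(3) rep_iso_iff by blast
  then show ?thesis using d(1) by simp
qed

lemma irr_product: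
  assumes R: "irreducible_rep G R" and S: "irreducible_rep G S"
  shows "(\<Sum>g\<in>carrier G. character S (inv g) * character R g) = (if rep_iso G R S then irr_norm S else 0)"
proof -
  have RS: "representation G R" "representation G S" using R S by (auto simp: irreducible_rep_def)
  show ?thesis
    using irr_orthogonal[OF S R] rep_iso_sym[OF RS(2)] rep_iso_character[OF RS]
    by (auto simp: irr_norm_def)
qed

end

section \<open>Multiplicities and the expansion of characters\<close>

definition component :: "('x \<Rightarrow> complex) set set \<Rightarrow> ('x \<Rightarrow> complex) set \<Rightarrow> ('x \<Rightarrow> complex) \<Rightarrow> 'x \<Rightarrow> complex" where
  "component A W v = inv_into (\<Pi>\<^sub>E W\<in>A. W) (\<lambda>w. \<Sum>W\<in>A. w W) v W"

text \<open>The maps \<open>component A W\<close> are the projections of an internal direct sum.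
  They are read off the inverse of the summation bijection, so each property is an instance of the
  uniqueness of summands.\<close>

lemma component:
  assumes A: "irr_decomposition G R A"
  shows "W \<in> A \<Longrightarrow> lin_on (vspace R) (component A W)"
    "W \<in> A \<Longrightarrow> v \<in> vspace R \<Longrightarrow> component A W v \<in> W"
    "W \<in> A \<Longrightarrow> w \<in> W \<Longrightarrow> component A W w = w"
    "v \<in> vspace R \<Longrightarrow> (\<Sum>W\<in>A. component A W v) = v"
    "(\<And>W. W \<in> A \<Longrightarrow> y W \<in> W) \<Longrightarrow> v = (\<Sum>W\<in>A. y W) \<Longrightarrow> v \<in> vspace R \<and> (\<forall>W\<in>A. component A W v = y W)"
proof -
  let ?\<sigma> = "\<lambda>w. \<Sum>W\<in>A. w W" and ?P = "\<Pi>\<^sub>E W\<in>A. W"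
  have fin: "finite A" and b: "bij_betw ?\<sigma> ?P (vspace R)"
    and inv: "\<And>W. W \<in> A \<Longrightarrow> cfun.subspace W" "\<And>W. W \<in> A \<Longrightarrow> W \<subseteq> vspace R"
    using A by (auto simp: irr_decomposition_def invariant_subspace_def)
  let ?\<pi> = "component A"
  have mem: "inv_into ?P ?\<sigma> v \<in> ?P" if "v \<in> vspace R" for v
    using that b by (metis bij_betw_imp_surj_on inv_into_into)
  have p: "?\<pi> W v \<in> W" if "W \<in> A" "v \<in> vspace R" for W v
    using mem[OF that(2)] that(1) by (auto simp: component_def)
  have s: "(\<Sum>W\<in>A. ?\<pi> W v) = v" if "v \<in> vspace R" for v
    using bij_betw_inv_into_right[OF b that] by (simp add: component_def)
  \<comment> \<open>Any family with the right sum is the family of components. Linearity, and the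
    identity on a summand, follow by exhibiting suitable families.\<close>
  have uniq: "v \<in> vspace R \<and> (\<forall>W\<in>A. ?\<pi> W v = w W)"
    if w: "\<And>W. W \<in> A \<Longrightarrow> w W \<in> W" and v: "v = (\<Sum>W\<in>A. w W)" for v w
  proof -
    have r: "restrict w A \<in> ?P" using w by auto
    have v': "v = ?\<sigma> (restrict w A)" unfolding v by (rule sum.cong) auto
    have "inv_into ?P ?\<sigma> v = restrict w A"
      unfolding v' by (rule inv_into_f_f[OF bij_betw_imp_inj_on[OF b] r])
    moreover have "v \<in> vspace R" unfolding v' using bij_betw_imp_surj_on[OF b] r by blast
    ultimately show ?thesis by (simp add: component_def)
  qed
  show "lin_on (vspace R) (?\<pi> W)" if W: "W \<in> A" for W
  proof (rule lin_onI)
      fix u v assume uv: "u \<in> vspace R" "v \<in> vspace R"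
      have "u + v = (\<Sum>W\<in>A. ?\<pi> W u + ?\<pi> W v)" unfolding sum.distrib s[OF uv(1)] s[OF uv(2)] ..
      then show "?\<pi> W (u + v) = ?\<pi> W u + ?\<pi> W v"
        using uniq[of "\<lambda>W. ?\<pi> W u + ?\<pi> W v" "u + v"] p uv cfun.subspace_add[OF inv(1)] W by blast
    next
      fix k v assume v: "v \<in> vspace R"
      have "cscale k v = (\<Sum>W\<in>A. cscale k (?\<pi> W v))" unfolding cfun.scale_sum_right[symmetric] s[OF v] ..
      then show "?\<pi> W (cscale k v) = cscale k (?\<pi> W v)"
        using uniq[of "\<lambda>W. cscale k (?\<pi> W v)" "cscale k v"] p v cfun.subspace_scale[OF inv(1)] W by blast
    qed
  show "?\<pi> W w = w" if W: "W \<in> A" and w: "w \<in> W" for W w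
  proof -
    have "w = (\<Sum>X\<in>A. if X = W then w else 0)" using W fin by simp
    then show "?\<pi> W w = w"
      using uniq[of "\<lambda>X. if X = W then w else 0" w] w W cfun.subspace_0[OF inv(1)] by auto
  qed
  show "W \<in> A \<Longrightarrow> v \<in> vspace R \<Longrightarrow> ?\<pi> W v \<in> W" by (rule p)
  show "v \<in> vspace R \<Longrightarrow> (\<Sum>W\<in>A. ?\<pi> W v) = v" by (rule s)
  show "(\<And>W. W \<in> A \<Longrightarrow> y W \<in> W) \<Longrightarrow> v = (\<Sum>W\<in>A. y W) \<Longrightarrow> v \<in> vspace R \<and> (\<forall>W\<in>A. ?\<pi> W v = y W)"
    by (rule uniq)
qed

lemma irr_decompositionD:
  assumes "irr_decomposition G R A"
  shows "finite A" "W \<in> A \<Longrightarrow> invariant_subspace G R W" "W \<in> A \<Longrightarrow> irreducible_rep G (R\<lparr>vspace := W\<rparr>)"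
  using assms by (auto simp: irr_decomposition_def)

lemma character_decomposition:
  assumes R: "representation G R" and A: "irr_decomposition G R A" and g: "g \<in> carrier G"
  shows "character R g = (\<Sum>W\<in>A. character (R\<lparr>vspace := W\<rparr>) g)"
proof -
  note \<pi> = component[OF A]
  have inv: "cfun.subspace W" "W \<subseteq> vspace R" "act R g ` W \<subseteq> W" if "W \<in> A" for W
    using irr_decompositionD(2)[OF A that] g by (auto simp: invariant_subspace_def)
  have "ltrace (vspace R) (act R g) = (\<Sum>W\<in>A. ltrace W (act R g))"
  proof (rule ltrace_decomp[where \<pi> = "component A", OF repD(1)[OF R] irr_decompositionD(1)[OF A] repD(3)[OF R g]])
    show "component A W ` vspace R \<subseteq> W" if "W \<in> A" for W using \<pi>(2)[OF that] by blast
  qed (fact inv \<pi>)+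
  then show ?thesis by (simp add: character_def)
qed

context fin_group
begin

text \<open>By orthogonality each summand contributes \<open>irr_norm S\<close> or nothing. The left
  side does not mention \<open>A\<close>, so the count is the same for every decomposition.\<close>

lemma irr_product_decomposition:
  assumes R: "representation G R" and A: "irr_decomposition G R A" and S: "irreducible_rep G S"
  shows "(\<Sum>g\<in>carrier G. character S (inv g) * character R g) =
    of_nat (card {W \<in> A. rep_iso G (R\<lparr>vspace := W\<rparr>) S}) * irr_norm S"
proof -
  have "(\<Sum>g\<in>carrier G. character S (inv g) * character R g) =
      (\<Sum>W\<in>A. \<Sum>g\<in>carrier G. character S (inv g) * character (R\<lparr>vspace := W\<rparr>) g)"
    by (subst sum.swap) (simp add: character_decomposition[OF R A] sum_distrib_left)
  also have "\<dots> = (\<Sum>W\<in>A. if rep_iso G (R\<lparr>vspace := W\<rparr>) S then irr_norm S else 0)"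
    by (intro sum.cong refl irr_product irr_decompositionD[OF A] S)
  also have "\<dots> = of_nat (card {W \<in> A. rep_iso G (R\<lparr>vspace := W\<rparr>) S}) * irr_norm S"
    using irr_decompositionD(1)[OF A] by (simp add: sum.If_cases Int_def)
  finally show ?thesis .
qed

text \<open>The pairing of characters determines the count, which makes the definite description in
  \<open>multiplicity\<close> meaningful.\<close>

lemma multiplicity_eq:
  assumes R: "representation G R" and A: "irr_decomposition G R A" and S: "irreducible_rep G S"
  shows "multiplicity G S R = card {W \<in> A. rep_iso G (R\<lparr>vspace := W\<rparr>) S}"
  unfolding multiplicity_def
proof (rule the_equality)
  fix m assume "\<exists>B. irr_decomposition G R B \<and> m = card {W \<in> B. rep_iso G (R\<lparr>vspace := W\<rparr>) S}"
  then obtain B where B: "irr_decomposition G R B" "m = card {W \<in> B. rep_iso G (R\<lparr>vspace := W\<rparr>) S}" by blast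
  have "of_nat m * irr_norm S = of_nat (card {W \<in> A. rep_iso G (R\<lparr>vspace := W\<rparr>) S}) * irr_norm S"
    using irr_product_decomposition[OF R A S] irr_product_decomposition[OF R B(1) S] B(2) by simp
  then show "m = card {W \<in> A. rep_iso G (R\<lparr>vspace := W\<rparr>) S}"
    using irr_norm_nonzero[OF S] by simp
qed (use A in blast)

text \<open>Completeness of the family \<open>S\<close> is demanded on the coordinate type of
  \<open>R\<close>, since the irreducible summands of \<open>R\<close> live there. The summands are
  then grouped by the member of the family to which they are isomorphic.\<close>

lemma character_expansion:
  fixes R :: "('a, 'x) rep" and S :: "'i \<Rightarrow> ('a, 'y) rep"
  assumes R: "representation G R" and fin: "finite I"
    and S: "\<And>i. i \<in> I \<Longrightarrow> irreducible_rep G (S i)"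
    and ne: "\<And>i j. i \<in> I \<Longrightarrow> j \<in> I \<Longrightarrow> i \<noteq> j \<Longrightarrow> \<not> rep_iso G (S i) (S j)"
    and compl: "\<And>X :: ('a, 'x) rep. irreducible_rep G X \<Longrightarrow> \<exists>i\<in>I. rep_iso G X (S i)"
    and g: "g \<in> carrier G"
  shows "character R g = (\<Sum>i\<in>I. of_nat (multiplicity G (S i) R) * character (S i) g)"
proof -
  obtain A where A: "irr_decomposition G R A" using irr_decomposition_exists[OF R] by blast
  let ?X = "\<lambda>W. R\<lparr>vspace := W\<rparr>"
  have irr: "irreducible_rep G (?X W)" "representation G (?X W)" if "W \<in> A" for W
    using irr_decompositionD(3)[OF A that] by (auto simp: irreducible_rep_def)
  have "\<forall>W\<in>A. \<exists>i. i \<in> I \<and> rep_iso G (?X W) (S i)" using compl irr(1) by blast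
  then obtain \<kappa> where \<kappa>: "\<And>W. W \<in> A \<Longrightarrow> \<kappa> W \<in> I \<and> rep_iso G (?X W) (S (\<kappa> W))" by metis
  have eq: "{W \<in> A. \<kappa> W = i} = {W \<in> A. rep_iso G (?X W) (S i)}" if i: "i \<in> I" for i
  proof -
    have "\<kappa> W = i" if W: "W \<in> A" "rep_iso G (?X W) (S i)" for W
      using ne[of "\<kappa> W" i] \<kappa>[OF W(1)] i rep_iso_trans[OF rep_iso_sym[OF irr(2)[OF W(1)]] W(2)] by blast
    then show ?thesis using \<kappa> by blast
  qed
  have "character R g = (\<Sum>W\<in>A. character (?X W) g)" by (rule character_decomposition[OF R A g])
  also have "\<dots> = (\<Sum>W\<in>A. character (S (\<kappa> W)) g)"
  proof (rule sum.cong[OF refl])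
    fix W assume W: "W \<in> A"
    then have "representation G (S (\<kappa> W))" using \<kappa> S by (simp add: irreducible_rep_def)
    then show "character (?X W) g = character (S (\<kappa> W)) g"
      using rep_iso_character[OF irr(2)[OF W]] \<kappa>[OF W] g by blast
  qed
  also have "\<dots> = (\<Sum>i\<in>I. \<Sum>W\<in>{W \<in> A. \<kappa> W = i}. character (S (\<kappa> W)) g)"
    using \<kappa> by (intro sum.group[symmetric] irr_decompositionD(1)[OF A] fin) auto
  also have "\<dots> = (\<Sum>i\<in>I. of_nat (card {W \<in> A. \<kappa> W = i}) * character (S i) g)"
    by (intro sum.cong refl) (simp add: sum.cong)
  also have "\<dots> = (\<Sum>i\<in>I. of_nat (multiplicity G (S i) R) * character (S i) g)"
    using eq multiplicity_eq[OF R A S] by (intro sum.cong refl) simp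
  finally show ?thesis .
qed

text \<open>Orthogonality with nonzero norms gives linear independence, and functions constant on
  the fibres of \<open>cls\<close> lie in the span of the fibre indicators. Any labelling
  \<open>cls\<close> will do; for the symmetric group it is the cycle type.\<close>

lemma orthogonal_class_functions_card_le:
  fixes f :: "'i \<Rightarrow> 'a \<Rightarrow> complex"
  assumes "finite I" "finite K" "cls ` carrier G \<subseteq> K"
    and cls: "\<And>i g h. i \<in> I \<Longrightarrow> g \<in> carrier G \<Longrightarrow> h \<in> carrier G \<Longrightarrow> cls g = cls h \<Longrightarrow> f i g = f i h"
    and orth: "\<And>i j. i \<in> I \<Longrightarrow> j \<in> I \<Longrightarrow> i \<noteq> j \<Longrightarrow> (\<Sum>g\<in>carrier G. f i (inv g) * f j g) = 0"
    and nz: "\<And>i. i \<in> I \<Longrightarrow> (\<Sum>g\<in>carrier G. f i (inv g) * f i g) \<noteq> 0"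
  shows "card I \<le> card K"
proof -
  \<comment> \<open>Cutting off outside the group turns equality on the group into equality of
    functions, as linear algebra in a function space requires.\<close>
  define F where "F = (\<lambda>i g. if g \<in> carrier G then f i g else 0)"
  define u where "u = (\<lambda>k g. if g \<in> carrier G \<and> cls g = k then 1 else (0::complex))"
  have ip: "(\<Sum>g\<in>carrier G. f i (inv g) * F j g) = (\<Sum>g\<in>carrier G. f i (inv g) * f j g)" for i j
    by (intro sum.cong) (auto simp: F_def)
  have inj: "inj_on F I"
  proof (rule inj_onI, rule ccontr)
    fix i j assume ij: "i \<in> I" "j \<in> I" "F i = F j" "i \<noteq> j"
    have "(\<Sum>g\<in>carrier G. f i (inv g) * f i g) = (\<Sum>g\<in>carrier G. f i (inv g) * f j g)"
      unfolding ip[symmetric] ij(3) ..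
    then show False using orth[OF ij(1,2,4)] nz[OF ij(1)] by simp
  qed
  have "F i \<in> cfun.span (u ` K)" if i: "i \<in> I" for i
  proof -
    define r where "r = inv_into (carrier G) cls"
    have r: "r k \<in> carrier G \<and> cls (r k) = k" if "k \<in> cls ` carrier G" for k
      using that by (simp add: r_def inv_into_into f_inv_into_f)
    have "F i = (\<Sum>k\<in>cls ` carrier G. cscale (f i (r k)) (u k))"
    proof
      fix g
      have "(\<Sum>k\<in>cls ` carrier G. f i (r k) * u k g) =
          (\<Sum>k\<in>cls ` carrier G. if k = cls g then (if g \<in> carrier G then f i (r k) else 0) else 0)"
        by (intro sum.cong) (auto simp: u_def)
      also have "\<dots> = F i g"
        using fin r[of "cls g"] cls[OF i, of g "r (cls g)"] by (auto simp: F_def)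
      finally show "F i g = (\<Sum>k\<in>cls ` carrier G. cscale (f i (r k)) (u k)) g"
        by (simp add: sum_fun_apply)
    qed
    also have "\<dots> \<in> cfun.span (u ` K)"
      using assms(3) by (intro cfun.span_sum cfun.span_scale cfun.span_base) auto
    finally show ?thesis .
  qed
  moreover have "cfun.independent (F ` I)"
  proof (rule cfun.independent_if_scalars_zero)
    fix a x assume 0: "(\<Sum>x\<in>F ` I. cscale (a x) x) = 0" and "x \<in> F ` I"
    then obtain i where i: "i \<in> I" "x = F i" by blast
    have z: "(\<Sum>j\<in>I. a (F j) * F j g) = 0" for g
      using fun_cong[OF 0, of g] by (simp add: sum.reindex[OF inj] sum_fun_apply)
    have "0 = (\<Sum>g\<in>carrier G. f i (inv g) * (\<Sum>j\<in>I. a (F j) * F j g))" by (simp add: z)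
    also have "\<dots> = (\<Sum>j\<in>I. a (F j) * (\<Sum>g\<in>carrier G. f i (inv g) * f j g))"
      unfolding ip[symmetric] sum_distrib_left by (subst sum.swap) (simp add: ac_simps)
    also have "\<dots> = (\<Sum>j\<in>I. if j = i then a (F i) * (\<Sum>g\<in>carrier G. f i (inv g) * f i g) else 0)"
      using orth i by (intro sum.cong) auto
    finally show "a x = 0" using assms(1) i nz[OF i(1)] by simp
  qed (simp add: assms(1))
  ultimately have "card (F ` I) \<le> card (u ` K)"
    using cfun.independent_span_bound[of "u ` K" "F ` I"] assms(2) by auto
  then show ?thesis using card_image[OF inj] card_image_le[OF assms(2), of u] by simp
qed

text \<open>Equal characters give equal multiplicities of every irreducible representation. The
  summands of the two decompositions can therefore be matched in isomorphic pairs, and the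
  isomorphisms of the pairs are glued along the components.\<close>

lemma character_eq_imp_rep_iso:
  fixes R :: "('a, 'x) rep" and S :: "('a, 'y) rep"
  assumes R: "representation G R" and S: "representation G S"
    and eq: "\<And>g. g \<in> carrier G \<Longrightarrow> character R g = character S g"
  shows "rep_iso G R S"
proof -
  obtain A where A: "irr_decomposition G R A" using irr_decomposition_exists[OF R] by blast
  obtain B where B: "irr_decomposition G S B" using irr_decomposition_exists[OF S] by blast
  let ?X = "\<lambda>W. R\<lparr>vspace := W\<rparr>" and ?Y = "\<lambda>W. S\<lparr>vspace := W\<rparr>"
  have irr: "irreducible_rep G (?X W)" "representation G (?X W)" if "W \<in> A" for W
    using irr_decompositionD(3)[OF A that] by (auto simp: irreducible_rep_def)
  have irr': "irreducible_rep G (?Y W)" "representation G (?Y W)" if "W \<in> B" for W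
    using irr_decompositionD(3)[OF B that] by (auto simp: irreducible_rep_def)
  have sumeq: "(\<Sum>g\<in>carrier G. character V (inv g) * character R g) =
      (\<Sum>g\<in>carrier G. character V (inv g) * character S g)" for V :: "('a, 'z) rep"
    using eq by (intro sum.cong) auto
  \<comment> \<open>\<open>V\<close> has a coordinate type of its own because it is instantiated
    with summands of \<open>R\<close> as well as of \<open>S\<close>.\<close>
  have cA: "card {W \<in> A. rep_iso G (?X W) V} = card {W \<in> B. rep_iso G (?Y W) V}"
    if "irreducible_rep G V" for V :: "('a, 'z) rep"
    using irr_product_decomposition[OF R A that] irr_product_decomposition[OF S B that]
      irr_norm_nonzero[OF that] sumeq[of V] by simp
  \<comment> \<open>Keys for the matching. The isomorphism class of a summand of either side is
    encoded by the set of summands in \<open>A\<close> isomorphic to it, so that keys from both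
    sides have one type.\<close>
  define kA where "kA = (\<lambda>W. {W' \<in> A. rep_iso G (?X W') (?X W)})"
  define kB where "kB = (\<lambda>W. {W' \<in> A. rep_iso G (?X W') (?Y W)})"
  have sA: "kA W = kA W' \<longleftrightarrow> rep_iso G (?X W') (?X W)" if "W \<in> A" "W' \<in> A" for W W'
  proof
    assume "kA W = kA W'"
    then have "W' \<in> kA W" using that rep_iso_refl by (auto simp: kA_def)
    then show "rep_iso G (?X W') (?X W)" by (simp add: kA_def)
  next
    assume "rep_iso G (?X W') (?X W)"
    show "kA W = kA W'"
      by (simp add: kA_def rep_iso_cong_right[OF irr(2)[OF that(2)] \<open>rep_iso G (?X W') (?X W)\<close>])
  qed
  have sB: "kB X = kA W \<longleftrightarrow> rep_iso G (?Y X) (?X W)" if "W \<in> A" "X \<in> B" for W X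
  proof
    assume "kB X = kA W"
    then have "W \<in> kB X" using that rep_iso_refl by (auto simp: kA_def)
    then show "rep_iso G (?Y X) (?X W)" by (intro rep_iso_sym[OF irr(2)[OF that(1)]]) (simp add: kB_def)
  next
    assume "rep_iso G (?Y X) (?X W)"
    show "kB X = kA W"
      by (simp add: kA_def kB_def rep_iso_cong_right[OF irr'(2)[OF that(2)] \<open>rep_iso G (?Y X) (?X W)\<close>])
  qed
  have cc: "card {a \<in> A. kA a = k} = card {b \<in> B. kB b = k}" for k
  proof (cases "k \<in> kA ` A")
    case True
    then obtain W where W: "W \<in> A" "k = kA W" by blast
    have "{a \<in> A. kA a = k} = {W' \<in> A. rep_iso G (?X W') (?X W)}"
      using sA W by blast
    moreover have "{b \<in> B. kB b = k} = {W' \<in> B. rep_iso G (?Y W') (?X W)}"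
      using sB W by blast
    ultimately show ?thesis using cA[OF irr(1)[OF W(1)]] by simp
  next
    case False
    \<comment> \<open>By equality of counts a summand of \<open>S\<close> also occurs in
      \<open>R\<close>, so its key is already a key of some member of \<open>A\<close>.\<close>
    have "kB X \<noteq> k" if X: "X \<in> B" for X
    proof -
      have "{W \<in> B. rep_iso G (?Y W) (?Y X)} \<noteq> {}" using X rep_iso_refl by blast
      then have "card {W \<in> B. rep_iso G (?Y W) (?Y X)} \<noteq> 0"
        using irr_decompositionD(1)[OF B] by simp
      then have "{W \<in> A. rep_iso G (?X W) (?Y X)} \<noteq> {}"
        using cA[OF irr'(1)[OF X]] by (metis card.empty)
      then obtain W where W: "W \<in> A" "rep_iso G (?X W) (?Y X)" by blast
      then have "kB X = kA W" using sB[OF W(1) X] rep_iso_sym[OF irr(2)[OF W(1)] W(2)] by simp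
      then show ?thesis using False W(1) by blast
    qed
    then have "{b \<in> B. kB b = k} = {}" by blast
    moreover have "{a \<in> A. kA a = k} = {}" using False by blast
    ultimately show ?thesis by (simp only: card.empty)
  qed
  obtain f where f: "bij_betw f A B" "\<And>W. W \<in> A \<Longrightarrow> kB (f W) = kA W"
    by (rule bij_betw_of_fibre_cards[OF irr_decompositionD(1)[OF A] irr_decompositionD(1)[OF B] cc])
      (rule that; fast)
  have fB: "f W \<in> B" if "W \<in> A" for W using that f(1) by (auto simp: bij_betw_def)
  have "\<forall>W\<in>A. \<exists>T. lin_on W T \<and> bij_betw T W (f W) \<and>
      (\<forall>g\<in>carrier G. \<forall>v\<in>W. T (act R g v) = act S g (T v))"
  proof
    fix W assume W: "W \<in> A"
    have "rep_iso G (?X W) (?Y (f W))"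
      using sB[OF W fB[OF W]] f(2)[OF W] by (intro rep_iso_sym[OF irr'(2)[OF fB[OF W]]]) simp
    then show "\<exists>T. lin_on W T \<and> bij_betw T W (f W) \<and>
      (\<forall>g\<in>carrier G. \<forall>v\<in>W. T (act R g v) = act S g (T v))" by (simp add: rep_iso_def)
  qed
  then obtain \<tau> where \<tau>: "\<And>W. W \<in> A \<Longrightarrow> lin_on W (\<tau> W)" "\<And>W. W \<in> A \<Longrightarrow> bij_betw (\<tau> W) W (f W)"
    "\<And>W g v. W \<in> A \<Longrightarrow> g \<in> carrier G \<Longrightarrow> v \<in> W \<Longrightarrow> \<tau> W (act R g v) = act S g (\<tau> W v)" by metis
  let ?\<pi> = "component A" and ?\<rho> = "component B"
  note \<pi> = component[OF A] and \<rho> = component[OF B]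
  define f' where "f' = inv_into A f"
  have f': "f' X \<in> A" "f (f' X) = X" if "X \<in> B" for X
    using that f(1) by (auto simp: f'_def bij_betw_def inv_into_into f_inv_into_f)
  have f'f: "f' (f W) = W" if "W \<in> A" for W
    using that f(1) by (auto simp: f'_def bij_betw_def)
  \<comment> \<open>The glued map: take components in \<open>A\<close>, move each to its partner,
    and add. \<open>TB\<close> rewrites the sum over \<open>B\<close>, where uniqueness of
    components applies.\<close>
  define T where "T = (\<lambda>v. \<Sum>W\<in>A. \<tau> W (?\<pi> W v))"
  have \<tau>m: "\<tau> W w \<in> f W" if "W \<in> A" "w \<in> W" for W w
    using \<tau>(2)[OF that(1)] that(2) by (auto simp: bij_betw_def)
  have TB: "T v = (\<Sum>X\<in>B. \<tau> (f' X) (?\<pi> (f' X) v))" for v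
    unfolding T_def sum.reindex_bij_betw[OF f(1), symmetric] using f'f by (intro sum.cong refl) simp
  have T\<rho>: "T v \<in> vspace S \<and> (\<forall>X\<in>B. ?\<rho> X (T v) = \<tau> (f' X) (?\<pi> (f' X) v))" if v: "v \<in> vspace R" for v
    using \<tau>m[OF f'(1) \<pi>(2)[OF f'(1) v]] f'(2) by (intro \<rho>(5) TB) auto
  have T_lin: "lin_on (vspace R) T"
    unfolding T_def
    by (rule lin_on_sum_fun, rule lin_on_comp[OF \<pi>(1) _ \<tau>(1)]) (use \<pi>(2) in auto)
  have inj: "inj_on T (vspace R)"
  proof (rule inj_onI)
    fix u v assume uv: "u \<in> vspace R" "v \<in> vspace R" "T u = T v"
    have "?\<pi> W u = ?\<pi> W v" if W: "W \<in> A" for W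
    proof -
      have "\<tau> (f' (f W)) (?\<pi> (f' (f W)) u) = \<tau> (f' (f W)) (?\<pi> (f' (f W)) v)"
        using T\<rho>[OF uv(1)] T\<rho>[OF uv(2)] uv(3) fB[OF W] by metis
      then show ?thesis
        unfolding f'f[OF W]
        by (rule inj_onD[OF bij_betw_imp_inj_on[OF \<tau>(2)[OF W]] _ \<pi>(2)[OF W uv(1)] \<pi>(2)[OF W uv(2)]])
    qed
    then have "(\<Sum>W\<in>A. ?\<pi> W u) = (\<Sum>W\<in>A. ?\<pi> W v)" by (rule sum.cong[OF refl])
    then show "u = v" unfolding \<pi>(4)[OF uv(1)] \<pi>(4)[OF uv(2)] .
  qed
  have surj: "vspace S \<subseteq> T ` vspace R"
  proof
    fix y assume y: "y \<in> vspace S"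
    define w where "w = (\<lambda>W. inv_into W (\<tau> W) (?\<rho> (f W) y))"
    have w: "w W \<in> W" "\<tau> W (w W) = ?\<rho> (f W) y" if W: "W \<in> A" for W
    proof -
      have "?\<rho> (f W) y \<in> \<tau> W ` W"
        using \<tau>(2)[OF W] \<rho>(2)[OF fB[OF W] y] by (auto simp: bij_betw_def)
      then show "w W \<in> W" "\<tau> W (w W) = ?\<rho> (f W) y"
        by (auto simp: w_def inv_into_into f_inv_into_f)
    qed
    let ?v = "\<Sum>W\<in>A. w W"
    have v: "?v \<in> vspace R" "\<And>W. W \<in> A \<Longrightarrow> ?\<pi> W ?v = w W" using \<pi>(5)[OF w(1) refl] by auto
    have "T ?v = (\<Sum>W\<in>A. ?\<rho> (f W) y)" unfolding T_def using v(2) w(2) by (intro sum.cong) auto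
    also have "\<dots> = (\<Sum>X\<in>B. ?\<rho> X y)" by (rule sum.reindex_bij_betw[OF f(1)])
    also have "\<dots> = y" by (rule \<rho>(4)[OF y])
    finally show "y \<in> T ` vspace R" using v(1) by (metis image_eqI)
  qed
  have "T (act R g v) = act S g (T v)" if g: "g \<in> carrier G" and v: "v \<in> vspace R" for g v
  proof -
    have inv: "cfun.subspace W" "W \<subseteq> vspace R" "\<And>w. w \<in> W \<Longrightarrow> act R g w \<in> W" if "W \<in> A" for W
      using irr_decompositionD(2)[OF A that] g by (auto simp: invariant_subspace_def)
    have invB: "X \<subseteq> vspace S" if "X \<in> B" for X
      using irr_decompositionD(2)[OF B that] by (auto simp: invariant_subspace_def)
    have "act R g v = act R g (\<Sum>W\<in>A. ?\<pi> W v)" unfolding \<pi>(4)[OF v] ..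
    also have "\<dots> = (\<Sum>W\<in>A. act R g (?\<pi> W v))"
      using \<pi>(2)[OF _ v] inv(2) by (intro lin_on_sum[OF repD(3)[OF R g] repD(2)[OF R]]) blast
    finally have "?\<pi> W (act R g v) = act R g (?\<pi> W v)" if "W \<in> A" for W
      using \<pi>(5)[of "\<lambda>W. act R g (?\<pi> W v)" "act R g v"] inv(3) \<pi>(2)[OF _ v] that by blast
    then have "T (act R g v) = (\<Sum>W\<in>A. act S g (\<tau> W (?\<pi> W v)))"
      unfolding T_def using \<tau>(3)[OF _ g \<pi>(2)[OF _ v]] by (intro sum.cong refl) simp
    also have "\<dots> = act S g (T v)"
      unfolding T_def using \<tau>m[OF _ \<pi>(2)[OF _ v]] invB[OF fB]
      by (intro lin_on_sum[OF repD(3)[OF S g] repD(2)[OF S], symmetric]) blast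
    finally show ?thesis .
  qed
  moreover have "bij_betw T (vspace R) (vspace S)"
    unfolding bij_betw_def using inj surj T\<rho> by blast
  ultimately show ?thesis unfolding rep_iso_def using T_lin by blast
qed

end

section \<open>Specht modules\<close>

definition tab_act :: "(nat \<Rightarrow> nat) \<Rightarrow> (nat set list \<Rightarrow> complex) \<Rightarrow> nat set list \<Rightarrow> complex" where
  "tab_act p v = (\<lambda>T. v (map (image (Hilbert_Choice.inv p)) T))"

definition tab_delta :: "nat set list \<Rightarrow> nat set list \<Rightarrow> complex" where
  "tab_delta T' = (\<lambda>T. if T = T' then 1 else 0)"

text \<open>James's signed column sum \<open>\<kappa>_t\<close>, as an operator on functions on
  tabloids. It may be applied to tabloids of another shape than \<open>\<mu>\<close>.\<close>

definition col_antisym :: "nat list \<Rightarrow> (nat \<times> nat \<Rightarrow> nat) \<Rightarrow> (nat set list \<Rightarrow> complex) \<Rightarrow> nat set list \<Rightarrow> complex" where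
  "col_antisym \<mu> t v = (\<Sum>p\<in>column_stabilizer \<mu> t. cscale (of_int (sign p)) (tab_act p v))"

text \<open>The row of the cell of \<open>t\<close> that holds \<open>x\<close>, counted from 0;
  meaningful only for entries \<open>x\<close> of the tableau.\<close>

definition row_of :: "nat list \<Rightarrow> (nat \<times> nat \<Rightarrow> nat) \<Rightarrow> nat \<Rightarrow> nat" where
  "row_of \<mu> t x = fst (inv_into (diagram \<mu>) t x)"

definition col_of :: "nat list \<Rightarrow> (nat \<times> nat \<Rightarrow> nat) \<Rightarrow> nat \<Rightarrow> nat" where
  "col_of \<mu> t x = snd (inv_into (diagram \<mu>) t x)"

lemma specht_simps: "vspace (specht \<mu>) = cfun.span (polytabloid \<mu> ` {t. tableau \<mu> t})"
  "act (specht \<mu>) = tab_act"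
  by (simp_all add: specht_def tab_act_def fun_eq_iff)

lemma tab_act_lin: "lin_on V (tab_act p)"
  by (auto simp: lin_on_def tab_act_def fun_eq_iff)

lemma tab_act_comp:
  assumes "bij p" "bij q"
  shows "tab_act (p \<circ> q) v = tab_act p (tab_act q v)"
  using o_inv_distrib[OF assms] by (simp add: tab_act_def image_comp comp_def)

lemma tab_act_id: "tab_act id v = v"
  by (simp add: tab_act_def)

lemma map_image_inv_eq_iff:
  assumes "bij p"
  shows "map (image (Hilbert_Choice.inv p)) T = T' \<longleftrightarrow> T = map (image p) T'"
proof
  assume "map (image (Hilbert_Choice.inv p)) T = T'"
  then have "map (image p) T' = map (image p) (map (image (Hilbert_Choice.inv p)) T)" by simp
  also have "\<dots> = T" by (simp add: comp_def image_image surj_f_inv_f[OF bij_is_surj[OF assms]])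
  finally show "T = map (image p) T'" by simp
next
  assume "T = map (image p) T'"
  then show "map (image (Hilbert_Choice.inv p)) T = T'"
    by (simp add: comp_def image_image inv_f_f[OF bij_is_inj[OF assms]])
qed

lemma tab_act_delta: "bij p \<Longrightarrow> tab_act p (tab_delta T) = tab_delta (map (image p) T)"
  by (auto simp: tab_act_def tab_delta_def fun_eq_iff map_image_inv_eq_iff)

lemma finite_column_stabilizer: "finite (column_stabilizer \<mu> t)"
  by (rule finite_subset[OF _ finite_permutations[of "{1..sum_list \<mu>}"]])
    (auto simp: column_stabilizer_def)

lemma column_stabilizer_permutes: "p \<in> column_stabilizer \<mu> t \<Longrightarrow> p permutes {1..sum_list \<mu>}"
  by (simp add: column_stabilizer_def)

lemma polytabloid_eq: "polytabloid \<mu> t = col_antisym \<mu> t (tab_delta (tabloid \<mu> t))"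
proof
  fix T
  have "tab_act p (tab_delta (tabloid \<mu> t)) T = (if T = map (image p) (tabloid \<mu> t) then 1 else 0)"
    if "p \<in> column_stabilizer \<mu> t" for p
    unfolding tab_act_delta[OF permutes_bij[OF column_stabilizer_permutes[OF that]]]
    by (simp add: tab_delta_def)
  then show "polytabloid \<mu> t T = col_antisym \<mu> t (tab_delta (tabloid \<mu> t)) T"
    by (simp add: polytabloid_def col_antisym_def sum_fun_apply)
qed

lemma permutes_interval_permutation: "p permutes {1..n::nat} \<Longrightarrow> permutation p"
  unfolding permutation_permutes by blast

lemma column_stabilizer_comp:
  assumes "p \<in> column_stabilizer \<mu> t" "q \<in> column_stabilizer \<mu> t"
  shows "p \<circ> q \<in> column_stabilizer \<mu> t"
  unfolding column_stabilizer_def mem_Collect_eq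
proof (intro conjI allI)
  show "p \<circ> q permutes {1..sum_list \<mu>}"
    using assms by (auto simp: column_stabilizer_def intro: permutes_compose)
  show "(p \<circ> q) ` t ` {c \<in> diagram \<mu>. snd c = j} = t ` {c \<in> diagram \<mu>. snd c = j}" for j
    using assms unfolding column_stabilizer_def image_comp[of p q, symmetric] mem_Collect_eq by metis
qed

lemma column_stabilizer_inv:
  assumes "p \<in> column_stabilizer \<mu> t"
  shows "Hilbert_Choice.inv p \<in> column_stabilizer \<mu> t"
proof -
  have p: "p permutes {1..sum_list \<mu>}" and c: "\<And>j. p ` t ` {c \<in> diagram \<mu>. snd c = j} = t ` {c \<in> diagram \<mu>. snd c = j}"
    using assms by (auto simp: column_stabilizer_def)
  have "Hilbert_Choice.inv p ` t ` {c \<in> diagram \<mu>. snd c = j} = t ` {c \<in> diagram \<mu>. snd c = j}" for j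
  proof -
    have "Hilbert_Choice.inv p ` p ` t ` {c \<in> diagram \<mu>. snd c = j} = t ` {c \<in> diagram \<mu>. snd c = j}"
      by (rule image_inv_f_f[OF permutes_inj[OF p]])
    then show ?thesis by (simp only: c)
  qed
  then show ?thesis using permutes_inv[OF p] unfolding column_stabilizer_def by blast
qed

lemma col_antisym_lin: "lin_on V (col_antisym \<mu> t)"
  unfolding col_antisym_def[abs_def]
  by (rule lin_on_sum_fun) (auto simp: lin_on_def tab_act_def fun_eq_iff algebra_simps)

lemma sign_sq: "of_int (sign p) * of_int (sign p) = (1 :: complex)"
  by (simp add: sign_def)

text \<open>Right multiplication by \<open>q\<close> permutes the column stabilizer and changes
  every sign by \<open>sign q\<close>.\<close>

lemma col_antisym_tab_act:
  assumes q: "q \<in> column_stabilizer \<mu> t"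
  shows "col_antisym \<mu> t (tab_act q v) = cscale (of_int (sign q)) (col_antisym \<mu> t v)"
proof -
  note qp = column_stabilizer_permutes[OF q]
  note P = column_stabilizer_permutes permutes_bij permutes_interval_permutation
  have "col_antisym \<mu> t (tab_act q v) = (\<Sum>p\<in>column_stabilizer \<mu> t. cscale (of_int (sign q)) (cscale (of_int (sign p)) (tab_act p v)))"
    unfolding col_antisym_def
  proof (rule sum.reindex_bij_witness[where j = "\<lambda>p. p \<circ> q" and i = "\<lambda>p. p \<circ> Hilbert_Choice.inv q"])
    fix p assume p: "p \<in> column_stabilizer \<mu> t"
    show "(p \<circ> q) \<circ> Hilbert_Choice.inv q = p" "(p \<circ> Hilbert_Choice.inv q) \<circ> q = p"
      by (simp_all add: comp_assoc permutes_inv_o[OF qp])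
    show "p \<circ> q \<in> column_stabilizer \<mu> t" "p \<circ> Hilbert_Choice.inv q \<in> column_stabilizer \<mu> t"
      using column_stabilizer_comp column_stabilizer_inv p q by auto
    have b: "bij p" "bij q" "permutation p" "permutation q" using p q P by blast+
    show "cscale (of_int (sign q)) (cscale (of_int (sign (p \<circ> q))) (tab_act (p \<circ> q) v)) =
        cscale (of_int (sign p)) (tab_act p (tab_act q v))"
      using sign_sq[of q] by (simp add: tab_act_comp[OF b(1,2)] sign_compose[OF b(3,4)] fun_eq_iff)
  qed
  then show ?thesis by (simp add: col_antisym_def cfun.scale_sum_right)
qed

text \<open>The same reindexing with multiplication on the left.\<close>

lemma tab_act_col_antisym:
  assumes q: "q \<in> column_stabilizer \<mu> t"
  shows "tab_act q (col_antisym \<mu> t v) = cscale (of_int (sign q)) (col_antisym \<mu> t v)"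
proof -
  note qp = column_stabilizer_permutes[OF q]
  note P = column_stabilizer_permutes permutes_bij permutes_interval_permutation
  have "tab_act q (col_antisym \<mu> t v) = (\<Sum>p\<in>column_stabilizer \<mu> t. cscale (of_int (sign p)) (tab_act q (tab_act p v)))"
    unfolding col_antisym_def
    by (rule lin_on_lincomb[OF tab_act_lin[of UNIV]]) auto
  also have "\<dots> = (\<Sum>p\<in>column_stabilizer \<mu> t. cscale (of_int (sign q)) (cscale (of_int (sign p)) (tab_act p v)))"
  proof (rule sum.reindex_bij_witness[where j = "\<lambda>p. q \<circ> p" and i = "\<lambda>p. Hilbert_Choice.inv q \<circ> p"])
    fix p assume p: "p \<in> column_stabilizer \<mu> t"
    show "Hilbert_Choice.inv q \<circ> (q \<circ> p) = p" "q \<circ> (Hilbert_Choice.inv q \<circ> p) = p"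
      by (simp_all add: comp_assoc[symmetric] permutes_inv_o[OF qp])
    show "q \<circ> p \<in> column_stabilizer \<mu> t" "Hilbert_Choice.inv q \<circ> p \<in> column_stabilizer \<mu> t"
      using column_stabilizer_comp column_stabilizer_inv p q by auto
    have b: "bij p" "bij q" "permutation p" "permutation q" using p q P by blast+
    show "cscale (of_int (sign q)) (cscale (of_int (sign (q \<circ> p))) (tab_act (q \<circ> p) v)) =
        cscale (of_int (sign p)) (tab_act q (tab_act p v))"
      using sign_sq[of q] by (simp add: tab_act_comp[OF b(2,1)] sign_compose[OF b(4,3)] fun_eq_iff)
  qed
  finally show ?thesis by (simp add: col_antisym_def cfun.scale_sum_right)
qed

section \<open>Tableaux, their rows and columns, and the action on the Specht module\<close>

lemma diagram_Sigma: "diagram \<mu> = Sigma {..<length \<mu>} (\<lambda>i. {..<\<mu> ! i})"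
  by (auto simp: diagram_def)

lemma finite_diagram: "finite (diagram \<mu>)"
  by (simp add: diagram_Sigma)

lemma card_diagram_rows: "card {c \<in> diagram \<mu>. fst c < m} = sum_list (take m \<mu>)"
proof -
  have "{c \<in> diagram \<mu>. fst c < m} = Sigma {..<min m (length \<mu>)} (\<lambda>i. {..<\<mu> ! i})"
    by (auto simp: diagram_def)
  then show ?thesis by (simp add: sum_list_sum_nth atLeast0LessThan min.commute)
qed

lemma card_diagram: "card (diagram \<mu>) = sum_list \<mu>"
proof -
  have "{c \<in> diagram \<mu>. fst c < length \<mu>} = diagram \<mu>" by (auto simp: diagram_def)
  then show ?thesis using card_diagram_rows[of \<mu> "length \<mu>"] by simp
qed

lemma tableau_exists: "\<exists>t. tableau \<mu> t"
  unfolding tableau_def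
  by (rule finite_same_card_bij) (auto simp: finite_diagram card_diagram)

lemma tableau_cell:
  assumes "tableau \<mu> t"
  shows "x \<in> {1..sum_list \<mu>} \<Longrightarrow> (row_of \<mu> t x, col_of \<mu> t x) \<in> diagram \<mu>"
    "x \<in> {1..sum_list \<mu>} \<Longrightarrow> t (row_of \<mu> t x, col_of \<mu> t x) = x"
    "(i, j) \<in> diagram \<mu> \<Longrightarrow> row_of \<mu> t (t (i, j)) = i"
    "(i, j) \<in> diagram \<mu> \<Longrightarrow> col_of \<mu> t (t (i, j)) = j"
    "(i, j) \<in> diagram \<mu> \<Longrightarrow> t (i, j) \<in> {1..sum_list \<mu>}"
proof -
  have b: "inj_on t (diagram \<mu>)" "t ` diagram \<mu> = {1..sum_list \<mu>}"
    using assms by (auto simp: tableau_def bij_betw_def)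
  show "(row_of \<mu> t x, col_of \<mu> t x) \<in> diagram \<mu>" "t (row_of \<mu> t x, col_of \<mu> t x) = x"
    if "x \<in> {1..sum_list \<mu>}"
    using inv_into_into[of x t "diagram \<mu>"] f_inv_into_f[of x t "diagram \<mu>"] that
    unfolding row_of_def col_of_def prod.collapse b(2) by simp_all
  assume ij: "(i, j) \<in> diagram \<mu>"
  then show "row_of \<mu> t (t (i, j)) = i" "col_of \<mu> t (t (i, j)) = j"
    by (simp_all add: row_of_def col_of_def b(1))
  show "t (i, j) \<in> {1..sum_list \<mu>}" using b(2) ij by blast
qed

lemma tabloid_rows:
  assumes "tableau \<mu> t"
  shows "tabloid \<mu> t = map (\<lambda>i. {x \<in> {1..sum_list \<mu>}. row_of \<mu> t x = i}) [0..<length \<mu>]"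
  unfolding tabloid_def
proof (rule map_cong[OF refl], intro equalityI subsetI)
  fix i x assume "i \<in> set [0..<length \<mu>]" "x \<in> t ` {(i, j) |j. j < \<mu> ! i}"
  then obtain j where j: "(i, j) \<in> diagram \<mu>" "x = t (i, j)" by (auto simp: diagram_def)
  then show "x \<in> {x \<in> {1..sum_list \<mu>}. row_of \<mu> t x = i}"
    using tableau_cell(3,5)[OF assms j(1)] by simp
next
  fix i x assume "i \<in> set [0..<length \<mu>]" "x \<in> {x \<in> {1..sum_list \<mu>}. row_of \<mu> t x = i}"
  then have x: "x \<in> {1..sum_list \<mu>}" "row_of \<mu> t x = i" by auto
  have "(i, col_of \<mu> t x) \<in> diagram \<mu>" "x = t (i, col_of \<mu> t x)"
    using tableau_cell(1,2)[OF assms x(1)] x(2) by auto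
  then show "x \<in> t ` {(i, j) |j. j < \<mu> ! i}" by (auto simp: diagram_def)
qed

text \<open>Preserving the column of each entry maps every column into itself; being finite, it is
  then mapped onto itself.\<close>

lemma column_stabilizer_iff:
  assumes "tableau \<mu> t"
  shows "p \<in> column_stabilizer \<mu> t \<longleftrightarrow> p permutes {1..sum_list \<mu>} \<and>
    (\<forall>x\<in>{1..sum_list \<mu>}. col_of \<mu> t (p x) = col_of \<mu> t x)"
proof -
  let ?C = "\<lambda>j. t ` {c \<in> diagram \<mu>. snd c = j}"
  have C: "?C j = {x \<in> {1..sum_list \<mu>}. col_of \<mu> t x = j}" for j
  proof (intro equalityI subsetI)
    fix x assume "x \<in> ?C j"
    then obtain i where "(i, j) \<in> diagram \<mu>" "x = t (i, j)" by auto
    then show "x \<in> {x \<in> {1..sum_list \<mu>}. col_of \<mu> t x = j}"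
      using tableau_cell(4,5)[OF assms] by simp
  next
    fix x assume "x \<in> {x \<in> {1..sum_list \<mu>}. col_of \<mu> t x = j}"
    then have x: "x \<in> {1..sum_list \<mu>}" "col_of \<mu> t x = j" by auto
    show "x \<in> ?C j"
      using tableau_cell(1,2)[OF assms x(1)] x(2)
      by (intro image_eqI[of _ _ "(row_of \<mu> t x, col_of \<mu> t x)"]) auto
  qed
  show ?thesis
  proof
    assume "p \<in> column_stabilizer \<mu> t"
    then have p: "p permutes {1..sum_list \<mu>}" "\<And>j. p ` ?C j = ?C j" by (auto simp: column_stabilizer_def)
    have "col_of \<mu> t (p x) = col_of \<mu> t x" if "x \<in> {1..sum_list \<mu>}" for x
      using p(2)[of "col_of \<mu> t x"] that unfolding C by blast
    then show "p permutes {1..sum_list \<mu>} \<and> (\<forall>x\<in>{1..sum_list \<mu>}. col_of \<mu> t (p x) = col_of \<mu> t x)"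
      using p(1) by blast
  next
    assume r: "p permutes {1..sum_list \<mu>} \<and> (\<forall>x\<in>{1..sum_list \<mu>}. col_of \<mu> t (p x) = col_of \<mu> t x)"
    have "p ` ?C j = ?C j" for j
    proof (rule endo_inj_surj)
      show "p ` ?C j \<subseteq> ?C j" unfolding C using r permutes_in_image[of p "{1..sum_list \<mu>}"] by auto
      show "inj_on p (?C j)" using r permutes_inj_on by blast
    qed (simp add: finite_diagram)
    then show "p \<in> column_stabilizer \<mu> t" using r by (simp add: column_stabilizer_def)
  qed
qed

text \<open>The column stabilizer of \<open>p \<circ> t\<close> is the conjugate by \<open>p\<close>
  of that of \<open>t\<close>, and conjugation preserves signs.\<close>

lemma permuted_tableau:
  assumes t: "tableau \<mu> t" and p: "p permutes {1..sum_list \<mu>}"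
  shows "tableau \<mu> (p \<circ> t)" "tabloid \<mu> (p \<circ> t) = map (image p) (tabloid \<mu> t)"
    "polytabloid \<mu> (p \<circ> t) = tab_act p (polytabloid \<mu> t)"
proof -
  show "tableau \<mu> (p \<circ> t)"
    using t bij_betw_trans[OF _ permutes_imp_bij[OF p]] by (auto simp: tableau_def)
  show tb: "tabloid \<mu> (p \<circ> t) = map (image p) (tabloid \<mu> t)"
    by (simp add: tabloid_def image_comp)
  note bp = permutes_bij[OF p]
  let ?i = "Hilbert_Choice.inv p"
  note ip = permutes_inv[OF p] and io = permutes_inv_o[OF p]
  have cs: "q \<in> column_stabilizer \<mu> (p \<circ> t) \<longleftrightarrow> ?i \<circ> q \<circ> p \<in> column_stabilizer \<mu> t" for q
  proof -
    have "q permutes {1..sum_list \<mu>} \<longleftrightarrow> ?i \<circ> q \<circ> p permutes {1..sum_list \<mu>}"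
    proof
      assume "q permutes {1..sum_list \<mu>}"
      then show "?i \<circ> q \<circ> p permutes {1..sum_list \<mu>}" using p ip by (intro permutes_compose)
    next
      assume r: "?i \<circ> q \<circ> p permutes {1..sum_list \<mu>}"
      have "p \<circ> (?i \<circ> q \<circ> p) \<circ> ?i permutes {1..sum_list \<mu>}"
        by (rule permutes_compose[OF ip permutes_compose[OF r p]])
      also have "p \<circ> (?i \<circ> q \<circ> p) \<circ> ?i = (p \<circ> ?i) \<circ> q \<circ> (p \<circ> ?i)" by (simp only: comp_assoc)
      also have "\<dots> = q" by (simp add: io)
      finally show "q permutes {1..sum_list \<mu>}" .
    qed
    moreover have "q ` (p \<circ> t) ` X = (p \<circ> t) ` X \<longleftrightarrow> (?i \<circ> q \<circ> p) ` t ` X = t ` X" for X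
    proof -
      have "(?i \<circ> q \<circ> p) ` t ` X = ?i ` q ` (p \<circ> t) ` X" by (simp add: image_comp comp_assoc)
      moreover have "t ` X = ?i ` (p \<circ> t) ` X"
        using permutes_inj[OF p] by (simp add: image_comp comp_assoc[symmetric] io)
      ultimately show ?thesis
        using inj_image_eq_iff[OF permutes_inj[OF ip]] by (metis (no_types, lifting))
    qed
    ultimately show ?thesis unfolding column_stabilizer_def mem_Collect_eq by simp
  qed
  have "tab_act p (polytabloid \<mu> t) =
      (\<Sum>q\<in>column_stabilizer \<mu> t. cscale (of_int (sign q)) (tab_act p (tab_act q (tab_delta (tabloid \<mu> t)))))"
    unfolding polytabloid_eq col_antisym_def
    by (rule lin_on_lincomb[OF tab_act_lin[of UNIV]]) auto
  also have "\<dots> = (\<Sum>q\<in>column_stabilizer \<mu> (p \<circ> t). cscale (of_int (sign q)) (tab_act q (tab_delta (tabloid \<mu> (p \<circ> t)))))"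
  proof (rule sum.reindex_bij_witness[where j = "\<lambda>q. p \<circ> q \<circ> ?i" and i = "\<lambda>q. ?i \<circ> q \<circ> p"])
    fix q assume q: "q \<in> column_stabilizer \<mu> t"
    have *: "?i \<circ> (p \<circ> q \<circ> ?i) \<circ> p = (?i \<circ> p) \<circ> q \<circ> (?i \<circ> p)" by (simp only: comp_assoc)
    show e: "?i \<circ> (p \<circ> q \<circ> ?i) \<circ> p = q" unfolding * by (simp add: io)
    show "p \<circ> q \<circ> ?i \<in> column_stabilizer \<mu> (p \<circ> t)" unfolding cs e by (rule q)
    note qp = column_stabilizer_permutes[OF q]
    have b: "permutation p" "permutation q" "permutation ?i" "bij q" "bij ?i"
      using permutes_interval_permutation[OF p] permutes_interval_permutation[OF qp]
        permutes_interval_permutation[OF ip] permutes_bij[OF qp] permutes_bij[OF ip] by auto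
    have s: "sign (p \<circ> q \<circ> ?i) = sign q"
      using sign_compose[OF permutation_compose[OF b(1,2)] b(3)] sign_compose[OF b(1,2)] sign_inverse[OF b(1)]
        by (simp add: sign_def)
    have "tab_act (p \<circ> q \<circ> ?i) (tab_delta (tabloid \<mu> (p \<circ> t))) =
        tab_act (p \<circ> q) (tab_act (?i \<circ> p) (tab_delta (tabloid \<mu> t)))"
      unfolding tb tab_act_delta[OF bp, symmetric]
      by (simp add: tab_act_comp bp b bij_comp)
    also have "\<dots> = tab_act p (tab_act q (tab_delta (tabloid \<mu> t)))"
      by (simp add: io tab_act_id tab_act_comp bp b)
    finally show "cscale (of_int (sign (p \<circ> q \<circ> ?i))) (tab_act (p \<circ> q \<circ> ?i) (tab_delta (tabloid \<mu> (p \<circ> t)))) =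
        cscale (of_int (sign q)) (tab_act p (tab_act q (tab_delta (tabloid \<mu> t))))" unfolding s by (rule arg_cong)
  next
    fix q assume q: "q \<in> column_stabilizer \<mu> (p \<circ> t)"
    have *: "p \<circ> (?i \<circ> q \<circ> p) \<circ> ?i = (p \<circ> ?i) \<circ> q \<circ> (p \<circ> ?i)" by (simp only: comp_assoc)
    show "p \<circ> (?i \<circ> q \<circ> p) \<circ> ?i = q" unfolding * by (simp add: io)
    show "?i \<circ> q \<circ> p \<in> column_stabilizer \<mu> t" using q unfolding cs .
  qed
  finally show "polytabloid \<mu> (p \<circ> t) = tab_act p (polytabloid \<mu> t)"
    by (simp add: polytabloid_eq col_antisym_def)
qed

lemma coords_supported:
  assumes "finite D"
  shows "coords {v. \<forall>x. x \<notin> D \<longrightarrow> v x = 0} D (\<lambda>p x. if x = p then 1 else 0)"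
proof (rule coordsI)
  fix v :: "'a \<Rightarrow> complex" and x
  assume "v \<in> {v. \<forall>x. x \<notin> D \<longrightarrow> v x = 0}"
  then have "x \<notin> D \<Longrightarrow> v x = 0" by blast
  moreover have "(\<Sum>p\<in>D. v p * (if x = p then 1 else 0)) = (\<Sum>p\<in>D. if x = p then v p else 0)"
    by (intro sum.cong) auto
  ultimately show "v x = (\<Sum>p\<in>D. v p * (if x = p then 1 else 0))" using assms by simp
qed (use assms in \<open>auto simp: cfun.subspace_def\<close>)

definition tabloids :: "nat list \<Rightarrow> nat set list set" where
  "tabloids \<mu> = tabloid \<mu> ` {t. tableau \<mu> t}"

lemma finite_tabloids: "finite (tabloids \<mu>)"
proof (rule finite_subset)
  show "tabloids \<mu> \<subseteq> {xs. set xs \<subseteq> Pow {1..sum_list \<mu>} \<and> length xs = length \<mu>}"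
    by (auto simp: tabloids_def tabloid_rows)
  show "finite {xs. set xs \<subseteq> Pow {1..sum_list \<mu>} \<and> length xs = length \<mu>}"
    by (rule finite_lists_length_eq) simp
qed

lemma polytabloid_supported:
  assumes "tableau \<mu> t" "T \<notin> tabloids \<mu>"
  shows "polytabloid \<mu> t T = 0"
proof -
  have "T \<noteq> map (image p) (tabloid \<mu> t)" if "p \<in> column_stabilizer \<mu> t" for p
    using permuted_tableau[OF assms(1) column_stabilizer_permutes[OF that]] assms(2)
    unfolding tabloids_def by (metis image_eqI mem_Collect_eq)
  then show ?thesis unfolding polytabloid_def by (intro sum.neutral) simp
qed

lemma specht_supported:
  assumes "v \<in> vspace (specht \<mu>)" "T \<notin> tabloids \<mu>"
  shows "v T = 0"
proof -
  have "vspace (specht \<mu>) \<subseteq> {v. \<forall>T. T \<notin> tabloids \<mu> \<longrightarrow> v T = 0}"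
    unfolding specht_simps
    by (intro cfun.span_minimal coordsD(2)[OF coords_supported[OF finite_tabloids]])
      (auto simp: polytabloid_supported)
  then show ?thesis using assms by blast
qed

lemma polytabloid_in_specht: "tableau \<mu> t \<Longrightarrow> polytabloid \<mu> t \<in> vspace (specht \<mu>)"
  unfolding specht_simps by (intro cfun.span_base) blast

lemma specht_rep: "representation (sym_group (sum_list \<mu>)) (specht \<mu>)"
proof (rule repI)
  have "vspace (specht \<mu>) \<subseteq> {v. \<forall>T. T \<notin> tabloids \<mu> \<longrightarrow> v T = 0}"
    using specht_supported by blast
  then show "fdim (vspace (specht \<mu>))"
    by (rule fdim_subset[OF coords_fdim[OF coords_supported[OF finite_tabloids]], rotated])
      (simp add: specht_simps)
  show "lin_on (vspace (specht \<mu>)) (act (specht \<mu>) p)" for p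
    unfolding specht_simps by (rule tab_act_lin)
  show "act (specht \<mu>) p v \<in> vspace (specht \<mu>)"
    if "p \<in> carrier (sym_group (sum_list \<mu>))" "v \<in> vspace (specht \<mu>)" for p v
  proof -
    have p: "p permutes {1..sum_list \<mu>}" using that(1) by (simp add: sym_group_carrier)
    show ?thesis
      unfolding specht_simps(2)
    proof (rule lin_on_span_closed[OF tab_act_lin _ _ that(2)[unfolded specht_simps]])
      show "cfun.subspace (vspace (specht \<mu>))" by (simp add: specht_simps)
      fix b assume "b \<in> polytabloid \<mu> ` {t. tableau \<mu> t}"
      then obtain t where t: "tableau \<mu> t" "b = polytabloid \<mu> t" by blast
      show "tab_act p b \<in> vspace (specht \<mu>)"
        unfolding t(2) permuted_tableau(3)[OF t(1) p, symmetric]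
        by (rule polytabloid_in_specht[OF permuted_tableau(1)[OF t(1) p]])
    qed
  qed
  show "act (specht \<mu>) \<one>\<^bsub>sym_group (sum_list \<mu>)\<^esub> v = v" for v
    by (simp add: specht_simps sym_group_one tab_act_id)
  show "act (specht \<mu>) (p \<otimes>\<^bsub>sym_group (sum_list \<mu>)\<^esub> q) v = act (specht \<mu>) p (act (specht \<mu>) q v)"
    if "p \<in> carrier (sym_group (sum_list \<mu>))" "q \<in> carrier (sym_group (sum_list \<mu>))" for p q v
    using that by (simp add: specht_simps sym_group_carrier sym_group_mult tab_act_comp permutes_bij)
qed

section \<open>Separated tableaux and the dominance order\<close>

lemma down_closed_nat_eq:
  fixes I :: "nat set"
  assumes "finite I" "\<And>i j. i \<in> I \<Longrightarrow> j < i \<Longrightarrow> j \<in> I"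
  shows "I = {..<card I}"
proof -
  obtain m where m: "I = {..<m}"
  proof (cases "I = {}")
    case True
    then show ?thesis using that[of 0] by simp
  next
    case False
    then have "Max I \<in> I" "\<And>i. i \<in> I \<Longrightarrow> i \<le> Max I" using assms(1) by auto
    then have "I = {..<Suc (Max I)}"
      using assms(2)[of "Max I"] by (auto simp: less_Suc_eq_le le_less)
    then show ?thesis using that by blast
  qed
  then show ?thesis by simp
qed

text \<open>
  Entries in one row of \<^term>\<open>s\<close> lie in different columns of \<^term>\<open>t\<close>; then a column of
  \<^term>\<open>t\<close> contains at most \<^term>\<open>m\<close> entries of the first \<^term>\<open>m\<close> rows of \<^term>\<open>s\<close>.
\<close>

definition row_col_separated :: "nat list \<Rightarrow> (nat \<times> nat \<Rightarrow> nat) \<Rightarrow> nat list \<Rightarrow> (nat \<times> nat \<Rightarrow> nat) \<Rightarrow> bool" where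
  "row_col_separated \<nu> s \<mu> t \<longleftrightarrow>
     (\<forall>x\<in>{1..sum_list \<mu>}. \<forall>y\<in>{1..sum_list \<mu>}. row_of \<nu> s x = row_of \<nu> s y \<and> col_of \<mu> t x = col_of \<mu> t y \<longrightarrow> x = y)"

lemma partition_nth_mono: "partition_of \<mu> n \<Longrightarrow> i \<le> j \<Longrightarrow> j < length \<mu> \<Longrightarrow> \<mu> ! j \<le> \<mu> ! i"
  by (cases "i = j") (auto simp: partition_of_def sorted_wrt_iff_nth_less)

lemma card_first_rows:
  assumes "tableau \<mu> t"
  shows "card {x \<in> {1..sum_list \<mu>}. row_of \<mu> t x < m} = sum_list (take m \<mu>)"
proof -
  have "bij_betw t {c \<in> diagram \<mu>. fst c < m} {x \<in> {1..sum_list \<mu>}. row_of \<mu> t x < m}"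
    unfolding bij_betw_def
  proof
    show "inj_on t {c \<in> diagram \<mu>. fst c < m}"
      using assms by (auto simp: tableau_def bij_betw_def intro: inj_on_subset)
    show "t ` {c \<in> diagram \<mu>. fst c < m} = {x \<in> {1..sum_list \<mu>}. row_of \<mu> t x < m}"
    proof (intro equalityI subsetI)
      fix x assume "x \<in> {x \<in> {1..sum_list \<mu>}. row_of \<mu> t x < m}"
      then have x: "x \<in> {1..sum_list \<mu>}" "row_of \<mu> t x < m" by auto
      show "x \<in> t ` {c \<in> diagram \<mu>. fst c < m}"
        using tableau_cell(1,2)[OF assms x(1)] x(2)
        by (intro image_eqI[of _ _ "(row_of \<mu> t x, col_of \<mu> t x)"]) auto
    next
      fix x assume "x \<in> t ` {c \<in> diagram \<mu>. fst c < m}"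
      then obtain i j where c: "(i, j) \<in> diagram \<mu>" "i < m" "x = t (i, j)" by auto
      show "x \<in> {x \<in> {1..sum_list \<mu>}. row_of \<mu> t x < m}"
        using tableau_cell(3,5)[OF assms c(1)] c(2,3) by simp
    qed
  qed
  then show ?thesis unfolding card_diagram_rows[symmetric] by (rule bij_betw_same_card[symmetric])
qed

text \<open>The row function \<open>r\<close> is left free so that the count by columns of
  \<open>t\<close> applies to the rows of \<open>t\<close> and to the rows of another
  tableau.\<close>

lemma card_rows_by_col:
  assumes "tableau \<mu> t"
  shows "card {x \<in> {1..sum_list \<mu>}. r x < m} =
    (\<Sum>j\<in>col_of \<mu> t ` {1..sum_list \<mu>}. card {x \<in> {1..sum_list \<mu>}. col_of \<mu> t x = j \<and> r x < m})"
proof -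
  let ?X = "{x \<in> {1..sum_list \<mu>}. r x < m}"
  have "card ?X = (\<Sum>x\<in>?X. 1)" by simp
  also have "\<dots> = (\<Sum>j\<in>col_of \<mu> t ` {1..sum_list \<mu>}. \<Sum>x\<in>{x \<in> ?X. col_of \<mu> t x = j}. 1)"
    by (rule sum.group[symmetric]) auto
  also have "\<dots> = (\<Sum>j\<in>col_of \<mu> t ` {1..sum_list \<mu>}. card {x \<in> {1..sum_list \<mu>}. col_of \<mu> t x = j \<and> r x < m})"
    by (intro sum.cong refl) (simp add: conj_ac)
  finally show ?thesis .
qed

text \<open>Column \<open>j\<close> of \<open>t\<close> meets an initial segment of the rows, one
  entry each, so it has exactly the minimum of its length and \<open>m\<close> entries in the first
  \<open>m\<close> rows. By separation its entries also lie in distinct rows of \<open>s\<close>, so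
  at most that many are in the first \<open>m\<close> rows of \<open>s\<close>.\<close>

lemma column_rows_le:
  assumes \<mu>: "partition_of \<mu> n" and t: "tableau \<mu> t" and sep: "row_col_separated \<nu> s \<mu> t"
  shows "card {x \<in> {1..sum_list \<mu>}. col_of \<mu> t x = j \<and> row_of \<nu> s x < m} \<le>
    card {x \<in> {1..sum_list \<mu>}. col_of \<mu> t x = j \<and> row_of \<mu> t x < m}" (is "card ?A \<le> card ?B")
proof -
  let ?C = "{x \<in> {1..sum_list \<mu>}. col_of \<mu> t x = j}"
  let ?I = "{i. i < length \<mu> \<and> j < \<mu> ! i}"
  have I: "?I = {..<card ?I}"
  proof (rule down_closed_nat_eq)
    fix i k assume "i \<in> ?I" "k < i"
    then show "k \<in> ?I" using partition_nth_mono[OF \<mu>, of k i] by auto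
  qed simp
  have bij: "bij_betw (row_of \<mu> t) ?C ?I"
    unfolding bij_betw_def
  proof
    show "inj_on (row_of \<mu> t) ?C"
    proof (rule inj_onI)
      fix x y assume "x \<in> ?C" "y \<in> ?C" "row_of \<mu> t x = row_of \<mu> t y"
      then show "x = y" using tableau_cell(2)[OF t, of x] tableau_cell(2)[OF t, of y] by simp
    qed
    show "row_of \<mu> t ` ?C = ?I"
    proof (intro equalityI subsetI)
      fix i assume "i \<in> ?I"
      then have "(i, j) \<in> diagram \<mu>" by (simp add: diagram_def)
      then show "i \<in> row_of \<mu> t ` ?C"
        using tableau_cell(3-5)[OF t] by (intro image_eqI[of _ _ "t (i, j)"]) auto
    next
      fix i assume "i \<in> row_of \<mu> t ` ?C"
      then obtain x where "x \<in> {1..sum_list \<mu>}" "col_of \<mu> t x = j" "i = row_of \<mu> t x" by auto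
      then show "i \<in> ?I" using tableau_cell(1)[OF t, of x] by (simp add: diagram_def)
    qed
  qed
  have img: "r ` {x \<in> C. r x \<in> M} = r ` C \<inter> M" for r :: "nat \<Rightarrow> nat" and C M by blast
  have B: "?B = {x \<in> ?C. row_of \<mu> t x \<in> {..<m}}" by blast
  have "card ?B = card (row_of \<mu> t ` ?B)"
    by (rule card_image[symmetric], rule inj_on_subset[OF bij_betw_imp_inj_on[OF bij]]) blast
  also have "\<dots> = card (?I \<inter> {..<m})"
    unfolding B img bij_betw_imp_surj_on[OF bij] ..
  also have "\<dots> = card ({..<card ?I} \<inter> {..<m})" using I by (simp only:)
  also have "\<dots> = min (card ?I) m" 
  proof -
    have "{..<a} \<inter> {..<m} = {..<min a m}" for a by auto
    then show ?thesis by simp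
  qed
  finally have B: "card ?B = min (card ?I) m" .
  have "card ?A \<le> card ?C" by (intro card_mono) auto
  moreover have "card ?C = card ?I" using bij by (rule bij_betw_same_card)
  moreover have "card ?A \<le> card {..<m}"
  proof (rule card_inj_on_le)
    show "inj_on (row_of \<nu> s) ?A" using sep by (intro inj_onI) (auto simp: row_col_separated_def)
  qed auto
  ultimately show ?thesis using B by simp
qed

text \<open>Sum the bound of \<open>column_rows_le\<close> over the columns of \<open>t\<close>: the
  first \<open>m\<close> rows of \<open>s\<close> hold no more entries than those of
  \<open>t\<close>.\<close>

lemma dominance:
  assumes \<mu>: "partition_of \<mu> n" and t: "tableau \<mu> t" and s: "tableau \<nu> s"
    and n: "sum_list \<nu> = sum_list \<mu>" and sep: "row_col_separated \<nu> s \<mu> t"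
  shows "sum_list (take m \<nu>) \<le> sum_list (take m \<mu>)"
  unfolding card_first_rows[OF s, symmetric] card_first_rows[OF t, symmetric] n
  unfolding card_rows_by_col[OF t]
  by (intro sum_mono column_rows_le[OF \<mu> t sep])

text \<open>Differences of consecutive partial sums recover the parts. Trailing zeros would be
  invisible to partial sums; excluding them makes the lengths agree.\<close>

lemma eq_if_take_sums_eq:
  fixes \<mu> \<nu> :: "nat list"
  assumes "\<And>m. sum_list (take m \<mu>) = sum_list (take m \<nu>)" "0 \<notin> set \<mu>" "0 \<notin> set \<nu>"
  shows "\<mu> = \<nu>"
proof -
  have le: "length \<beta> \<le> length \<alpha>"
    if e: "\<And>m. sum_list (take m \<alpha>) = sum_list (take m \<beta>)" and z: "0 \<notin> set \<beta>" for \<alpha> \<beta> :: "nat list"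
  proof (rule ccontr)
    assume "\<not> length \<beta> \<le> length \<alpha>"
    then have l: "length \<alpha> < length \<beta>" by simp
    have "sum_list (take (Suc (length \<alpha>)) \<beta>) = sum_list (take (length \<alpha>) \<beta>)"
      using e[of "Suc (length \<alpha>)"] e[of "length \<alpha>"] by simp
    then have "\<beta> ! length \<alpha> = 0" using l by (simp add: take_Suc_conv_app_nth)
    moreover have "\<beta> ! length \<alpha> \<in> set \<beta>" using l by (rule nth_mem)
    ultimately show False using z by simp
  qed
  have l: "length \<mu> = length \<nu>"
    using le[OF assms(1) assms(3)] le[OF assms(1)[symmetric] assms(2)] by simp
  show ?thesis
  proof (rule nth_equalityI[OF l])
    fix i assume "i < length \<mu>"
    then show "\<mu> ! i = \<nu> ! i"
      using assms(1)[of "Suc i"] assms(1)[of i] l by (simp add: take_Suc_conv_app_nth)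
  qed
qed

text \<open>For equal shapes the totals in the dominance argument agree, so each column inequality
  is an equality: every column of \<open>t\<close> contains as many entries of a given row of
  \<open>s\<close> as of that row of \<open>t\<close>. Rearranging inside the columns then turns the
  rows of \<open>t\<close> into those of \<open>s\<close>.\<close>

lemma separated_same_shape:
  assumes \<mu>: "partition_of \<mu> n" and t: "tableau \<mu> t" and s: "tableau \<mu> s" and sep: "row_col_separated \<mu> s \<mu> t"
  obtains p where "p \<in> column_stabilizer \<mu> t" "tabloid \<mu> s = map (image p) (tabloid \<mu> t)"
proof -
  let ?X = "{1..sum_list \<mu>}" and ?c = "col_of \<mu> t" and ?r = "row_of \<mu> t" and ?r' = "row_of \<mu> s"
  let ?J = "?c ` ?X"
  have le: "card {x \<in> ?X. ?c x = j \<and> ?r' x < m} \<le> card {x \<in> ?X. ?c x = j \<and> ?r x < m}" for j m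
    by (rule column_rows_le[OF \<mu> t sep])
  have lt: "card {x \<in> ?X. ?c x = j \<and> ?r' x < m} = card {x \<in> ?X. ?c x = j \<and> ?r x < m}" for j m
  proof (cases "j \<in> ?J")
    case True
    have "(\<Sum>j\<in>?J. card {x \<in> ?X. ?c x = j \<and> ?r' x < m}) = (\<Sum>j\<in>?J. card {x \<in> ?X. ?c x = j \<and> ?r x < m})"
      unfolding card_rows_by_col[OF t, symmetric] card_first_rows[OF s] card_first_rows[OF t] ..
    then show ?thesis
      using sum_mono_inv[of "\<lambda>j. card {x \<in> ?X. ?c x = j \<and> ?r' x < m}" ?J
          "\<lambda>j. card {x \<in> ?X. ?c x = j \<and> ?r x < m}" j] le True by blast
  next
    case False
    then have "{x \<in> ?X. ?c x = j \<and> ?r' x < m} = {}" "{x \<in> ?X. ?c x = j \<and> ?r x < m} = {}" by blast+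
    then show ?thesis by (simp only:)
  qed
  \<comment> \<open>Counts for a single row are differences of counts for initial segments of
    rows.\<close>
  have split: "card {x \<in> ?X. (?c x, r x) = (j, i)} =
      card {x \<in> ?X. ?c x = j \<and> r x < Suc i} - card {x \<in> ?X. ?c x = j \<and> r x < i}" for r j i
  proof -
    have e: "{x \<in> ?X. (?c x, r x) = (j, i)} = {x \<in> ?X. ?c x = j \<and> r x < Suc i} - {x \<in> ?X. ?c x = j \<and> r x < i}"
      by auto
    have "finite {x \<in> ?X. ?c x = j \<and> r x < i}" by simp
    moreover have "{x \<in> ?X. ?c x = j \<and> r x < i} \<subseteq> {x \<in> ?X. ?c x = j \<and> r x < Suc i}" by auto
    ultimately show ?thesis unfolding e by (rule card_Diff_subset)
  qed
  \<comment> \<open>The key pairs the column in \<open>t\<close> with a row, taken in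
    \<open>t\<close> on one side and in \<open>s\<close> on the other; a matching therefore
    preserves columns and carries rows of \<open>t\<close> to rows of \<open>s\<close>.\<close>
  have cc: "card {x \<in> ?X. (?c x, ?r x) = k} = card {x \<in> ?X. (?c x, ?r' x) = k}" for k
    by (cases k) (simp only: split lt)
  have "\<exists>h. bij_betw h ?X ?X \<and> (\<forall>x\<in>?X. (?c (h x), ?r' (h x)) = (?c x, ?r x))"
    by (rule bij_betw_of_fibre_cards[OF finite_atLeastAtMost finite_atLeastAtMost cc]) blast
  then obtain h where h: "bij_betw h ?X ?X" "\<And>x. x \<in> ?X \<Longrightarrow> (?c (h x), ?r' (h x)) = (?c x, ?r x)"
    by blast
  define p where "p = (\<lambda>x. if x \<in> ?X then h x else x)"
  have ph: "bij_betw p ?X ?X"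
    using h(1) by (rule bij_betw_cong[THEN iffD1, rotated]) (simp add: p_def)
  then have p: "p permutes ?X" by (rule bij_imp_permutes) (unfold p_def, rule if_not_P)
  have pc: "?c (p x) = ?c x" "?r' (p x) = ?r x" if "x \<in> ?X" for x using h(2)[OF that] that by (auto simp: p_def)
  have "p \<in> column_stabilizer \<mu> t" using p pc by (simp add: column_stabilizer_iff[OF t])
  moreover have "tabloid \<mu> s = map (image p) (tabloid \<mu> t)"
  proof -
    have "{x \<in> ?X. ?r' x = i} = p ` {x \<in> ?X. ?r x = i}" for i
    proof (intro equalityI subsetI)
      fix y assume y: "y \<in> {x \<in> ?X. ?r' x = i}"
      then obtain x where "x \<in> ?X" "y = p x" using bij_betw_imp_surj_on[OF ph] by blast
      then show "y \<in> p ` {x \<in> ?X. ?r x = i}" using y pc by auto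
    next
      fix y assume "y \<in> p ` {x \<in> ?X. ?r x = i}"
      then show "y \<in> {x \<in> ?X. ?r' x = i}" using bij_betw_imp_surj_on[OF ph] pc by blast
    qed
    then show ?thesis by (simp add: tabloid_rows[OF s] tabloid_rows[OF t])
  qed
  ultimately show ?thesis by (rule that)
qed

text \<open>A transposition of two entries in one row of \<^term>\<open>s\<close> and one column of \<^term>\<open>t\<close> kills the antisymmetrised tabloid.\<close>

lemma col_antisym_nonzero_separated:
  assumes t: "tableau \<mu> t" and s: "tableau \<nu> s" and n: "sum_list \<nu> = sum_list \<mu>"
    and nz: "col_antisym \<mu> t (tab_delta (tabloid \<nu> s)) \<noteq> 0"
  shows "row_col_separated \<nu> s \<mu> t"
  unfolding row_col_separated_def
proof (intro ballI impI, rule ccontr)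
  fix x y assume xy: "x \<in> {1..sum_list \<mu>}" "y \<in> {1..sum_list \<mu>}"
    and rc: "row_of \<nu> s x = row_of \<nu> s y \<and> col_of \<mu> t x = col_of \<mu> t y" and "x \<noteq> y"
  let ?q = "transpose x y" and ?K = "col_antisym \<mu> t (tab_delta (tabloid \<nu> s))"
  have q: "?q permutes {1..sum_list \<mu>}" using xy by (intro permutes_swap_id)
  have qc: "?q \<in> column_stabilizer \<mu> t"
    unfolding column_stabilizer_iff[OF t] using q rc by (auto simp: transpose_def)
  have "?q ` {z \<in> {1..sum_list \<nu>}. row_of \<nu> s z = i} = {z \<in> {1..sum_list \<nu>}. row_of \<nu> s z = i}" for i
  proof (rule endo_inj_surj)
    show "?q ` {z \<in> {1..sum_list \<nu>}. row_of \<nu> s z = i} \<subseteq> {z \<in> {1..sum_list \<nu>}. row_of \<nu> s z = i}"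
      using rc xy n by (auto simp: transpose_def split: if_splits)
  qed (auto intro: inj_on_subset[OF inj_transpose])
  then have "map (image ?q) (tabloid \<nu> s) = tabloid \<nu> s"
    by (simp add: tabloid_rows[OF s])
  then have "tab_act ?q (tab_delta (tabloid \<nu> s)) = tab_delta (tabloid \<nu> s)"
    using tab_act_delta[OF permutes_bij[OF q]] by simp
  then have "?K = cscale (of_int (sign ?q)) ?K" using col_antisym_tab_act[OF qc, of "tab_delta (tabloid \<nu> s)"] by simp
  moreover have "sign ?q = -1" using \<open>x \<noteq> y\<close> by (simp add: sign_swap_id)
  ultimately have e: "?K = cscale (- 1) ?K" by simp
  have "?K T = 0" for T using fun_cong[OF e, of T] by simp
  then show False using nz by (simp add: fun_eq_iff)
qed

section \<open>Irreducibility and pairwise inequivalence of the Specht modules\<close>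

lemma supported_expansion:
  assumes "\<And>T. T \<notin> tabloids \<mu> \<Longrightarrow> v T = 0"
  shows "v = (\<Sum>T\<in>tabloids \<mu>. cscale (v T) (tab_delta T))"
proof
  fix T
  have "(\<Sum>T'\<in>tabloids \<mu>. v T' * tab_delta T' T) = (\<Sum>T'\<in>tabloids \<mu>. if T' = T then v T' else 0)"
    by (intro sum.cong) (auto simp: tab_delta_def)
  then show "v T = (\<Sum>T\<in>tabloids \<mu>. cscale (v T) (tab_delta T)) T"
    using assms[of T] finite_tabloids by (simp add: sum_fun_apply)
qed

lemma col_antisym_expansion:
  assumes "\<And>T. T \<notin> tabloids \<nu> \<Longrightarrow> v T = 0"
  shows "col_antisym \<mu> t v = (\<Sum>T\<in>tabloids \<nu>. cscale (v T) (col_antisym \<mu> t (tab_delta T)))"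
proof -
  have "col_antisym \<mu> t v = col_antisym \<mu> t (\<Sum>T\<in>tabloids \<nu>. cscale (v T) (tab_delta T))"
    by (rule arg_cong[OF supported_expansion[OF assms]])
  also have "\<dots> = (\<Sum>T\<in>tabloids \<nu>. cscale (v T) (col_antisym \<mu> t (tab_delta T)))"
    by (rule lin_on_lincomb[OF col_antisym_lin[of UNIV]]) auto
  finally show ?thesis .
qed

text \<open>It suffices to consider a single tabloid of shape \<open>\<mu>\<close>. Either the
  antisymmetriser kills it, or its tableau is separated from \<open>t\<close> and it arises from the
  tabloid of \<open>t\<close> by a column permutation, which contributes only a sign.\<close>

lemma col_antisym_multiple:
  assumes \<mu>: "partition_of \<mu> n" and t: "tableau \<mu> t" and v: "\<And>T. T \<notin> tabloids \<mu> \<Longrightarrow> v T = 0"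
  shows "\<exists>c. col_antisym \<mu> t v = cscale c (polytabloid \<mu> t)"
proof -
  have "\<exists>c. col_antisym \<mu> t (tab_delta T) = cscale c (polytabloid \<mu> t)" if "T \<in> tabloids \<mu>" for T
  proof -
    obtain s where s: "tableau \<mu> s" "T = tabloid \<mu> s"
      using \<open>T \<in> tabloids \<mu>\<close> unfolding tabloids_def by blast
    show ?thesis
    proof (cases "col_antisym \<mu> t (tab_delta T) = 0")
      case True
      then show ?thesis by (intro exI[of _ 0]) simp
    next
      case False
      have "row_col_separated \<mu> s \<mu> t"
        using False unfolding s(2) by (intro col_antisym_nonzero_separated[OF t s(1) refl])
      then obtain p where p: "p \<in> column_stabilizer \<mu> t" "tabloid \<mu> s = map (image p) (tabloid \<mu> t)"
        by (rule separated_same_shape[OF \<mu> t s(1)])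
      have "col_antisym \<mu> t (tab_delta T) = col_antisym \<mu> t (tab_act p (tab_delta (tabloid \<mu> t)))"
        unfolding s(2) p(2) tab_act_delta[OF permutes_bij[OF column_stabilizer_permutes[OF p(1)]]] ..
      also have "\<dots> = cscale (of_int (sign p)) (polytabloid \<mu> t)"
        unfolding col_antisym_tab_act[OF p(1)] polytabloid_eq ..
      finally show ?thesis by blast
    qed
  qed
  then obtain c where c: "\<And>T. T \<in> tabloids \<mu> \<Longrightarrow> col_antisym \<mu> t (tab_delta T) = cscale (c T) (polytabloid \<mu> t)" by metis
  have "col_antisym \<mu> t v = (\<Sum>T\<in>tabloids \<mu>. cscale (v T) (col_antisym \<mu> t (tab_delta T)))"
    by (rule col_antisym_expansion[OF v])
  also have "\<dots> = (\<Sum>T\<in>tabloids \<mu>. cscale (v T * c T) (polytabloid \<mu> t))"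
    by (rule sum.cong[OF refl]) (simp only: c cfun.scale_scale)
  also have "\<dots> = cscale (\<Sum>T\<in>tabloids \<mu>. v T * c T) (polytabloid \<mu> t)"
    by (rule cfun.scale_sum_left[symmetric])
  finally show ?thesis by blast
qed

text \<open>A permutation that preserves both the columns and the rows of \<open>t\<close> is the
  identity, so the tabloid of \<open>t\<close> occurs exactly once. In particular polytabloids are
  nonzero.\<close>

lemma polytabloid_self:
  assumes t: "tableau \<mu> t"
  shows "polytabloid \<mu> t (tabloid \<mu> t) = 1"
proof -
  have "p = id" if p: "p \<in> column_stabilizer \<mu> t" and e: "tabloid \<mu> t = map (image p) (tabloid \<mu> t)" for p
  proof
    fix x
    have pp: "p permutes {1..sum_list \<mu>}" "\<And>x. x \<in> {1..sum_list \<mu>} \<Longrightarrow> col_of \<mu> t (p x) = col_of \<mu> t x"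
      using p by (auto simp: column_stabilizer_iff[OF t])
    show "p x = id x"
    proof (cases "x \<in> {1..sum_list \<mu>}")
      case True
      then have px: "p x \<in> {1..sum_list \<mu>}" using permutes_in_image[OF pp(1)] by blast
      let ?i = "row_of \<mu> t x"
      have i: "?i < length \<mu>" using tableau_cell(1)[OF t True] by (simp add: diagram_def)
      have "tabloid \<mu> t ! ?i = p ` (tabloid \<mu> t ! ?i)"
        using arg_cong[OF e, of "\<lambda>T. T ! ?i"] i by (simp add: tabloid_def)
      moreover have "x \<in> tabloid \<mu> t ! ?i" using True i by (simp add: tabloid_rows[OF t])
      ultimately have "p x \<in> tabloid \<mu> t ! ?i" by blast
      then have "row_of \<mu> t (p x) = ?i" using i by (simp add: tabloid_rows[OF t])
      then show ?thesis
        using tableau_cell(2)[OF t True] tableau_cell(2)[OF t px] pp(2)[OF True] by simp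
    next
      case False
      then show ?thesis using permutes_not_in[OF pp(1)] by simp
    qed
  qed
  moreover have "id \<in> column_stabilizer \<mu> t" by (simp add: column_stabilizer_iff[OF t] permutes_id)
  ultimately have "polytabloid \<mu> t (tabloid \<mu> t) = (\<Sum>p\<in>column_stabilizer \<mu> t. if p = id then 1 else 0)"
    unfolding polytabloid_def by (intro sum.cong refl) auto
  then show ?thesis using \<open>id \<in> column_stabilizer \<mu> t\<close> finite_column_stabilizer by simp
qed

lemma tableaux_permuted:
  assumes "tableau \<mu> t" "tableau \<mu> s"
  obtains p where "p permutes {1..sum_list \<mu>}" "polytabloid \<mu> s = tab_act p (polytabloid \<mu> t)"
proof -
  let ?X = "{1..sum_list \<mu>}"
  define p where "p = (\<lambda>x. if x \<in> ?X then s (inv_into (diagram \<mu>) t x) else x)"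
  have bt: "bij_betw t (diagram \<mu>) ?X" and bs: "bij_betw s (diagram \<mu>) ?X" using assms by (auto simp: tableau_def)
  have "bij_betw p ?X ?X"
    using bij_betw_trans[OF bij_betw_inv_into[OF bt] bs]
    by (rule bij_betw_cong[THEN iffD1, rotated]) (simp add: p_def)
  then have p: "p permutes ?X" by (rule bij_imp_permutes) (unfold p_def, rule if_not_P)
  \<comment> \<open>\<open>p \<circ> t\<close> and \<open>s\<close> agree on the diagram but may
    differ off it, so they are compared through their tabloids and column stabilizers.\<close>
  have e: "p (t c) = s c" if "c \<in> diagram \<mu>" for c
    using that bt bij_betw_inv_into_left[OF bt that] by (auto simp: p_def bij_betw_def)
  have "(p \<circ> t) ` {(i, j) |j. j < \<mu> ! i} = s ` {(i, j) |j. j < \<mu> ! i}" if "i < length \<mu>" for i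
    using e that by (intro image_cong) (auto simp: diagram_def)
  then have 1: "tabloid \<mu> (p \<circ> t) = tabloid \<mu> s" by (simp add: tabloid_def)
  have "(p \<circ> t) ` {c \<in> diagram \<mu>. snd c = j} = s ` {c \<in> diagram \<mu>. snd c = j}" for j
    using e by (intro image_cong) auto
  then have "column_stabilizer \<mu> (p \<circ> t) = column_stabilizer \<mu> s" by (simp add: column_stabilizer_def)
  then have "polytabloid \<mu> (p \<circ> t) = polytabloid \<mu> s" using 1 by (simp add: polytabloid_def)
  then show ?thesis using that[OF p] permuted_tableau(3)[OF assms(1) p] by simp
qed

text \<open>Polytabloids have real values. This permits pairing a vector of the module with its own
  conjugate, which makes the bilinear form on tabloids definite.\<close>

lemma cnj_in_specht:
  assumes "v \<in> vspace (specht \<mu>)"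
  shows "(\<lambda>T. cnj (v T)) \<in> vspace (specht \<mu>)"
proof -
  have S: "cfun.subspace (vspace (specht \<mu>))" by (simp add: specht_simps)
  have "cfun.subspace {v. (\<lambda>T. cnj (v T)) \<in> vspace (specht \<mu>)}"
    unfolding cfun.subspace_def mem_Collect_eq
  proof (intro conjI ballI allI)
    show "(\<lambda>T. cnj ((0 :: nat set list \<Rightarrow> complex) T)) \<in> vspace (specht \<mu>)"
      using cfun.subspace_0[OF S] by (simp add: zero_fun_def)
    fix x y assume xy: "x \<in> {v. (\<lambda>T. cnj (v T)) \<in> vspace (specht \<mu>)}" "y \<in> {v. (\<lambda>T. cnj (v T)) \<in> vspace (specht \<mu>)}"
    have "(\<lambda>T. cnj ((x + y) T)) = (\<lambda>T. cnj (x T)) + (\<lambda>T. cnj (y T))" by (simp add: fun_eq_iff)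
    then show "(\<lambda>T. cnj ((x + y) T)) \<in> vspace (specht \<mu>)" using xy cfun.subspace_add[OF S] by simp
  next
    fix c x assume x: "x \<in> {v. (\<lambda>T. cnj (v T)) \<in> vspace (specht \<mu>)}"
    have "(\<lambda>T. cnj (cscale c x T)) = cscale (cnj c) (\<lambda>T. cnj (x T))" by (simp add: fun_eq_iff)
    then show "(\<lambda>T. cnj (cscale c x T)) \<in> vspace (specht \<mu>)" using x cfun.subspace_scale[OF S] by simp
  qed
  moreover have "(\<lambda>T. cnj (polytabloid \<mu> t T)) = polytabloid \<mu> t" for t
    by (auto simp: polytabloid_def fun_eq_iff intro!: sum.cong)
  ultimately have "vspace (specht \<mu>) \<subseteq> {v. (\<lambda>T. cnj (v T)) \<in> vspace (specht \<mu>)}"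
    using polytabloid_in_specht by (subst specht_simps) (intro cfun.span_minimal, auto)
  then show ?thesis using assms by blast
qed

text \<open>James's submodule argument. If some antisymmetriser is nonzero on \<open>W\<close>, then
  \<open>W\<close> contains a polytabloid and hence all of them. Otherwise \<open>W\<close> is
  orthogonal to every polytabloid, hence to the whole module and to the conjugates of its own
  vectors, so it is zero.\<close>

theorem specht_irreducible:
  assumes \<mu>: "partition_of \<mu> n"
  shows "irreducible_rep (sym_group n) (specht \<mu>)"
  unfolding irreducible_rep_def
proof (intro conjI allI impI)
  have n: "sum_list \<mu> = n" using \<mu> by (simp add: partition_of_def)
  show R: "representation (sym_group n) (specht \<mu>)" using specht_rep[of \<mu>] n by simp
  obtain t0 where t0: "tableau \<mu> t0" using tableau_exists by blast
  show "vspace (specht \<mu>) \<noteq> {0}"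
    using polytabloid_in_specht[OF t0] polytabloid_self[OF t0] by auto
  fix W assume W: "invariant_subspace (sym_group n) (specht \<mu>) W"
  then have W': "cfun.subspace W" "W \<subseteq> vspace (specht \<mu>)"
    by (auto simp: invariant_subspace_def)
  have W'3: "tab_act p w \<in> W" if "p permutes {1..n}" "w \<in> W" for p w
  proof -
    have "p \<in> carrier (sym_group n)" using that(1) by (simp only: sym_group_carrier)
    then have "act (specht \<mu>) p ` W \<subseteq> W" using W by (simp only: invariant_subspace_def)
    then show ?thesis using that(2) unfolding specht_simps by blast
  qed
  show "W = {0} \<or> W = vspace (specht \<mu>)"
  proof (cases "\<exists>w\<in>W. \<exists>t. tableau \<mu> t \<and> col_antisym \<mu> t w \<noteq> 0")
    case True
    then obtain w t where wt: "w \<in> W" "tableau \<mu> t" "col_antisym \<mu> t w \<noteq> 0" by blast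
    obtain c where c: "col_antisym \<mu> t w = cscale c (polytabloid \<mu> t)"
      using col_antisym_multiple[OF \<mu> wt(2)] specht_supported wt(1) W'(2) by blast
    have "col_antisym \<mu> t w \<in> W"
      unfolding col_antisym_def using column_stabilizer_permutes n wt(1) W'3
      by (intro cfun.subspace_sum cfun.subspace_scale W'(1)) blast
    then have "cscale (1 / c) (cscale c (polytabloid \<mu> t)) \<in> W"
      unfolding c by (rule cfun.subspace_scale[OF W'(1)])
    moreover have "c \<noteq> 0" using wt(3) c by auto
    ultimately have e: "polytabloid \<mu> t \<in> W" by simp
    have "polytabloid \<mu> s \<in> W" if s: "tableau \<mu> s" for s
    proof -
      obtain p where "p permutes {1..sum_list \<mu>}" "polytabloid \<mu> s = tab_act p (polytabloid \<mu> t)"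
        by (rule tableaux_permuted[OF wt(2) s])
      then show ?thesis using W'3 e n by simp
    qed
    then have "vspace (specht \<mu>) \<subseteq> W"
      unfolding specht_simps by (intro cfun.span_minimal W'(1)) auto
    then show ?thesis using W'(2) by blast
  next
    case False
    have "w = 0" if w: "w \<in> W" for w
    proof -
      \<comment> \<open>The pairing of \<open>w\<close> with the polytabloid of \<open>t\<close>
        equals the value of \<open>col_antisym \<mu> t w\<close> at the tabloid of \<open>t\<close>:
        the antisymmetriser is self-adjoint, by passing to inverses in the column
        stabilizer.\<close>
      have pz: "(\<Sum>T\<in>tabloids \<mu>. w T * polytabloid \<mu> t T) = 0" if t: "tableau \<mu> t" for t
      proof -
        have m: "map (image p) (tabloid \<mu> t) \<in> tabloids \<mu>" if "p \<in> column_stabilizer \<mu> t" for p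
        proof -
          note pt = permuted_tableau[OF t column_stabilizer_permutes[OF that]]
          show ?thesis unfolding tabloids_def pt(2)[symmetric] using pt(1) by blast
        qed
        have "(\<Sum>T\<in>tabloids \<mu>. w T * polytabloid \<mu> t T) =
            (\<Sum>p\<in>column_stabilizer \<mu> t. \<Sum>T\<in>tabloids \<mu>. if T = map (image p) (tabloid \<mu> t) then w T * of_int (sign p) else 0)"
          unfolding polytabloid_def sum_distrib_left by (subst sum.swap) (auto intro!: sum.cong)
        also have "\<dots> = (\<Sum>p\<in>column_stabilizer \<mu> t. w (map (image p) (tabloid \<mu> t)) * of_int (sign p))"
          using m finite_tabloids by (intro sum.cong refl) simp
        also have "\<dots> = (\<Sum>p\<in>column_stabilizer \<mu> t. of_int (sign p) * tab_act p w (tabloid \<mu> t))"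
        proof (rule sum.reindex_bij_witness[where i = Hilbert_Choice.inv and j = Hilbert_Choice.inv])
          fix p assume p: "p \<in> column_stabilizer \<mu> t"
          note pp = column_stabilizer_permutes[OF p]
          show "Hilbert_Choice.inv (Hilbert_Choice.inv p) = p" "Hilbert_Choice.inv (Hilbert_Choice.inv p) = p"
            using permutes_inv_inv[OF pp] by simp_all
          show "Hilbert_Choice.inv p \<in> column_stabilizer \<mu> t" "Hilbert_Choice.inv p \<in> column_stabilizer \<mu> t"
            using column_stabilizer_inv[OF p] by simp_all
          show "of_int (sign (Hilbert_Choice.inv p)) * tab_act (Hilbert_Choice.inv p) w (tabloid \<mu> t) =
              w (map (image p) (tabloid \<mu> t)) * of_int (sign p)"
            by (simp add: tab_act_def permutes_inv_inv[OF pp] sign_inverse[OF permutes_interval_permutation[OF pp]])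
        qed
        also have "\<dots> = col_antisym \<mu> t w (tabloid \<mu> t)" by (simp add: col_antisym_def sum_fun_apply)
        also have "\<dots> = 0" using False w t by auto
        finally show ?thesis .
      qed
      have z: "(\<Sum>T\<in>tabloids \<mu>. w T * u T) = 0" if u: "u \<in> vspace (specht \<mu>)" for u
      proof -
        have "cfun.subspace {u. (\<Sum>T\<in>tabloids \<mu>. w T * u T) = 0}"
          unfolding cfun.subspace_def
          by (auto simp: algebra_simps sum.distrib sum_distrib_left[symmetric])
        then have "vspace (specht \<mu>) \<subseteq> {u. (\<Sum>T\<in>tabloids \<mu>. w T * u T) = 0}"
          using pz unfolding specht_simps by (intro cfun.span_minimal) auto
        then show ?thesis using u by blast
      qed
      have "w \<in> vspace (specht \<mu>)" using w W'(2) by blast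
      \<comment> \<open>Pairing with the conjugate yields a sum of squared norms.\<close>
      then have "(\<Sum>T\<in>tabloids \<mu>. w T * cnj (w T)) = 0" by (intro z cnj_in_specht)
      then have "complex_of_real (\<Sum>T\<in>tabloids \<mu>. (norm (w T))\<^sup>2) = 0"
        by (simp only: of_real_sum complex_norm_square)
      then have "(\<Sum>T\<in>tabloids \<mu>. (norm (w T))\<^sup>2) = 0" by (simp only: of_real_eq_0_iff)
      then have "w T = 0" if "T \<in> tabloids \<mu>" for T
        using that finite_tabloids by (simp add: sum_nonneg_eq_0_iff)
      then show "w = 0" using specht_supported[OF \<open>w \<in> vspace (specht \<mu>)\<close>]
        by (intro ext) (metis zero_fun_apply)
    qed
    then show ?thesis using cfun.subspace_0[OF W'(1)] by blast
  qed
qed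

text \<open>The antisymmetriser of \<open>t\<close> multiplies the polytabloid of \<open>t\<close>
  by the order of the column stabilizer, and an intertwiner \<open>T\<close> carries this over to
  its image. So the antisymmetriser does not kill the image, some tabloid of shape
  \<open>\<nu>\<close> survives it, and that tabloid is separated from \<open>t\<close>.\<close>

lemma specht_iso_dominance:
  assumes \<mu>: "partition_of \<mu> n" and \<nu>: "partition_of \<nu> n" and iso: "rep_iso (sym_group n) (specht \<mu>) (specht \<nu>)"
  shows "sum_list (take m \<nu>) \<le> sum_list (take m \<mu>)"
proof -
  have n: "sum_list \<mu> = n" "sum_list \<nu> = n" using \<mu> \<nu> by (auto simp: partition_of_def)
  obtain T where T: "lin_on (vspace (specht \<mu>)) T" "bij_betw T (vspace (specht \<mu>)) (vspace (specht \<nu>))"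
    "\<And>p v. p permutes {1..n} \<Longrightarrow> v \<in> vspace (specht \<mu>) \<Longrightarrow> T (tab_act p v) = tab_act p (T v)"
    using iso by (auto simp: rep_iso_def specht_simps(2) sym_group_carrier)
  have S: "cfun.subspace (vspace (specht \<mu>))" by (simp add: specht_simps)
  obtain t where t: "tableau \<mu> t" using tableau_exists by blast
  let ?e = "polytabloid \<mu> t"
  have e: "?e \<in> vspace (specht \<mu>)" by (rule polytabloid_in_specht[OF t])
  have e0: "?e \<noteq> 0" using polytabloid_self[OF t] by auto
  have "T 0 = 0" by (rule lin_on_zero[OF T(1) cfun.subspace_0[OF S]])
  then have Te: "T ?e \<noteq> 0"
    using inj_onD[OF bij_betw_imp_inj_on[OF T(2)] _ e cfun.subspace_0[OF S]] e0 by auto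
  have pe: "tab_act p ?e \<in> vspace (specht \<mu>)" if "p \<in> column_stabilizer \<mu> t" for p
    unfolding permuted_tableau(3)[OF t column_stabilizer_permutes[OF that], symmetric]
    by (rule polytabloid_in_specht[OF permuted_tableau(1)[OF t column_stabilizer_permutes[OF that]]])
  have "col_antisym \<mu> t (T ?e) = (\<Sum>p\<in>column_stabilizer \<mu> t. cscale (of_int (sign p)) (T (tab_act p ?e)))"
    unfolding col_antisym_def 
    by (intro sum.cong refl arg_cong[where f = "cscale _"] T(3)[symmetric] e)
      (use column_stabilizer_permutes n in blast)
  also have "\<dots> = (\<Sum>p\<in>column_stabilizer \<mu> t. T ?e)"
  proof (rule sum.cong[OF refl])
    fix p assume p: "p \<in> column_stabilizer \<mu> t"
    have "tab_act p ?e = cscale (of_int (sign p)) ?e"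
      unfolding polytabloid_eq by (rule tab_act_col_antisym[OF p])
    then have "T (tab_act p ?e) = cscale (of_int (sign p)) (T ?e)" using lin_on_scale[OF T(1) e] by simp
    then show "cscale (of_int (sign p)) (T (tab_act p ?e)) = T ?e" by (simp add: sign_sq)
  qed
  also have "\<dots> = cscale (of_nat (card (column_stabilizer \<mu> t))) (T ?e)"
    by (simp add: fun_eq_iff sum_fun_apply)
  finally have "col_antisym \<mu> t (T ?e) = cscale (of_nat (card (column_stabilizer \<mu> t))) (T ?e)" .
  moreover have "id \<in> column_stabilizer \<mu> t" by (simp add: column_stabilizer_iff[OF t] permutes_id)
  then have "card (column_stabilizer \<mu> t) \<noteq> 0"
    using finite_column_stabilizer[of \<mu> t] by auto
  ultimately have nz: "col_antisym \<mu> t (T ?e) \<noteq> 0" using Te by simp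
  have "T ?e \<in> vspace (specht \<nu>)" using T(2) e by (auto simp: bij_betw_def)
  then have "col_antisym \<mu> t (T ?e) = (\<Sum>X\<in>tabloids \<nu>. cscale (T ?e X) (col_antisym \<mu> t (tab_delta X)))"
    by (intro col_antisym_expansion specht_supported)
  with nz have "\<exists>X\<in>tabloids \<nu>. cscale (T ?e X) (col_antisym \<mu> t (tab_delta X)) \<noteq> 0"
    using sum.neutral[of "tabloids \<nu>" "\<lambda>X. cscale (T ?e X) (col_antisym \<mu> t (tab_delta X))"] by auto
  then obtain s where s: "tableau \<nu> s" "col_antisym \<mu> t (tab_delta (tabloid \<nu> s)) \<noteq> 0"
    by (auto simp: tabloids_def)
  show ?thesis
    using col_antisym_nonzero_separated[OF t s(1) _ s(2)] n by (intro dominance[OF \<mu> t s(1)]) auto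
qed

lemma specht_iso_imp_eq:
  assumes \<mu>: "partition_of \<mu> n" and \<nu>: "partition_of \<nu> n" and iso: "rep_iso (sym_group n) (specht \<mu>) (specht \<nu>)"
  shows "\<mu> = \<nu>"
proof (rule eq_if_take_sums_eq)
  have "representation (sym_group n) (specht \<mu>)" using specht_irreducible[OF \<mu>] by (simp add: irreducible_rep_def)
  from rep_iso_sym[OF this iso] show "sum_list (take m \<mu>) = sum_list (take m \<nu>)" for m
    using specht_iso_dominance[OF \<mu> \<nu> iso] specht_iso_dominance[OF \<nu> \<mu>] by (intro order_antisym)
qed (use \<mu> \<nu> in \<open>auto simp: partition_of_def\<close>)

section \<open>Cycle types and conjugacy of permutations\<close>

lemma funpow_eq_iff_mod:
  assumes "permutation p"
  shows "(p ^^ i) a = (p ^^ j) a \<longleftrightarrow> i mod least_power p a = j mod least_power p a"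
proof -
  have *: "(p ^^ i) a = (p ^^ j) a \<longleftrightarrow> i mod least_power p a = j mod least_power p a" if "i \<le> j" for i j
  proof -
    have e: "(p ^^ j) a = (p ^^ i) ((p ^^ (j - i)) a)"
      using funpow_add[of i "j - i" p] that by simp
    have inj: "inj (p ^^ i)" using assms by (simp add: permutation bij_is_inj bij_fn)
    have "(p ^^ i) a = (p ^^ j) a \<longleftrightarrow> (p ^^ (j - i)) a = a"
      unfolding e inj_eq[OF inj] by (rule eq_commute)
    also have "\<dots> \<longleftrightarrow> least_power p a dvd (j - i)" using least_power_dvd[OF assms] by blast
    also have "\<dots> \<longleftrightarrow> i mod least_power p a = j mod least_power p a"
      using mod_eq_dvd_iff_nat[OF that, of "least_power p a"] by auto
    finally show ?thesis .
  qed
  show ?thesis using *[of i j] *[of j i] by (cases "i \<le> j") auto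
qed

definition cycle_set :: "('a \<Rightarrow> 'a) \<Rightarrow> 'a \<Rightarrow> 'a set" where
  "cycle_set p x = range (\<lambda>i. (p ^^ i) x)"

lemma cycle_set:
  assumes "permutation p"
  shows "x \<in> cycle_set p x" "(p ^^ i) x \<in> cycle_set p x"
    "card (cycle_set p x) = least_power p x" "y \<in> cycle_set p x \<Longrightarrow> cycle_set p y = cycle_set p x"
    "finite (cycle_set p x)"
proof -
  note s = support_set[OF assms, folded cycle_set_def]
  show x: "x \<in> cycle_set p x" for x unfolding cycle_set_def by (rule range_eqI[of _ _ 0]) simp
  show "(p ^^ i) x \<in> cycle_set p x" by (simp add: cycle_set_def)
  show "card (cycle_set p x) = least_power p x"
    unfolding s[symmetric] using distinct_card[OF cycle_of_permutation[OF assms]] by simp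
  show "finite (cycle_set p x)" unfolding s[symmetric] by simp
  assume y: "y \<in> cycle_set p x"
  have "disjoint (range (cycle_set p))" using disjoint_support[OF assms] unfolding s .
  then show "cycle_set p y = cycle_set p x" using x[of y] y unfolding disjoint_def by blast
qed

lemma cycle_set_subset:
  assumes "p permutes X" "x \<in> X"
  shows "cycle_set p x \<subseteq> X"
proof -
  have "(p ^^ i) x \<in> X" for i
    by (induction i) (use assms permutes_in_image[OF assms(1)] in auto)
  then show ?thesis by (auto simp: cycle_set_def)
qed

text \<open>The cycles are taken through all points of \<open>{1..n}\<close>, so fixed points
  contribute parts 1; the reversal produces the decreasing order of a partition.\<close>

definition cycle_type :: "nat \<Rightarrow> (nat \<Rightarrow> nat) \<Rightarrow> nat list" where
  "cycle_type n p = rev (sorted_list_of_multiset (image_mset card (mset_set (cycle_set p ` {1..n}))))"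

lemma cycle_type_partition:
  assumes "p permutes {1..n}"
  shows "partition_of (cycle_type n p) n"
  unfolding partition_of_def
proof (intro conjI)
  note perm = permutes_interval_permutation[OF assms]
  show "sorted_wrt (\<ge>) (cycle_type n p)"
    by (simp add: cycle_type_def sorted_wrt_rev)
  have c: "card (cycle_set p x) \<noteq> 0" for x using cycle_set(1,5)[OF perm, of x] by auto
  show "0 \<notin> set (cycle_type n p)"
  proof
    assume "0 \<in> set (cycle_type n p)"
    then obtain y where "0 = card (cycle_set p y)" by (auto simp: cycle_type_def)
    then show False using c[of y] by simp
  qed
  have "sum_list (cycle_type n p) = sum_mset (mset (cycle_type n p))" by (rule sum_mset_sum_list[symmetric])
  also have "\<dots> = (\<Sum>C\<in>cycle_set p ` {1..n}. card C)"
    by (simp add: cycle_type_def sum_unfold_sum_mset)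
  also have "\<dots> = card (\<Union> (cycle_set p ` {1..n}))"
  proof (rule card_Union_disjoint[symmetric])
    show "disjoint (cycle_set p ` {1..n})"
      using cycle_set(4)[OF perm] unfolding disjoint_def by blast
  qed (use cycle_set(5)[OF perm] in auto)
  also have "\<Union> (cycle_set p ` {1..n}) = {1..n}"
    using cycle_set_subset[OF assms] cycle_set(1)[OF perm] by blast
  finally show "sum_list (cycle_type n p) = n" by simp
qed

text \<open>Match the cycles of \<open>p\<close> with cycles of \<open>q\<close> of the same length,
  choose a base point in each, and send the point reached after \<open>i\<close> steps of
  \<open>p\<close> to the point reached after \<open>i\<close> steps of \<open>q\<close>.\<close>

lemma cycle_type_eq_imp_conjugate:
  assumes p: "p permutes {1..n}" and q: "q permutes {1..n}" and eq: "cycle_type n p = cycle_type n q"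
  shows "\<exists>s. s permutes {1..n} \<and> s \<circ> p = q \<circ> s"
proof -
  let ?X = "{1..n}"
  note pp = permutes_interval_permutation[OF p] and qq = permutes_interval_permutation[OF q]
  let ?P = "cycle_set p ` ?X" and ?Q = "cycle_set q ` ?X"
  have "mset (cycle_type n p) = mset (cycle_type n q)" using eq by simp
  then have m: "image_mset card (mset_set ?P) = image_mset card (mset_set ?Q)"
    by (simp add: cycle_type_def)
  have c: "card {C \<in> A. card C = k} = count (image_mset card (mset_set A)) k" if "finite A"
    for A :: "nat set set" and k
    using that by (simp add: count_image_mset_eq_card_vimage)
  have cc: "card {C \<in> ?P. card C = k} = card {C \<in> ?Q. card C = k}" for k
    unfolding c[OF finite_imageI[OF finite_atLeastAtMost]] m ..
  have "\<exists>\<beta>. bij_betw \<beta> ?P ?Q \<and> (\<forall>C\<in>?P. card (\<beta> C) = card C)"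
    by (rule bij_betw_of_fibre_cards[OF finite_imageI[OF finite_atLeastAtMost] finite_imageI[OF finite_atLeastAtMost] cc]) blast
  then obtain \<beta> where \<beta>: "bij_betw \<beta> ?P ?Q" "\<And>C. C \<in> ?P \<Longrightarrow> card (\<beta> C) = card C" by blast
  have \<beta>Q: "\<beta> C \<in> ?Q" if "C \<in> ?P" for C using \<beta>(1) that by (auto simp: bij_betw_def)
  define b where "b = (\<lambda>C :: nat set. SOME x. x \<in> C)"
  have bP: "b C \<in> ?X" "cycle_set p (b C) = C" if C: "C \<in> ?P" for C
  proof -
    obtain x where x: "x \<in> ?X" "C = cycle_set p x" using C by blast
    have "x \<in> C" unfolding x(2) by (rule cycle_set(1)[OF pp])
    then have bC: "b C \<in> C" unfolding b_def by (rule someI)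
    then show "b C \<in> ?X" using cycle_set_subset[OF p x(1)] x(2) by blast
    show "cycle_set p (b C) = C" using cycle_set(4)[OF pp] bC x(2) by blast
  qed
  have bQ: "b C \<in> ?X" "cycle_set q (b C) = C" if C: "C \<in> ?Q" for C
  proof -
    obtain x where x: "x \<in> ?X" "C = cycle_set q x" using C by blast
    have "x \<in> C" unfolding x(2) by (rule cycle_set(1)[OF qq])
    then have bC: "b C \<in> C" unfolding b_def by (rule someI)
    then show "b C \<in> ?X" using cycle_set_subset[OF q x(1)] x(2) by blast
    show "cycle_set q (b C) = C" using cycle_set(4)[OF qq] bC x(2) by blast
  qed
  \<comment> \<open>Matched cycles have equal length, so step counts are identified in the same way
    on both; this makes the map well defined and injective on a cycle.\<close>
  have same: "(p ^^ i) (b C) = (p ^^ j) (b C) \<longleftrightarrow> (q ^^ i) (b (\<beta> C)) = (q ^^ j) (b (\<beta> C))" if C: "C \<in> ?P" for C i j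
  proof -
    have "least_power p (b C) = least_power q (b (\<beta> C))"
      unfolding cycle_set(3)[OF pp, symmetric] cycle_set(3)[OF qq, symmetric]
      using bP(2)[OF C] bQ(2)[OF \<beta>Q[OF C]] \<beta>(2)[OF C] by simp
    then show ?thesis by (simp add: funpow_eq_iff_mod[OF pp] funpow_eq_iff_mod[OF qq])
  qed
  \<comment> \<open>\<open>k x\<close> is some number of steps from the base point to
    \<open>x\<close>. By \<open>same\<close> the image of \<open>x\<close> does not depend on which
    number is chosen.\<close>
  define k where "k = (\<lambda>x. SOME k. (p ^^ k) (b (cycle_set p x)) = x)"
  define s where "s = (\<lambda>x. if x \<in> ?X then (q ^^ k x) (b (\<beta> (cycle_set p x))) else x)"
  have k: "(p ^^ k x) (b (cycle_set p x)) = x" if "x \<in> ?X" for x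
  proof -
    have "x \<in> cycle_set p (b (cycle_set p x))"
      using bP(2)[of "cycle_set p x"] cycle_set(1)[OF pp, of x] that by simp
    then have "\<exists>k. (p ^^ k) (b (cycle_set p x)) = x" 
      unfolding cycle_set_def[of p "b (cycle_set p x)"] by (metis imageE)
    then show ?thesis unfolding k_def by (rule someI_ex)
  qed
  have key: "s ((p ^^ i) (b C)) = (q ^^ i) (b (\<beta> C))" if C: "C \<in> ?P" for C i
  proof -
    let ?x = "(p ^^ i) (b C)"
    have xC: "?x \<in> C" using cycle_set(2)[OF pp, of i "b C"] bP(2)[OF C] by simp
    have x: "?x \<in> ?X" using cycle_set_subset[OF p bP(1)[OF C]] bP(2)[OF C] xC by blast
    have cx: "cycle_set p ?x = C" using cycle_set(4)[OF pp, of ?x "b C"] bP(2)[OF C] xC by simp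
    have "(p ^^ k ?x) (b C) = (p ^^ i) (b C)" using k[OF x] unfolding cx .
    then have "(q ^^ k ?x) (b (\<beta> C)) = (q ^^ i) (b (\<beta> C))" using same[OF C] by blast
    then show ?thesis using x unfolding s_def cx by simp
  qed
  have sP: "s x \<in> \<beta> (cycle_set p x)" "s x \<in> ?X" if x: "x \<in> ?X" for x
  proof -
    have C: "cycle_set p x \<in> ?P" using x by blast
    have "(q ^^ k x) (b (\<beta> (cycle_set p x))) \<in> cycle_set q (b (\<beta> (cycle_set p x)))"
      by (rule cycle_set(2)[OF qq])
    then show sx: "s x \<in> \<beta> (cycle_set p x)" using bQ(2)[OF \<beta>Q[OF C]] x by (simp add: s_def)
    then show "s x \<in> ?X" using cycle_set_subset[OF q bQ(1)[OF \<beta>Q[OF C]]] bQ(2)[OF \<beta>Q[OF C]] by blast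
  qed
  have inj: "inj_on s ?X"
  proof (rule inj_onI)
    fix x y assume x: "x \<in> ?X" and y: "y \<in> ?X" and e: "s x = s y"
    let ?C = "cycle_set p x" and ?D = "cycle_set p y"
    have C: "?C \<in> ?P" "?D \<in> ?P" using x y by blast+
    have "\<beta> ?C = \<beta> ?D"
      using cycle_set(4)[OF qq, of "s x" "b (\<beta> ?C)"] cycle_set(4)[OF qq, of "s x" "b (\<beta> ?D)"]
        bQ(2)[OF \<beta>Q[OF C(1)]] bQ(2)[OF \<beta>Q[OF C(2)]] sP(1)[OF x] sP(1)[OF y] e by simp
    then have CD: "?C = ?D" by (rule inj_onD[OF bij_betw_imp_inj_on[OF \<beta>(1)] _ C])
    have "(q ^^ k x) (b (\<beta> ?C)) = s x" using x by (simp only: s_def if_True)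
    also have "\<dots> = (q ^^ k y) (b (\<beta> ?C))" unfolding e CD using y by (simp only: s_def if_True)
    finally have "(q ^^ k x) (b (\<beta> ?C)) = (q ^^ k y) (b (\<beta> ?C))" .
    then have pk: "(p ^^ k x) (b ?C) = (p ^^ k y) (b ?C)" using same[OF C(1)] by blast
    have "x = (p ^^ k x) (b ?C)" by (rule k[OF x, symmetric])
    also note pk
    also have "(p ^^ k y) (b ?C) = y" unfolding CD by (rule k[OF y])
    finally show "x = y" .
  qed
  have "s ` ?X = ?X" using sP(2) inj by (intro endo_inj_surj) auto
  then have "bij_betw s ?X ?X" using inj by (simp add: bij_betw_def)
  then have s: "s permutes ?X" by (rule bij_imp_permutes) (unfold s_def, rule if_not_P)
  have "s (p x) = q (s x)" for x
  proof (cases "x \<in> ?X")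
    case True
    let ?C = "cycle_set p x"
    have C: "?C \<in> ?P" using True by blast
    have "s (p x) = s ((p ^^ Suc (k x)) (b ?C))" using k[OF True] by simp
    also have "\<dots> = (q ^^ Suc (k x)) (b (\<beta> ?C))" by (rule key[OF C])
    also have "\<dots> = q (s x)" using True by (simp add: s_def)
    finally show ?thesis .
  next
    case False
    show ?thesis
      unfolding permutes_not_in[OF p False] permutes_not_in[OF s False] permutes_not_in[OF q False] ..
  qed
  then show ?thesis using s by (intro exI[of _ s]) (auto simp: fun_eq_iff)
qed

lemma finite_partitions: "finite {\<mu>. partition_of \<mu> n}"
proof (rule finite_subset)
  show "{\<mu>. partition_of \<mu> n} \<subseteq> {\<mu>. set \<mu> \<subseteq> {0..n} \<and> length \<mu> \<le> n}"
  proof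
    fix \<mu> assume "\<mu> \<in> {\<mu>. partition_of \<mu> n}"
    then have \<mu>: "0 \<notin> set \<mu>" "sum_list \<mu> = n" by (auto simp: partition_of_def)
    have "length \<mu> \<le> sum_list \<mu>" using \<mu>(1) by (induction \<mu>) auto
    moreover have "x \<le> sum_list \<mu>" if "x \<in> set \<mu>" for x using that by (intro member_le_sum_list) auto
    ultimately show "\<mu> \<in> {\<mu>. set \<mu> \<subseteq> {0..n} \<and> length \<mu> \<le> n}" using \<mu>(2) by auto
  qed
  show "finite {\<mu>. set \<mu> \<subseteq> {0..n} \<and> length \<mu> \<le> n}" by (rule finite_lists_length_le) simp
qed

text \<open>Rotate \<open>inv s\<close> around the trace. Conjugacy is expressed by
  \<open>s \<otimes> g = h \<otimes> s\<close>, the form in which conjugating permutations are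
  constructed.\<close>

lemma (in fin_group) character_conjugate:
  assumes R: "representation G R" and g: "g \<in> carrier G" "h \<in> carrier G" "s \<in> carrier G" "s \<otimes> g = h \<otimes> s"
  shows "character R g = character R h"
proof -
  note R' = repD[OF R]
  have sg: "s \<otimes> g \<in> carrier G" "inv s \<in> carrier G" using g by auto
  have "character R g = ltrace (vspace R) (\<lambda>v. act R (inv s) (act R (s \<otimes> g) v))"
    unfolding character_def using g(1,3)
    by (intro ltrace_cong R'(1)) (simp add: R'(6)[symmetric] m_assoc[symmetric])
  also have "\<dots> = ltrace (vspace R) (\<lambda>v. act R (s \<otimes> g) (act R (inv s) v))"
    using R'(4) sg by (intro ltrace_comm R'(1,3) sg) blast+
  also have "\<dots> = character R h"
    unfolding character_def
  proof (intro ltrace_cong R'(1))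
    fix v assume v: "v \<in> vspace R"
    have "act R (s \<otimes> g) (act R (inv s) v) = act R (s \<otimes> g \<otimes> inv s) v"
      by (rule R'(6)[OF sg v, symmetric])
    also have "s \<otimes> g \<otimes> inv s = h" unfolding g(4) using g by (simp add: m_assoc)
    finally show "act R (s \<otimes> g) (act R (inv s) v) = act R h v" .
  qed
  finally show ?thesis .
qed

lemma fin_group_sym_group: "fin_group (sym_group n)"
  by (intro fin_group.intro sym_group_is_group fin_group_axioms.intro)
    (simp add: sym_group_def finite_permutations)

text \<open>
  An irreducible representation not isomorphic to a Specht module would give more orthogonal class
  functions than there are cycle types.
\<close>

theorem specht_complete:
  fixes X :: "(nat \<Rightarrow> nat, 'x) rep"
  assumes X: "irreducible_rep (sym_group n) X"
  shows "\<exists>\<mu>\<in>{\<mu>. partition_of \<mu> n}. rep_iso (sym_group n) X (specht \<mu>)"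
proof (rule ccontr)
  assume no: "\<not> ?thesis"
  interpret S: fin_group "sym_group n" by (rule fin_group_sym_group)
  let ?P = "{\<mu>. partition_of \<mu> n}"
  \<comment> \<open>\<open>None\<close> stands for the hypothetical further irreducible
    representation, whose coordinate type differs from that of the Specht modules; the characters
    have a common type.\<close>
  define f where "f = (\<lambda>i. case i of None \<Rightarrow> character X | Some \<mu> \<Rightarrow> character (specht \<mu>))"
  have X': "representation (sym_group n) X" using X by (simp add: irreducible_rep_def)
  have sp: "irreducible_rep (sym_group n) (specht \<mu>)" "representation (sym_group n) (specht \<mu>)" if "\<mu> \<in> ?P" for \<mu>
    using specht_irreducible[of \<mu> n] that by (auto simp: irreducible_rep_def)
  have n1: "\<not> rep_iso (sym_group n) X (specht \<mu>)" if "\<mu> \<in> ?P" for \<mu> using no that by blast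
  have n2: "\<not> rep_iso (sym_group n) (specht \<mu>) X" if "\<mu> \<in> ?P" for \<mu>
    using n1[OF that] rep_iso_sym[OF sp(2)[OF that]] by blast
  have "card (insert None (Some ` ?P)) \<le> card ?P"
  proof (rule S.orthogonal_class_functions_card_le)
    show "finite (insert None (Some ` ?P))" "finite ?P" using finite_partitions by auto
    show "cycle_type n ` carrier (sym_group n) \<subseteq> ?P"
      using cycle_type_partition by (auto simp: sym_group_carrier)
    show "f i g = f i h"
      if i: "i \<in> insert None (Some ` ?P)" and g: "g \<in> carrier (sym_group n)" "h \<in> carrier (sym_group n)"
        and e: "cycle_type n g = cycle_type n h" for i g h
    proof -
      obtain s where s: "s permutes {1..n}" "s \<circ> g = h \<circ> s"
        using cycle_type_eq_imp_conjugate[OF _ _ e] g unfolding sym_group_carrier by blast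
      have s': "s \<in> carrier (sym_group n)" "s \<otimes>\<^bsub>sym_group n\<^esub> g = h \<otimes>\<^bsub>sym_group n\<^esub> s"
        using s by (simp_all add: sym_group_carrier sym_group_mult)
      show ?thesis
        using i S.character_conjugate[OF X' g s'] S.character_conjugate[OF sp(2) g s']
        by (auto simp: f_def)
    qed
    show "(\<Sum>g\<in>carrier (sym_group n). f i (inv\<^bsub>sym_group n\<^esub> g) * f j g) = 0"
      if i: "i \<in> insert None (Some ` ?P)" and j: "j \<in> insert None (Some ` ?P)" and ne: "i \<noteq> j" for i j
    proof -
      consider \<mu> where "i = None" "j = Some \<mu>" "\<mu> \<in> ?P" | \<mu> where "i = Some \<mu>" "j = None" "\<mu> \<in> ?P"
        | \<mu> \<nu> where "i = Some \<mu>" "j = Some \<nu>" "\<mu> \<in> ?P" "\<nu> \<in> ?P" "\<mu> \<noteq> \<nu>"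
        using i j ne by blast
      then show ?thesis
      proof cases
        case 1
        then show ?thesis using S.irr_orthogonal[OF X sp(1) n1] by (simp add: f_def)
      next
        case 2
        then show ?thesis using S.irr_orthogonal[OF sp(1) X n2] by (simp add: f_def)
      next
        case 3
        have "\<not> rep_iso (sym_group n) (specht \<mu>) (specht \<nu>)" using specht_iso_imp_eq 3(3-5) by blast
        then show ?thesis using S.irr_orthogonal[OF sp(1)[OF 3(3)] sp(1)[OF 3(4)]] 3(1,2) by (simp add: f_def)
      qed
    qed
    show "(\<Sum>g\<in>carrier (sym_group n). f i (inv\<^bsub>sym_group n\<^esub> g) * f i g) \<noteq> 0"
      if i: "i \<in> insert None (Some ` ?P)" for i
      using i S.irr_norm_nonzero[OF X] S.irr_norm_nonzero[OF sp(1)] by (auto simp: f_def S.irr_norm_def)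
  qed
  moreover have "card (insert None (Some ` ?P)) = Suc (card (Some ` ?P))"
    using finite_partitions[of n] by (intro card_insert_disjoint) auto
  moreover have "card (Some ` ?P) = card ?P" by (rule card_image) (auto simp: inj_on_def)
  ultimately show False by simp
qed

section \<open>Characters of the constructions\<close>

lemma character_pullback: "character (pullback \<phi> R) h = character R (\<phi> h)"
  by (simp add: character_def pullback_def)

lemma pullback_rep:
  assumes "representation G R" "\<And>h. h \<in> carrier H \<Longrightarrow> \<phi> h \<in> carrier G" "\<phi> \<one>\<^bsub>H\<^esub> = \<one>\<^bsub>G\<^esub>"
    "\<And>g h. g \<in> carrier H \<Longrightarrow> h \<in> carrier H \<Longrightarrow> \<phi> (g \<otimes>\<^bsub>H\<^esub> h) = \<phi> g \<otimes>\<^bsub>G\<^esub> \<phi> h"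
  shows "representation H (pullback \<phi> R)"
  by (rule repI) (use assms repD[OF assms(1)] in \<open>simp_all add: pullback_def\<close>)

text \<open>The choice in \<open>lin_ext\<close> says something only once a linear map with the
  given values exists; for each tensor construction such a map is written down in
  coordinates.\<close>

lemma lin_ext:
  assumes "\<exists>T. lin_on (cfun.span (p ` P)) T \<and> (\<forall>u\<in>P. T (p u) = q u)"
  shows "lin_on (cfun.span (p ` P)) (lin_ext P p q)" "u \<in> P \<Longrightarrow> lin_ext P p q (p u) = q u"
  using someI_ex[OF assms, folded lin_ext_def] by blast+

text \<open>On the spanning vectors \<open>p u\<close> the group acts through the labels
  \<open>u\<close>. The laws are required only after applying \<open>p\<close>, because different
  labels may name the same vector.\<close>

lemma rep_of_generators:
  assumes G: "monoid G" and V: "vspace R = cfun.span (p ` P)" "fdim (vspace R)"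
    and lin: "\<And>g. g \<in> carrier G \<Longrightarrow> lin_on (vspace R) (act R g)"
    and gen: "\<And>g u. g \<in> carrier G \<Longrightarrow> u \<in> P \<Longrightarrow> \<alpha> g u \<in> P"
      "\<And>g u. g \<in> carrier G \<Longrightarrow> u \<in> P \<Longrightarrow> act R g (p u) = p (\<alpha> g u)"
    and one: "\<And>u. u \<in> P \<Longrightarrow> p (\<alpha> \<one>\<^bsub>G\<^esub> u) = p u"
    and mult: "\<And>g h u. g \<in> carrier G \<Longrightarrow> h \<in> carrier G \<Longrightarrow> u \<in> P \<Longrightarrow> p (\<alpha> (g \<otimes>\<^bsub>G\<^esub> h) u) = p (\<alpha> g (\<alpha> h u))"
  shows "representation G R"
proof (rule repI)
  interpret monoid G by (rule G)
  note linS = lin[unfolded V(1)]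
  have cl: "act R g v \<in> vspace R" if g: "g \<in> carrier G" and v: "v \<in> vspace R" for g v
    unfolding V(1)
  proof (rule lin_on_span_closed[OF linS[OF g] _ cfun.subspace_span v[unfolded V(1)]])
    fix b assume "b \<in> p ` P"
    then obtain u where "u \<in> P" "b = p u" by blast
    then show "act R g b \<in> cfun.span (p ` P)" using gen[OF g] by (auto intro: cfun.span_base)
  qed
  then show "\<And>g v. g \<in> carrier G \<Longrightarrow> v \<in> vspace R \<Longrightarrow> act R g v \<in> vspace R" .
  show "act R \<one>\<^bsub>G\<^esub> v = v" if "v \<in> vspace R" for v
  proof (rule lin_on_eq_span[OF linS[OF one_closed] lin_on_id _ that[unfolded V(1)]])
    fix b assume "b \<in> p ` P"
    then obtain u where "u \<in> P" "b = p u" by blast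
    then show "act R \<one>\<^bsub>G\<^esub> b = b" using gen one by simp
  qed
  show "act R (g \<otimes>\<^bsub>G\<^esub> h) v = act R g (act R h v)"
    if g: "g \<in> carrier G" and h: "h \<in> carrier G" and v: "v \<in> vspace R" for g h v
  proof (rule lin_on_eq_span[OF linS[OF m_closed[OF g h]] _ _ v[unfolded V(1)]])
    show "lin_on (cfun.span (p ` P)) (\<lambda>v. act R g (act R h v))"
      using cl[OF h] by (intro lin_on_comp[OF linS[OF h] _ lin[OF g]]) (auto simp: V(1))
    fix b assume "b \<in> p ` P"
    then obtain u where "u \<in> P" "b = p u" by blast
    then show "act R (g \<otimes>\<^bsub>G\<^esub> h) b = act R g (act R h b)" using gen mult g h by simp
  qed
qed (use lin V in auto)

text \<open>The reproduction formula is linear in the vector, so it passes from \<open>S\<close> to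
  its span.\<close>

lemma coords_spanI:
  assumes "finite P" "\<And>p. p \<in> P \<Longrightarrow> e p \<in> S"
    "\<And>p q. p \<in> P \<Longrightarrow> q \<in> P \<Longrightarrow> e p q = (if p = q then 1 else 0)"
    "\<And>s x. s \<in> S \<Longrightarrow> s x = (\<Sum>p\<in>P. s p * e p x)"
  shows "coords (cfun.span S) P e"
proof (rule coordsI)
  fix v x assume v: "v \<in> cfun.span S"
  have "cfun.subspace {v. v x = (\<Sum>p\<in>P. v p * e p x)}"
    unfolding cfun.subspace_def by (auto simp: algebra_simps sum.distrib sum_distrib_left)
  then have "cfun.span S \<subseteq> {v. v x = (\<Sum>p\<in>P. v p * e p x)}"
    using assms(4) by (intro cfun.span_minimal) blast+
  then show "v x = (\<Sum>p\<in>P. v p * e p x)" using v by blast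
next
  show "e p \<in> cfun.span S" if "p \<in> P" for p using assms(2)[OF that] by (rule cfun.span_base)
qed (use assms(1,3) in auto)

lemma prod_if_one_zero: "finite I \<Longrightarrow> (\<Prod>i\<in>I. if Q i then 1 else 0) = (if \<forall>i\<in>I. Q i then 1 else (0 :: complex))"
  by (induction I rule: finite_induct) auto

subsection \<open>Outer tensor products\<close>

lemma coords_pure2:
  fixes V :: "('x \<Rightarrow> complex) set" and W :: "('y \<Rightarrow> complex) set"
  assumes "coords V P b" "coords W Q c"
  shows "coords (cfun.span (pure2 ` (V \<times> W))) (P \<times> Q) (\<lambda>(p, q). pure2 (b p, c q))"
proof (rule coords_spanI)
  note P = coordsD[OF assms(1)] and Q = coordsD[OF assms(2)]
  show "finite (P \<times> Q)" using P(1) Q(1) by simp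
  show "(case z of (p, q) \<Rightarrow> pure2 (b p, c q)) \<in> pure2 ` (V \<times> W)" if "z \<in> P \<times> Q" for z
    using that P(3) Q(3) by auto
  show "(case z of (p, q) \<Rightarrow> pure2 (b p, c q)) w = (if z = w then 1 else 0)" if "z \<in> P \<times> Q" "w \<in> P \<times> Q" for z w
  proof -
    obtain p q p' q' where zw: "z = (p, q)" "w = (p', q')" "p \<in> P" "p' \<in> P" "q \<in> Q" "q' \<in> Q"
      using \<open>z \<in> P \<times> Q\<close> \<open>w \<in> P \<times> Q\<close> by auto
    show ?thesis using P(4)[OF zw(3,4)] Q(4)[OF zw(5,6)] by (simp add: zw(1,2) pure2_def)
  qed
  fix s :: "'x \<times> 'y \<Rightarrow> complex" and z :: "'x \<times> 'y" assume "s \<in> pure2 ` (V \<times> W)"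
  then obtain v w where vw: "s = pure2 (v, w)" "v \<in> V" "w \<in> W" by auto
  obtain x y where z: "z = (x, y)" by (cases z)
  have "s z = v x * w y" by (simp add: vw(1) z pure2_def)
  also have "\<dots> = (\<Sum>p\<in>P. v p * b p x) * (\<Sum>q\<in>Q. w q * c q y)"
    by (rule arg_cong2[where f = "(*)", OF P(6)[OF vw(2)] Q(6)[OF vw(3)]])
  also have "\<dots> = (\<Sum>(p, q)\<in>P \<times> Q. (v p * b p x) * (w q * c q y))"
    by (simp add: sum_product sum.cartesian_product)
  finally show "s z = (\<Sum>p\<in>P \<times> Q. s p * (case p of (p, q) \<Rightarrow> pure2 (b p, c q)) z)"
    by (simp add: vw(1) z pure2_def case_prod_unfold ac_simps)
qed

text \<open>The map is defined on every function through its values at the dual points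
  \<open>P \<times> Q\<close>. Linearity is then automatic, and only pure tensors remain to be
  checked.\<close>

lemma outer_tensor_lin_ext:
  assumes "fdim V" "fdim W" "lin_on V S" "lin_on W T"
  shows "\<exists>L. lin_on (cfun.span (pure2 ` (V \<times> W))) L \<and>
    (\<forall>u\<in>V \<times> W. L (pure2 u) = (\<lambda>(v, w). pure2 (S v, T w)) u)"
proof -
  obtain P b Q c where P: "coords V P b" and Q: "coords W Q c" using fdim_coords assms(1,2) by metis
  define L where "L = (\<lambda>F. \<Sum>z\<in>P \<times> Q. cscale (F z) (pure2 (S (b (fst z)), T (c (snd z)))))"
  have "lin_on X L" for X
    by (auto simp: L_def lin_on_def fun_eq_iff sum_fun_apply algebra_simps sum.distrib sum_distrib_left)
  moreover have "L (pure2 (v, w)) = pure2 (S v, T w)" if v: "v \<in> V" and w: "w \<in> W" for v w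
  proof
    fix z :: "'c \<times> 'd"
    obtain x y where z: "z = (x, y)" by (cases z)
    have "pure2 (S v, T w) z = (\<Sum>p\<in>P. v p * S (b p) x) * (\<Sum>q\<in>Q. w q * T (c q) y)"
      using coords_lin[OF P assms(3) v] coords_lin[OF Q assms(4) w] by (simp add: z pure2_def)
    also have "\<dots> = L (pure2 (v, w)) z"
      by (simp add: sum_product sum.cartesian_product L_def sum_fun_apply z pure2_def case_prod_unfold ac_simps)
    finally show "L (pure2 (v, w)) z = pure2 (S v, T w) z" by simp
  qed
  ultimately show ?thesis by (intro exI[of _ L]) auto
qed

lemma outer_tensor:
  assumes R: "representation G R" and S: "representation H S" and G: "group G" and H: "group H"
  shows "representation (G \<times>\<times> H) (R \<boxtimes> S)"
    "g \<in> carrier G \<Longrightarrow> h \<in> carrier H \<Longrightarrow> character (R \<boxtimes> S) (g, h) = character R g * character S h"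
proof -
  note R' = repD[OF R] and S' = repD[OF S]
  interpret G: group G by (rule G)
  interpret H: group H by (rule H)
  obtain P b Q c where P: "coords (vspace R) P b" and Q: "coords (vspace S) Q c"
    using fdim_coords R'(1) S'(1) by metis
  note PQ = coords_pure2[OF P Q]
  have vs: "vspace (R \<boxtimes> S) = cfun.span (pure2 ` (vspace R \<times> vspace S))" by (simp add: outer_tensor_def)
  have ac: "act (R \<boxtimes> S) (g, h) = lin_ext (vspace R \<times> vspace S) pure2 (\<lambda>(v, w). pure2 (act R g v, act S h w))"
    for g h by (simp add: outer_tensor_def)
  have L: "lin_on (vspace (R \<boxtimes> S)) (act (R \<boxtimes> S) (g, h))"
    "\<And>u. u \<in> vspace R \<times> vspace S \<Longrightarrow> act (R \<boxtimes> S) (g, h) (pure2 u) = pure2 (act R g (fst u), act S h (snd u))"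
    if "g \<in> carrier G" "h \<in> carrier H" for g h
    using lin_ext[OF outer_tensor_lin_ext[OF R'(1) S'(1) R'(3)[OF that(1)] S'(3)[OF that(2)]]]
    unfolding vs ac by (auto simp: case_prod_unfold)
  show rep: "representation (G \<times>\<times> H) (R \<boxtimes> S)"
  proof (rule rep_of_generators[where \<alpha> = "\<lambda>g u. (act R (fst g) (fst u), act S (snd g) (snd u))", OF _ vs])
    show "monoid (G \<times>\<times> H)" by (rule DirProd_monoid) unfold_locales
    show "fdim (vspace (R \<boxtimes> S))" unfolding vs by (rule coords_fdim[OF PQ])
  qed (use L R' S' in \<open>auto simp: DirProd_def\<close>)
  assume g: "g \<in> carrier G" and h: "h \<in> carrier H"
  have gh: "(g, h) \<in> carrier (G \<times>\<times> H)" using g h by (simp add: DirProd_def)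
  have "character (R \<boxtimes> S) (g, h) = (\<Sum>z\<in>P \<times> Q. act (R \<boxtimes> S) (g, h) ((\<lambda>(p, q). pure2 (b p, c q)) z) z)"
    by (rule character_coords[OF rep _ gh]) (simp only: vs PQ)
  also have "\<dots> = (\<Sum>z\<in>P \<times> Q. act R g (b (fst z)) (fst z) * act S h (c (snd z)) (snd z))"
    using L(2)[OF g h] coordsD(3)[OF P] coordsD(3)[OF Q] by (intro sum.cong refl) (auto simp: pure2_def)
  also have "\<dots> = character R g * character S h"
    by (simp add: character_coords[OF R P g] character_coords[OF S Q h] sum_product sum.cartesian_product case_prod_unfold)
  finally show "character (R \<boxtimes> S) (g, h) = character R g * character S h" .
qed

lemma inner_tensor:
  assumes R: "representation G R" and S: "representation G S" and G: "group G"
  shows "representation G (inner_tensor R S)"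
    "g \<in> carrier G \<Longrightarrow> character (inner_tensor R S) g = character R g * character S g"
proof -
  show "representation G (inner_tensor R S)"
    unfolding inner_tensor_def by (rule pullback_rep[OF outer_tensor(1)[OF R S G G]]) (auto simp: DirProd_def)
  show "g \<in> carrier G \<Longrightarrow> character (inner_tensor R S) g = character R g * character S g"
    by (simp add: inner_tensor_def character_pullback outer_tensor(2)[OF R S G G])
qed

subsection \<open>Tensor products of families\<close>

text \<open>Dual points of the tensor space are choices of a dual point in every factor. Reproducing
  a pure tensor amounts to distributing a product of sums over these choices.\<close>

lemma coords_tensor_space:
  assumes I: "finite I" and c: "\<And>i. i \<in> I \<Longrightarrow> coords (V i) (P i) (b i)"
  shows "coords (tensor_space I V) (PiE I P) (\<lambda>\<phi>. pure_tensor I (\<lambda>i\<in>I. b i (\<phi> i)))"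
  unfolding tensor_space_def
proof (rule coords_spanI)
  show "finite (PiE I P)" using I coordsD(1)[OF c] by (intro finite_PiE)
  show "pure_tensor I (\<lambda>i\<in>I. b i (\<phi> i)) \<in> pure_tensor I ` (\<Pi>\<^sub>E i\<in>I. V i)" if "\<phi> \<in> PiE I P" for \<phi>
    by (intro imageI restrict_PiE_iff[THEN iffD2] ballI coordsD(3)[OF c] PiE_mem[OF that])
  show "pure_tensor I (\<lambda>i\<in>I. b i (\<phi> i)) \<psi> = (if \<phi> = \<psi> then 1 else 0)"
    if \<phi>: "\<phi> \<in> PiE I P" and \<psi>: "\<psi> \<in> PiE I P" for \<phi> \<psi>
  proof -
    have "pure_tensor I (\<lambda>i\<in>I. b i (\<phi> i)) \<psi> = (\<Prod>i\<in>I. if \<phi> i = \<psi> i then 1 else 0)"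
      unfolding pure_tensor_def
      by (intro prod.cong refl) (simp add: coordsD(4)[OF c PiE_mem[OF \<phi>] PiE_mem[OF \<psi>]])
    moreover have "(\<forall>i\<in>I. \<phi> i = \<psi> i) \<longleftrightarrow> \<phi> = \<psi>" using PiE_ext[OF \<phi> \<psi>] by blast
    ultimately show ?thesis by (simp add: prod_if_one_zero[OF I])
  qed
  fix s \<psi> assume "s \<in> pure_tensor I ` (\<Pi>\<^sub>E i\<in>I. V i)"
  then obtain u where u: "s = pure_tensor I u" "u \<in> (\<Pi>\<^sub>E i\<in>I. V i)" by blast
  have "s \<psi> = (\<Prod>i\<in>I. \<Sum>p\<in>P i. u i p * b i p (\<psi> i))"
    unfolding u(1) pure_tensor_def using u(2) by (intro prod.cong refl coordsD(6)[OF c]) auto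
  also have "\<dots> = (\<Sum>\<phi>\<in>PiE I P. \<Prod>i\<in>I. u i (\<phi> i) * b i (\<phi> i) (\<psi> i))"
    using I coordsD(1)[OF c] by (rule prod_sum_PiE)
  also have "\<dots> = (\<Sum>\<phi>\<in>PiE I P. s \<phi> * pure_tensor I (\<lambda>i\<in>I. b i (\<phi> i)) \<psi>)"
    by (intro sum.cong refl) (simp add: u(1) pure_tensor_def prod.distrib)
  finally show "s \<psi> = (\<Sum>\<phi>\<in>PiE I P. s \<phi> * pure_tensor I (\<lambda>i\<in>I. b i (\<phi> i)) \<psi>)" .
qed

text \<open>The map \<open>A i\<close> leads from the factor with index \<open>\<sigma> i\<close> to
  the factor with index \<open>i\<close>, so that permuting the factors and acting on them are
  treated at once.\<close>

lemma tensor_lin_ext: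
  fixes b :: "'i \<Rightarrow> 'x \<Rightarrow> 'x \<Rightarrow> complex"
  assumes I: "finite I" and c: "\<And>i. i \<in> I \<Longrightarrow> coords (V i) (P i) (b i)" and \<sigma>: "bij_betw \<sigma> I I"
    and A: "\<And>i. i \<in> I \<Longrightarrow> lin_on (V (\<sigma> i)) (A i)"
  shows "\<exists>L. lin_on (cfun.span (pure_tensor I ` (\<Pi>\<^sub>E i\<in>I. V i))) L \<and>
    (\<forall>u\<in>\<Pi>\<^sub>E i\<in>I. V i. L (pure_tensor I u) = pure_tensor I (\<lambda>i. A i (u (\<sigma> i))))"
proof -
  define L where "L = (\<lambda>F. \<Sum>\<phi>\<in>PiE I P. cscale (F \<phi>) (pure_tensor I (\<lambda>i. A i (b (\<sigma> i) (\<phi> (\<sigma> i))))))"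
  have "lin_on X L" for X
    by (auto simp: L_def lin_on_def fun_eq_iff sum_fun_apply algebra_simps sum.distrib sum_distrib_left)
  moreover have "L (pure_tensor I u) = pure_tensor I (\<lambda>i. A i (u (\<sigma> i)))" if u: "u \<in> (\<Pi>\<^sub>E i\<in>I. V i)" for u
  proof
    fix \<psi>
    \<comment> \<open>The product is reindexed by \<open>j = \<sigma> i\<close>; each factor then
      involves \<open>u j\<close> alone and the product of sums can be distributed.\<close>
    let ?\<tau> = "inv_into I \<sigma>"
    have \<sigma>I: "\<sigma> i \<in> I" if "i \<in> I" for i using \<sigma> that by (auto simp: bij_betw_def)
    have \<tau>\<sigma>: "?\<tau> (\<sigma> i) = i" if "i \<in> I" for i by (rule bij_betw_inv_into_left[OF \<sigma> that])
    have "pure_tensor I (\<lambda>i. A i (u (\<sigma> i))) \<psi> = (\<Prod>i\<in>I. \<Sum>p\<in>P (\<sigma> i). u (\<sigma> i) p * A i (b (\<sigma> i) p) (\<psi> i))"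
      unfolding pure_tensor_def using u \<sigma>I by (intro prod.cong refl coords_lin[OF c A]) auto
    also have "\<dots> = (\<Prod>i\<in>I. (\<lambda>j. \<Sum>p\<in>P j. u j p * A (?\<tau> j) (b j p) (\<psi> (?\<tau> j))) (\<sigma> i))"
      using \<tau>\<sigma> by (intro prod.cong refl) simp
    also have "\<dots> = (\<Prod>j\<in>I. \<Sum>p\<in>P j. u j p * A (?\<tau> j) (b j p) (\<psi> (?\<tau> j)))"
      by (rule prod.reindex_bij_betw[OF \<sigma>])
    also have "\<dots> = (\<Sum>\<phi>\<in>PiE I P. \<Prod>j\<in>I. u j (\<phi> j) * A (?\<tau> j) (b j (\<phi> j)) (\<psi> (?\<tau> j)))"
      using I coordsD(1)[OF c] by (rule prod_sum_PiE)
    also have "\<dots> = (\<Sum>\<phi>\<in>PiE I P. (\<Prod>j\<in>I. u j (\<phi> j)) * (\<Prod>i\<in>I. A i (b (\<sigma> i) (\<phi> (\<sigma> i))) (\<psi> i)))"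
    proof (intro sum.cong refl)
      fix \<phi>
      have "(\<Prod>j\<in>I. A (?\<tau> j) (b j (\<phi> j)) (\<psi> (?\<tau> j))) = (\<Prod>i\<in>I. (\<lambda>j. A (?\<tau> j) (b j (\<phi> j)) (\<psi> (?\<tau> j))) (\<sigma> i))"
        by (rule prod.reindex_bij_betw[OF \<sigma>, symmetric])
      also have "\<dots> = (\<Prod>i\<in>I. A i (b (\<sigma> i) (\<phi> (\<sigma> i))) (\<psi> i))"
        using \<tau>\<sigma> by (intro prod.cong refl) simp
      finally show "(\<Prod>j\<in>I. u j (\<phi> j) * A (?\<tau> j) (b j (\<phi> j)) (\<psi> (?\<tau> j))) =
          (\<Prod>j\<in>I. u j (\<phi> j)) * (\<Prod>i\<in>I. A i (b (\<sigma> i) (\<phi> (\<sigma> i))) (\<psi> i))" by (simp add: prod.distrib)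
    qed
    also have "\<dots> = L (pure_tensor I u) \<psi>" by (simp add: L_def sum_fun_apply pure_tensor_def)
    finally show "L (pure_tensor I u) \<psi> = pure_tensor I (\<lambda>i. A i (u (\<sigma> i))) \<psi>" by simp
  qed
  ultimately show ?thesis by (intro exI[of _ L]) blast
qed

text \<open>
  The twisted tensor power: \<^term>\<open>\<sigma> g\<close> permutes the factors and \<^term>\<open>A g i\<close> then acts on the
  factor with index \<^term>\<open>i\<close>.
\<close>

lemma twisted_tensor_rep:
  fixes G :: "('g, 'm) monoid_scheme" (structure) and R :: "('g, 'i \<Rightarrow> 'x) rep"
  assumes G: "group G" and I: "finite I" and c: "\<And>i. i \<in> I \<Longrightarrow> coords (V i) (P i) (b i)"
    and vs: "vspace R = tensor_space I V"
    and ac: "\<And>g. g \<in> carrier G \<Longrightarrow> act R g = lin_ext (\<Pi>\<^sub>E i\<in>I. V i) (pure_tensor I) (\<lambda>u. pure_tensor I (\<lambda>i. A g i (u (\<sigma> g i))))"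
    and \<sigma>: "\<And>g. g \<in> carrier G \<Longrightarrow> bij_betw (\<sigma> g) I I"
    and A: "\<And>g i. g \<in> carrier G \<Longrightarrow> i \<in> I \<Longrightarrow> lin_on (V (\<sigma> g i)) (A g i)"
      "\<And>g i v. g \<in> carrier G \<Longrightarrow> i \<in> I \<Longrightarrow> v \<in> V (\<sigma> g i) \<Longrightarrow> A g i v \<in> V i"
    and one: "\<And>i v. i \<in> I \<Longrightarrow> v \<in> V i \<Longrightarrow> \<sigma> \<one>\<^bsub>G\<^esub> i = i \<and> A \<one>\<^bsub>G\<^esub> i v = v"
    and mult: "\<And>g h i. g \<in> carrier G \<Longrightarrow> h \<in> carrier G \<Longrightarrow> i \<in> I \<Longrightarrow> \<sigma> (g \<otimes>\<^bsub>G\<^esub> h) i = \<sigma> h (\<sigma> g i)"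
      "\<And>g h i v. g \<in> carrier G \<Longrightarrow> h \<in> carrier G \<Longrightarrow> i \<in> I \<Longrightarrow> v \<in> V (\<sigma> h (\<sigma> g i)) \<Longrightarrow>
        A (g \<otimes>\<^bsub>G\<^esub> h) i v = A g i (A h (\<sigma> g i) v)"
  shows "representation G R"
    "g \<in> carrier G \<Longrightarrow> character R g = (\<Sum>\<phi>\<in>PiE I P. \<Prod>i\<in>I. A g i (b (\<sigma> g i) (\<phi> (\<sigma> g i))) (\<phi> i))"
proof -
  interpret group G by (rule G)
  note C = coords_tensor_space[OF I c]
  have vs': "vspace R = cfun.span (pure_tensor I ` (\<Pi>\<^sub>E i\<in>I. V i))" unfolding vs tensor_space_def ..
  have L: "lin_on (vspace R) (act R g)"
    "\<And>u. u \<in> (\<Pi>\<^sub>E i\<in>I. V i) \<Longrightarrow> act R g (pure_tensor I u) = pure_tensor I (\<lambda>i. A g i (u (\<sigma> g i)))"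
    if g: "g \<in> carrier G" for g
    using lin_ext[OF tensor_lin_ext[where V = V and \<sigma> = "\<sigma> g" and A = "A g", OF I c \<sigma>[OF g] A(1)[OF g]]]
    unfolding vs' ac[OF g] by auto
  \<comment> \<open>Values outside \<open>I\<close> do not affect a pure tensor, so families may be
    cut down to extensional ones.\<close>
  have restr: "pure_tensor I (restrict u I) = pure_tensor I u" for u :: "'i \<Rightarrow> 'x \<Rightarrow> complex"
    by (auto simp: pure_tensor_def fun_eq_iff intro!: prod.cong)
  have cong: "pure_tensor I u = pure_tensor I w" if "\<And>i. i \<in> I \<Longrightarrow> u i = w i" for u w :: "'i \<Rightarrow> 'x \<Rightarrow> complex"
    using that by (auto simp: pure_tensor_def fun_eq_iff intro!: prod.cong)
  have \<sigma>I: "\<sigma> g i \<in> I" if "g \<in> carrier G" "i \<in> I" for g i using \<sigma>[OF that(1)] that(2) by (auto simp: bij_betw_def)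
  show rep: "representation G R"
  proof (rule rep_of_generators[where \<alpha> = "\<lambda>g u. \<lambda>i\<in>I. A g i (u (\<sigma> g i))", OF _ vs'])
    show "monoid G" by unfold_locales
    show "fdim (vspace R)" unfolding vs by (rule coords_fdim[OF C])
    fix g assume g: "g \<in> carrier G"
    show "lin_on (vspace R) (act R g)" by (rule L(1)[OF g])
    fix u assume u: "u \<in> (\<Pi>\<^sub>E i\<in>I. V i)"
    show "(\<lambda>i\<in>I. A g i (u (\<sigma> g i))) \<in> (\<Pi>\<^sub>E i\<in>I. V i)" using A(2)[OF g] u \<sigma>I[OF g] by (auto simp: PiE_iff)
    show "act R g (pure_tensor I u) = pure_tensor I (\<lambda>i\<in>I. A g i (u (\<sigma> g i)))" by (simp add: L(2)[OF g u] restr)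
    fix h assume h: "h \<in> carrier G"
    have "A (g \<otimes> h) i (u (\<sigma> (g \<otimes> h) i)) = A g i (A h (\<sigma> g i) (u (\<sigma> h (\<sigma> g i))))" if i: "i \<in> I" for i
      using mult(1)[OF g h i] mult(2)[OF g h i, of "u (\<sigma> h (\<sigma> g i))"] u \<sigma>I[OF h \<sigma>I[OF g i]] by auto
    then show "pure_tensor I (\<lambda>i\<in>I. A (g \<otimes> h) i (u (\<sigma> (g \<otimes> h) i))) =
        pure_tensor I (\<lambda>i\<in>I. A g i ((\<lambda>i\<in>I. A h i (u (\<sigma> h i))) (\<sigma> g i)))"
      using \<sigma>I[OF g] by (intro cong) simp
  next
    fix u assume u: "u \<in> (\<Pi>\<^sub>E i\<in>I. V i)"
    show "pure_tensor I (\<lambda>i\<in>I. A \<one> i (u (\<sigma> \<one> i))) = pure_tensor I u"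
      using one u by (intro cong) (auto simp: PiE_iff)
  qed
  assume g: "g \<in> carrier G"
  have "character R g = (\<Sum>\<phi>\<in>PiE I P. act R g (pure_tensor I (\<lambda>i\<in>I. b i (\<phi> i))) \<phi>)"
    by (rule character_coords[OF rep _ g]) (simp only: vs C)
  also have "\<dots> = (\<Sum>\<phi>\<in>PiE I P. \<Prod>i\<in>I. A g i (b (\<sigma> g i) (\<phi> (\<sigma> g i))) (\<phi> i))"
  proof (intro sum.cong refl)
    fix \<phi> assume \<phi>: "\<phi> \<in> PiE I P"
    have "(\<lambda>i\<in>I. b i (\<phi> i)) \<in> (\<Pi>\<^sub>E i\<in>I. V i)"
      by (intro restrict_PiE_iff[THEN iffD2] ballI coordsD(3)[OF c] PiE_mem[OF \<phi>])
    from L(2)[OF g this] show "act R g (pure_tensor I (\<lambda>i\<in>I. b i (\<phi> i))) \<phi> = (\<Prod>i\<in>I. A g i (b (\<sigma> g i) (\<phi> (\<sigma> g i))) (\<phi> i))"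
      by (simp only: pure_tensor_def) (intro prod.cong refl, simp add: \<sigma>I[OF g])
  qed
  finally show "character R g = (\<Sum>\<phi>\<in>PiE I P. \<Prod>i\<in>I. A g i (b (\<sigma> g i) (\<phi> (\<sigma> g i))) (\<phi> i))" .
qed

subsection \<open>Direct sums\<close>

lemma direct_sum:
  fixes R :: "'j \<Rightarrow> ('g, 'x) rep"
  assumes J: "finite J" and R: "\<And>j. j \<in> J \<Longrightarrow> representation G (R j)"
  shows "representation G (direct_sum J R)"
    "g \<in> carrier G \<Longrightarrow> character (direct_sum J R) g = (\<Sum>j\<in>J. character (R j) g)"
proof -
  note R' = repD[OF R]
  have "\<forall>j\<in>J. \<exists>P b. coords (vspace (R j)) P b" using fdim_coords R'(1) by blast
  then obtain P b where c: "\<And>j. j \<in> J \<Longrightarrow> coords (vspace (R j)) (P j) (b j)" by metis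
  let ?S = "direct_sum J R"
  have mem: "f \<in> vspace ?S \<longleftrightarrow> (\<forall>j\<in>J. (\<lambda>x. f (j, x)) \<in> vspace (R j)) \<and> (\<forall>j x. j \<notin> J \<longrightarrow> f (j, x) = 0)" for f
    by (auto simp: direct_sum_def)
  have ac: "act ?S g f (j, x) = (if j \<in> J then act (R j) g (\<lambda>y. f (j, y)) x else 0)" for g f j x
    by (simp add: direct_sum_def)
  have acs: "(\<lambda>x. act ?S g f (j, x)) = act (R j) g (\<lambda>y. f (j, y))" if "j \<in> J" for g f j
    using that by (simp add: ac fun_eq_iff)
  have pl: "(\<lambda>x. (u + v) (j, x)) = (\<lambda>x. u (j, x)) + (\<lambda>x. v (j, x))"
    and sc: "(\<lambda>x. cscale k u (j, x)) = cscale k (\<lambda>x. u (j, x))" for u v :: "'j \<times> 'x \<Rightarrow> complex" and j k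
    by (auto simp: fun_eq_iff)
  have sub: "cfun.subspace (vspace ?S)"
    unfolding cfun.subspace_def
  proof (intro conjI ballI allI)
    show "0 \<in> vspace ?S"
      using cfun.subspace_0[OF R'(2)] by (auto simp: mem zero_fun_def)
    show "u + v \<in> vspace ?S" if "u \<in> vspace ?S" "v \<in> vspace ?S" for u v
      using that cfun.subspace_add[OF R'(2)] unfolding mem pl by simp
    show "cscale k v \<in> vspace ?S" if "v \<in> vspace ?S" for k v
      using that cfun.subspace_scale[OF R'(2)] unfolding mem sc by simp
  qed
  let ?e = "\<lambda>(j, p) (j', y). if j' = j then b j p y else 0"
  have C: "coords (vspace ?S) (Sigma J P) ?e"
  proof (rule coordsI)
    show "finite (Sigma J P)" using J coordsD(1)[OF c] by simp
    show "?e z \<in> vspace ?S" if z: "z \<in> Sigma J P" for z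
    proof -
      obtain j p where jp: "z = (j, p)" "j \<in> J" "p \<in> P j" using z by auto
      have "(\<lambda>x. ?e z (j', x)) = (if j' = j then b j p else 0)" for j' by (auto simp: jp(1) fun_eq_iff)
      then show ?thesis using jp coordsD(3)[OF c] cfun.subspace_0[OF R'(2)] by (auto simp: mem)
    qed
    show "?e z w = (if z = w then 1 else 0)" if "z \<in> Sigma J P" "w \<in> Sigma J P" for z w
    proof -
      obtain j p j' p' where zw: "z = (j, p)" "w = (j', p')" "j \<in> J" "j' \<in> J" "p \<in> P j" "p' \<in> P j'"
        using \<open>z \<in> Sigma J P\<close> \<open>w \<in> Sigma J P\<close> by auto
      show ?thesis
        using coordsD(4)[OF c[OF zw(3)] zw(5), of p'] zw(6) by (cases "j = j'") (auto simp: zw(1,2))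
    qed
    fix v and z :: "'j \<times> 'x" assume v: "v \<in> vspace ?S"
    obtain j x where z: "z = (j, x)" by (cases z)
    have "(\<Sum>p\<in>Sigma J P. v p * ?e p z) = (\<Sum>i\<in>J. \<Sum>p\<in>P i. v (i, p) * (if j = i then b i p x else 0))"
      using J coordsD(1)[OF c] by (subst sum.Sigma) (auto simp: z intro!: sum.cong)
    also have "\<dots> = (\<Sum>i\<in>J. if i = j then \<Sum>p\<in>P j. v (j, p) * b j p x else 0)"
      by (intro sum.cong refl) auto
    also have "\<dots> = v z"
      using v J coordsD(6)[OF c, of j "\<lambda>x. v (j, x)" x] by (auto simp: mem z)
    finally show "v z = (\<Sum>p\<in>Sigma J P. v p * ?e p z)" by simp
  qed (rule sub)
  show rep: "representation G ?S"
  proof (rule repI)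
    show "fdim (vspace ?S)" by (rule coords_fdim[OF C])
    fix g assume g: "g \<in> carrier G"
    show "lin_on (vspace ?S) (act ?S g)"
    proof (rule lin_onI)
      fix u v assume uv: "u \<in> vspace ?S" "v \<in> vspace ?S"
      show "act ?S g (u + v) = act ?S g u + act ?S g v"
      proof
        fix z :: "'j \<times> 'x"
        obtain j x where z: "z = (j, x)" by (cases z)
        show "act ?S g (u + v) z = (act ?S g u + act ?S g v) z"
        proof (cases "j \<in> J")
          case True
          have m: "(\<lambda>y. u (j, y)) \<in> vspace (R j)" "(\<lambda>y. v (j, y)) \<in> vspace (R j)"
            using uv True by (simp_all add: mem)
          have "act ?S g (u + v) z = act (R j) g (\<lambda>y. (u + v) (j, y)) x"
            unfolding z by (simp only: ac if_P[OF True])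
          also have "\<dots> = (act (R j) g (\<lambda>y. u (j, y)) + act (R j) g (\<lambda>y. v (j, y))) x"
            unfolding pl lin_on_add[OF R'(3)[OF True g] m] ..
          finally show ?thesis by (simp add: z ac True)
        qed (simp add: z ac)
      qed
    next
      fix k v assume v: "v \<in> vspace ?S"
      show "act ?S g (cscale k v) = cscale k (act ?S g v)"
      proof
        fix z :: "'j \<times> 'x"
        obtain j x where z: "z = (j, x)" by (cases z)
        show "act ?S g (cscale k v) z = cscale k (act ?S g v) z"
        proof (cases "j \<in> J")
          case True
          have m: "(\<lambda>y. v (j, y)) \<in> vspace (R j)" using v True by (simp add: mem)
          have "act ?S g (cscale k v) z = act (R j) g (\<lambda>y. cscale k v (j, y)) x"
            unfolding z by (simp only: ac if_P[OF True])
          also have "\<dots> = cscale k (act (R j) g (\<lambda>y. v (j, y))) x"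
            unfolding sc lin_on_scale[OF R'(3)[OF True g] m] ..
          finally show ?thesis by (simp add: z ac True)
        qed (simp add: z ac)
      qed
    qed
    fix v assume v: "v \<in> vspace ?S"
    then show "act ?S g v \<in> vspace ?S" using R'(4)[OF _ g] by (simp add: mem acs ac)
    fix h assume h: "h \<in> carrier G"
    show "act ?S (g \<otimes>\<^bsub>G\<^esub> h) v = act ?S g (act ?S h v)"
    proof
      fix z show "act ?S (g \<otimes>\<^bsub>G\<^esub> h) v z = act ?S g (act ?S h v) z"
        using v R'(6)[OF _ g h] by (cases z) (simp add: ac[of "g \<otimes>\<^bsub>G\<^esub> h"] ac[of g] acs mem)
    qed
  next
    fix v assume v: "v \<in> vspace ?S"
    show "act ?S \<one>\<^bsub>G\<^esub> v = v"
    proof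
      fix z show "act ?S \<one>\<^bsub>G\<^esub> v z = v z" using v R'(5) by (cases z) (simp add: ac mem)
    qed
  qed
  assume g: "g \<in> carrier G"
  have "character ?S g = (\<Sum>z\<in>Sigma J P. act ?S g (?e z) z)" by (rule character_coords[OF rep C g])
  also have "\<dots> = (\<Sum>(j, p)\<in>Sigma J P. act (R j) g (b j p) p)"
    by (intro sum.cong refl) (auto simp: ac)
  also have "\<dots> = (\<Sum>j\<in>J. \<Sum>p\<in>P j. act (R j) g (b j p) p)"
    using J coordsD(1)[OF c] by (intro sum.Sigma[symmetric]) auto
  also have "\<dots> = (\<Sum>j\<in>J. character (R j) g)"
    by (intro sum.cong refl) (simp add: character_coords[OF R c g])
  finally show "character ?S g = (\<Sum>j\<in>J. character (R j) g)" .
qed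

lemma copies:
  assumes "representation G R"
  shows "representation G (copies m R)"
    "g \<in> carrier G \<Longrightarrow> character (copies m R) g = of_nat m * character R g"
  using direct_sum[of "{..<m}" G "\<lambda>_. R"] assms by (simp_all add: copies_def)

subsection \<open>Induced representations\<close>

text \<open>\<open>C\<close> is a left transversal of \<open>H\<close>, kept arbitrary so that
  colourings can index it later. A member of the induced space is determined by its values on
  \<open>C\<close>, and \<open>g\<close> contributes to the trace at \<open>c\<close> exactly when
  it fixes the coset of \<open>c\<close>.\<close>

lemma induced:
  fixes G :: "('g, 'm) monoid_scheme" (structure) and R :: "('g, 'x) rep"
  assumes G: "fin_group G" and H: "subgroup H G" and R: "representation (G\<lparr>carrier := H\<rparr>) R"
    and C: "C \<subseteq> carrier G" "\<And>x. x \<in> carrier G \<Longrightarrow> \<exists>c\<in>C. inv\<^bsub>G\<^esub> c \<otimes>\<^bsub>G\<^esub> x \<in> H"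
      "\<And>c d. c \<in> C \<Longrightarrow> d \<in> C \<Longrightarrow> inv\<^bsub>G\<^esub> c \<otimes>\<^bsub>G\<^esub> d \<in> H \<Longrightarrow> c = d"
  shows "representation G (Ind G H R)"
    "g \<in> carrier G \<Longrightarrow> character (Ind G H R) g =
       (\<Sum>c\<in>C. if inv\<^bsub>G\<^esub> c \<otimes>\<^bsub>G\<^esub> g \<otimes>\<^bsub>G\<^esub> c \<in> H then character R (inv\<^bsub>G\<^esub> c \<otimes>\<^bsub>G\<^esub> g \<otimes>\<^bsub>G\<^esub> c) else 0)"
proof -
  interpret fin_group G by (rule G)
  interpret H: subgroup H G by (rule H)
  let ?I = "Ind G H R"
  have HG: "h \<in> carrier G" if "h \<in> H" for h using that H.subset by blast
  have R3: "lin_on (vspace R) (act R h)" and R4: "v \<in> vspace R \<Longrightarrow> act R h v \<in> vspace R" if "h \<in> H" for h v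
    using repD(3,4)[OF R] that by simp_all
  have R5: "v \<in> vspace R \<Longrightarrow> act R \<one>\<^bsub>G\<^esub> v = v" for v using repD(5)[OF R] by simp
  have R6: "act R (h \<otimes> k) v = act R h (act R k v)" if "h \<in> H" "k \<in> H" "v \<in> vspace R" for h k v
    using repD(6)[OF R] that by simp
  note V = repD(2)[OF R]
  have act0: "act R h 0 = 0" if "h \<in> H" for h by (rule lin_on_zero[OF R3[OF that] cfun.subspace_0[OF V]])
  obtain P b where P: "coords (vspace R) P b" using fdim_coords repD(1)[OF R] by blast
  note P' = coordsD[OF P]
  have finC: "finite C" using C(1) fin finite_subset by blast
  have mem: "f \<in> vspace ?I \<longleftrightarrow> (\<forall>x\<in>carrier G. (\<lambda>y. f (x, y)) \<in> vspace R) \<and> (\<forall>x y. x \<notin> carrier G \<longrightarrow> f (x, y) = 0) \<and>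
      (\<forall>x\<in>carrier G. \<forall>h\<in>H. (\<lambda>y. f (x \<otimes> h, y)) = act R (inv h) (\<lambda>y. f (x, y)))" for f
    by (auto simp: Ind_def)
  have ac: "act ?I g f (x, y) = (if x \<in> carrier G then f (inv g \<otimes> x, y) else 0)" for g f x y
    by (simp add: Ind_def)
  have pl: "(\<lambda>x. (u + v) (j, x)) = (\<lambda>x. u (j, x)) + (\<lambda>x. v (j, x))"
    and sc: "(\<lambda>x. cscale k u (j, x)) = cscale k (\<lambda>x. u (j, x))" for u v :: "'g \<times> 'x \<Rightarrow> complex" and j k
    by (auto simp: fun_eq_iff)
  have sub: "cfun.subspace (vspace ?I)"
    unfolding cfun.subspace_def
  proof (intro conjI ballI allI)
    have "(\<lambda>y. (0 :: 'g \<times> 'x \<Rightarrow> complex) (x, y)) = 0" for x by (auto simp: fun_eq_iff)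
    then show "0 \<in> vspace ?I" using cfun.subspace_0[OF V] act0 by (simp add: mem)
    show "u + v \<in> vspace ?I" if uv: "u \<in> vspace ?I" "v \<in> vspace ?I" for u v
    proof -
      have "(\<lambda>y. (u + v) (x \<otimes> h, y)) = act R (inv h) (\<lambda>y. (u + v) (x, y))" if "x \<in> carrier G" "h \<in> H" for x h
      proof -
        have m: "(\<lambda>y. u (x, y)) \<in> vspace R" "(\<lambda>y. v (x, y)) \<in> vspace R" using uv that(1) by (simp_all add: mem)
        have e: "(\<lambda>y. u (x \<otimes> h, y)) = act R (inv h) (\<lambda>y. u (x, y))" "(\<lambda>y. v (x \<otimes> h, y)) = act R (inv h) (\<lambda>y. v (x, y))"
          using uv that by (simp_all only: mem)
        show ?thesis unfolding pl lin_on_add[OF R3[OF H.m_inv_closed[OF that(2)]] m] e ..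
      qed
      moreover have "(\<lambda>y. (u + v) (x, y)) \<in> vspace R" if "x \<in> carrier G" for x
        unfolding pl using uv that by (intro cfun.subspace_add[OF V]) (simp_all add: mem)
      moreover have "(u + v) (x, y) = 0" if "x \<notin> carrier G" for x y using uv that by (simp add: mem)
      ultimately show ?thesis unfolding mem by blast
    qed
    show "cscale k v \<in> vspace ?I" if v: "v \<in> vspace ?I" for k v
    proof -
      have "(\<lambda>y. cscale k v (x \<otimes> h, y)) = act R (inv h) (\<lambda>y. cscale k v (x, y))" if "x \<in> carrier G" "h \<in> H" for x h
      proof -
        have m: "(\<lambda>y. v (x, y)) \<in> vspace R" using v that(1) by (simp add: mem)
        have e: "(\<lambda>y. v (x \<otimes> h, y)) = act R (inv h) (\<lambda>y. v (x, y))"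
          using v that by (simp only: mem)
        show ?thesis unfolding sc lin_on_scale[OF R3[OF H.m_inv_closed[OF that(2)]] m] e ..
      qed
      moreover have "(\<lambda>y. cscale k v (x, y)) \<in> vspace R" if "x \<in> carrier G" for x
        unfolding sc using v that by (intro cfun.subspace_scale[OF V]) (simp_all add: mem)
      moreover have "cscale k v (x, y) = 0" if "x \<notin> carrier G" for x y using v that by (simp add: mem)
      ultimately show ?thesis unfolding mem by blast
    qed
  qed
  \<comment> \<open>The function supported on the coset of \<open>c\<close> with value
    \<open>b p\<close> at \<open>c\<close> itself; equivariance dictates the other values on the
    coset.\<close>
  define e where "e = (\<lambda>(c, p) (x, y). if x \<in> carrier G \<and> inv c \<otimes> x \<in> H then act R (inv (inv c \<otimes> x)) (b p) y else 0)"
  have es: "(\<lambda>y. e (c, p) (x, y)) = (if x \<in> carrier G \<and> inv c \<otimes> x \<in> H then act R (inv (inv c \<otimes> x)) (b p) else 0)" for c p x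
    by (auto simp: e_def fun_eq_iff)
  have coset: "inv c \<otimes> (x \<otimes> h) \<in> H \<longleftrightarrow> inv c \<otimes> x \<in> H" if "c \<in> carrier G" "x \<in> carrier G" "h \<in> H" for c x h
  proof
    assume "inv c \<otimes> (x \<otimes> h) \<in> H"
    then have "inv c \<otimes> (x \<otimes> h) \<otimes> inv h \<in> H" by (rule H.m_closed[OF _ H.m_inv_closed[OF that(3)]])
    moreover have "inv c \<otimes> (x \<otimes> h) \<otimes> inv h = inv c \<otimes> x" using that HG by (simp add: m_assoc)
    ultimately show "inv c \<otimes> x \<in> H" by simp
  next
    assume "inv c \<otimes> x \<in> H"
    then have "inv c \<otimes> x \<otimes> h \<in> H" by (rule H.m_closed[OF _ that(3)])
    then show "inv c \<otimes> (x \<otimes> h) \<in> H" using that HG by (simp add: m_assoc)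
  qed
  have eI: "e (c, p) \<in> vspace ?I" if c: "c \<in> C" and p: "p \<in> P" for c p
    unfolding mem
  proof (intro conjI ballI allI impI)
    have cG: "c \<in> carrier G" using c C(1) by blast
    fix x assume x: "x \<in> carrier G"
    show "(\<lambda>y. e (c, p) (x, y)) \<in> vspace R"
      unfolding es using P'(3)[OF p] R4 cfun.subspace_0[OF V] by auto
    fix h assume h: "h \<in> H"
    show "(\<lambda>y. e (c, p) (x \<otimes> h, y)) = act R (inv h) (\<lambda>y. e (c, p) (x, y))"
    proof (cases "inv c \<otimes> x \<in> H")
      case True
      have "inv (inv c \<otimes> (x \<otimes> h)) = inv h \<otimes> inv (inv c \<otimes> x)"
        using cG x h HG by (simp add: inv_mult_group m_assoc)
      then show ?thesis
        unfolding es coset[OF cG x h] using True x h HG P'(3)[OF p] by (simp add: R6)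
    next
      case False
      then show ?thesis unfolding es coset[OF cG x h] using h act0 by simp
    qed
  next
    fix x y assume "x \<notin> carrier G"
    then show "e (c, p) (x, y) = 0" by (simp add: e_def)
  qed
  have CC: "coords (vspace ?I) (C \<times> P) e"
  proof (rule coordsI)
    show "finite (C \<times> P)" using finC P'(1) by simp
    show "e z \<in> vspace ?I" if "z \<in> C \<times> P" for z using eI that by (cases z) blast
    show "e z w = (if z = w then 1 else 0)" if z: "z \<in> C \<times> P" and w: "w \<in> C \<times> P" for z w
    proof -
      obtain c p d q where zw: "z = (c, p)" "w = (d, q)" "c \<in> C" "p \<in> P" "d \<in> C" "q \<in> P" using z w by auto
      have cd: "c \<in> carrier G" "d \<in> carrier G" using zw C(1) by auto
      show ?thesis
      proof (cases "c = d")
        case True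
        then show ?thesis using zw cd P'(4) R5[OF P'(3)] by (simp add: e_def)
      next
        case False
        then show ?thesis using zw cd C(3)[of c d] by (auto simp: e_def)
      qed
    qed
    fix f and z :: "'g \<times> 'x" assume f: "f \<in> vspace ?I"
    obtain x y where z: "z = (x, y)" by (cases z)
    show "f z = (\<Sum>w\<in>C \<times> P. f w * e w z)"
    proof (cases "x \<in> carrier G")
      case False
      have "f w * e w z = 0" for w using False by (cases w) (simp add: e_def z)
      then have "(\<Sum>w\<in>C \<times> P. f w * e w z) = 0" by (intro sum.neutral ballI)
      moreover have "f z = 0" using False f unfolding mem z by blast
      ultimately show ?thesis by (simp only:)
    next
      case x: True
      obtain c where c: "c \<in> C" "inv c \<otimes> x \<in> H" using C(2)[OF x] by blast
      have cG: "c \<in> carrier G" using c C(1) by blast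
      have uniq: "d = c" if d: "d \<in> C" "inv d \<otimes> x \<in> H" for d
      proof -
        have dG: "d \<in> carrier G" using d C(1) by blast
        have "(inv d \<otimes> x) \<otimes> inv (inv c \<otimes> x) \<in> H" by (rule H.m_closed[OF d(2) H.m_inv_closed[OF c(2)]])
        moreover have "(inv d \<otimes> x) \<otimes> inv (inv c \<otimes> x) = inv d \<otimes> c"
          using dG cG x by (simp add: inv_mult_group m_assoc[symmetric]) (simp add: m_assoc)
        ultimately show ?thesis using C(3) d(1) c(1) by simp
      qed
      let ?h = "inv c \<otimes> x"
      have xc: "c \<otimes> ?h = x" using cG x by (simp add: m_assoc[symmetric])
      have m: "(\<lambda>y. f (c, y)) \<in> vspace R" using f cG by (simp add: mem)
      have "(\<lambda>y. f (c \<otimes> ?h, y)) = act R (inv ?h) (\<lambda>y. f (c, y))"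
        using f cG c(2) unfolding mem by blast
      then have "f (x, y) = act R (inv ?h) (\<lambda>y. f (c, y)) y" unfolding xc by (rule fun_cong)
      also have "\<dots> = (\<Sum>p\<in>P. f (c, p) * act R (inv ?h) (b p) y)"
        by (rule coords_lin[OF P R3[OF H.m_inv_closed[OF c(2)]] m])
      also have "\<dots> = (\<Sum>d\<in>C. if d = c then \<Sum>p\<in>P. f (c, p) * act R (inv ?h) (b p) y else 0)"
        using finC c(1) by simp
      also have "\<dots> = (\<Sum>d\<in>C. \<Sum>p\<in>P. f (d, p) * e (d, p) z)"
      proof (rule sum.cong[OF refl])
        fix d assume d: "d \<in> C"
        show "(if d = c then \<Sum>p\<in>P. f (c, p) * act R (inv ?h) (b p) y else 0) = (\<Sum>p\<in>P. f (d, p) * e (d, p) z)"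
        proof (cases "d = c")
          case True
          then show ?thesis using x c(2) by (simp add: e_def z)
        next
          case False
          then have "inv d \<otimes> x \<notin> H" using uniq[OF d] by blast
          then show ?thesis using False by (simp add: e_def z)
        qed
      qed
      also have "\<dots> = (\<Sum>w\<in>C \<times> P. f w * e w z)" by (simp add: sum.cartesian_product case_prod_unfold)
      finally show ?thesis unfolding z .
    qed
  qed (rule sub)
  show rep: "representation G ?I"
  proof (rule repI)
    show "fdim (vspace ?I)" by (rule coords_fdim[OF CC])
    fix g assume g: "g \<in> carrier G"
    show "lin_on (vspace ?I) (act ?I g)" by (auto simp: lin_on_def fun_eq_iff ac)
    fix v assume v: "v \<in> vspace ?I"
    have "(\<lambda>y. act ?I g v (x, y)) = (\<lambda>y. v (inv g \<otimes> x, y))" if "x \<in> carrier G" for x using that by (simp add: ac)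
    then show "act ?I g v \<in> vspace ?I" using v g HG by (simp add: mem ac m_assoc[symmetric])
    fix h assume h: "h \<in> carrier G"
    show "act ?I (g \<otimes> h) v = act ?I g (act ?I h v)"
    proof
      fix z show "act ?I (g \<otimes> h) v z = act ?I g (act ?I h v) z"
        using g h by (cases z) (simp add: ac inv_mult_group m_assoc)
    qed
  next
    fix v assume v: "v \<in> vspace ?I"
    show "act ?I \<one> v = v"
    proof
      fix z show "act ?I \<one> v z = v z" using v by (cases z) (simp add: ac mem)
    qed
  qed
  assume g: "g \<in> carrier G"
  have "character ?I g = (\<Sum>z\<in>C \<times> P. act ?I g (e z) z)" by (rule character_coords[OF rep CC g])
  also have "\<dots> = (\<Sum>c\<in>C. \<Sum>p\<in>P. act ?I g (e (c, p)) (c, p))" by (simp add: sum.cartesian_product case_prod_unfold)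
  also have "\<dots> = (\<Sum>c\<in>C. if inv c \<otimes> g \<otimes> c \<in> H then character R (inv c \<otimes> g \<otimes> c) else 0)"
  proof (intro sum.cong refl)
    fix c assume "c \<in> C"
    then have c: "c \<in> carrier G" using C(1) by blast
    have i: "inv (inv c \<otimes> (inv g \<otimes> c)) = inv c \<otimes> g \<otimes> c" using c g by (simp add: inv_mult_group m_assoc)
    have k: "inv c \<otimes> (inv g \<otimes> c) = inv (inv c \<otimes> g \<otimes> c)" using c g by (simp add: inv_mult_group m_assoc)
    \<comment> \<open>Evaluating the translate at \<open>c\<close> asks whether
      \<open>inv g \<otimes> c\<close> lies in the coset of \<open>c\<close>. Closure of
      \<open>H\<close> under inverses turns this into the usual condition on the conjugate of
      \<open>g\<close>.\<close>
    have iff: "inv c \<otimes> (inv g \<otimes> c) \<in> H \<longleftrightarrow> inv c \<otimes> g \<otimes> c \<in> H"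
    proof
      assume "inv c \<otimes> (inv g \<otimes> c) \<in> H"
      from H.m_inv_closed[OF this] show "inv c \<otimes> g \<otimes> c \<in> H" unfolding i .
    next
      assume "inv c \<otimes> g \<otimes> c \<in> H"
      from H.m_inv_closed[OF this] show "inv c \<otimes> (inv g \<otimes> c) \<in> H" unfolding k .
    qed
    have "act ?I g (e (c, p)) (c, p) = (if inv c \<otimes> g \<otimes> c \<in> H then act R (inv c \<otimes> g \<otimes> c) (b p) p else 0)" for p
      using c g by (simp add: ac e_def iff i)
    then show "(\<Sum>p\<in>P. act ?I g (e (c, p)) (c, p)) = (if inv c \<otimes> g \<otimes> c \<in> H then character R (inv c \<otimes> g \<otimes> c) else 0)"
      using character_coords[OF R P, of "inv c \<otimes> g \<otimes> c"] by simp
  qed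
  finally show "character ?I g = (\<Sum>c\<in>C. if inv c \<otimes> g \<otimes> c \<in> H then character R (inv c \<otimes> g \<otimes> c) else 0)" .
qed

section \<open>Wreath products and colourings\<close>

lemma wreath_sym_carrier:
  "(f, p) \<in> carrier (wreath_sym F n) \<longleftrightarrow> f \<in> {1..n} \<rightarrow>\<^sub>E carrier F \<and> p permutes {1..n}"
  by (simp add: wreath_sym_def wreath_def sym_group_carrier)

lemma wreath_sym_one: "\<one>\<^bsub>wreath_sym F n\<^esub> = (\<lambda>x\<in>{1..n}. \<one>\<^bsub>F\<^esub>, id)"
  by (simp add: wreath_sym_def wreath_def sym_group_one)

lemma wreath_sym_mult:
  assumes "p permutes {1..n}"
  shows "(f, p) \<otimes>\<^bsub>wreath_sym F n\<^esub> (f', p') = (\<lambda>x\<in>{1..n}. f x \<otimes>\<^bsub>F\<^esub> f' (Hilbert_Choice.inv p x), p \<circ> p')"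
  using assms by (simp add: wreath_sym_def wreath_def sym_group_mult sym_group_carrier)

lemma permutes_inv_mem: "p permutes X \<Longrightarrow> x \<in> X \<Longrightarrow> Hilbert_Choice.inv p x \<in> X"
  by (simp add: permutes_in_image[OF permutes_inv])

lemma permutes_mem: "p permutes X \<Longrightarrow> x \<in> X \<Longrightarrow> p x \<in> X"
  by (simp add: permutes_in_image)

lemma restrict_PiE_memI: "(\<And>x. x \<in> X \<Longrightarrow> f x \<in> Y x) \<Longrightarrow> (\<lambda>x\<in>X. f x) \<in> (\<Pi>\<^sub>E x\<in>X. Y x)"
  by auto

lemma wreath_sym_group:
  assumes F: "group F"
  shows "group (wreath_sym F n)"
proof (rule groupI)
  interpret F: group F by (rule F)
  let ?G = "wreath_sym F n" and ?X = "{1..n}"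
  show "\<one>\<^bsub>?G\<^esub> \<in> carrier ?G" by (simp add: wreath_sym_one wreath_sym_carrier permutes_id)
  fix x assume x: "x \<in> carrier ?G"
  obtain f p where fp: "x = (f, p)" by (cases x)
  have f: "f \<in> ?X \<rightarrow>\<^sub>E carrier F" and p: "p permutes ?X" using x by (simp_all only: fp wreath_sym_carrier)
  have fx: "f i \<in> carrier F" if "i \<in> ?X" for i using f that by (rule PiE_mem)
  note pi = permutes_inv_mem[OF p]
  show "\<one>\<^bsub>?G\<^esub> \<otimes>\<^bsub>?G\<^esub> x = x"
  proof -
    have "(\<lambda>i\<in>?X. (\<lambda>i\<in>?X. \<one>\<^bsub>F\<^esub>) i \<otimes>\<^bsub>F\<^esub> f (Hilbert_Choice.inv id i)) = f"
      by (rule PiE_ext[OF restrict_PiE_memI f]) (simp_all add: fx del: atLeastAtMost_iff)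
    then show ?thesis unfolding fp wreath_sym_one wreath_sym_mult[OF permutes_id] by simp
  qed
  show "\<exists>y\<in>carrier ?G. y \<otimes>\<^bsub>?G\<^esub> x = \<one>\<^bsub>?G\<^esub>"
  \<comment> \<open>The base part of the inverse is read at \<open>p i\<close>, because multiplying
    by \<open>inv p\<close> in front shifts \<open>f\<close> by the inverse of \<open>inv p\<close>,
    that is by \<open>p\<close>.\<close>
  proof (rule bexI[of _ "(\<lambda>i\<in>?X. inv\<^bsub>F\<^esub> (f (p i)), Hilbert_Choice.inv p)"])
    have fpx: "f (p i) \<in> carrier F" if "i \<in> ?X" for i using fx[OF permutes_mem[OF p that]] .
    show "(\<lambda>i\<in>?X. inv\<^bsub>F\<^esub> (f (p i)), Hilbert_Choice.inv p) \<in> carrier ?G"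
      unfolding wreath_sym_carrier using fpx permutes_inv[OF p] by (intro conjI restrict_PiE_memI) simp_all
    have "(\<lambda>i\<in>?X. (\<lambda>i\<in>?X. inv\<^bsub>F\<^esub> (f (p i))) i \<otimes>\<^bsub>F\<^esub> f (Hilbert_Choice.inv (Hilbert_Choice.inv p) i)) = (\<lambda>i\<in>?X. \<one>\<^bsub>F\<^esub>)"
      by (rule restrict_ext) (simp add: fpx permutes_inv_inv[OF p] del: atLeastAtMost_iff)
    then show "(\<lambda>i\<in>?X. inv\<^bsub>F\<^esub> (f (p i)), Hilbert_Choice.inv p) \<otimes>\<^bsub>?G\<^esub> x = \<one>\<^bsub>?G\<^esub>"
      unfolding fp wreath_sym_mult[OF permutes_inv[OF p]] wreath_sym_one permutes_inv_o[OF p] by simp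
  qed
  fix y assume y: "y \<in> carrier ?G"
  obtain f' p' where fp': "y = (f', p')" by (cases y)
  have f': "f' \<in> ?X \<rightarrow>\<^sub>E carrier F" and p': "p' permutes ?X" using y by (simp_all only: fp' wreath_sym_carrier)
  have fx': "f' i \<in> carrier F" if "i \<in> ?X" for i using f' that by (rule PiE_mem)
  show "x \<otimes>\<^bsub>?G\<^esub> y \<in> carrier ?G"
    unfolding fp fp' wreath_sym_mult[OF p] wreath_sym_carrier
    using fx fx' pi permutes_compose[OF p' p] by (intro conjI restrict_PiE_memI) auto
  fix z assume z: "z \<in> carrier ?G"
  obtain f'' p'' where fp'': "z = (f'', p'')" by (cases z)
  have f'': "f'' \<in> ?X \<rightarrow>\<^sub>E carrier F" using z by (simp_all only: fp'' wreath_sym_carrier)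
  have fx'': "f'' i \<in> carrier F" if "i \<in> ?X" for i using f'' that by (rule PiE_mem)
  have "(\<lambda>i\<in>?X. (\<lambda>i\<in>?X. f i \<otimes>\<^bsub>F\<^esub> f' (Hilbert_Choice.inv p i)) i \<otimes>\<^bsub>F\<^esub> f'' (Hilbert_Choice.inv (p \<circ> p') i)) =
     (\<lambda>i\<in>?X. f i \<otimes>\<^bsub>F\<^esub> (\<lambda>i\<in>?X. f' i \<otimes>\<^bsub>F\<^esub> f'' (Hilbert_Choice.inv p' i)) (Hilbert_Choice.inv p i))"
  proof (rule restrict_ext)
    fix i assume i: "i \<in> ?X"
    have "Hilbert_Choice.inv (p \<circ> p') i = Hilbert_Choice.inv p' (Hilbert_Choice.inv p i)"
      using o_inv_distrib[OF permutes_bij[OF p] permutes_bij[OF p']] by simp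
    then show "(\<lambda>i\<in>?X. f i \<otimes>\<^bsub>F\<^esub> f' (Hilbert_Choice.inv p i)) i \<otimes>\<^bsub>F\<^esub> f'' (Hilbert_Choice.inv (p \<circ> p') i) =
      f i \<otimes>\<^bsub>F\<^esub> (\<lambda>i\<in>?X. f' i \<otimes>\<^bsub>F\<^esub> f'' (Hilbert_Choice.inv p' i)) (Hilbert_Choice.inv p i)"
      using i pi[OF i] fx[OF i] fx'[OF pi[OF i]] fx''[OF permutes_inv_mem[OF p' pi[OF i]]]
      by (simp add: F.m_assoc del: atLeastAtMost_iff)
  qed
  then show "x \<otimes>\<^bsub>?G\<^esub> y \<otimes>\<^bsub>?G\<^esub> z = x \<otimes>\<^bsub>?G\<^esub> (y \<otimes>\<^bsub>?G\<^esub> z)"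
    unfolding fp fp' fp'' wreath_sym_mult[OF p] wreath_sym_mult[OF p'] wreath_sym_mult[OF permutes_compose[OF p' p]]
    by (simp add: comp_assoc)
qed

lemma wreath_sym_fin_group:
  assumes F: "group F" "finite (carrier F)"
  shows "fin_group (wreath_sym F n)"
proof (intro fin_group.intro wreath_sym_group F fin_group_axioms.intro)
  have "finite (({1..n} \<rightarrow>\<^sub>E carrier F) \<times> {p. p permutes {1..n}})"
    using F(2) by (intro finite_cartesian_product finite_PiE finite_permutations) auto
  moreover have "carrier (wreath_sym F n) = ({1..n} \<rightarrow>\<^sub>E carrier F) \<times> {p. p permutes {1..n}}"
    using wreath_sym_carrier[of _ _ F n] by auto
  ultimately show "finite (carrier (wreath_sym F n))" by (simp only:)
qed

text \<open>The coset representatives have trivial base part, so conjugation by them merely permutes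
  the values of \<open>f\<close>.\<close>

lemma wreath_sym_conj:
  assumes F: "group F" and f: "f \<in> {1..n} \<rightarrow>\<^sub>E carrier F" and p: "p permutes {1..n}" and s: "s permutes {1..n}"
  defines "G \<equiv> wreath_sym F n" and "c \<equiv> (\<lambda>x\<in>{1..n}. \<one>\<^bsub>F\<^esub>, s)"
  shows "c \<in> carrier G" "inv\<^bsub>G\<^esub> c \<otimes>\<^bsub>G\<^esub> (f, p) = (\<lambda>x\<in>{1..n}. f (s x), Hilbert_Choice.inv s \<circ> p)"
    "inv\<^bsub>G\<^esub> c \<otimes>\<^bsub>G\<^esub> (f, p) \<otimes>\<^bsub>G\<^esub> c = (\<lambda>x\<in>{1..n}. f (s x), Hilbert_Choice.inv s \<circ> p \<circ> s)"
proof -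
  interpret F: group F by (rule F)
  interpret G: group G unfolding G_def by (rule wreath_sym_group[OF F])
  let ?X = "{1..n}"
  show c: "c \<in> carrier G" unfolding c_def G_def wreath_sym_carrier using s by auto
  let ?d = "(\<lambda>x\<in>?X. \<one>\<^bsub>F\<^esub>, Hilbert_Choice.inv s)"
  note sinv = permutes_inv[OF s]
  have d: "?d \<in> carrier G" unfolding G_def wreath_sym_carrier using sinv by auto
  have "(\<lambda>x\<in>?X. (\<lambda>x\<in>?X. \<one>\<^bsub>F\<^esub>) x \<otimes>\<^bsub>F\<^esub> (\<lambda>x\<in>?X. \<one>\<^bsub>F\<^esub>) (Hilbert_Choice.inv (Hilbert_Choice.inv s) x)) = (\<lambda>x\<in>?X. \<one>\<^bsub>F\<^esub>)"
    using permutes_mem[OF s] by (intro restrict_ext) (simp add: permutes_inv_inv[OF s] del: atLeastAtMost_iff)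
  then have "?d \<otimes>\<^bsub>G\<^esub> c = \<one>\<^bsub>G\<^esub>"
    unfolding c_def G_def wreath_sym_mult[OF sinv] wreath_sym_one permutes_inv_o[OF s] by simp
  then have i: "inv\<^bsub>G\<^esub> c = ?d" by (rule G.inv_equality[OF _ c d])
  have fx: "f x \<in> carrier F" if "x \<in> ?X" for x using f that by (rule PiE_mem)
  have "(\<lambda>x\<in>?X. (\<lambda>x\<in>?X. \<one>\<^bsub>F\<^esub>) x \<otimes>\<^bsub>F\<^esub> f (Hilbert_Choice.inv (Hilbert_Choice.inv s) x)) = (\<lambda>x\<in>?X. f (s x))"
    using fx[OF permutes_mem[OF s]] by (intro restrict_ext) (simp add: permutes_inv_inv[OF s] del: atLeastAtMost_iff)
  then show m: "inv\<^bsub>G\<^esub> c \<otimes>\<^bsub>G\<^esub> (f, p) = (\<lambda>x\<in>?X. f (s x), Hilbert_Choice.inv s \<circ> p)"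
    unfolding i unfolding G_def wreath_sym_mult[OF sinv] by (simp only:)
  have ip: "Hilbert_Choice.inv s \<circ> p permutes ?X" by (rule permutes_compose[OF p sinv])
  have "(\<lambda>x\<in>?X. (\<lambda>x\<in>?X. f (s x)) x \<otimes>\<^bsub>F\<^esub> (\<lambda>x\<in>?X. \<one>\<^bsub>F\<^esub>) (Hilbert_Choice.inv (Hilbert_Choice.inv s \<circ> p) x)) = (\<lambda>x\<in>?X. f (s x))"
    using fx[OF permutes_mem[OF s]] permutes_inv_mem[OF ip] by (intro restrict_ext) (simp del: atLeastAtMost_iff)
  then show "inv\<^bsub>G\<^esub> c \<otimes>\<^bsub>G\<^esub> (f, p) \<otimes>\<^bsub>G\<^esub> c = (\<lambda>x\<in>?X. f (s x), Hilbert_Choice.inv s \<circ> p \<circ> s)"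
    unfolding m unfolding c_def G_def wreath_sym_mult[OF ip] by (simp only:)
qed

subsection \<open>Blocks\<close>

lemma offset_Suc: "i < length ns \<Longrightarrow> offset ns (Suc i) = offset ns i + ns ! i"
  by (simp add: offset_def take_Suc_conv_app_nth)

lemma offset_mono: "i \<le> j \<Longrightarrow> offset ns i \<le> offset ns j"
proof (induction rule: dec_induct)
  case (step m)
  then show ?case
    by (cases "m < length ns") (simp add: offset_Suc, simp add: offset_def)
qed simp

lemma block_subset: "i < length ns \<Longrightarrow> block ns i \<subseteq> {1..sum_list ns}"
proof -
  assume i: "i < length ns"
  have "offset ns i + ns ! i \<le> offset ns (length ns)"
    using offset_mono[of "Suc i" "length ns" ns] i by (simp add: offset_Suc)
  then show ?thesis by (auto simp: block_def offset_def)
qed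

lemma block_disjoint:
  assumes "i < length ns" "j < length ns" "x \<in> block ns i" "x \<in> block ns j"
  shows "i = j"
proof -
  have False if "i < j" "i < length ns" "x \<in> block ns i" "x \<in> block ns j" for i j
    using offset_mono[of "Suc i" j ns] that by (auto simp: block_def offset_Suc)
  then show ?thesis using assms by (metis linorder_neqE_nat)
qed

lemma block_cover:
  assumes "x \<in> {1..sum_list ns}"
  shows "\<exists>i<length ns. x \<in> block ns i"
proof -
  have "1 \<le> x \<Longrightarrow> x \<le> offset ns m \<Longrightarrow> m \<le> length ns \<Longrightarrow> \<exists>i<m. x \<in> block ns i" for m
  proof (induction m)
    case (Suc m)
    show ?case
    proof (cases "x \<le> offset ns m")
      case True
      then show ?thesis using Suc by (meson Suc_leD less_SucI)
    next
      case False
      then have "x \<in> block ns m" using Suc.prems by (auto simp: block_def offset_Suc)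
      then show ?thesis by blast
    qed
  qed (simp add: offset_def)
  from this[of "length ns"] show ?thesis using assms by (simp add: offset_def)
qed

lemma block_index:
  shows "i < length ns \<Longrightarrow> x \<in> block ns i \<Longrightarrow> block_index ns x = i"
    and "x \<in> {1..sum_list ns} \<Longrightarrow> block_index ns x < length ns"
    and "x \<in> {1..sum_list ns} \<Longrightarrow> x \<in> block ns (block_index ns x)"
proof -
  show 1: "block_index ns x = i" if "i < length ns" "x \<in> block ns i" for i
    unfolding block_index_def using that block_disjoint by (intro the_equality) blast+
  assume "x \<in> {1..sum_list ns}"
  then obtain i where "i < length ns" "x \<in> block ns i" using block_cover by blast
  then show "block_index ns x < length ns" "x \<in> block ns (block_index ns x)" using 1 by simp_all
qed

lemma block_eq: "i < length ns \<Longrightarrow> block ns i = {x \<in> {1..sum_list ns}. block_index ns x = i}"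
  using block_index block_subset[of i ns] by blast

text \<open>Preserving the block of each point maps every block into itself, and onto itself by
  finiteness.\<close>

lemma young_iff:
  "p \<in> young ns \<longleftrightarrow> p permutes {1..sum_list ns} \<and> (\<forall>x\<in>{1..sum_list ns}. block_index ns (p x) = block_index ns x)"
proof
  assume "p \<in> young ns"
  then have p: "p permutes {1..sum_list ns}" "\<And>i. i < length ns \<Longrightarrow> p ` block ns i = block ns i"
    by (auto simp: young_def)
  have "block_index ns (p x) = block_index ns x" if x: "x \<in> {1..sum_list ns}" for x
  proof (rule block_index(1))
    show l: "block_index ns x < length ns" by (rule block_index(2)[OF x])
    show "p x \<in> block ns (block_index ns x)" using p(2)[OF l] block_index(3)[OF x] by blast
  qed
  then show "p permutes {1..sum_list ns} \<and> (\<forall>x\<in>{1..sum_list ns}. block_index ns (p x) = block_index ns x)"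
    using p(1) by blast
next
  assume r: "p permutes {1..sum_list ns} \<and> (\<forall>x\<in>{1..sum_list ns}. block_index ns (p x) = block_index ns x)"
  have "p ` block ns i = block ns i" if i: "i < length ns" for i
  proof (rule endo_inj_surj)
    show "finite (block ns i)" by (simp add: block_def)
    show "p ` block ns i \<subseteq> block ns i"
    proof
      fix y assume "y \<in> p ` block ns i"
      then obtain x where x: "x \<in> block ns i" "y = p x" by blast
      then have xX: "x \<in> {1..sum_list ns}" using block_subset[OF i] by blast
      have "y \<in> {1..sum_list ns}" unfolding x(2) by (rule permutes_mem[OF conjunct1[OF r] xX])
      moreover have "block_index ns y = i" using r xX x block_index(1)[OF i] by simp
      ultimately show "y \<in> block ns i" unfolding block_eq[OF i] by blast
    qed
    show "inj_on p (block ns i)" using r permutes_inj_on by blast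
  qed
  then show "p \<in> young ns" using r by (simp add: young_def)
qed

lemma young_subgroup: "subgroup (young ns) (sym_group (sum_list ns))"
proof (rule subgroup.intro)
  let ?X = "{1..sum_list ns}"
  show "young ns \<subseteq> carrier (sym_group (sum_list ns))" by (auto simp: young_def sym_group_carrier)
  show "\<one>\<^bsub>sym_group (sum_list ns)\<^esub> \<in> young ns" by (simp add: sym_group_one young_iff permutes_id)
  show "p \<otimes>\<^bsub>sym_group (sum_list ns)\<^esub> q \<in> young ns" if "p \<in> young ns" "q \<in> young ns" for p q
    using that permutes_mem[of q ?X] permutes_compose[of q ?X p] unfolding young_iff sym_group_mult by simp
  fix p assume p: "p \<in> young ns"
  then have pp: "p permutes ?X" by (simp add: young_iff)
  have "block_index ns (Hilbert_Choice.inv p x) = block_index ns x" if x: "x \<in> ?X" for x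
  proof -
    have "block_index ns (p (Hilbert_Choice.inv p x)) = block_index ns (Hilbert_Choice.inv p x)"
      using p permutes_inv_mem[OF pp x] by (simp add: young_iff)
    then show ?thesis by (simp add: permutes_inverses[OF pp])
  qed
  then show "inv\<^bsub>sym_group (sum_list ns)\<^esub> p \<in> young ns"
    using pp permutes_inv[OF pp] by (simp add: sym_group_carrier young_iff)
qed

lemma wreath_sub_subgroup:
  assumes F: "group F" and H: "subgroup H (sym_group n)"
  shows "subgroup (wreath_sub F n H) (wreath_sym F n)"
proof -
  interpret F: group F by (rule F)
  interpret H: subgroup H "sym_group n" by (rule H)
  interpret G: group "wreath_sym F n" by (rule wreath_sym_group[OF F])
  let ?X = "{1..n}"
  have Hp: "p permutes ?X" if "p \<in> H" for p using H.subset that by (auto simp: sym_group_carrier)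
  have mem: "(f, p) \<in> wreath_sub F n H \<longleftrightarrow> f \<in> ?X \<rightarrow>\<^sub>E carrier F \<and> p \<in> H" for f p by (simp add: wreath_sub_def)
  have sub: "wreath_sub F n H \<subseteq> carrier (wreath_sym F n)" using Hp by (auto simp: mem wreath_sym_carrier)
  show ?thesis
  proof (rule subgroup.intro[OF sub])
    fix x y assume xy: "x \<in> wreath_sub F n H" "y \<in> wreath_sub F n H"
    have m: "x \<otimes>\<^bsub>wreath_sym F n\<^esub> y \<in> carrier (wreath_sym F n)" using xy sub by blast
    obtain f p g q where e: "x = (f, p)" "y = (g, q)" by (cases x, cases y)
    have pq: "p \<in> H" "q \<in> H" using xy by (simp_all only: e mem)
    then have "p \<circ> q \<in> H" using H.m_closed[of p q] by (simp add: sym_group_mult)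
    then show "x \<otimes>\<^bsub>wreath_sym F n\<^esub> y \<in> wreath_sub F n H"
      using m unfolding e wreath_sym_mult[OF Hp[OF pq(1)]] mem wreath_sym_carrier by blast
  next
    have "id \<in> H" using H.one_closed by (simp add: sym_group_one)
    then show "\<one>\<^bsub>wreath_sym F n\<^esub> \<in> wreath_sub F n H" unfolding wreath_sym_one mem by auto
  next
    fix x assume x: "x \<in> wreath_sub F n H"
    obtain f p where e: "x = (f, p)" by (cases x)
    have p: "p \<in> H" using x by (simp only: e mem)
    have xG: "x \<in> carrier (wreath_sym F n)" using x sub by blast
    \<comment> \<open>The inverse lies in the big group anyway; only its permutation part must be
      identified as \<open>inv p\<close>.\<close>
    obtain g q where i: "inv\<^bsub>wreath_sym F n\<^esub> x = (g, q)" by (cases "inv\<^bsub>wreath_sym F n\<^esub> x")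
    have iG: "(g, q) \<in> carrier (wreath_sym F n)" using G.inv_closed[OF xG] unfolding i .
    have "(f, p) \<otimes>\<^bsub>wreath_sym F n\<^esub> (g, q) = \<one>\<^bsub>wreath_sym F n\<^esub>" using G.r_inv[OF xG] unfolding i unfolding e .
    then have "p \<circ> q = id" unfolding wreath_sym_mult[OF Hp[OF p]] wreath_sym_one by simp
    then have "Hilbert_Choice.inv p \<circ> (p \<circ> q) = Hilbert_Choice.inv p" by simp
    then have "q = Hilbert_Choice.inv p" by (simp add: comp_assoc[symmetric] permutes_inv_o[OF Hp[OF p]])
    moreover have "Hilbert_Choice.inv p \<in> H" using H.m_inv_closed[OF p] Hp[OF p] by (simp add: sym_group_carrier)
    ultimately show "inv\<^bsub>wreath_sym F n\<^esub> x \<in> wreath_sub F n H"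
      using iG unfolding i mem wreath_sym_carrier by blast
  qed
qed

subsection \<open>Colourings as cosets of Young subgroups\<close>

text \<open>Over the full interval, \<open>c\<close> encodes the left coset of the permutations that
  carry block \<open>i\<close> onto colour class \<open>i\<close>. The set \<open>X\<close> is
  arbitrary because colour classes will themselves be coloured.\<close>

definition colourings :: "nat set \<Rightarrow> nat list \<Rightarrow> (nat \<Rightarrow> nat) set" where
  "colourings X ns = {c \<in> X \<rightarrow>\<^sub>E {..<length ns}. \<forall>i<length ns. card {x \<in> X. c x = i} = ns ! i}"

text \<open>Over the full interval these are the cosets fixed by left multiplication with
  \<open>p\<close>.\<close>

definition inv_colourings :: "nat set \<Rightarrow> nat list \<Rightarrow> (nat \<Rightarrow> nat) \<Rightarrow> (nat \<Rightarrow> nat) set" where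
  "inv_colourings X ns p = {c \<in> colourings X ns. \<forall>x\<in>X. c (p x) = c x}"

lemma finite_colourings: "finite X \<Longrightarrow> finite (colourings X ns)"
  unfolding colourings_def by (rule finite_subset[OF _ finite_PiE[of X "\<lambda>_. {..<length ns}"]]) auto

lemma finite_inv_colourings: "finite X \<Longrightarrow> finite (inv_colourings X ns p)"
  unfolding inv_colourings_def using finite_colourings by (rule finite_subset[rotated]) auto

text \<open>A representative of the coset encoded by \<open>c\<close>; it puts block
  \<open>i\<close> in place of colour class \<open>i\<close>.\<close>

definition colouring_perm :: "nat list \<Rightarrow> (nat \<Rightarrow> nat) \<Rightarrow> nat \<Rightarrow> nat" where
  "colouring_perm ns c = (SOME s. s permutes {1..sum_list ns} \<and> (\<forall>x\<in>{1..sum_list ns}. c (s x) = block_index ns x))"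

lemma colouring_perm:
  assumes c: "c \<in> colourings {1..sum_list ns} ns"
  shows "colouring_perm ns c permutes {1..sum_list ns}"
    "x \<in> {1..sum_list ns} \<Longrightarrow> c (colouring_perm ns c x) = block_index ns x"
proof -
  let ?X = "{1..sum_list ns}"
  have c': "c \<in> ?X \<rightarrow>\<^sub>E {..<length ns}" "\<And>i. i < length ns \<Longrightarrow> card {x \<in> ?X. c x = i} = ns ! i"
    using c by (auto simp: colourings_def)
  have cc: "card {x \<in> ?X. block_index ns x = i} = card {x \<in> ?X. c x = i}" for i
  proof (cases "i < length ns")
    case True
    show ?thesis unfolding block_eq[OF True, symmetric] c'(2)[OF True] by (simp add: block_def)
  next
    case False
    then have "{x \<in> ?X. block_index ns x = i} = {}" using block_index(2) by blast
    moreover have "{x \<in> ?X. c x = i} = {}" using PiE_mem[OF c'(1)] False by blast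
    ultimately show ?thesis by (simp only:)
  qed
  have "\<exists>h. bij_betw h ?X ?X \<and> (\<forall>x\<in>?X. c (h x) = block_index ns x)"
    by (rule bij_betw_of_fibre_cards[OF finite_atLeastAtMost finite_atLeastAtMost cc]) blast
  then obtain h where h: "bij_betw h ?X ?X" "\<And>x. x \<in> ?X \<Longrightarrow> c (h x) = block_index ns x" by blast
  define s where "s = (\<lambda>x. if x \<in> ?X then h x else x)"
  have "bij_betw s ?X ?X" using h(1) by (rule bij_betw_cong[THEN iffD1, rotated]) (simp add: s_def)
  then have "s permutes ?X" by (rule bij_imp_permutes) (unfold s_def, rule if_not_P)
  moreover have "\<forall>x\<in>?X. c (s x) = block_index ns x" using h(2) by (simp add: s_def)
  ultimately have "\<exists>s. s permutes ?X \<and> (\<forall>x\<in>?X. c (s x) = block_index ns x)" by blast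
  from someI_ex[OF this, folded colouring_perm_def]
  show "colouring_perm ns c permutes ?X" "x \<in> ?X \<Longrightarrow> c (colouring_perm ns c x) = block_index ns x" by blast+
qed

text \<open>Membership of \<open>p\<close> in the coset encoded by \<open>c\<close>, tested
  pointwise. That the representatives form a transversal, and which cosets are fixed, are both read
  off this criterion.\<close>

lemma colouring_perm_young:
  assumes c: "c \<in> colourings {1..sum_list ns} ns" and p: "p permutes {1..sum_list ns}"
  shows "Hilbert_Choice.inv (colouring_perm ns c) \<circ> p \<in> young ns \<longleftrightarrow>
    (\<forall>x\<in>{1..sum_list ns}. c (p x) = block_index ns x)"
proof -
  let ?X = "{1..sum_list ns}" and ?s = "colouring_perm ns c"
  note s = colouring_perm[OF c]
  have "block_index ns (Hilbert_Choice.inv ?s (p x)) = c (p x)" if x: "x \<in> ?X" for x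
    using s(2)[OF permutes_inv_mem[OF s(1) permutes_mem[OF p x]]] by (simp add: permutes_inverses[OF s(1)])
  moreover have "Hilbert_Choice.inv ?s \<circ> p permutes ?X" by (rule permutes_compose[OF p permutes_inv[OF s(1)]])
  ultimately show ?thesis unfolding young_iff by simp
qed

lemma colouring_transversal:
  assumes p: "p permutes {1..sum_list ns}"
  shows "\<exists>c\<in>colourings {1..sum_list ns} ns. Hilbert_Choice.inv (colouring_perm ns c) \<circ> p \<in> young ns"
proof -
  let ?X = "{1..sum_list ns}"
  \<comment> \<open>The colouring encoding the coset of \<open>p\<close>: the pattern of blocks
    carried along by \<open>p\<close>.\<close>
  define c where "c = (\<lambda>x\<in>?X. block_index ns (Hilbert_Choice.inv p x))"
  have "card {x \<in> ?X. c x = i} = ns ! i" if i: "i < length ns" for i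
  proof -
    have "{x \<in> ?X. c x = i} = p ` block ns i"
    proof (intro equalityI subsetI)
      fix x assume "x \<in> {x \<in> ?X. c x = i}"
      then have x: "x \<in> ?X" "c x = i" by blast+
      then have xi: "block_index ns (Hilbert_Choice.inv p x) = i" by (simp add: c_def del: atLeastAtMost_iff)
      have "Hilbert_Choice.inv p x \<in> block ns i" unfolding block_eq[OF i] using permutes_inv_mem[OF p x(1)] xi by blast
      then show "x \<in> p ` block ns i" using permutes_inverses(1)[OF p] by (metis image_eqI)
    next
      fix y assume "y \<in> p ` block ns i"
      then obtain x where x: "x \<in> ?X" "block_index ns x = i" "y = p x" unfolding block_eq[OF i] by blast
      then show "y \<in> {x \<in> ?X. c x = i}"
        using permutes_mem[OF p x(1)] by (simp add: c_def permutes_inverses[OF p] del: atLeastAtMost_iff)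
    qed
    moreover have "card (p ` block ns i) = card (block ns i)" by (rule card_image[OF permutes_inj_on[OF p]])
    ultimately show ?thesis by (simp add: block_def)
  qed
  moreover have "c \<in> ?X \<rightarrow>\<^sub>E {..<length ns}"
    unfolding c_def using block_index(2)[OF permutes_inv_mem[OF p]] by (intro restrict_PiE_memI) simp
  ultimately have c: "c \<in> colourings ?X ns" unfolding colourings_def by blast
  have "c (p x) = block_index ns x" if x: "x \<in> ?X" for x
    using permutes_mem[OF p x] by (simp add: c_def permutes_inverses[OF p] del: atLeastAtMost_iff)
  then show ?thesis using c colouring_perm_young[OF c p] by blast
qed

lemma colouring_transversal_unique:
  assumes c: "c \<in> colourings {1..sum_list ns} ns" and d: "d \<in> colourings {1..sum_list ns} ns"
    and y: "Hilbert_Choice.inv (colouring_perm ns c) \<circ> colouring_perm ns d \<in> young ns"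
  shows "c = d"
proof -
  let ?X = "{1..sum_list ns}"
  note s = colouring_perm[OF d]
  have cd: "c \<in> ?X \<rightarrow>\<^sub>E {..<length ns}" "d \<in> ?X \<rightarrow>\<^sub>E {..<length ns}" using c d by (auto simp: colourings_def)
  have "c x = d x" if x: "x \<in> ?X" for x
  proof -
    let ?y = "Hilbert_Choice.inv (colouring_perm ns d) x"
    have "?y \<in> ?X" by (rule permutes_inv_mem[OF s(1) x])
    then have "c (colouring_perm ns d ?y) = d (colouring_perm ns d ?y)"
      using y s(2) unfolding colouring_perm_young[OF c s(1)] by simp
    then show ?thesis by (simp add: permutes_inverses[OF s(1)])
  qed
  then show ?thesis by (rule PiE_ext[OF cd])
qed

lemma colouring_perm_conj_young:
  assumes c: "c \<in> colourings {1..sum_list ns} ns" and p: "p permutes {1..sum_list ns}"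
  defines "s \<equiv> colouring_perm ns c"
  shows "Hilbert_Choice.inv s \<circ> p \<circ> s \<in> young ns \<longleftrightarrow> c \<in> inv_colourings {1..sum_list ns} ns p"
proof -
  let ?X = "{1..sum_list ns}"
  note s = colouring_perm[OF c, folded s_def]
  have "Hilbert_Choice.inv s \<circ> p \<circ> s \<in> young ns \<longleftrightarrow> (\<forall>x\<in>?X. c (p (s x)) = block_index ns x)"
    using colouring_perm_young[OF c permutes_compose[OF s(1) p]] by (simp add: s_def comp_assoc)
  also have "\<dots> \<longleftrightarrow> (\<forall>x\<in>?X. c (p (s x)) = c (s x))" using s(2) by simp
  also have "\<dots> \<longleftrightarrow> (\<forall>x\<in>s ` ?X. c (p x) = c x)" by blast
  also have "s ` ?X = ?X" by (rule permutes_image[OF s(1)])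
  finally show ?thesis using c unfolding inv_colourings_def by blast
qed

lemma sum_colourings_if:
  assumes "\<And>c. c \<in> colourings X ns \<Longrightarrow> Q c \<longleftrightarrow> c \<in> inv_colourings X ns p" "finite X"
  shows "(\<Sum>c\<in>colourings X ns. if Q c then g c else 0) = (\<Sum>c\<in>inv_colourings X ns p. g c :: complex)"
proof -
  have "{c \<in> colourings X ns. Q c} = inv_colourings X ns p" using assms(1) by (auto simp: inv_colourings_def)
  then show ?thesis using finite_colourings[OF assms(2)] by (simp add: sum.inter_filter[symmetric])
qed

text \<open>The formula of \<open>induced\<close> for the transversal indexed by colourings; the
  terms that survive are those of the invariant colourings.\<close>

lemma ind_sym:
  assumes R: "representation ((sym_group (sum_list ns))\<lparr>carrier := young ns\<rparr>) R"
  defines "G \<equiv> sym_group (sum_list ns)"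
  shows "representation G (Ind G (young ns) R)"
    "p permutes {1..sum_list ns} \<Longrightarrow> character (Ind G (young ns) R) p =
       (\<Sum>c\<in>inv_colourings {1..sum_list ns} ns p. character R (Hilbert_Choice.inv (colouring_perm ns c) \<circ> p \<circ> colouring_perm ns c))"
proof -
  let ?X = "{1..sum_list ns}"
  let ?C = "colouring_perm ns ` colourings ?X ns"
  have s: "colouring_perm ns c permutes ?X" if "c \<in> colourings ?X ns" for c by (rule colouring_perm(1)[OF that])
  have i: "inv\<^bsub>G\<^esub> colouring_perm ns c = Hilbert_Choice.inv (colouring_perm ns c)" if "c \<in> colourings ?X ns" for c
    unfolding G_def using s[OF that] by (simp add: sym_group_carrier)
  have CG: "?C \<subseteq> carrier G" using s by (auto simp: G_def sym_group_carrier)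
  have C2: "\<exists>c\<in>?C. inv\<^bsub>G\<^esub> c \<otimes>\<^bsub>G\<^esub> x \<in> young ns" if "x \<in> carrier G" for x
    using colouring_transversal[of x ns] that i by (auto simp: G_def sym_group_carrier sym_group_mult)
  have C3: "c = d" if cd: "c \<in> ?C" "d \<in> ?C" "inv\<^bsub>G\<^esub> c \<otimes>\<^bsub>G\<^esub> d \<in> young ns" for c d
  proof -
    obtain c' d' where e: "c' \<in> colourings ?X ns" "d' \<in> colourings ?X ns" "c = colouring_perm ns c'" "d = colouring_perm ns d'"
      using cd(1,2) by blast
    have "Hilbert_Choice.inv (colouring_perm ns c') \<circ> colouring_perm ns d' \<in> young ns"
      using cd(3) i[OF e(1)] unfolding e(3,4) by (simp add: G_def sym_group_mult)
    then show ?thesis using colouring_transversal_unique[OF e(1,2)] e(3,4) by simp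
  qed
  note ind = induced[OF fin_group_sym_group[of "sum_list ns", folded G_def] young_subgroup[of ns, folded G_def] R[folded G_def] CG]
  show "representation G (Ind G (young ns) R)" by (rule ind(1)[OF C2 C3])
  assume p: "p permutes ?X"
  have inj: "inj_on (colouring_perm ns) (colourings ?X ns)"
  proof (rule inj_onI)
    fix c d assume cd: "c \<in> colourings ?X ns" "d \<in> colourings ?X ns" "colouring_perm ns c = colouring_perm ns d"
    have "Hilbert_Choice.inv (colouring_perm ns c) \<circ> colouring_perm ns d = id"
      unfolding cd(3) by (rule permutes_inv_o(2)[OF s[OF cd(2)]])
    then show "c = d"
      using colouring_transversal_unique[OF cd(1,2)] by (simp add: young_iff permutes_id)
  qed
  have "character (Ind G (young ns) R) p = (\<Sum>c\<in>colourings ?X ns.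
      if Hilbert_Choice.inv (colouring_perm ns c) \<circ> p \<circ> colouring_perm ns c \<in> young ns
      then character R (Hilbert_Choice.inv (colouring_perm ns c) \<circ> p \<circ> colouring_perm ns c) else 0)"
  proof -
    have pG: "p \<in> carrier G" using p by (simp add: G_def sym_group_carrier)
    have "character (Ind G (young ns) R) p = (\<Sum>c\<in>?C.
        if inv\<^bsub>G\<^esub> c \<otimes>\<^bsub>G\<^esub> p \<otimes>\<^bsub>G\<^esub> c \<in> young ns then character R (inv\<^bsub>G\<^esub> c \<otimes>\<^bsub>G\<^esub> p \<otimes>\<^bsub>G\<^esub> c) else 0)"
      by (rule ind(2)[OF C2 C3 pG])
    also have "\<dots> = (\<Sum>c\<in>colourings ?X ns.
        if Hilbert_Choice.inv (colouring_perm ns c) \<circ> p \<circ> colouring_perm ns c \<in> young ns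
        then character R (Hilbert_Choice.inv (colouring_perm ns c) \<circ> p \<circ> colouring_perm ns c) else 0)"
      unfolding sum.reindex[OF inj] comp_def[of _ "colouring_perm ns"]
    proof (rule sum.cong[OF refl])
      fix c assume c: "c \<in> colourings ?X ns"
      have t: "inv\<^bsub>G\<^esub> colouring_perm ns c \<otimes>\<^bsub>G\<^esub> p \<otimes>\<^bsub>G\<^esub> colouring_perm ns c =
          Hilbert_Choice.inv (colouring_perm ns c) \<circ> p \<circ> colouring_perm ns c"
        unfolding i[OF c] by (simp add: G_def sym_group_mult)
      show "(if inv\<^bsub>G\<^esub> colouring_perm ns c \<otimes>\<^bsub>G\<^esub> p \<otimes>\<^bsub>G\<^esub> colouring_perm ns c \<in> young ns
          then character R (inv\<^bsub>G\<^esub> colouring_perm ns c \<otimes>\<^bsub>G\<^esub> p \<otimes>\<^bsub>G\<^esub> colouring_perm ns c) else 0) =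
        (if Hilbert_Choice.inv (colouring_perm ns c) \<circ> p \<circ> colouring_perm ns c \<in> young ns
          then character R (Hilbert_Choice.inv (colouring_perm ns c) \<circ> p \<circ> colouring_perm ns c) else 0)"
        unfolding t ..
    qed
    finally show ?thesis .
  qed
  also have "\<dots> = (\<Sum>c\<in>inv_colourings ?X ns p. character R (Hilbert_Choice.inv (colouring_perm ns c) \<circ> p \<circ> colouring_perm ns c))"
    by (rule sum_colourings_if) (simp_all add: colouring_perm_conj_young[OF _ p])
  finally show "character (Ind G (young ns) R) p =
       (\<Sum>c\<in>inv_colourings ?X ns p. character R (Hilbert_Choice.inv (colouring_perm ns c) \<circ> p \<circ> colouring_perm ns c))" .
qed

lemma ind_wreath:
  fixes F :: "('f, 'm) monoid_scheme" and ns :: "nat list"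
  assumes F: "group F" "finite (carrier F)"
  defines "G \<equiv> wreath_sym F (sum_list ns)" and "H \<equiv> wreath_sub F (sum_list ns) (young ns)"
  assumes R: "representation (G\<lparr>carrier := H\<rparr>) R"
  shows "representation G (Ind G H R)"
    "(f, p) \<in> carrier G \<Longrightarrow> character (Ind G H R) (f, p) =
       (\<Sum>c\<in>inv_colourings {1..sum_list ns} ns p. character R (\<lambda>x\<in>{1..sum_list ns}. f (colouring_perm ns c x),
          Hilbert_Choice.inv (colouring_perm ns c) \<circ> p \<circ> colouring_perm ns c))"
proof -
  let ?n = "sum_list ns"
  let ?X = "{1..?n}"
  \<comment> \<open>Representatives of the cosets in the wreath product may be taken with trivial
    base part, since the subgroup contains the whole base group.\<close>
  define e where "e = (\<lambda>c. (\<lambda>x\<in>?X. \<one>\<^bsub>F\<^esub>, colouring_perm ns c))"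
  let ?C = "e ` colourings ?X ns"
  have s: "colouring_perm ns c permutes ?X" if "c \<in> colourings ?X ns" for c by (rule colouring_perm(1)[OF that])
  have memG: "(f, p) \<in> carrier G \<longleftrightarrow> f \<in> ?X \<rightarrow>\<^sub>E carrier F \<and> p permutes ?X" for f p
    unfolding G_def by (rule wreath_sym_carrier)
  have memH: "(f, p) \<in> H \<longleftrightarrow> f \<in> ?X \<rightarrow>\<^sub>E carrier F \<and> p \<in> young ns" for f p by (simp add: H_def wreath_sub_def)
  note conj = wreath_sym_conj[OF F(1), of _ ?n, folded G_def]
  have CG: "?C \<subseteq> carrier G"
  proof
    fix z assume "z \<in> ?C"
    then obtain c where c: "c \<in> colourings ?X ns" "z = e c" by blast
    have one: "(\<lambda>x\<in>?X. \<one>\<^bsub>F\<^esub>) \<in> ?X \<rightarrow>\<^sub>E carrier F"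
      using group.is_monoid[OF F(1)] by (auto simp: monoid.one_closed)
    show "z \<in> carrier G" unfolding c(2) e_def by (rule conj(1)[OF one permutes_id s[OF c(1)]])
  qed
  have inH: "inv\<^bsub>G\<^esub> (e c) \<otimes>\<^bsub>G\<^esub> (f, p) \<in> H \<longleftrightarrow> Hilbert_Choice.inv (colouring_perm ns c) \<circ> p \<in> young ns"
    if c: "c \<in> colourings ?X ns" and fp: "(f, p) \<in> carrier G" for c f p
  proof -
    have f: "f \<in> ?X \<rightarrow>\<^sub>E carrier F" and p: "p permutes ?X" using fp by (simp_all add: memG)
    have "(\<lambda>x\<in>?X. f (colouring_perm ns c x)) \<in> ?X \<rightarrow>\<^sub>E carrier F"
      by (rule restrict_PiE_memI) (rule PiE_mem[OF f permutes_mem[OF s[OF c]]])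
    then show ?thesis unfolding e_def conj(2)[OF f p s[OF c]] memH by blast
  qed
  have C2: "\<exists>c\<in>?C. inv\<^bsub>G\<^esub> c \<otimes>\<^bsub>G\<^esub> x \<in> H" if x: "x \<in> carrier G" for x
  proof -
    obtain f p where fp: "x = (f, p)" by (cases x)
    have "p permutes ?X" using x by (simp add: fp memG)
    then obtain c where c: "c \<in> colourings ?X ns" "Hilbert_Choice.inv (colouring_perm ns c) \<circ> p \<in> young ns"
      using colouring_transversal by blast
    then have "inv\<^bsub>G\<^esub> (e c) \<otimes>\<^bsub>G\<^esub> x \<in> H" using inH[OF c(1)] x unfolding fp by blast
    then show ?thesis using c(1) by blast
  qed
  have C3': "c = d"
    if cd: "c \<in> colourings ?X ns" "d \<in> colourings ?X ns" "inv\<^bsub>G\<^esub> (e c) \<otimes>\<^bsub>G\<^esub> e d \<in> H" for c d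
  proof -
    have "e d \<in> carrier G" using CG cd(2) by blast
    then have "Hilbert_Choice.inv (colouring_perm ns c) \<circ> colouring_perm ns d \<in> young ns"
      using inH[OF cd(1)] cd(3) unfolding e_def by blast
    then show ?thesis using colouring_transversal_unique[OF cd(1,2)] by blast
  qed
  have C3: "c = d" if cd: "c \<in> ?C" "d \<in> ?C" "inv\<^bsub>G\<^esub> c \<otimes>\<^bsub>G\<^esub> d \<in> H" for c d
    using cd C3' by blast
  have Hs: "subgroup H G" unfolding G_def H_def by (rule wreath_sub_subgroup[OF F(1) young_subgroup])
  have Gf: "fin_group G" unfolding G_def by (rule wreath_sym_fin_group[OF F])
  note ind = induced[OF Gf Hs R CG]
  show "representation G (Ind G H R)" by (rule ind(1)[OF C2 C3])
  assume fp: "(f, p) \<in> carrier G"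
  then have f: "f \<in> ?X \<rightarrow>\<^sub>E carrier F" and p: "p permutes ?X" by (simp_all add: memG)
  have inj: "inj_on e (colourings ?X ns)"
  proof (rule inj_onI)
    fix c d assume cd: "c \<in> colourings ?X ns" "d \<in> colourings ?X ns" "e c = e d"
    then have "colouring_perm ns c = colouring_perm ns d" by (simp add: e_def)
    then have "Hilbert_Choice.inv (colouring_perm ns c) \<circ> colouring_perm ns d = id"
      using permutes_inv_o(2)[OF s[OF cd(2)]] by simp
    then show "c = d"
      using colouring_transversal_unique[OF cd(1,2)] by (simp add: young_iff permutes_id)
  qed
  have ind2: "character (Ind G H R) (f, p) = (\<Sum>c\<in>?C.
      if inv\<^bsub>G\<^esub> c \<otimes>\<^bsub>G\<^esub> (f, p) \<otimes>\<^bsub>G\<^esub> c \<in> H then character R (inv\<^bsub>G\<^esub> c \<otimes>\<^bsub>G\<^esub> (f, p) \<otimes>\<^bsub>G\<^esub> c) else 0)"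
    by (rule ind(2)[OF C2 C3 fp])
  let ?t = "\<lambda>c. (\<lambda>x\<in>?X. f (colouring_perm ns c x), Hilbert_Choice.inv (colouring_perm ns c) \<circ> p \<circ> colouring_perm ns c)"
  have "character (Ind G H R) (f, p) = (\<Sum>c\<in>colourings ?X ns.
      if Hilbert_Choice.inv (colouring_perm ns c) \<circ> p \<circ> colouring_perm ns c \<in> young ns then character R (?t c) else 0)"
    unfolding ind2 sum.reindex[OF inj] comp_def[of _ e]
  proof (rule sum.cong[OF refl])
    fix c assume c: "c \<in> colourings ?X ns"
    have m: "(\<lambda>x\<in>?X. f (colouring_perm ns c x)) \<in> ?X \<rightarrow>\<^sub>E carrier F"
      by (rule restrict_PiE_memI) (rule PiE_mem[OF f permutes_mem[OF s[OF c]]])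
    have t: "inv\<^bsub>G\<^esub> e c \<otimes>\<^bsub>G\<^esub> (f, p) \<otimes>\<^bsub>G\<^esub> e c = ?t c" unfolding e_def by (rule conj(3)[OF f p s[OF c]])
    show "(if inv\<^bsub>G\<^esub> e c \<otimes>\<^bsub>G\<^esub> (f, p) \<otimes>\<^bsub>G\<^esub> e c \<in> H then character R (inv\<^bsub>G\<^esub> e c \<otimes>\<^bsub>G\<^esub> (f, p) \<otimes>\<^bsub>G\<^esub> e c) else 0) =
      (if Hilbert_Choice.inv (colouring_perm ns c) \<circ> p \<circ> colouring_perm ns c \<in> young ns then character R (?t c) else 0)"
      unfolding t memH using m by simp
  qed
  also have "\<dots> = (\<Sum>c\<in>inv_colourings ?X ns p. character R (?t c))"
    by (rule sum_colourings_if) (simp_all add: colouring_perm_conj_young[OF _ p])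
  finally show "character (Ind G H R) (f, p) = (\<Sum>c\<in>inv_colourings ?X ns p. character R (?t c))" .
qed

section \<open>Characters of Specht modules and tensor powers on arbitrary finite sets\<close>

text \<open>The restriction of \<open>p\<close> to \<open>A\<close>, conjugated to
  \<open>{1..a}\<close> along \<open>\<tau>\<close> and extended by the identity so that it is a
  permutation of \<open>{1..a}\<close>.\<close>

definition transport_perm :: "(nat \<Rightarrow> nat) \<Rightarrow> nat \<Rightarrow> (nat \<Rightarrow> nat) \<Rightarrow> nat \<Rightarrow> nat" where
  "transport_perm \<tau> a p = (\<lambda>x. if x \<in> {1..a} then inv_into {1..a} \<tau> (p (\<tau> x)) else x)"

lemma bij_betw_mem: "bij_betw f A B \<Longrightarrow> x \<in> A \<Longrightarrow> f x \<in> B"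
  by (auto simp: bij_betw_def)

lemma transport_perm:
  assumes \<tau>: "bij_betw \<tau> {1..a} A" and p: "bij_betw p A A"
  shows "transport_perm \<tau> a p permutes {1..a}"
    "x \<in> {1..a} \<Longrightarrow> \<tau> (transport_perm \<tau> a p x) = p (\<tau> x)"
proof -
  have "bij_betw (inv_into {1..a} \<tau> \<circ> (p \<circ> \<tau>)) {1..a} {1..a}"
    by (rule bij_betw_trans[OF bij_betw_trans[OF \<tau> p] bij_betw_inv_into[OF \<tau>]])
  then have "bij_betw (transport_perm \<tau> a p) {1..a} {1..a}"
    by (rule bij_betw_cong[THEN iffD1, rotated]) (simp add: transport_perm_def)
  then show "transport_perm \<tau> a p permutes {1..a}"
    by (rule bij_imp_permutes) (unfold transport_perm_def, rule if_not_P)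
  assume x: "x \<in> {1..a}"
  have "p (\<tau> x) \<in> A" by (rule bij_betw_mem[OF p bij_betw_mem[OF \<tau> x]])
  then show "\<tau> (transport_perm \<tau> a p x) = p (\<tau> x)"
    unfolding transport_perm_def if_P[OF x] by (rule bij_betw_inv_into_right[OF \<tau>])
qed

lemma transport_perm_eqI:
  assumes \<tau>: "bij_betw \<tau> {1..a} A"
    and q: "\<And>x. x \<in> {1..a} \<Longrightarrow> q x \<in> {1..a}" "\<And>x. x \<in> {1..a} \<Longrightarrow> \<tau> (q x) = p (\<tau> x)"
      "\<And>x. x \<notin> {1..a} \<Longrightarrow> q x = x"
  shows "q = transport_perm \<tau> a p"
proof
  fix x
  show "q x = transport_perm \<tau> a p x"
  proof (cases "x \<in> {1..a}")
    case True
    show ?thesis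
      unfolding transport_perm_def if_P[OF True] q(2)[OF True, symmetric]
      by (rule bij_betw_inv_into_left[OF \<tau> q(1)[OF True], symmetric])
  next
    case False
    show ?thesis unfolding transport_perm_def if_not_P[OF False] by (rule q(3)[OF False])
  qed
qed

text \<open>The Specht character at a permutation of an arbitrary finite set, as needed on colour
  classes. The enumeration is a choice without effect, by \<open>specht_char_eq\<close>.\<close>

definition specht_char :: "nat list \<Rightarrow> nat set \<Rightarrow> (nat \<Rightarrow> nat) \<Rightarrow> complex" where
  "specht_char \<mu> A p = character (specht \<mu>) (transport_perm (SOME \<tau>. bij_betw \<tau> {1..card A} A) (card A) p)"

lemma enumeration_exists:
  assumes "finite A"
  shows "bij_betw (SOME \<tau>. bij_betw \<tau> {1..card A} A) {1..card A} (A :: nat set)"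
proof -
  have "\<exists>\<tau>. bij_betw \<tau> {1..card A} A" using assms by (intro finite_same_card_bij) auto
  then show ?thesis by (rule someI_ex)
qed

text \<open>Two enumerations of \<open>A\<close> differ by a permutation \<open>s\<close> of
  \<open>{1..a}\<close>, which conjugates one transported permutation into the other; characters do
  not see this.\<close>

lemma specht_char_eq:
  assumes \<tau>: "bij_betw \<tau> {1..a} A" and a: "sum_list \<mu> = a" and p: "bij_betw p A A"
  shows "character (specht \<mu>) (transport_perm \<tau> a p) = specht_char \<mu> A p"
proof -
  have fA: "finite A" using \<tau> by (metis bij_betw_finite finite_atLeastAtMost)
  have cA: "card A = a" using bij_betw_same_card[OF \<tau>] by simp
  define e where "e = (SOME \<tau>. bij_betw \<tau> {1..card A} A)"
  have e: "bij_betw e {1..a} A" using enumeration_exists[OF fA] unfolding e_def cA .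
  interpret S: fin_group "sym_group a" by (rule fin_group_sym_group)
  define s where "s = (\<lambda>x. if x \<in> {1..a} then inv_into {1..a} e (\<tau> x) else x)"
  have "bij_betw (inv_into {1..a} e \<circ> \<tau>) {1..a} {1..a}"
    by (rule bij_betw_trans[OF \<tau> bij_betw_inv_into[OF e]])
  then have "bij_betw s {1..a} {1..a}" by (rule bij_betw_cong[THEN iffD1, rotated]) (simp add: s_def)
  then have s: "s permutes {1..a}" by (rule bij_imp_permutes) (unfold s_def, rule if_not_P)
  have es: "e (s x) = \<tau> x" if x: "x \<in> {1..a}" for x
    unfolding s_def if_P[OF x] by (rule bij_betw_inv_into_right[OF e bij_betw_mem[OF \<tau> x]])
  note t = transport_perm[OF \<tau> p] and t' = transport_perm[OF e p]
  have "s \<circ> transport_perm \<tau> a p = transport_perm e a p \<circ> s"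
  proof
    fix x
    show "(s \<circ> transport_perm \<tau> a p) x = (transport_perm e a p \<circ> s) x"
    proof (cases "x \<in> {1..a}")
      case x: True
      note m = permutes_mem[OF t(1) x] and sx = permutes_mem[OF s x]
      have "e (s (transport_perm \<tau> a p x)) = e (transport_perm e a p (s x))"
        unfolding es[OF m] t(2)[OF x] t'(2)[OF sx] es[OF x] ..
      then have "s (transport_perm \<tau> a p x) = transport_perm e a p (s x)"
        by (rule inj_onD[OF bij_betw_imp_inj_on[OF e] _ permutes_mem[OF s m] permutes_mem[OF t'(1) sx]])
      then show ?thesis by simp
    next
      case False
      show ?thesis
        unfolding comp_def permutes_not_in[OF t(1) False] permutes_not_in[OF s False] permutes_not_in[OF t'(1) False] ..
    qed
  qed
  then have "character (specht \<mu>) (transport_perm \<tau> a p) = character (specht \<mu>) (transport_perm e a p)"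
    using specht_rep[of \<mu>] t(1) t'(1) s
    by (intro S.character_conjugate[of _ _ _ s]) (simp_all add: sym_group_carrier sym_group_mult a)
  then show ?thesis unfolding specht_char_def e_def cA .
qed

lemma specht_char_transport:
  assumes \<tau>: "bij_betw \<tau> B A" and B: "finite B" "sum_list \<mu> = card B"
    and p: "bij_betw p A A" and p': "bij_betw p' B B" and eq: "\<And>y. y \<in> B \<Longrightarrow> \<tau> (p' y) = p (\<tau> y)"
  shows "specht_char \<mu> B p' = specht_char \<mu> A p"
proof -
  define e where "e = (SOME \<tau>. bij_betw \<tau> {1..card B} B)"
  have e: "bij_betw e {1..card B} B" using enumeration_exists[OF B(1)] unfolding e_def .
  note t = transport_perm[OF e p']
  have \<tau>e: "bij_betw (\<tau> \<circ> e) {1..card B} A" by (rule bij_betw_trans[OF e \<tau>])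
  have "transport_perm e (card B) p' = transport_perm (\<tau> \<circ> e) (card B) p"
  proof (rule transport_perm_eqI[OF \<tau>e])
    fix x assume x: "x \<in> {1..card B}"
    show "transport_perm e (card B) p' x \<in> {1..card B}" by (rule permutes_mem[OF t(1) x])
    show "(\<tau> \<circ> e) (transport_perm e (card B) p' x) = p ((\<tau> \<circ> e) x)"
      unfolding comp_def t(2)[OF x] by (rule eq[OF bij_betw_mem[OF e x]])
  qed (rule permutes_not_in[OF t(1)])
  then show ?thesis
    unfolding specht_char_eq[OF \<tau>e B(2) p, symmetric] specht_char_def[of \<mu> B p'] e_def[symmetric]
    by (simp only:)
qed

lemma colour_class_bij:
  assumes p: "bij_betw p X X" and X: "finite X" and c: "\<And>x. x \<in> X \<Longrightarrow> c (p x) = c x"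
  shows "bij_betw p {x \<in> X. c x = i} {x \<in> X. c x = i}"
proof -
  have inj: "inj_on p {x \<in> X. c x = i}" by (rule inj_on_subset[OF bij_betw_imp_inj_on[OF p]]) blast
  have "p ` {x \<in> X. c x = i} = {x \<in> X. c x = i}"
    by (rule endo_inj_surj[OF _ _ inj]) (use X c bij_betw_mem[OF p] in auto)
  then show ?thesis using inj by (simp add: bij_betw_def)
qed

lemma block_shift_bij: "bij_betw (\<lambda>x. offset ns i + x) {1..ns ! i} (block ns i)"
proof -
  have "(\<lambda>x. offset ns i + x) ` {1..ns ! i} = {offset ns i + 1..offset ns i + ns ! i}"
    using image_add_atLeastAtMost[of "offset ns i" 1 "ns ! i"] by simp
  also have "\<dots> = block ns i" by (auto simp: block_def)
  finally show ?thesis by (simp add: bij_betw_def)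
qed

lemma block_colour_bij:
  assumes c: "c \<in> colourings {1..sum_list ns} ns" and i: "i < length ns"
  shows "bij_betw (\<lambda>x. colouring_perm ns c (offset ns i + x)) {1..ns ! i} {x \<in> {1..sum_list ns}. c x = i}"
proof -
  let ?X = "{1..sum_list ns}" and ?s = "colouring_perm ns c"
  note s = colouring_perm[OF c]
  have "?s ` block ns i = {x \<in> ?X. c x = i}"
  proof (intro equalityI subsetI)
    fix y assume "y \<in> ?s ` block ns i"
    then obtain x where x: "x \<in> ?X" "block_index ns x = i" "y = ?s x" unfolding block_eq[OF i] by blast
    then show "y \<in> {x \<in> ?X. c x = i}" using permutes_mem[OF s(1) x(1)] s(2)[OF x(1)] by blast
  next
    fix y assume "y \<in> {x \<in> ?X. c x = i}"
    then have y: "y \<in> ?X" "c y = i" by blast+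
    let ?x = "Hilbert_Choice.inv ?s y"
    have x: "?x \<in> ?X" by (rule permutes_inv_mem[OF s(1) y(1)])
    have sx: "?s ?x = y" by (rule permutes_inverses(1)[OF s(1)])
    have "block_index ns ?x = i" using s(2)[OF x] y(2) unfolding sx by simp
    then have "?x \<in> block ns i" unfolding block_eq[OF i] using x by blast
    then show "y \<in> ?s ` block ns i" using sx by (metis image_eqI)
  qed
  then have "bij_betw ?s (block ns i) {x \<in> ?X. c x = i}"
    using permutes_inj_on[OF s(1)] by (simp add: bij_betw_def)
  from bij_betw_trans[OF block_shift_bij this] show ?thesis by (simp add: comp_def)
qed

text \<open>A point of block \<open>i\<close> stays in its block and hence above the offset, so the
  truncated subtraction in \<open>young_component\<close> is exact. The component is then the
  transport of \<open>p\<close> along the shift.\<close>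

lemma young_component:
  assumes p: "p \<in> young ns" and i: "i < length ns"
  shows "young_component ns i p permutes {1..ns ! i}"
    "x \<in> {1..ns ! i} \<Longrightarrow> offset ns i + young_component ns i p x = p (offset ns i + x)"
proof -
  have p': "p permutes {1..sum_list ns}" "p ` block ns i = block ns i" using p i by (auto simp: young_def)
  then have b: "bij_betw p (block ns i) (block ns i)" using permutes_inj_on by (auto simp: bij_betw_def)
  note t = transport_perm[OF block_shift_bij b]
  have "young_component ns i p = transport_perm (\<lambda>x. offset ns i + x) (ns ! i) p"
  proof
    fix x
    show "young_component ns i p x = transport_perm (\<lambda>x. offset ns i + x) (ns ! i) p x"
    proof (cases "x \<in> {1..ns ! i}")
      case True
      show ?thesis unfolding young_component_def if_P[OF True] t(2)[OF True, symmetric] by simp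
    next
      case False
      show ?thesis unfolding young_component_def transport_perm_def if_not_P[OF False] ..
    qed
  qed
  then show "young_component ns i p permutes {1..ns ! i}"
    "x \<in> {1..ns ! i} \<Longrightarrow> offset ns i + young_component ns i p x = p (offset ns i + x)" using t by simp_all
qed

lemma young_component_comp:
  assumes p: "p \<in> young ns" and q: "q \<in> young ns" and pq: "p \<circ> q \<in> young ns" and i: "i < length ns"
  shows "young_component ns i (p \<circ> q) = young_component ns i p \<circ> young_component ns i q"
proof
  fix x
  note cp = young_component[OF p i] and cq = young_component[OF q i] and cpq = young_component[OF pq i]
  show "young_component ns i (p \<circ> q) x = (young_component ns i p \<circ> young_component ns i q) x"
  proof (cases "x \<in> {1..ns ! i}")
    case x: True
    have "offset ns i + young_component ns i (p \<circ> q) x = offset ns i + young_component ns i p (young_component ns i q x)"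
      unfolding cpq(2)[OF x] cp(2)[OF permutes_mem[OF cq(1) x]] cq(2)[OF x] by simp
    then show ?thesis by simp
  next
    case False
    show ?thesis
      unfolding comp_def permutes_not_in[OF cq(1) False] permutes_not_in[OF cp(1) False]
      using permutes_not_in[OF cpq(1) False] by (simp add: comp_def)
  qed
qed

lemma young_component_id: "young_component ns i id = id"
  by (auto simp: young_component_def fun_eq_iff)

text \<open>The coset representative identifies block \<open>i\<close> with colour class
  \<open>i\<close>. Hence the component on the block is the restriction of \<open>p\<close> to the
  class, up to enumeration, which is what \<open>specht_char\<close> accepts.\<close>

lemma young_component_conj:
  assumes c: "c \<in> inv_colourings {1..sum_list ns} ns p" and p: "p permutes {1..sum_list ns}" and i: "i < length ns"
  defines "s \<equiv> colouring_perm ns c"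
  shows "young_component ns i (Hilbert_Choice.inv s \<circ> p \<circ> s) = transport_perm (\<lambda>x. s (offset ns i + x)) (ns ! i) p"
proof -
  have c': "c \<in> colourings {1..sum_list ns} ns" using c by (simp add: inv_colourings_def)
  have y: "Hilbert_Choice.inv s \<circ> p \<circ> s \<in> young ns"
    using c colouring_perm_conj_young[OF c' p] by (simp add: s_def)
  note s = colouring_perm[OF c', folded s_def]
  show ?thesis
  proof (rule transport_perm_eqI)
    show "bij_betw (\<lambda>x. s (offset ns i + x)) {1..ns ! i} {x \<in> {1..sum_list ns}. c x = i}"
      unfolding s_def by (rule block_colour_bij[OF c' i])
    fix x assume x: "x \<in> {1..ns ! i}"
    show "young_component ns i (Hilbert_Choice.inv s \<circ> p \<circ> s) x \<in> {1..ns ! i}"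
      by (rule permutes_mem[OF young_component(1)[OF y i] x])
    show "s (offset ns i + young_component ns i (Hilbert_Choice.inv s \<circ> p \<circ> s) x) = p (s (offset ns i + x))"
      unfolding young_component(2)[OF y i x] by (simp add: permutes_inverses[OF s(1)])
  qed (rule permutes_not_in[OF young_component(1)[OF y i]])
qed

lemma young_group: "group ((sym_group (sum_list ns))\<lparr>carrier := young ns\<rparr>)"
  by (rule group.subgroup_imp_group[OF sym_group_is_group young_subgroup])

lemma young_closed: "p \<in> young ns \<Longrightarrow> q \<in> young ns \<Longrightarrow> p \<circ> q \<in> young ns"
  using subgroup.m_closed[OF young_subgroup] by (simp add: sym_group_mult)

text \<open>An instance of the twisted tensor product in which no factors are permuted; the sum over
  choices of basis vectors then factorises into traces.\<close>

lemma specht_multi: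
  fixes \<Lambda> :: "nat list list"
  defines "ns \<equiv> map sum_list \<Lambda>"
  shows "representation ((sym_group (sum_list ns))\<lparr>carrier := young ns\<rparr>) (specht_multi \<Lambda>)"
    "p \<in> young ns \<Longrightarrow> character (specht_multi \<Lambda>) p = (\<Prod>i<length \<Lambda>. character (specht (\<Lambda> ! i)) (young_component ns i p))"
proof -
  let ?G = "(sym_group (sum_list ns))\<lparr>carrier := young ns\<rparr>" and ?S = "\<lambda>i. specht (\<Lambda> ! i)"
  have nsi: "i < length ns" "ns ! i = sum_list (\<Lambda> ! i)" if "i \<in> {..<length \<Lambda>}" for i using that by (simp_all add: ns_def)
  have "\<forall>i. \<exists>P b. coords (vspace (?S i)) P b" using fdim_coords repD(1)[OF specht_rep] by blast
  then obtain P b where c: "\<And>i. coords (vspace (?S i)) (P i) (b i)" by metis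
  have Sr: "representation (sym_group (ns ! i)) (?S i)" if "i \<in> {..<length \<Lambda>}" for i
    unfolding nsi(2)[OF that] by (rule specht_rep)
  have yc: "young_component ns i p \<in> carrier (sym_group (ns ! i))" if "p \<in> young ns" "i \<in> {..<length \<Lambda>}" for p i
    using young_component(1)[OF that(1) nsi(1)[OF that(2)]] by (simp only: sym_group_carrier)
  note tw = twisted_tensor_rep[where G = ?G and R = "specht_multi \<Lambda>" and I = "{..<length \<Lambda>}"
      and V = "\<lambda>i. vspace (?S i)" and P = P and b = b and \<sigma> = "\<lambda>_ i. i"
      and A = "\<lambda>p i. act (?S i) (young_component ns i p)", OF young_group finite_lessThan c]
  have 1: "vspace (specht_multi \<Lambda>) = tensor_space {..<length \<Lambda>} (\<lambda>i. vspace (?S i))"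
    by (simp add: specht_multi_def pullback_def outer_tensor_family_def)
  have 2: "act (specht_multi \<Lambda>) p = lin_ext (\<Pi>\<^sub>E i\<in>{..<length \<Lambda>}. vspace (?S i)) (pure_tensor {..<length \<Lambda>})
      (\<lambda>u. pure_tensor {..<length \<Lambda>} (\<lambda>i. act (?S i) (young_component ns i p) (u i)))" for p
    by (simp add: specht_multi_def pullback_def outer_tensor_family_def ns_def)
  have 3: "bij_betw (\<lambda>i. i) {..<length \<Lambda>} {..<length \<Lambda>}" by (simp add: bij_betw_def)
  have 4: "lin_on (vspace (?S i)) (act (?S i) (young_component ns i p))"
    if "p \<in> carrier ?G" "i \<in> {..<length \<Lambda>}" for p i
    using repD(3)[OF Sr[OF that(2)] yc] that by simp
  have 5: "act (?S i) (young_component ns i p) v \<in> vspace (?S i)"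
    if "p \<in> carrier ?G" "i \<in> {..<length \<Lambda>}" "v \<in> vspace (?S i)" for p i v
    using repD(4)[OF Sr[OF that(2)] yc] that by simp
  have 6: "i = i \<and> act (?S i) (young_component ns i \<one>\<^bsub>?G\<^esub>) v = v"
    if "i \<in> {..<length \<Lambda>}" "v \<in> vspace (?S i)" for i v
    using repD(5)[OF Sr[OF that(1)] that(2)] by (simp add: sym_group_one young_component_id)
  have 7: "act (?S i) (young_component ns i (p \<otimes>\<^bsub>?G\<^esub> q)) v = act (?S i) (young_component ns i p) (act (?S i) (young_component ns i q) v)"
    if "p \<in> carrier ?G" "q \<in> carrier ?G" "i \<in> {..<length \<Lambda>}" "v \<in> vspace (?S i)" for p q i v
  proof -
    have pq: "p \<in> young ns" "q \<in> young ns" using that by simp_all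
    have "young_component ns i (p \<otimes>\<^bsub>?G\<^esub> q) = young_component ns i p \<otimes>\<^bsub>sym_group (ns ! i)\<^esub> young_component ns i q"
      using young_component_comp[OF pq young_closed[OF pq] nsi(1)[OF that(3)]] by (simp add: sym_group_mult)
    then show ?thesis using repD(6)[OF Sr[OF that(3)] yc[OF pq(1) that(3)] yc[OF pq(2) that(3)] that(4)] by simp
  qed
  show "representation ?G (specht_multi \<Lambda>)"
    by (rule tw(1)[OF 1 2 3 4 5 6 refl 7])
  assume p: "p \<in> young ns"
  then have pG: "p \<in> carrier ?G" by simp
  have "character (specht_multi \<Lambda>) p = (\<Sum>\<phi>\<in>PiE {..<length \<Lambda>} P. \<Prod>i<length \<Lambda>. act (?S i) (young_component ns i p) (b i (\<phi> i)) (\<phi> i))"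
    by (rule tw(2)[OF 1 2 3 4 5 6 refl 7 pG])
  also have "\<dots> = (\<Prod>i<length \<Lambda>. \<Sum>q\<in>P i. act (?S i) (young_component ns i p) (b i q) q)"
    using coordsD(1)[OF c] by (intro prod_sum_PiE[symmetric]) auto
  also have "\<dots> = (\<Prod>i<length \<Lambda>. character (?S i) (young_component ns i p))"
    by (intro prod.cong refl) (rule character_coords[OF Sr c yc[OF p], symmetric])
  finally show "character (specht_multi \<Lambda>) p = (\<Prod>i<length \<Lambda>. character (?S i) (young_component ns i p))" .
qed

section \<open>Tensor powers and the characters of \<open>Phi\<close>, with fixed coordinates on
  each \<open>U ! i\<close>\<close>

locale wreath_reps =
  fixes F :: "('f, 'm) monoid_scheme" and U :: "('f, 'u) rep list"
    and P :: "nat \<Rightarrow> 'u set" and b :: "nat \<Rightarrow> 'u \<Rightarrow> 'u \<Rightarrow> complex"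
  assumes F: "group F" "finite (carrier F)"
    and U: "\<And>i. i < length U \<Longrightarrow> representation F (U ! i)"
    and Pb: "\<And>i. i < length U \<Longrightarrow> coords (vspace (U ! i)) (P i) (b i)"
begin

text \<open>A trace of the twisted tensor power: each assignment of basis indices to the points
  contributes the product of the matrix entries along the arrows from \<open>x\<close> to
  \<open>p x\<close>. In this form it splits over \<open>p\<close>-stable pieces and transports
  along bijections.\<close>

definition tensor_char :: "nat set \<Rightarrow> (nat \<Rightarrow> nat) \<Rightarrow> (nat \<Rightarrow> 'f) \<Rightarrow> (nat \<Rightarrow> nat) \<Rightarrow> complex" where
  "tensor_char X c f p = (\<Sum>\<phi>\<in>(\<Pi>\<^sub>E x\<in>X. P (c x)). \<Prod>x\<in>X. act (U ! c x) (f (p x)) (b (c x) (\<phi> x)) (\<phi> (p x)))"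

lemma tensor_char_transport:
  assumes \<tau>: "bij_betw \<tau> Y X"
    and p: "\<And>y. y \<in> Y \<Longrightarrow> p' y \<in> Y" "\<And>y. y \<in> Y \<Longrightarrow> \<tau> (p' y) = p (\<tau> y)"
    and cf: "\<And>y. y \<in> Y \<Longrightarrow> c' y = c (\<tau> y)" "\<And>y. y \<in> Y \<Longrightarrow> f' y = f (\<tau> y)"
  shows "tensor_char Y c' f' p' = tensor_char X c f p"
  unfolding tensor_char_def
proof (rule sum.reindex_bij_witness[where j = "\<lambda>\<psi>. \<lambda>x\<in>X. \<psi> (inv_into Y \<tau> x)" and i = "\<lambda>\<phi>. \<lambda>y\<in>Y. \<phi> (\<tau> y)"])
  have \<tau>Y: "\<tau> y \<in> X" if "y \<in> Y" for y by (rule bij_betw_mem[OF \<tau> that])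
  have iX: "inv_into Y \<tau> x \<in> Y" if "x \<in> X" for x by (rule bij_betw_mem[OF bij_betw_inv_into[OF \<tau>] that])
  have i\<tau>: "inv_into Y \<tau> (\<tau> y) = y" if "y \<in> Y" for y by (rule bij_betw_inv_into_left[OF \<tau> that])
  have \<tau>i: "\<tau> (inv_into Y \<tau> x) = x" if "x \<in> X" for x by (rule bij_betw_inv_into_right[OF \<tau> that])
  fix \<psi> assume \<psi>: "\<psi> \<in> (\<Pi>\<^sub>E y\<in>Y. P (c' y))"
  show m: "(\<lambda>x\<in>X. \<psi> (inv_into Y \<tau> x)) \<in> (\<Pi>\<^sub>E x\<in>X. P (c x))"
    using PiE_mem[OF \<psi> iX] cf(1)[OF iX] \<tau>i by (intro restrict_PiE_memI) simp
  show "(\<lambda>y\<in>Y. (\<lambda>x\<in>X. \<psi> (inv_into Y \<tau> x)) (\<tau> y)) = \<psi>"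
    by (rule PiE_ext[OF restrict_PiE_memI \<psi>]) (use PiE_mem[OF \<psi>] \<tau>Y i\<tau> in simp_all)
  have "(\<Prod>x\<in>X. act (U ! c x) (f (p x)) (b (c x) ((\<lambda>x\<in>X. \<psi> (inv_into Y \<tau> x)) x)) ((\<lambda>x\<in>X. \<psi> (inv_into Y \<tau> x)) (p x))) =
      (\<Prod>y\<in>Y. (\<lambda>x. act (U ! c x) (f (p x)) (b (c x) ((\<lambda>x\<in>X. \<psi> (inv_into Y \<tau> x)) x)) ((\<lambda>x\<in>X. \<psi> (inv_into Y \<tau> x)) (p x))) (\<tau> y))"
    by (rule prod.reindex_bij_betw[OF \<tau>, symmetric])
  also have "\<dots> = (\<Prod>y\<in>Y. act (U ! c' y) (f' (p' y)) (b (c' y) (\<psi> y)) (\<psi> (p' y)))"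
    using \<tau>Y p i\<tau> cf by (intro prod.cong refl) (simp add: p(2)[symmetric])
  finally show "(\<Prod>x\<in>X. act (U ! c x) (f (p x)) (b (c x) ((\<lambda>x\<in>X. \<psi> (inv_into Y \<tau> x)) x)) ((\<lambda>x\<in>X. \<psi> (inv_into Y \<tau> x)) (p x))) =
      (\<Prod>y\<in>Y. act (U ! c' y) (f' (p' y)) (b (c' y) (\<psi> y)) (\<psi> (p' y)))" .
next
  have \<tau>Y: "\<tau> y \<in> X" if "y \<in> Y" for y by (rule bij_betw_mem[OF \<tau> that])
  have iX: "inv_into Y \<tau> x \<in> Y" if "x \<in> X" for x by (rule bij_betw_mem[OF bij_betw_inv_into[OF \<tau>] that])
  have \<tau>i: "\<tau> (inv_into Y \<tau> x) = x" if "x \<in> X" for x by (rule bij_betw_inv_into_right[OF \<tau> that])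
  fix \<phi> assume \<phi>: "\<phi> \<in> (\<Pi>\<^sub>E x\<in>X. P (c x))"
  show "(\<lambda>y\<in>Y. \<phi> (\<tau> y)) \<in> (\<Pi>\<^sub>E y\<in>Y. P (c' y))"
    using PiE_mem[OF \<phi> \<tau>Y] cf(1) by (intro restrict_PiE_memI) simp
  show "(\<lambda>x\<in>X. (\<lambda>y\<in>Y. \<phi> (\<tau> y)) (inv_into Y \<tau> x)) = \<phi>"
    by (rule PiE_ext[OF restrict_PiE_memI \<phi>]) (use PiE_mem[OF \<phi>] iX \<tau>i in simp_all)
qed

lemma tensor_char_cong:
  assumes "\<And>x. x \<in> X \<Longrightarrow> c x = c' x"
  shows "tensor_char X c f p = tensor_char X c' f p"
proof -
  have "(\<Pi>\<^sub>E x\<in>X. P (c x)) = (\<Pi>\<^sub>E x\<in>X. P (c' x))" using assms by (intro PiE_cong) simp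
  then show ?thesis unfolding tensor_char_def using assms by (intro sum.cong prod.cong) simp_all
qed

text \<open>No arrow from \<open>x\<close> to \<open>p x\<close> leaves its piece, so an assignment
  on \<open>X\<close> is a pair of independent assignments on \<open>A\<close> and
  \<open>B\<close>.\<close>

lemma tensor_char_union:
  assumes X: "finite X" "X = A \<union> B" "A \<inter> B = {}" and p: "\<And>x. x \<in> A \<Longrightarrow> p x \<in> A" "\<And>x. x \<in> B \<Longrightarrow> p x \<in> B"
  shows "tensor_char X c f p = tensor_char A c f p * tensor_char B c f p"
proof -
  have fin: "finite A" "finite B" using X by auto
  let ?t = "\<lambda>\<phi> x. act (U ! c x) (f (p x)) (b (c x) (\<phi> x)) (\<phi> (p x))"
  have "tensor_char X c f p = (\<Sum>(\<phi>, \<psi>)\<in>(\<Pi>\<^sub>E x\<in>A. P (c x)) \<times> (\<Pi>\<^sub>E x\<in>B. P (c x)). (\<Prod>x\<in>A. ?t \<phi> x) * (\<Prod>x\<in>B. ?t \<psi> x))"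
    unfolding tensor_char_def
  proof (rule sum.reindex_bij_witness[where j = "\<lambda>\<phi>. (restrict \<phi> A, restrict \<phi> B)"
        and i = "\<lambda>(\<phi>, \<psi>). \<lambda>x\<in>X. if x \<in> A then \<phi> x else \<psi> x"])
    fix \<phi> assume \<phi>: "\<phi> \<in> (\<Pi>\<^sub>E x\<in>X. P (c x))"
    show "(case (restrict \<phi> A, restrict \<phi> B) of (\<phi>, \<psi>) \<Rightarrow> \<lambda>x\<in>X. if x \<in> A then \<phi> x else \<psi> x) = \<phi>"
      unfolding prod.case by (rule PiE_ext[OF restrict_PiE_memI \<phi>]) (use PiE_mem[OF \<phi>] X(2) in auto)
    show "(restrict \<phi> A, restrict \<phi> B) \<in> (\<Pi>\<^sub>E x\<in>A. P (c x)) \<times> (\<Pi>\<^sub>E x\<in>B. P (c x))"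
      using PiE_mem[OF \<phi>] X(2) by (intro SigmaI restrict_PiE_memI) auto
    have "(\<Prod>x\<in>X. ?t \<phi> x) = (\<Prod>x\<in>A. ?t \<phi> x) * (\<Prod>x\<in>B. ?t \<phi> x)"
      unfolding X(2) by (rule prod.union_disjoint[OF fin X(3)])
    also have "\<dots> = (\<Prod>x\<in>A. ?t (restrict \<phi> A) x) * (\<Prod>x\<in>B. ?t (restrict \<phi> B) x)"
      using p by (intro arg_cong2[where f = "(*)"] prod.cong refl) simp_all
    finally show "(case (restrict \<phi> A, restrict \<phi> B) of (\<phi>, \<psi>) \<Rightarrow> (\<Prod>x\<in>A. ?t \<phi> x) * (\<Prod>x\<in>B. ?t \<psi> x)) = (\<Prod>x\<in>X. ?t \<phi> x)"
      unfolding prod.case by (rule sym)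
  next
    fix z assume z: "z \<in> (\<Pi>\<^sub>E x\<in>A. P (c x)) \<times> (\<Pi>\<^sub>E x\<in>B. P (c x))"
    obtain \<phi> \<psi> where e: "z = (\<phi>, \<psi>)" by (cases z)
    have \<phi>: "\<phi> \<in> (\<Pi>\<^sub>E x\<in>A. P (c x))" and \<psi>: "\<psi> \<in> (\<Pi>\<^sub>E x\<in>B. P (c x))" using z e by auto
    let ?\<chi> = "\<lambda>x\<in>X. if x \<in> A then \<phi> x else \<psi> x"
    have "restrict ?\<chi> A = \<phi>"
      by (rule PiE_ext[OF restrict_PiE_memI \<phi>]) (use PiE_mem[OF \<phi>] X(2) in auto)
    moreover have "restrict ?\<chi> B = \<psi>"
      by (rule PiE_ext[OF restrict_PiE_memI \<psi>]) (use PiE_mem[OF \<psi>] X(2,3) in auto)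
    ultimately show "(restrict (case z of (\<phi>, \<psi>) \<Rightarrow> \<lambda>x\<in>X. if x \<in> A then \<phi> x else \<psi> x) A,
        restrict (case z of (\<phi>, \<psi>) \<Rightarrow> \<lambda>x\<in>X. if x \<in> A then \<phi> x else \<psi> x) B) = z"
      unfolding e prod.case by simp
    show "(case z of (\<phi>, \<psi>) \<Rightarrow> \<lambda>x\<in>X. if x \<in> A then \<phi> x else \<psi> x) \<in> (\<Pi>\<^sub>E x\<in>X. P (c x))"
      unfolding e prod.case using PiE_mem[OF \<phi>] PiE_mem[OF \<psi>] X(2) by (intro restrict_PiE_memI) auto
  qed
  also have "\<dots> = tensor_char A c f p * tensor_char B c f p"
    unfolding tensor_char_def sum_product sum.cartesian_product ..
  finally show ?thesis .
qed

text \<open>The twisted tensor product whose permutation of factors is the inverse of the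
  permutation part. Elements of the Young subgroup preserve blocks, so the permuted factors carry
  the same representation.\<close>

lemma U_tilde:
  assumes l: "length ns = length U"
  defines "n \<equiv> sum_list ns"
  defines "H \<equiv> wreath_sub F n (young ns)"
  shows "representation ((wreath_sym F n)\<lparr>carrier := H\<rparr>) (U_tilde U ns)"
    "(f, p) \<in> H \<Longrightarrow> character (U_tilde U ns) (f, p) = tensor_char {1..n} (block_index ns) f p"
proof -
  let ?G = "(wreath_sym F n)\<lparr>carrier := H\<rparr>" and ?X = "{1..n}" and ?u = "\<lambda>x. block_index ns x"
  have G: "group ?G"
    unfolding H_def n_def by (rule group.subgroup_imp_group[OF wreath_sym_group[OF F(1)] wreath_sub_subgroup[OF F(1) young_subgroup]])
  have bi: "?u x < length U" if "x \<in> ?X" for x using block_index(2)[of x ns] that by (simp add: l n_def)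
  have memH: "z \<in> carrier ?G \<longleftrightarrow> fst z \<in> ?X \<rightarrow>\<^sub>E carrier F \<and> snd z \<in> young ns" for z
    by (cases z) (simp add: H_def wreath_sub_def)
  have perm: "p permutes ?X" if "p \<in> young ns" for p using that by (simp add: young_iff n_def)
  have yi: "?u (Hilbert_Choice.inv p x) = ?u x" if "p \<in> young ns" "x \<in> ?X" for p x
  proof -
    have "?u (p (Hilbert_Choice.inv p x)) = ?u (Hilbert_Choice.inv p x)"
      using that(1) permutes_inv_mem[OF perm[OF that(1)] that(2)] by (simp add: young_iff n_def)
    then show ?thesis by (simp add: permutes_inverses[OF perm[OF that(1)]])
  qed
  let ?V = "\<lambda>x. vspace (U ! ?u x)" and ?A = "\<lambda>g x. act (U ! ?u x) (fst g x)" and ?\<sigma> = "\<lambda>g. Hilbert_Choice.inv (snd g)"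
  have c: "coords (?V x) (P (?u x)) (b (?u x))" if "x \<in> ?X" for x by (rule Pb[OF bi[OF that]])
  have Ur: "representation F (U ! ?u x)" if "x \<in> ?X" for x by (rule U[OF bi[OF that]])
  have fx: "fst g x \<in> carrier F" if "g \<in> carrier ?G" "x \<in> ?X" for g x
    using that memH PiE_mem by metis
  have 1: "vspace (U_tilde U ns) = tensor_space ?X ?V" by (simp add: U_tilde_def Let_def n_def)
  have 2: "act (U_tilde U ns) g = lin_ext (\<Pi>\<^sub>E x\<in>?X. ?V x) (pure_tensor ?X) (\<lambda>u. pure_tensor ?X (\<lambda>x. ?A g x (u (?\<sigma> g x))))"
    for g by (simp add: U_tilde_def Let_def n_def case_prod_unfold)
  have 3: "bij_betw (?\<sigma> g) ?X ?X" if "g \<in> carrier ?G" for g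
    by (rule permutes_imp_bij[OF permutes_inv[OF perm]]) (use that memH in blast)
  have yg: "?u (?\<sigma> g x) = ?u x" if "g \<in> carrier ?G" "x \<in> ?X" for g x
    using yi[OF _ that(2), of "snd g"] that(1) memH by blast
  have 4: "lin_on (?V (?\<sigma> g x)) (?A g x)" if "g \<in> carrier ?G" "x \<in> ?X" for g x
    unfolding yg[OF that] by (rule repD(3)[OF Ur[OF that(2)] fx[OF that]])
  have 5: "?A g x v \<in> ?V x" if "g \<in> carrier ?G" "x \<in> ?X" "v \<in> ?V (?\<sigma> g x)" for g x v
    using that(3) unfolding yg[OF that(1,2)] by (rule repD(4)[OF Ur[OF that(2)] fx[OF that(1,2)]])
  have 6: "?\<sigma> \<one>\<^bsub>?G\<^esub> x = x \<and> ?A \<one>\<^bsub>?G\<^esub> x v = v" if "x \<in> ?X" "v \<in> ?V x" for x v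
    using repD(5)[OF Ur[OF that(1)] that(2)] that(1) by (simp add: wreath_sym_one)
  have m: "fst (g \<otimes>\<^bsub>?G\<^esub> h) = (\<lambda>x\<in>?X. fst g x \<otimes>\<^bsub>F\<^esub> fst h (?\<sigma> g x))" "snd (g \<otimes>\<^bsub>?G\<^esub> h) = snd g \<circ> snd h"
    if "g \<in> carrier ?G" for g h
  proof -
    have y: "snd g \<in> young ns" using that memH by blast
    have e: "g \<otimes>\<^bsub>?G\<^esub> h = (\<lambda>x\<in>?X. fst g x \<otimes>\<^bsub>F\<^esub> fst h (?\<sigma> g x), snd g \<circ> snd h)"
      using wreath_sym_mult[OF perm[OF y], of F "fst g" "fst h" "snd h"] by simp
    show "fst (g \<otimes>\<^bsub>?G\<^esub> h) = (\<lambda>x\<in>?X. fst g x \<otimes>\<^bsub>F\<^esub> fst h (?\<sigma> g x))" "snd (g \<otimes>\<^bsub>?G\<^esub> h) = snd g \<circ> snd h"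
      unfolding e by simp_all
  qed
  have 7: "?\<sigma> (g \<otimes>\<^bsub>?G\<^esub> h) x = ?\<sigma> h (?\<sigma> g x)" if "g \<in> carrier ?G" "h \<in> carrier ?G" "x \<in> ?X" for g h x
  proof -
    have "bij (snd g)" "bij (snd h)" using that(1,2) memH permutes_bij[OF perm] by blast+
    then show ?thesis unfolding m(2)[OF that(1)] by (simp add: o_inv_distrib)
  qed
  have 8: "?A (g \<otimes>\<^bsub>?G\<^esub> h) x v = ?A g x (?A h (?\<sigma> g x) v)"
    if "g \<in> carrier ?G" "h \<in> carrier ?G" "x \<in> ?X" "v \<in> ?V (?\<sigma> h (?\<sigma> g x))" for g h x v
  proof -
    have x': "?\<sigma> g x \<in> ?X" by (rule bij_betw_mem[OF 3[OF that(1)] that(3)])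
    have v: "v \<in> ?V x" using that(4) unfolding yg[OF that(2) x'] yg[OF that(1,3)] .
    show ?thesis
      unfolding m(1)[OF that(1)] yg[OF that(1,3)]
      using repD(6)[OF Ur[OF that(3)] fx[OF that(1,3)] fx[OF that(2) x'] v] that(3)
      by (simp del: atLeastAtMost_iff)
  qed
  note tw = twisted_tensor_rep[where G = ?G and R = "U_tilde U ns" and \<sigma> = ?\<sigma> and A = ?A and V = ?V and I = ?X
      and P = "\<lambda>x. P (?u x)" and b = "\<lambda>x. b (?u x)", OF G finite_atLeastAtMost]
  show "representation ?G (U_tilde U ns)" by (rule tw(1)[OF c 1 2 3 4 5 6 7 8])
  assume fp: "(f, p) \<in> H"
  then have fp': "(f, p) \<in> carrier ?G" by simp
  have p: "p permutes ?X" and y: "p \<in> young ns" using fp perm by (auto simp: H_def wreath_sub_def)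
  let ?i = "Hilbert_Choice.inv p"
  have "character (U_tilde U ns) (f, p) = (\<Sum>\<phi>\<in>(\<Pi>\<^sub>E x\<in>?X. P (?u x)). \<Prod>x\<in>?X. act (U ! ?u x) (f x) (b (?u (?i x)) (\<phi> (?i x))) (\<phi> x))"
  proof -
    have "character (U_tilde U ns) (f, p) = (\<Sum>\<phi>\<in>(\<Pi>\<^sub>E x\<in>?X. P (?u x)). \<Prod>x\<in>?X.
        ?A (f, p) x (b (?u (?\<sigma> (f, p) x)) (\<phi> (?\<sigma> (f, p) x))) (\<phi> x))"
      by (rule tw(2)[OF c 1 2 3 4 5 6 7 8 fp'])
    then show ?thesis unfolding fst_conv snd_conv .
  qed
  also have "\<dots> = tensor_char ?X ?u f p"
    unfolding tensor_char_def
  proof (rule sum.cong[OF refl])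
    fix \<phi>
    \<comment> \<open>The definition looks back from \<open>x\<close> to its preimage; reindexing
      along \<open>p\<close> makes every factor look forward from \<open>x\<close> to
      \<open>p x\<close>.\<close>
    have "(\<Prod>x\<in>?X. act (U ! ?u x) (f x) (b (?u (?i x)) (\<phi> (?i x))) (\<phi> x)) =
        (\<Prod>x\<in>?X. (\<lambda>x. act (U ! ?u x) (f x) (b (?u (?i x)) (\<phi> (?i x))) (\<phi> x)) (p x))"
      by (rule prod.reindex_bij_betw[OF permutes_imp_bij[OF p], symmetric])
    also have "\<dots> = (\<Prod>x\<in>?X. act (U ! ?u x) (f (p x)) (b (?u x) (\<phi> x)) (\<phi> (p x)))"
      using y by (intro prod.cong refl) (simp add: permutes_inverses[OF p] young_iff n_def)
    finally show "(\<Prod>x\<in>?X. act (U ! ?u x) (f x) (b (?u (?i x)) (\<phi> (?i x))) (\<phi> x)) =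
      (\<Prod>x\<in>?X. act (U ! ?u x) (f (p x)) (b (?u x) (\<phi> x)) (\<phi> (p x)))" .
  qed
  finally show "character (U_tilde U ns) (f, p) = tensor_char ?X ?u f p" .
qed

text \<open>The character of \<open>Phi\<close> made available on any finite set, so that it can be
  evaluated on the two pieces of \<open>{1..k + r}\<close> belonging to the two factors.\<close>

definition phi_char :: "nat set \<Rightarrow> nat list list \<Rightarrow> (nat \<Rightarrow> 'f) \<Rightarrow> (nat \<Rightarrow> nat) \<Rightarrow> complex" where
  "phi_char X \<Lambda> f p = (\<Sum>c\<in>inv_colourings X (map sum_list \<Lambda>) p.
     tensor_char X c f p * (\<Prod>i<length \<Lambda>. specht_char (\<Lambda> ! i) {x \<in> X. c x = i} p))"

lemma Phi:
  assumes l: "length \<Lambda> = length U"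
  defines "n \<equiv> sum_list (map sum_list \<Lambda>)"
  shows "representation (wreath_sym F n) (Phi F U \<Lambda>)"
    "(f, p) \<in> carrier (wreath_sym F n) \<Longrightarrow> character (Phi F U \<Lambda>) (f, p) = phi_char {1..n} \<Lambda> f p"
proof -
  define ns where "ns = map sum_list \<Lambda>"
  let ?H = "wreath_sub F n (young ns)" and ?X = "{1..n}"
  let ?G = "(wreath_sym F n)\<lparr>carrier := ?H\<rparr>"
  have n: "n = sum_list ns" by (simp add: n_def ns_def)
  have lU: "length ns = length U" using l by (simp add: ns_def)
  note UT = U_tilde[OF lU, folded n]
  note SM = specht_multi[where \<Lambda> = \<Lambda>, folded ns_def, folded n]
  have G: "group ?G"
    unfolding n by (rule group.subgroup_imp_group[OF wreath_sym_group[OF F(1)] wreath_sub_subgroup[OF F(1) young_subgroup]])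
  have memH: "(f, p) \<in> ?H \<longleftrightarrow> f \<in> ?X \<rightarrow>\<^sub>E carrier F \<and> p \<in> young ns" for f p by (simp add: wreath_sub_def)
  have perm: "p permutes ?X" if "p \<in> young ns" for p using that by (simp add: young_iff n)
  have PB: "representation ?G (pullback snd (specht_multi \<Lambda>))"
  proof (rule pullback_rep[OF SM(1)])
    fix g h assume g: "g \<in> carrier ?G" and "h \<in> carrier ?G"
    obtain f p f' p' where e: "g = (f, p)" "h = (f', p')" by (cases g, cases h)
    have "p permutes ?X" using g perm by (simp add: e memH)
    then show "snd (g \<otimes>\<^bsub>?G\<^esub> h) = snd g \<otimes>\<^bsub>(sym_group n)\<lparr>carrier := young ns\<rparr>\<^esub> snd h"
      using wreath_sym_mult[of p n F f f' p'] by (simp add: e sym_group_mult)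
  qed (auto simp: wreath_sub_def wreath_sym_one sym_group_one)
  note IT = inner_tensor[OF UT(1) PB G]
  have Ph: "Phi F U \<Lambda> = Ind (wreath_sym F n) ?H (inner_tensor (U_tilde U ns) (pullback snd (specht_multi \<Lambda>)))"
    by (simp add: Phi_def Let_def n ns_def)
  note IW = ind_wreath[OF F, of ns, folded n, OF IT(1)]
  show "representation (wreath_sym F n) (Phi F U \<Lambda>)" unfolding Ph by (rule IW(1))
  assume fp: "(f, p) \<in> carrier (wreath_sym F n)"
  then have f: "f \<in> ?X \<rightarrow>\<^sub>E carrier F" and p: "p permutes ?X" by (simp_all only: wreath_sym_carrier)
  show "character (Phi F U \<Lambda>) (f, p) = phi_char ?X \<Lambda> f p"
    unfolding Ph IW(2)[OF fp] phi_char_def ns_def[symmetric]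
  proof (rule sum.cong[OF refl])
    fix c assume c: "c \<in> inv_colourings ?X ns p"
    then have c': "c \<in> colourings {1..sum_list ns} ns" by (simp add: inv_colourings_def n)
    let ?s = "colouring_perm ns c"
    let ?f = "\<lambda>x\<in>?X. f (?s x)" and ?p = "Hilbert_Choice.inv ?s \<circ> p \<circ> ?s"
    note s = colouring_perm[OF c', folded n]
    have y: "?p \<in> young ns" using colouring_perm_conj_young[OF c'] c p by (simp add: n)
    have H: "(?f, ?p) \<in> ?H"
      unfolding memH using y by (intro conjI restrict_PiE_memI) (rule PiE_mem[OF f permutes_mem[OF s(1)]])
    have HG: "(?f, ?p) \<in> carrier ?G" using H by simp
    have "character (inner_tensor (U_tilde U ns) (pullback snd (specht_multi \<Lambda>))) (?f, ?p) =
        character (U_tilde U ns) (?f, ?p) * character (specht_multi \<Lambda>) ?p"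
      using IT(2)[OF HG] unfolding character_pullback snd_conv .
    also have "character (U_tilde U ns) (?f, ?p) = tensor_char ?X (block_index ns) ?f ?p" by (rule UT(2)[OF H])
    \<comment> \<open>Transport along the coset representative replaces the block pattern by
      \<open>c\<close> and undoes the conjugation of \<open>f\<close> and \<open>p\<close>.\<close>
    also have "\<dots> = tensor_char ?X c f p"
    proof (rule tensor_char_transport[OF permutes_imp_bij[OF s(1)]])
      fix x assume x: "x \<in> ?X"
      show "?p x \<in> ?X" by (rule permutes_mem[OF perm[OF y] x])
      show "?s (?p x) = p (?s x)" by (simp add: permutes_inverses[OF s(1)])
      show "block_index ns x = c (?s x)" using s(2)[OF x] by simp
      show "?f x = f (?s x)" using x by (rule restrict_apply')
    qed
    also have "character (specht_multi \<Lambda>) ?p = (\<Prod>i<length \<Lambda>. specht_char (\<Lambda> ! i) {x \<in> ?X. c x = i} p)"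
      unfolding SM(2)[OF y]
    proof (rule prod.cong[OF refl])
      fix i assume "i \<in> {..<length \<Lambda>}"
      then have i: "i < length ns" and si: "sum_list (\<Lambda> ! i) = ns ! i" by (simp_all add: ns_def)
      have cl: "bij_betw p {x \<in> ?X. c x = i} {x \<in> ?X. c x = i}"
        by (rule colour_class_bij[OF permutes_imp_bij[OF p]]) (use c in \<open>simp_all add: inv_colourings_def\<close>)
      show "character (specht (\<Lambda> ! i)) (young_component ns i ?p) = specht_char (\<Lambda> ! i) {x \<in> ?X. c x = i} p"
        unfolding young_component_conj[OF c[unfolded n] p[unfolded n] i]
        by (rule specht_char_eq[OF block_colour_bij[OF c' i, folded n] si cl])
    qed
    finally show "character (inner_tensor (U_tilde U ns) (pullback snd (specht_multi \<Lambda>))) (?f, ?p) =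
        tensor_char ?X c f p * (\<Prod>i<length \<Lambda>. specht_char (\<Lambda> ! i) {x \<in> ?X. c x = i} p)" .
  qed
qed

end

section \<open>Littlewood-Richardson coefficients and induced characters\<close>

lemma colour_class_transport:
  assumes "bij_betw \<tau> Y X"
  shows "bij_betw \<tau> {y \<in> Y. Q (\<tau> y)} {x \<in> X. Q x}"
proof -
  have "inj_on \<tau> {y \<in> Y. Q (\<tau> y)}" by (rule inj_on_subset[OF bij_betw_imp_inj_on[OF assms]]) blast
  moreover have "\<tau> ` {y \<in> Y. Q (\<tau> y)} = {x \<in> X. Q x}" using bij_betw_imp_surj_on[OF assms] by blast
  ultimately show ?thesis by (simp add: bij_betw_def)
qed

lemma inv_colouringsD:
  assumes "c \<in> inv_colourings X ns p"
  shows "c \<in> X \<rightarrow>\<^sub>E {..<length ns}" "i < length ns \<Longrightarrow> card {x \<in> X. c x = i} = ns ! i"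
    "x \<in> X \<Longrightarrow> c (p x) = c x"
  using assms unfolding inv_colourings_def colourings_def mem_Collect_eq by blast+

lemma inv_colouringsI:
  assumes "c \<in> X \<rightarrow>\<^sub>E {..<length ns}" "\<And>i. i < length ns \<Longrightarrow> card {x \<in> X. c x = i} = ns ! i"
    "\<And>x. x \<in> X \<Longrightarrow> c (p x) = c x"
  shows "c \<in> inv_colourings X ns p"
  unfolding inv_colourings_def colourings_def mem_Collect_eq using assms by blast

lemma inv_colourings_transport:
  assumes \<tau>: "bij_betw \<tau> Y X" and p: "\<And>y. y \<in> Y \<Longrightarrow> p' y \<in> Y" "\<And>y. y \<in> Y \<Longrightarrow> \<tau> (p' y) = p (\<tau> y)"
    and c: "c \<in> inv_colourings X ns p"
  shows "(\<lambda>y\<in>Y. c (\<tau> y)) \<in> inv_colourings Y ns p'"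
proof -
  have c': "c \<in> X \<rightarrow>\<^sub>E {..<length ns}" "\<And>i. i < length ns \<Longrightarrow> card {x \<in> X. c x = i} = ns ! i"
    "\<And>x. x \<in> X \<Longrightarrow> c (p x) = c x"
    using c by (auto simp: inv_colourings_def colourings_def)
  note \<tau>Y = bij_betw_mem[OF \<tau>]
  have "(\<lambda>y\<in>Y. c (\<tau> y)) \<in> Y \<rightarrow>\<^sub>E {..<length ns}"
    by (rule restrict_PiE_memI) (rule PiE_mem[OF c'(1) \<tau>Y])
  moreover have "card {y \<in> Y. (\<lambda>y\<in>Y. c (\<tau> y)) y = i} = ns ! i" if "i < length ns" for i
  proof -
    have "{y \<in> Y. (\<lambda>y\<in>Y. c (\<tau> y)) y = i} = {y \<in> Y. c (\<tau> y) = i}" by auto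
    then show ?thesis
      using bij_betw_same_card[OF colour_class_transport[OF \<tau>, of "\<lambda>x. c x = i"]] c'(2)[OF that] by simp
  qed
  moreover have "(\<lambda>y\<in>Y. c (\<tau> y)) (p' y) = (\<lambda>y\<in>Y. c (\<tau> y)) y" if "y \<in> Y" for y
    using p[OF that] c'(3)[OF \<tau>Y[OF that]] that by simp
  ultimately show ?thesis unfolding inv_colourings_def colourings_def by blast
qed

text \<open>Pulling colourings back along \<open>\<tau>\<close> and along its inverse are mutually
  inverse, and both preserve class sizes and invariance.\<close>

lemma sum_inv_colourings_transport:
  assumes \<tau>: "bij_betw \<tau> Y X" and p: "\<And>x. x \<in> X \<Longrightarrow> p x \<in> X" "\<And>y. y \<in> Y \<Longrightarrow> p' y \<in> Y"
      "\<And>y. y \<in> Y \<Longrightarrow> \<tau> (p' y) = p (\<tau> y)"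
    and g: "\<And>c. c \<in> inv_colourings X ns p \<Longrightarrow> g' (\<lambda>y\<in>Y. c (\<tau> y)) = g c"
  shows "(\<Sum>c\<in>inv_colourings Y ns p'. g' c) = (\<Sum>c\<in>inv_colourings X ns p. g c :: complex)"
proof (rule sym, rule sum.reindex_bij_witness[where j = "\<lambda>c. \<lambda>y\<in>Y. c (\<tau> y)" and i = "\<lambda>c. \<lambda>x\<in>X. c (inv_into Y \<tau> x)"])
  let ?i = "inv_into Y \<tau>"
  have i: "bij_betw ?i X Y" by (rule bij_betw_inv_into[OF \<tau>])
  have \<tau>Y: "\<tau> y \<in> X" if "y \<in> Y" for y by (rule bij_betw_mem[OF \<tau> that])
  have iX: "?i x \<in> Y" if "x \<in> X" for x by (rule bij_betw_mem[OF i that])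
  have i\<tau>: "?i (\<tau> y) = y" if "y \<in> Y" for y by (rule bij_betw_inv_into_left[OF \<tau> that])
  have \<tau>i: "\<tau> (?i x) = x" if "x \<in> X" for x by (rule bij_betw_inv_into_right[OF \<tau> that])
  have ip: "?i (p x) = p' (?i x)" if x: "x \<in> X" for x
    using p(3)[OF iX[OF x]] i\<tau>[OF p(2)[OF iX[OF x]]] unfolding \<tau>i[OF x] by simp
  have ext: "c \<in> Z \<rightarrow>\<^sub>E {..<length ns}" if "c \<in> inv_colourings Z ns q" for c Z q
    using that by (simp add: inv_colourings_def colourings_def)
  fix c assume c: "c \<in> inv_colourings X ns p"
  show "(\<lambda>y\<in>Y. c (\<tau> y)) \<in> inv_colourings Y ns p'" by (rule inv_colourings_transport[where \<tau> = \<tau> and p = p and p' = p', OF \<tau> p(2,3) c])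
  show "(\<lambda>x\<in>X. (\<lambda>y\<in>Y. c (\<tau> y)) (?i x)) = c"
    by (rule PiE_ext[OF restrict_PiE_memI ext[OF c]]) (use PiE_mem[OF ext[OF c]] iX \<tau>i in simp_all)
  show "g' (\<lambda>y\<in>Y. c (\<tau> y)) = g c" by (rule g[OF c])
next
  let ?i = "inv_into Y \<tau>"
  have i: "bij_betw ?i X Y" by (rule bij_betw_inv_into[OF \<tau>])
  have \<tau>Y: "\<tau> y \<in> X" if "y \<in> Y" for y by (rule bij_betw_mem[OF \<tau> that])
  have iX: "?i x \<in> Y" if "x \<in> X" for x by (rule bij_betw_mem[OF i that])
  have i\<tau>: "?i (\<tau> y) = y" if "y \<in> Y" for y by (rule bij_betw_inv_into_left[OF \<tau> that])
  have \<tau>i: "\<tau> (?i x) = x" if "x \<in> X" for x by (rule bij_betw_inv_into_right[OF \<tau> that])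
  have ip: "?i (p x) = p' (?i x)" if x: "x \<in> X" for x
    using p(3)[OF iX[OF x]] i\<tau>[OF p(2)[OF iX[OF x]]] unfolding \<tau>i[OF x] by simp
  fix c assume c: "c \<in> inv_colourings Y ns p'"
  then have ext: "c \<in> Y \<rightarrow>\<^sub>E {..<length ns}" by (simp add: inv_colourings_def colourings_def)
  show "(\<lambda>x\<in>X. c (?i x)) \<in> inv_colourings X ns p" by (rule inv_colourings_transport[where \<tau> = ?i and p = p' and p' = p, OF i p(1) ip c])
  show "(\<lambda>y\<in>Y. (\<lambda>x\<in>X. c (?i x)) (\<tau> y)) = c"
    by (rule PiE_ext[OF restrict_PiE_memI ext]) (use PiE_mem[OF ext] \<tau>Y i\<tau> in simp_all)
qed

lemma sum_list_two: "sum_list [a, b] = a + b" for a b :: nat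
  by simp

lemma two_less: "0 < length [a, b]" "1 < length [a, b]"
  by simp_all

lemma nth_two: "[a, b] ! 0 = a" "[a, b] ! 1 = b"
  by simp_all

lemma sym_split_rep:
  assumes R: "representation (sym_group a) R" and S: "representation (sym_group b) S"
  shows "representation ((sym_group (a + b))\<lparr>carrier := young [a, b]\<rparr>) (pullback (sym_split a b) (R \<boxtimes> S))"
proof (rule pullback_rep[OF outer_tensor(1)[OF R S sym_group_is_group sym_group_is_group]])
  have yc: "young_component [a, b] 0 p permutes {1..a}" "young_component [a, b] 1 p permutes {1..b}"
    if "p \<in> young [a, b]" for p
    using young_component(1)[OF that two_less(1)] young_component(1)[OF that two_less(2)] by simp_all
  let ?G = "(sym_group (a + b))\<lparr>carrier := young [a, b]\<rparr>"
  show "sym_split a b p \<in> carrier (sym_group a \<times>\<times> sym_group b)" if "p \<in> carrier ?G" for p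
    using yc that by (simp add: sym_split_def DirProd_def sym_group_carrier)
  show "sym_split a b \<one>\<^bsub>?G\<^esub> = \<one>\<^bsub>sym_group a \<times>\<times> sym_group b\<^esub>"
    by (simp add: sym_split_def DirProd_def sym_group_one young_component_id)
  show "sym_split a b (p \<otimes>\<^bsub>?G\<^esub> q) = sym_split a b p \<otimes>\<^bsub>sym_group a \<times>\<times> sym_group b\<^esub> sym_split a b q"
    if "p \<in> carrier ?G" "q \<in> carrier ?G" for p q
  proof -
    have pq: "p \<in> young [a, b]" "q \<in> young [a, b]" using that by simp_all
    note cm = young_component_comp[OF pq young_closed[OF pq]]
    show ?thesis using cm[OF two_less(1)] cm[OF two_less(2)] by (simp add: sym_split_def DirProd_def sym_group_mult)
  qed
qed

text \<open>The induced character is computed twice: by expansion into Specht characters, where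
  \<open>lr_coeff\<close> is the multiplicity by definition, and as a sum over invariant colourings
  with two colours.\<close>

lemma lr_coeff_sum_interval:
  assumes q: "q permutes {1..sum_list \<mu> + sum_list \<delta>}"
  shows "(\<Sum>\<gamma> | partition_of \<gamma> (sum_list \<mu> + sum_list \<delta>). of_nat (lr_coeff \<mu> \<delta> \<gamma>) * character (specht \<gamma>) q) =
    (\<Sum>d\<in>inv_colourings {1..sum_list \<mu> + sum_list \<delta>} [sum_list \<mu>, sum_list \<delta>] q.
       specht_char \<mu> {x \<in> {1..sum_list \<mu> + sum_list \<delta>}. d x = 0} q *
       specht_char \<delta> {x \<in> {1..sum_list \<mu> + sum_list \<delta>}. d x = 1} q)"
proof -
  define a where "a = sum_list \<mu>"
  define b where "b = sum_list \<delta>"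
  let ?X = "{1..a + b}" and ?G = "sym_group (a + b)"
  have q': "q permutes ?X" using q by (simp only: a_def b_def)
  define R where "R = pullback (sym_split a b) (specht \<mu> \<boxtimes> specht \<delta>)"
  have S: "representation (sym_group a) (specht \<mu>)" "representation (sym_group b) (specht \<delta>)"
    unfolding a_def b_def by (rule specht_rep)+
  have R: "representation (?G\<lparr>carrier := young [a, b]\<rparr>) R" unfolding R_def by (rule sym_split_rep[OF S])
  note ind = ind_sym[of "[a, b]", unfolded sum_list_two, OF R]
  interpret G: fin_group ?G by (rule fin_group_sym_group)
  have "character (Ind ?G (young [a, b]) R) q = (\<Sum>\<gamma>\<in>{\<gamma>. partition_of \<gamma> (a + b)}.
      of_nat (multiplicity ?G (specht \<gamma>) (Ind ?G (young [a, b]) R)) * character (specht \<gamma>) q)"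
  proof (rule G.character_expansion[OF ind(1) finite_partitions])
    show "irreducible_rep ?G (specht \<gamma>)" if "\<gamma> \<in> {\<gamma>. partition_of \<gamma> (a + b)}" for \<gamma>
      using specht_irreducible that by blast
    show "\<not> rep_iso ?G (specht \<gamma>) (specht \<gamma>')"
      if "\<gamma> \<in> {\<gamma>. partition_of \<gamma> (a + b)}" "\<gamma>' \<in> {\<gamma>. partition_of \<gamma> (a + b)}" "\<gamma> \<noteq> \<gamma>'" for \<gamma> \<gamma>'
      using specht_iso_imp_eq[of \<gamma> "a + b" \<gamma>'] that by blast
    show "q \<in> carrier ?G" using q' by (simp only: sym_group_carrier)
  qed (rule specht_complete)
  moreover have "multiplicity ?G (specht \<gamma>) (Ind ?G (young [a, b]) R) = lr_coeff \<mu> \<delta> \<gamma>" for \<gamma>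
    unfolding lr_coeff_def Let_def R_def a_def b_def ..
  ultimately have 1: "character (Ind ?G (young [a, b]) R) q = (\<Sum>\<gamma>\<in>{\<gamma>. partition_of \<gamma> (a + b)}.
      of_nat (lr_coeff \<mu> \<delta> \<gamma>) * character (specht \<gamma>) q)" by (simp only:)
  have "character (Ind ?G (young [a, b]) R) q = (\<Sum>d\<in>inv_colourings ?X [a, b] q.
      specht_char \<mu> {x \<in> ?X. d x = 0} q * specht_char \<delta> {x \<in> ?X. d x = 1} q)"
    unfolding ind(2)[OF q']
  proof (rule sum.cong[OF refl])
    fix d assume d: "d \<in> inv_colourings ?X [a, b] q"
    then have d': "d \<in> inv_colourings {1..sum_list [a, b]} [a, b] q" and dc: "d \<in> colourings {1..sum_list [a, b]} [a, b]"
      by (simp_all add: inv_colourings_def)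
    have q'': "q permutes {1..sum_list [a, b]}" using q' by simp
    let ?s = "colouring_perm [a, b] d"
    let ?q = "Hilbert_Choice.inv ?s \<circ> q \<circ> ?s"
    have y: "?q \<in> young [a, b]" using colouring_perm_conj_young[OF dc q''] d' by blast
    have cl: "bij_betw q {x \<in> ?X. d x = i} {x \<in> ?X. d x = i}" for i
      by (rule colour_class_bij[OF permutes_imp_bij[OF q'] finite_atLeastAtMost], rule inv_colouringsD(3)[OF d])
    have comp: "young_component [a, b] 0 ?q \<in> carrier (sym_group a)" "young_component [a, b] 1 ?q \<in> carrier (sym_group b)"
      using young_component(1)[OF y two_less(1)] young_component(1)[OF y two_less(2)] by (simp_all add: sym_group_carrier)
    have e0: "character (specht \<mu>) (young_component [a, b] 0 ?q) = specht_char \<mu> {x \<in> ?X. d x = 0} q"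
    proof -
      have "sum_list \<mu> = [a, b] ! 0" by (simp add: a_def)
      then show ?thesis
        unfolding young_component_conj[OF d' q'' two_less(1)]
        by (rule specht_char_eq[OF block_colour_bij[OF dc two_less(1), unfolded sum_list_two] _ cl])
    qed
    have e1: "character (specht \<delta>) (young_component [a, b] 1 ?q) = specht_char \<delta> {x \<in> ?X. d x = 1} q"
    proof -
      have "sum_list \<delta> = [a, b] ! 1" by (simp add: b_def)
      then show ?thesis
        unfolding young_component_conj[OF d' q'' two_less(2)]
        by (rule specht_char_eq[OF block_colour_bij[OF dc two_less(2), unfolded sum_list_two] _ cl])
    qed
    show "character R ?q = specht_char \<mu> {x \<in> ?X. d x = 0} q * specht_char \<delta> {x \<in> ?X. d x = 1} q"
      unfolding R_def character_pullback sym_split_def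
        outer_tensor(2)[OF S sym_group_is_group sym_group_is_group comp] e0 e1 ..
  qed
  with 1 show ?thesis by (simp only: a_def b_def)
qed

text \<open>The interval is replaced by an arbitrary finite set \<open>B\<close>, because the
  identity will be applied to each colour class separately.\<close>

lemma lr_coeff_sum:
  assumes B: "finite B" "card B = sum_list \<mu> + sum_list \<delta>" and p: "bij_betw p B B"
  shows "(\<Sum>\<gamma> | partition_of \<gamma> (sum_list \<mu> + sum_list \<delta>). of_nat (lr_coeff \<mu> \<delta> \<gamma>) * specht_char \<gamma> B p) =
    (\<Sum>d\<in>inv_colourings B [sum_list \<mu>, sum_list \<delta>] p.
       specht_char \<mu> {x \<in> B. d x = 0} p * specht_char \<delta> {x \<in> B. d x = 1} p)"
proof -
  define n where "n = sum_list \<mu> + sum_list \<delta>"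
  let ?X = "{1..n}"
  define e where "e = (SOME \<tau>. bij_betw \<tau> {1..card B} B)"
  have e: "bij_betw e ?X B" using enumeration_exists[OF B(1)] unfolding e_def B(2) n_def .
  let ?q = "transport_perm e n p"
  note q = transport_perm[OF e p]
  have "(\<Sum>\<gamma> | partition_of \<gamma> n. of_nat (lr_coeff \<mu> \<delta> \<gamma>) * specht_char \<gamma> B p) =
      (\<Sum>\<gamma> | partition_of \<gamma> n. of_nat (lr_coeff \<mu> \<delta> \<gamma>) * character (specht \<gamma>) ?q)"
    by (intro sum.cong refl) (use specht_char_eq[OF e _ p] in \<open>simp add: partition_of_def\<close>)
  also have "\<dots> = (\<Sum>d\<in>inv_colourings ?X [sum_list \<mu>, sum_list \<delta>] ?q.
       specht_char \<mu> {x \<in> ?X. d x = 0} ?q * specht_char \<delta> {x \<in> ?X. d x = 1} ?q)"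
    unfolding n_def by (rule lr_coeff_sum_interval) (rule q(1)[unfolded n_def])
  also have "\<dots> = (\<Sum>d\<in>inv_colourings B [sum_list \<mu>, sum_list \<delta>] p.
       specht_char \<mu> {x \<in> B. d x = 0} p * specht_char \<delta> {x \<in> B. d x = 1} p)"
  proof (rule sum_inv_colourings_transport[where \<tau> = e and X = B and Y = ?X and p = p and p' = ?q
        and g = "\<lambda>d. specht_char \<mu> {x \<in> B. d x = 0} p * specht_char \<delta> {x \<in> B. d x = 1} p"
        and g' = "\<lambda>d. specht_char \<mu> {x \<in> ?X. d x = 0} ?q * specht_char \<delta> {x \<in> ?X. d x = 1} ?q",
        OF e bij_betw_mem[OF p] permutes_mem[OF q(1)] q(2)])
    fix d assume d: "d \<in> inv_colourings B [sum_list \<mu>, sum_list \<delta>] p"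
    let ?d = "\<lambda>y\<in>?X. d (e y)"
    have d2: "?d \<in> inv_colourings ?X [sum_list \<mu>, sum_list \<delta>] ?q"
      by (rule inv_colourings_transport[where \<tau> = e and p = p and p' = ?q, OF e permutes_mem[OF q(1)] q(2) d])
    have set: "{y \<in> ?X. ?d y = i} = {y \<in> ?X. d (e y) = i}" for i by auto
    have pB: "bij_betw p {x \<in> B. d x = i} {x \<in> B. d x = i}" for i
      by (rule colour_class_bij[OF p B(1)], rule inv_colouringsD(3)[OF d])
    have qX: "bij_betw ?q {y \<in> ?X. ?d y = i} {y \<in> ?X. ?d y = i}" for i
      by (rule colour_class_bij[OF permutes_imp_bij[OF q(1)] finite_atLeastAtMost], rule inv_colouringsD(3)[OF d2])
    have sz: "card {y \<in> ?X. ?d y = 0} = sum_list \<mu>" "card {y \<in> ?X. ?d y = 1} = sum_list \<delta>"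
      using inv_colouringsD(2)[OF d2 two_less(1)] inv_colouringsD(2)[OF d2 two_less(2)]
      unfolding nth_two .
    have tr: "specht_char \<gamma> {y \<in> ?X. ?d y = i} ?q = specht_char \<gamma> {x \<in> B. d x = i} p"
      if "sum_list \<gamma> = card {y \<in> ?X. ?d y = i}" for \<gamma> i
    proof (rule specht_char_transport[OF _ _ that pB qX])
      show "bij_betw e {y \<in> ?X. ?d y = i} {x \<in> B. d x = i}"
        unfolding set by (rule colour_class_transport[OF e])
      show "e (?q y) = p (e y)" if "y \<in> {y \<in> ?X. ?d y = i}" for y
        by (rule q(2)) (use that in blast)
    qed simp
    show "specht_char \<mu> {y \<in> ?X. ?d y = 0} ?q * specht_char \<delta> {y \<in> ?X. ?d y = 1} ?q =
        specht_char \<mu> {x \<in> B. d x = 0} p * specht_char \<delta> {x \<in> B. d x = 1} p"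
      using tr[of \<mu> 0] tr[of \<delta> 1] sz by (simp only:)
  qed
  finally show ?thesis unfolding n_def .
qed

section \<open>Sums over multipartitions, as functions on the index set\<close>

lemma multipartitions_eq_image:
  "{\<Gamma>. \<Gamma> \<tturnstile> ns} = (\<lambda>D. map D [0..<length ns]) ` (\<Pi>\<^sub>E i\<in>{..<length ns}. {\<gamma>. partition_of \<gamma> (ns ! i)})"
proof (intro equalityI subsetI)
  fix \<Gamma> assume "\<Gamma> \<in> {\<Gamma>. \<Gamma> \<tturnstile> ns}"
  then have \<Gamma>: "length \<Gamma> = length ns" "\<And>i. i < length ns \<Longrightarrow> partition_of (\<Gamma> ! i) (ns ! i)"
    unfolding multipartition_of_def mem_Collect_eq by blast+
  have "\<Gamma> = map (\<lambda>i\<in>{..<length ns}. \<Gamma> ! i) [0..<length ns]"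
    by (rule nth_equalityI) (simp_all add: \<Gamma>(1))
  moreover have "(\<lambda>i\<in>{..<length ns}. \<Gamma> ! i) \<in> (\<Pi>\<^sub>E i\<in>{..<length ns}. {\<gamma>. partition_of \<gamma> (ns ! i)})"
    by (rule restrict_PiE_memI) (use \<Gamma>(2) in blast)
  ultimately show "\<Gamma> \<in> (\<lambda>D. map D [0..<length ns]) ` (\<Pi>\<^sub>E i\<in>{..<length ns}. {\<gamma>. partition_of \<gamma> (ns ! i)})"
    by (rule image_eqI)
next
  fix \<Gamma> assume "\<Gamma> \<in> (\<lambda>D. map D [0..<length ns]) ` (\<Pi>\<^sub>E i\<in>{..<length ns}. {\<gamma>. partition_of \<gamma> (ns ! i)})"
  then obtain D where D: "D \<in> (\<Pi>\<^sub>E i\<in>{..<length ns}. {\<gamma>. partition_of \<gamma> (ns ! i)})" "\<Gamma> = map D [0..<length ns]"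
    by (rule imageE)
  have "partition_of (D i) (ns ! i)" if "i < length ns" for i
    using PiE_mem[OF D(1), of i] that by simp
  then show "\<Gamma> \<in> {\<Gamma>. \<Gamma> \<tturnstile> ns}" by (simp add: multipartition_of_def D(2))
qed

lemma finite_multipartitions: "finite {\<Gamma>. \<Gamma> \<tturnstile> ns}"
  unfolding multipartitions_eq_image by (intro finite_imageI finite_PiE finite_partitions) simp

text \<open>The components of a multipartition are chosen independently, so this is the distributive
  law.\<close>

lemma sum_multipartitions:
  fixes h :: "nat \<Rightarrow> nat list \<Rightarrow> complex"
  shows "(\<Sum>\<Gamma> | \<Gamma> \<tturnstile> ns. \<Prod>i<length ns. h i (\<Gamma> ! i)) = (\<Prod>i<length ns. \<Sum>\<gamma> | partition_of \<gamma> (ns ! i). h i \<gamma>)"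
proof -
  let ?D = "\<Pi>\<^sub>E i\<in>{..<length ns}. {\<gamma>. partition_of \<gamma> (ns ! i)}"
  have inj: "inj_on (\<lambda>D. map D [0..<length ns]) ?D"
  proof (rule inj_onI)
    fix D E assume D: "D \<in> ?D" and E: "E \<in> ?D" and eq: "map D [0..<length ns] = map E [0..<length ns]"
    have "D i = E i" if "i \<in> {..<length ns}" for i
      using eq that by simp
    then show "D = E" by (rule PiE_ext[OF D E])
  qed
  have "(\<Sum>\<Gamma> | \<Gamma> \<tturnstile> ns. \<Prod>i<length ns. h i (\<Gamma> ! i)) = (\<Sum>D\<in>?D. \<Prod>i<length ns. h i (D i))"
    unfolding multipartitions_eq_image sum.reindex[OF inj] comp_def by (intro sum.cong prod.cong refl) simp
  also have "\<dots> = (\<Prod>i<length ns. \<Sum>\<gamma> | partition_of \<gamma> (ns ! i). h i \<gamma>)"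
    by (rule prod_sum_PiE[symmetric]) (rule finite_lessThan, rule finite_partitions)
  finally show ?thesis .
qed

text \<open>Multiplication in the wreath product reads the second base function at
  \<open>inv p\<close>; splitting it over two blocks needs that inverse in terms of the
  components.\<close>

lemma young_component_inv:
  assumes p: "p \<in> young ns" and i: "i < length ns" and x: "x \<in> {1..ns ! i}"
  shows "Hilbert_Choice.inv p (offset ns i + x) = offset ns i + Hilbert_Choice.inv (young_component ns i p) x"
proof -
  note c = young_component[OF p i]
  have pp: "p permutes {1..sum_list ns}" using p by (simp add: young_iff)
  have "p (offset ns i + Hilbert_Choice.inv (young_component ns i p) x) = offset ns i + x"
    using c(2)[OF permutes_inv_mem[OF c(1) x]] by (simp add: permutes_inverses[OF c(1)])
  then have "Hilbert_Choice.inv p (p (offset ns i + Hilbert_Choice.inv (young_component ns i p) x)) =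
      Hilbert_Choice.inv p (offset ns i + x)" by (rule arg_cong)
  then show ?thesis unfolding permutes_inverses(2)[OF pp] by (rule sym)
qed

definition colour_pairs :: "nat set \<Rightarrow> nat list \<Rightarrow> nat list \<Rightarrow> (nat \<Rightarrow> nat) \<Rightarrow> ((nat \<Rightarrow> nat) \<times> (nat \<Rightarrow> nat)) set" where
  "colour_pairs X ks rs p = {(c0, c). c0 \<in> X \<rightarrow>\<^sub>E {..<2} \<and> c \<in> X \<rightarrow>\<^sub>E {..<length ks} \<and>
     (\<forall>x\<in>X. c0 (p x) = c0 x) \<and> (\<forall>x\<in>X. c (p x) = c x) \<and>
     (\<forall>i<length ks. card {x \<in> X. c x = i \<and> c0 x = 0} = ks ! i \<and> card {x \<in> X. c x = i \<and> c0 x = 1} = rs ! i)}"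

lemma card_by_colour:
  assumes X: "finite X" and c: "c \<in> X \<rightarrow>\<^sub>E {..<l :: nat}"
  shows "card {x \<in> X. Q x} = (\<Sum>i<l. card {x \<in> X. c x = i \<and> Q x})"
proof -
  let ?Y = "{x \<in> X. Q x}"
  have "card ?Y = (\<Sum>x\<in>?Y. 1)" by simp
  also have "\<dots> = (\<Sum>i<l. \<Sum>x\<in>{x \<in> ?Y. c x = i}. 1)"
    using X PiE_mem[OF c] by (intro sum.group[symmetric]) auto
  also have "\<dots> = (\<Sum>i<l. card {x \<in> X. c x = i \<and> Q x})"
    by (intro sum.cong refl) (simp add: conj_ac)
  finally show ?thesis .
qed

section \<open>The character of the induced outer product\<close>

context wreath_reps
begin

lemma phi_char_transport:
  assumes \<tau>: "bij_betw \<tau> Y X" and Y: "finite Y" and p: "bij_betw p X X" "bij_betw p' Y Y"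
    and eq: "\<And>y. y \<in> Y \<Longrightarrow> \<tau> (p' y) = p (\<tau> y)" and f: "\<And>y. y \<in> Y \<Longrightarrow> f' y = f (\<tau> y)"
  shows "phi_char Y \<Lambda> f' p' = phi_char X \<Lambda> f p"
  unfolding phi_char_def
proof (rule sum_inv_colourings_transport[where \<tau> = \<tau> and X = X and Y = Y and p = p and p' = p'
      and g = "\<lambda>c. tensor_char X c f p * (\<Prod>i<length \<Lambda>. specht_char (\<Lambda> ! i) {x \<in> X. c x = i} p)"
      and g' = "\<lambda>c. tensor_char Y c f' p' * (\<Prod>i<length \<Lambda>. specht_char (\<Lambda> ! i) {y \<in> Y. c y = i} p')",
      OF \<tau> bij_betw_mem[OF p(1)] bij_betw_mem[OF p(2)] eq])
  have X: "finite X" using bij_betw_finite[OF \<tau>] Y by blast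
  fix c assume c: "c \<in> inv_colourings X (map sum_list \<Lambda>) p"
  let ?c = "\<lambda>y\<in>Y. c (\<tau> y)"
  have c2: "?c \<in> inv_colourings Y (map sum_list \<Lambda>) p'"
    by (rule inv_colourings_transport[where \<tau> = \<tau> and p = p and p' = p', OF \<tau> bij_betw_mem[OF p(2)] eq c])
  have set: "{y \<in> Y. ?c y = i} = {y \<in> Y. c (\<tau> y) = i}" for i by auto
  have "tensor_char Y ?c f' p' = tensor_char X c f p"
    by (rule tensor_char_transport[where \<tau> = \<tau> and p = p and p' = p', OF \<tau> bij_betw_mem[OF p(2)] eq]) (simp_all add: f)
  moreover have "specht_char (\<Lambda> ! i) {y \<in> Y. ?c y = i} p' = specht_char (\<Lambda> ! i) {x \<in> X. c x = i} p"
    if i: "i \<in> {..<length \<Lambda>}" for i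
  proof (rule specht_char_transport)
    show "bij_betw \<tau> {y \<in> Y. ?c y = i} {x \<in> X. c x = i}" unfolding set by (rule colour_class_transport[OF \<tau>])
    show "finite {y \<in> Y. ?c y = i}" using Y by simp
    show "sum_list (\<Lambda> ! i) = card {y \<in> Y. ?c y = i}" 
      using inv_colouringsD(2)[OF c2, of i] i by (simp only: length_map lessThan_iff nth_map)
    show "bij_betw p {x \<in> X. c x = i} {x \<in> X. c x = i}"
      by (rule colour_class_bij[OF p(1) X], rule inv_colouringsD(3)[OF c])
    show "bij_betw p' {y \<in> Y. ?c y = i} {y \<in> Y. ?c y = i}"
      by (rule colour_class_bij[OF p(2) Y], rule inv_colouringsD(3)[OF c2])
    show "\<tau> (p' y) = p (\<tau> y)" if "y \<in> {y \<in> Y. ?c y = i}" for y 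
      by (rule eq) (use that in blast)
  qed
  ultimately show "tensor_char Y ?c f' p' * (\<Prod>i<length \<Lambda>. specht_char (\<Lambda> ! i) {y \<in> Y. ?c y = i} p') =
      tensor_char X c f p * (\<Prod>i<length \<Lambda>. specht_char (\<Lambda> ! i) {x \<in> X. c x = i} p)"
    by (intro arg_cong2[where f = "(*)"] prod.cong refl)
qed

lemma wreath_split_rep:
  assumes R: "representation (wreath_sym F k) R" and S: "representation (wreath_sym F r) S"
  shows "representation ((wreath_sym F (k + r))\<lparr>carrier := wreath_sub F (k + r) (young [k, r])\<rparr>)
    (pullback (wreath_split k r) (R \<boxtimes> S))"
proof (rule pullback_rep[OF outer_tensor(1)[OF R S wreath_sym_group[OF F(1)] wreath_sym_group[OF F(1)]]])
  let ?G = "(wreath_sym F (k + r))\<lparr>carrier := wreath_sub F (k + r) (young [k, r])\<rparr>"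
  let ?D = "wreath_sym F k \<times>\<times> wreath_sym F r"
  have mem: "(f, p) \<in> carrier ?G \<longleftrightarrow> f \<in> {1..k + r} \<rightarrow>\<^sub>E carrier F \<and> p \<in> young [k, r]" for f p
    by (simp add: wreath_sub_def)
  have yc: "young_component [k, r] 0 p permutes {1..k}" "young_component [k, r] 1 p permutes {1..r}"
    if "p \<in> young [k, r]" for p
    using young_component(1)[OF that two_less(1)] young_component(1)[OF that two_less(2)] by simp_all
  have sh: "k + x \<in> {1..k + r}" if "x \<in> {1..r}" for x using that by simp
  have lo: "x \<in> {1..k + r}" if "x \<in> {1..k}" for x using that by simp
  show "wreath_split k r z \<in> carrier ?D" if z: "z \<in> carrier ?G" for z
  proof -
    obtain f p where e: "z = (f, p)" by (cases z)
    have f: "f \<in> {1..k + r} \<rightarrow>\<^sub>E carrier F" and p: "p \<in> young [k, r]" using z unfolding e mem by blast+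
    have "(\<lambda>x\<in>{1..k}. f x) \<in> {1..k} \<rightarrow>\<^sub>E carrier F" by (rule restrict_PiE_memI) (rule PiE_mem[OF f lo])
    moreover have "(\<lambda>x\<in>{1..r}. f (k + x)) \<in> {1..r} \<rightarrow>\<^sub>E carrier F" by (rule restrict_PiE_memI) (rule PiE_mem[OF f sh])
    ultimately show ?thesis using yc[OF p] by (simp add: e wreath_split_def DirProd_def wreath_sym_carrier)
  qed
  show "wreath_split k r \<one>\<^bsub>?G\<^esub> = \<one>\<^bsub>?D\<^esub>"
  proof -
    have "(\<lambda>x\<in>{1..k}. (\<lambda>x\<in>{1..k + r}. \<one>\<^bsub>F\<^esub>) x) = (\<lambda>x\<in>{1..k}. \<one>\<^bsub>F\<^esub>)"
      by (rule restrict_ext, rule restrict_apply'[OF lo])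
    moreover have "(\<lambda>x\<in>{1..r}. (\<lambda>x\<in>{1..k + r}. \<one>\<^bsub>F\<^esub>) (k + x)) = (\<lambda>x\<in>{1..r}. \<one>\<^bsub>F\<^esub>)"
      by (rule restrict_ext, rule restrict_apply'[OF sh])
    moreover have "\<one>\<^bsub>?G\<^esub> = (\<lambda>x\<in>{1..k + r}. \<one>\<^bsub>F\<^esub>, id)" by (simp add: wreath_sym_one)
    ultimately show ?thesis
      by (simp only: wreath_split_def wreath_sym_one DirProd_def monoid.simps partial_object.simps prod.case young_component_id)
  qed
  show "wreath_split k r (z \<otimes>\<^bsub>?G\<^esub> w) = wreath_split k r z \<otimes>\<^bsub>?D\<^esub> wreath_split k r w"
    if z: "z \<in> carrier ?G" and w: "w \<in> carrier ?G" for z w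
  proof -
    obtain f p where e: "z = (f, p)" by (cases z)
    obtain f' p' where e': "w = (f', p')" by (cases w)
    have p: "p \<in> young [k, r]" and p': "p' \<in> young [k, r]" using z w unfolding e e' mem by blast+
    have pp: "p permutes {1..k + r}" using p by (simp add: young_iff)
    note cm = young_component_comp[OF p p' young_closed[OF p p']]
    have i0: "Hilbert_Choice.inv p x = Hilbert_Choice.inv (young_component [k, r] 0 p) x" if "x \<in> {1..k}" for x
      using young_component_inv[OF p two_less(1), of x] that by (simp add: offset_def)
    have i1: "Hilbert_Choice.inv p (k + x) = k + Hilbert_Choice.inv (young_component [k, r] 1 p) x" if "x \<in> {1..r}" for x
      using young_component_inv[OF p two_less(2), of x] that by (simp add: offset_def)
    have m: "z \<otimes>\<^bsub>?G\<^esub> w = (\<lambda>x\<in>{1..k + r}. f x \<otimes>\<^bsub>F\<^esub> f' (Hilbert_Choice.inv p x), p \<circ> p')"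
      using wreath_sym_mult[OF pp] by (simp add: e e')
    have "(\<lambda>x\<in>{1..k}. (\<lambda>x\<in>{1..k + r}. f x \<otimes>\<^bsub>F\<^esub> f' (Hilbert_Choice.inv p x)) x) =
        (\<lambda>x\<in>{1..k}. (\<lambda>x\<in>{1..k}. f x) x \<otimes>\<^bsub>F\<^esub> (\<lambda>x\<in>{1..k}. f' x) (Hilbert_Choice.inv (young_component [k, r] 0 p) x))"
      by (rule restrict_ext, unfold restrict_apply'[OF lo])
        (simp only: restrict_apply' i0 permutes_inv_mem[OF yc(1)[OF p]])
    moreover have "(\<lambda>x\<in>{1..r}. (\<lambda>x\<in>{1..k + r}. f x \<otimes>\<^bsub>F\<^esub> f' (Hilbert_Choice.inv p x)) (k + x)) =
        (\<lambda>x\<in>{1..r}. (\<lambda>x\<in>{1..r}. f (k + x)) x \<otimes>\<^bsub>F\<^esub> (\<lambda>x\<in>{1..r}. f' (k + x)) (Hilbert_Choice.inv (young_component [k, r] 1 p) x))"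
      by (rule restrict_ext, unfold restrict_apply'[OF sh])
        (simp only: restrict_apply' i1 permutes_inv_mem[OF yc(2)[OF p]])
    ultimately show ?thesis
      unfolding m unfolding e e'
      by (simp only: wreath_split_def prod.case mult_DirProd wreath_sym_mult[OF yc(1)[OF p]] wreath_sym_mult[OF yc(2)[OF p]]
          cm[OF two_less(1)] cm[OF two_less(2)])
  qed
qed

text \<open>A two-colouring records which points belong to which factor; on each of its classes the
  corresponding character of \<open>Phi\<close> is evaluated in place.\<close>

lemma ind_Phi_product:
  assumes l: "length \<Lambda> = length U" "length \<Delta> = length U"
    and k: "sum_list (map sum_list \<Lambda>) = k" and r: "sum_list (map sum_list \<Delta>) = r"
  defines "G \<equiv> wreath_sym F (k + r)"
  defines "I \<equiv> Ind G (wreath_sub F (k + r) (young [k, r])) (pullback (wreath_split k r) (Phi F U \<Lambda> \<boxtimes> Phi F U \<Delta>))"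
  shows "representation G I"
    "(f, p) \<in> carrier G \<Longrightarrow> character I (f, p) = (\<Sum>c\<in>inv_colourings {1..k + r} [k, r] p.
       phi_char {x \<in> {1..k + r}. c x = 0} \<Lambda> f p * phi_char {x \<in> {1..k + r}. c x = 1} \<Delta> f p)"
proof -
  let ?X = "{1..k + r}" and ?H = "wreath_sub F (k + r) (young [k, r])"
  note P\<Lambda> = Phi[OF l(1), unfolded k] and P\<Delta> = Phi[OF l(2), unfolded r]
  note ind = ind_wreath[OF F, of "[k, r]", unfolded sum_list_two, OF wreath_split_rep[OF P\<Lambda>(1) P\<Delta>(1)]]
  show "representation G I" unfolding I_def G_def by (rule ind(1))
  assume fp: "(f, p) \<in> carrier G"
  then have f: "f \<in> ?X \<rightarrow>\<^sub>E carrier F" and p: "p permutes ?X" by (simp_all only: G_def wreath_sym_carrier)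
  show "character I (f, p) = (\<Sum>c\<in>inv_colourings ?X [k, r] p.
       phi_char {x \<in> ?X. c x = 0} \<Lambda> f p * phi_char {x \<in> ?X. c x = 1} \<Delta> f p)"
    unfolding I_def G_def ind(2)[OF fp[unfolded G_def]]
  proof (rule sum.cong[OF refl])
    fix c assume c: "c \<in> inv_colourings ?X [k, r] p"
    then have c': "c \<in> inv_colourings {1..sum_list [k, r]} [k, r] p" and cc: "c \<in> colourings {1..sum_list [k, r]} [k, r]"
      by (simp_all add: inv_colourings_def)
    have p': "p permutes {1..sum_list [k, r]}" using p by simp
    let ?s = "colouring_perm [k, r] c"
    let ?fs = "\<lambda>x\<in>?X. f (?s x)" and ?ps = "Hilbert_Choice.inv ?s \<circ> p \<circ> ?s"
    note s = colouring_perm[OF cc, unfolded sum_list_two]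
    have y: "?ps \<in> young [k, r]" using colouring_perm_conj_young[OF cc p'] c' by blast
    have cl: "bij_betw p {x \<in> ?X. c x = i} {x \<in> ?X. c x = i}" for i
      by (rule colour_class_bij[OF permutes_imp_bij[OF p] finite_atLeastAtMost], rule inv_colouringsD(3)[OF c])
    let ?f0 = "\<lambda>x\<in>{1..k}. ?fs x" and ?f1 = "\<lambda>x\<in>{1..r}. ?fs (k + x)"
    let ?p0 = "young_component [k, r] 0 ?ps" and ?p1 = "young_component [k, r] 1 ?ps"
    have yc: "?p0 permutes {1..k}" "?p1 permutes {1..r}"
      using young_component(1)[OF y two_less(1)] young_component(1)[OF y two_less(2)] by simp_all
    have sh: "k + x \<in> ?X" if "x \<in> {1..r}" for x using that by simp
    have lo: "x \<in> ?X" if "x \<in> {1..k}" for x using that by simp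
    have fs: "f (?s x) \<in> carrier F" if "x \<in> ?X" for x by (rule PiE_mem[OF f permutes_mem[OF s(1) that]])
    have m0: "(?f0, ?p0) \<in> carrier (wreath_sym F k)"
      unfolding wreath_sym_carrier using yc(1) fs lo by (intro conjI restrict_PiE_memI) (simp_all del: atLeastAtMost_iff)
    have m1: "(?f1, ?p1) \<in> carrier (wreath_sym F r)"
      unfolding wreath_sym_carrier using yc(2) fs sh by (intro conjI restrict_PiE_memI) (simp_all del: atLeastAtMost_iff)
    \<comment> \<open>The coset representative carries the interval of each factor onto the class of
      points assigned to that factor, so \<open>phi_char\<close> can be transported there.\<close>
    let ?t0 = "\<lambda>x. ?s (offset [k, r] 0 + x)" and ?t1 = "\<lambda>x. ?s (offset [k, r] 1 + x)"
    have b0: "bij_betw ?t0 {1..k} {x \<in> ?X. c x = 0}"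
      using block_colour_bij[OF cc two_less(1)] unfolding nth_two sum_list_two .
    have b1: "bij_betw ?t1 {1..r} {x \<in> ?X. c x = 1}"
      using block_colour_bij[OF cc two_less(2)] unfolding nth_two sum_list_two .
    have e0: "?t0 (?p0 x) = p (?t0 x)" if "x \<in> {1..k}" for x
      unfolding young_component_conj[OF c' p' two_less(1)] nth_two by (rule transport_perm(2)[OF b0 cl that])
    have e1: "?t1 (?p1 x) = p (?t1 x)" if "x \<in> {1..r}" for x
      unfolding young_component_conj[OF c' p' two_less(2)] nth_two by (rule transport_perm(2)[OF b1 cl that])
    have o: "offset [k, r] 0 = 0" "offset [k, r] 1 = k" by (simp_all add: offset_def)
    have f0: "?f0 x = f (?t0 x)" if "x \<in> {1..k}" for x
      unfolding restrict_apply'[OF that] restrict_apply'[OF lo[OF that]] o add_0 ..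
    have f1: "?f1 x = f (?t1 x)" if "x \<in> {1..r}" for x
      unfolding restrict_apply'[OF that] restrict_apply'[OF sh[OF that]] o ..
    have "phi_char {1..k} \<Lambda> ?f0 ?p0 = phi_char {x \<in> ?X. c x = 0} \<Lambda> f p"
      by (rule phi_char_transport[where \<tau> = ?t0 and p = p and p' = ?p0 and f = f and f' = ?f0, OF b0 _ cl permutes_imp_bij[OF yc(1)] e0 f0])
        (rule finite_atLeastAtMost)
    moreover have "phi_char {1..r} \<Delta> ?f1 ?p1 = phi_char {x \<in> ?X. c x = 1} \<Delta> f p"
      by (rule phi_char_transport[where \<tau> = ?t1 and p = p and p' = ?p1 and f = f and f' = ?f1, OF b1 _ cl permutes_imp_bij[OF yc(2)] e1 f1])
        (rule finite_atLeastAtMost)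
    ultimately show "character (pullback (wreath_split k r) (Phi F U \<Lambda> \<boxtimes> Phi F U \<Delta>)) (?fs, ?ps) =
        phi_char {x \<in> ?X. c x = 0} \<Lambda> f p * phi_char {x \<in> ?X. c x = 1} \<Delta> f p"
      using character_pullback[of "wreath_split k r" "Phi F U \<Lambda> \<boxtimes> Phi F U \<Delta>" "(?fs, ?ps)"]
        outer_tensor(2)[OF P\<Lambda>(1) P\<Delta>(1) wreath_sym_group[OF F(1)] wreath_sym_group[OF F(1)] m0 m1]
      unfolding P\<Lambda>(2)[OF m0] P\<Delta>(2)[OF m1] unfolding wreath_split_def prod.case by (simp only:)
  qed
qed

end

section \<open>The product formula\<close>

text \<open>
  The colouring \<^term>\<open>c\<close> records which irreducible representation of \<open>F\<close> sits at each place, and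
  \<^term>\<open>c0\<close> to which of the two factors the place belongs.
\<close>

definition compatible :: "nat set \<Rightarrow> nat list \<Rightarrow> nat list \<Rightarrow> (nat \<Rightarrow> nat) \<Rightarrow> (nat \<Rightarrow> nat) \<Rightarrow> bool" where
  "compatible X ks rs c0 c \<longleftrightarrow> (\<forall>i<length ks. card {x \<in> X. c x = i \<and> c0 x = 0} = ks ! i \<and>
     card {x \<in> X. c x = i \<and> c0 x = 1} = rs ! i)"

lemma compatibleD:
  assumes "compatible X ks rs c0 c" "i < length ks"
  shows "card {x \<in> X. c x = i \<and> c0 x = 0} = ks ! i" "card {x \<in> X. c x = i \<and> c0 x = 1} = rs ! i"
  using assms unfolding compatible_def by blast+

lemma two_cases: "m < length [a, b] \<Longrightarrow> m = 0 \<or> m = 1"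
  by auto

lemma two_colours:
  assumes "c \<in> inv_colourings X [a, b] p" "x \<in> X"
  shows "c x = 0 \<or> c x = 1"
  by (rule two_cases) (use PiE_mem[OF inv_colouringsD(1)[OF assms(1)] assms(2)] in blast)

lemma card_two_colours:
  assumes X: "finite X" and c0: "\<And>x. x \<in> X \<Longrightarrow> c0 x = 0 \<or> c0 x = (1 :: nat)"
  shows "card {x \<in> X. c x = i} = card {x \<in> X. c x = i \<and> c0 x = 0} + card {x \<in> X. c x = i \<and> c0 x = 1}"
proof -
  have "{x \<in> X. c x = i} = {x \<in> X. c x = i \<and> c0 x = 0} \<union> {x \<in> X. c x = i \<and> c0 x = 1}" using c0 by blast
  then have "card {x \<in> X. c x = i} = card ({x \<in> X. c x = i \<and> c0 x = 0} \<union> {x \<in> X. c x = i \<and> c0 x = 1})" by (rule arg_cong)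
  also have "\<dots> = card {x \<in> X. c x = i \<and> c0 x = 0} + card {x \<in> X. c x = i \<and> c0 x = 1}"
    by (rule card_Un_disjoint) (use X in auto)
  finally show ?thesis .
qed

text \<open>For fixed \<open>c\<close>, a compatible \<open>c0\<close> is nothing but an independent
  choice of an invariant two-colouring, with prescribed sizes, on every class of \<open>c\<close>.
  The summand is a product over the classes, so the sum becomes a product of sums.\<close>

lemma sum_compatible:
  assumes X: "finite X" and p: "\<And>x. x \<in> X \<Longrightarrow> p x \<in> X" and l: "length rs = length ks"
    and c: "c \<in> inv_colourings X (map2 (+) ks rs) p"
  shows "(\<Sum>c0 | c0 \<in> inv_colourings X [sum_list ks, sum_list rs] p \<and> compatible X ks rs c0 c.
      \<Prod>i<length ks. h i {x \<in> X. c x = i \<and> c0 x = 0} {x \<in> X. c x = i \<and> c0 x = 1}) =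
    (\<Prod>i<length ks. \<Sum>d\<in>inv_colourings {x \<in> X. c x = i} [ks ! i, rs ! i] p.
      (h i {x \<in> {x \<in> X. c x = i}. d x = 0} {x \<in> {x \<in> X. c x = i}. d x = 1} :: complex))"
proof -
  let ?C = "\<lambda>i. {x \<in> X. c x = i}" and ?l = "length ks"
  let ?D = "\<Pi>\<^sub>E i\<in>{..<?l}. inv_colourings (?C i) [ks ! i, rs ! i] p"
  have len: "length (map2 (+) ks rs) = ?l" using l by simp
  note cX = inv_colouringsD(1)[OF c, unfolded len] and cp = inv_colouringsD(3)[OF c]
  have cl: "c x \<in> {..<?l}" if "x \<in> X" for x by (rule PiE_mem[OF cX that])
  have sum_nth: "(\<Sum>i<?l. ks ! i) = sum_list ks" "(\<Sum>i<?l. rs ! i) = sum_list rs"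
    using l by (simp_all add: sum_list_sum_nth atLeast0LessThan)
  have "(\<Sum>c0 | c0 \<in> inv_colourings X [sum_list ks, sum_list rs] p \<and> compatible X ks rs c0 c.
      \<Prod>i<?l. h i {x \<in> X. c x = i \<and> c0 x = 0} {x \<in> X. c x = i \<and> c0 x = 1}) =
    (\<Sum>D\<in>?D. \<Prod>i<?l. h i {x \<in> ?C i. D i x = 0} {x \<in> ?C i. D i x = 1})"
  proof (rule sum.reindex_bij_witness[where j = "\<lambda>c0. \<lambda>i\<in>{..<?l}. \<lambda>x\<in>?C i. c0 x" and i = "\<lambda>D. \<lambda>x\<in>X. D (c x) x"])
    fix c0 assume "c0 \<in> {c0. c0 \<in> inv_colourings X [sum_list ks, sum_list rs] p \<and> compatible X ks rs c0 c}"
    then have c0: "c0 \<in> inv_colourings X [sum_list ks, sum_list rs] p" and comp: "compatible X ks rs c0 c" by blast+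
    note m = inv_colouringsD[OF c0]
    let ?E = "\<lambda>i\<in>{..<?l}. \<lambda>x\<in>?C i. c0 x"
    have E: "?E i = (\<lambda>x\<in>?C i. c0 x)" if "i < ?l" for i using that by simp
    have Ex: "?E (c x) x = c0 x" if x: "x \<in> X" for x
      unfolding restrict_apply'[OF cl[OF x]] by (rule restrict_apply') (use x in blast)
    show "(\<lambda>x\<in>X. ?E (c x) x) = c0"
      by (rule PiE_ext[OF restrict_PiE_memI m(1)])
        (unfold restrict_apply', use Ex PiE_mem[OF m(1)] in \<open>simp_all only:\<close>)
    have set: "{x \<in> ?C i. ?E i x = m} = {x \<in> X. c x = i \<and> c0 x = m}" if "i < ?l" for i m
      unfolding E[OF that] by auto
    show "?E \<in> ?D"
    proof (rule restrict_PiE_memI)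
      fix i assume "i \<in> {..<?l}"
      then have i: "i < ?l" by simp
      show "(\<lambda>x\<in>?C i. c0 x) \<in> inv_colourings (?C i) [ks ! i, rs ! i] p"
      proof (rule inv_colouringsI)
        show "(\<lambda>x\<in>?C i. c0 x) \<in> ?C i \<rightarrow>\<^sub>E {..<length [ks ! i, rs ! i]}"
          by (rule restrict_PiE_memI) (use PiE_mem[OF m(1)] in auto)
        show "card {x \<in> ?C i. (\<lambda>x\<in>?C i. c0 x) x = n} = [ks ! i, rs ! i] ! n" if "n < length [ks ! i, rs ! i]" for n
          using two_cases[OF that] compatibleD[OF comp i] set[OF i, unfolded E[OF i]] by auto
        show "(\<lambda>x\<in>?C i. c0 x) (p x) = (\<lambda>x\<in>?C i. c0 x) x" if "x \<in> ?C i" for x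
          using that p cp m(3) by auto
      qed
    qed
    show "(\<Prod>i<?l. h i {x \<in> ?C i. ?E i x = 0} {x \<in> ?C i. ?E i x = 1}) =
        (\<Prod>i<?l. h i {x \<in> X. c x = i \<and> c0 x = 0} {x \<in> X. c x = i \<and> c0 x = 1})"
      by (rule prod.cong[OF refl], subst (1 2) set) simp_all
  next
    fix D assume D: "D \<in> ?D"
    let ?c = "\<lambda>x\<in>X. D (c x) x"
    have Di: "D i \<in> inv_colourings (?C i) [ks ! i, rs ! i] p" if "i < ?l" for i
      by (rule PiE_mem[OF D]) (use that in simp)
    have Dc: "D (c x) x < length [sum_list ks, sum_list rs]" "D (c x) (p x) = D (c x) x" if x: "x \<in> X" for x
    proof -
      have i: "c x < ?l" and x': "x \<in> ?C (c x)" using cl[OF x] x by simp_all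
      show "D (c x) x < length [sum_list ks, sum_list rs]" using PiE_mem[OF inv_colouringsD(1)[OF Di[OF i]] x'] by simp
      show "D (c x) (p x) = D (c x) x" by (rule inv_colouringsD(3)[OF Di[OF i] x'])
    qed
    have set: "{x \<in> X. c x = i \<and> ?c x = m} = {x \<in> ?C i. D i x = m}" for i m by auto
    have cnt: "card {x \<in> X. c x = i \<and> ?c x = 0} = ks ! i" "card {x \<in> X. c x = i \<and> ?c x = 1} = rs ! i" if i: "i < ?l" for i
      unfolding set using inv_colouringsD(2)[OF Di[OF i] two_less(1)] inv_colouringsD(2)[OF Di[OF i] two_less(2)]
      unfolding nth_two .
    have "?c \<in> inv_colourings X [sum_list ks, sum_list rs] p"
    proof (rule inv_colouringsI)
      show "?c \<in> X \<rightarrow>\<^sub>E {..<length [sum_list ks, sum_list rs]}"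
        by (rule restrict_PiE_memI) (use Dc(1) in blast)
      \<comment> \<open>The global class sizes follow from the local ones, by adding up over the
        classes of \<open>c\<close>.\<close>
      have "card {x \<in> X. ?c x = 0} = sum_list ks" "card {x \<in> X. ?c x = 1} = sum_list rs"
        unfolding card_by_colour[OF X cX, of "\<lambda>x. ?c x = 0"] card_by_colour[OF X cX, of "\<lambda>x. ?c x = 1"] sum_nth[symmetric]
        by (rule sum.cong[OF refl], rule cnt, simp)+
      then show "card {x \<in> X. ?c x = m} = [sum_list ks, sum_list rs] ! m" if "m < length [sum_list ks, sum_list rs]" for m
        using two_cases[OF that] by (elim disjE) (simp_all only: nth_two)
      show "?c (p x) = ?c x" if "x \<in> X" for x using that p cp Dc(2) by simp
    qed
    moreover have "compatible X ks rs ?c c" unfolding compatible_def using cnt by blast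
    ultimately show "?c \<in> {c0. c0 \<in> inv_colourings X [sum_list ks, sum_list rs] p \<and> compatible X ks rs c0 c}" by blast
    have r: "(\<lambda>x\<in>?C i. ?c x) = D i" if i: "i < ?l" for i
      by (rule PiE_ext[OF restrict_PiE_memI inv_colouringsD(1)[OF Di[OF i]]])
        (use PiE_mem[OF inv_colouringsD(1)[OF Di[OF i]]] in auto)
    show "(\<lambda>i\<in>{..<?l}. \<lambda>x\<in>?C i. ?c x) = D"
      by (rule PiE_ext[OF restrict_PiE_memI D]) (use r Di in \<open>simp_all only: lessThan_iff restrict_apply'\<close>)
  qed
  also have "\<dots> = (\<Prod>i<?l. \<Sum>d\<in>inv_colourings (?C i) [ks ! i, rs ! i] p. h i {x \<in> ?C i. d x = 0} {x \<in> ?C i. d x = 1})"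
    by (rule prod_sum_PiE[symmetric]) (simp_all add: finite_inv_colourings X)
  finally show ?thesis .
qed

section \<open>Comparison of the two orders of summation\<close>

context wreath_reps
begin

text \<open>For fixed \<open>c0\<close>, colouring its two classes separately is the same as one
  compatible colouring of \<open>X\<close>, whose class sizes are the sums. The tensor characters of
  the two pieces multiply because \<open>p\<close> preserves them.\<close>

lemma phi_char_product:
  assumes X: "finite X" and p: "\<And>x. x \<in> X \<Longrightarrow> p x \<in> X" and l: "length \<Delta> = length \<Lambda>"
    and ks: "map sum_list \<Lambda> = ks" and rs: "map sum_list \<Delta> = rs"
    and c0: "c0 \<in> inv_colourings X [k, r] p"
  shows "phi_char {x \<in> X. c0 x = 0} \<Lambda> f p * phi_char {x \<in> X. c0 x = 1} \<Delta> f p =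
    (\<Sum>c | c \<in> inv_colourings X (map2 (+) ks rs) p \<and> compatible X ks rs c0 c. tensor_char X c f p *
      (\<Prod>i<length ks. specht_char (\<Lambda> ! i) {x \<in> X. c x = i \<and> c0 x = 0} p * specht_char (\<Delta> ! i) {x \<in> X. c x = i \<and> c0 x = 1} p))"
proof -
  define A where "A = {x \<in> X. c0 x = 0}"
  define B where "B = {x \<in> X. c0 x = 1}"
  let ?l = "length ks" and ?T = "inv_colourings A ks p \<times> inv_colourings B rs p"
  have len: "length \<Lambda> = ?l" "length \<Delta> = ?l" "length rs = ?l" "length (map2 (+) ks rs) = ?l" using l ks rs by auto
  have AB: "X = A \<union> B" "A \<inter> B = {}" unfolding A_def B_def using two_colours[OF c0] by auto
  have pA: "p x \<in> A" if "x \<in> A" for x using that p inv_colouringsD(3)[OF c0] by (simp add: A_def)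
  have pB: "p x \<in> B" if "x \<in> B" for x using that p inv_colouringsD(3)[OF c0] by (simp add: B_def)
  let ?a = "\<lambda>c. tensor_char A c f p * (\<Prod>i<?l. specht_char (\<Lambda> ! i) {x \<in> A. c x = i} p)"
  let ?b = "\<lambda>c. tensor_char B c f p * (\<Prod>i<?l. specht_char (\<Delta> ! i) {x \<in> B. c x = i} p)"
  have set: "{x \<in> X. c x = i \<and> c0 x = 0} = {x \<in> A. c x = i}" "{x \<in> X. c x = i \<and> c0 x = 1} = {x \<in> B. c x = i}" for c i
    unfolding A_def B_def by auto
  have rset: "{x \<in> Z. restrict c Z x = i} = {x \<in> Z. c x = i}" for c and Z :: "nat set" and i by auto
  have "(\<Sum>c | c \<in> inv_colourings X (map2 (+) ks rs) p \<and> compatible X ks rs c0 c. tensor_char X c f p *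
      (\<Prod>i<?l. specht_char (\<Lambda> ! i) {x \<in> X. c x = i \<and> c0 x = 0} p * specht_char (\<Delta> ! i) {x \<in> X. c x = i \<and> c0 x = 1} p)) =
    (\<Sum>(c1, c2)\<in>?T. ?a c1 * ?b c2)"
    unfolding set
  proof (rule sum.reindex_bij_witness[where j = "\<lambda>c. (restrict c A, restrict c B)" and
        i = "\<lambda>(c1, c2). \<lambda>x\<in>X. if x \<in> A then c1 x else c2 x"])
    fix c assume "c \<in> {c. c \<in> inv_colourings X (map2 (+) ks rs) p \<and> compatible X ks rs c0 c}"
    then have c: "c \<in> inv_colourings X (map2 (+) ks rs) p" and comp: "compatible X ks rs c0 c" by blast+
    note m = inv_colouringsD[OF c, unfolded len]
    show "(case (restrict c A, restrict c B) of (c1, c2) \<Rightarrow> \<lambda>x\<in>X. if x \<in> A then c1 x else c2 x) = c"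
      unfolding prod.case by (rule PiE_ext[OF restrict_PiE_memI m(1)]) (use PiE_mem[OF m(1)] AB(1) in auto)
    have "restrict c A \<in> inv_colourings A ks p"
    proof (rule inv_colouringsI)
      show "restrict c A \<in> A \<rightarrow>\<^sub>E {..<?l}" by (rule restrict_PiE_memI, rule PiE_mem[OF m(1)]) (use AB(1) in blast)
      show "card {x \<in> A. restrict c A x = i} = ks ! i" if "i < ?l" for i
        unfolding rset by (rule compatibleD(1)[OF comp that, unfolded set])
      show "restrict c A (p x) = restrict c A x" if "x \<in> A" for x
        unfolding restrict_apply'[OF that] restrict_apply'[OF pA[OF that]] by (rule m(3)) (use that AB(1) in blast)
    qed
    moreover have "restrict c B \<in> inv_colourings B rs p"
    proof (rule inv_colouringsI, unfold len)
      show "restrict c B \<in> B \<rightarrow>\<^sub>E {..<?l}" by (rule restrict_PiE_memI, rule PiE_mem[OF m(1)]) (use AB(1) in blast)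
      show "card {x \<in> B. restrict c B x = i} = rs ! i" if "i < ?l" for i
        unfolding rset by (rule compatibleD(2)[OF comp that, unfolded set])
      show "restrict c B (p x) = restrict c B x" if "x \<in> B" for x
        unfolding restrict_apply'[OF that] restrict_apply'[OF pB[OF that]] by (rule m(3)) (use that AB(1) in blast)
    qed
    ultimately show "(restrict c A, restrict c B) \<in> ?T" by (rule SigmaI)
    have "tensor_char A (restrict c A) f p = tensor_char A c f p" "tensor_char B (restrict c B) f p = tensor_char B c f p"
      by (rule tensor_char_cong, rule restrict_apply', assumption)+
    moreover have "tensor_char X c f p = tensor_char A c f p * tensor_char B c f p"
      by (rule tensor_char_union[OF X AB pA pB])
    ultimately show "(case (restrict c A, restrict c B) of (c1, c2) \<Rightarrow> ?a c1 * ?b c2) =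
        tensor_char X c f p * (\<Prod>i<?l. specht_char (\<Lambda> ! i) {x \<in> A. c x = i} p * specht_char (\<Delta> ! i) {x \<in> B. c x = i} p)"
      unfolding prod.case rset prod.distrib by (simp only: mult_ac)
  next
    fix z assume "z \<in> ?T"
    then obtain c1 c2 where z: "z = (c1, c2)" and c1: "c1 \<in> inv_colourings A ks p" and c2: "c2 \<in> inv_colourings B rs p"
      by (rule SigmaE)
    note m1 = inv_colouringsD[OF c1] and m2 = inv_colouringsD[OF c2, unfolded len]
    let ?c = "\<lambda>x\<in>X. if x \<in> A then c1 x else c2 x"
    have cA: "?c x = c1 x" if "x \<in> A" for x using that AB by auto
    have cB: "?c x = c2 x" if "x \<in> B" for x using that AB by auto
    have sA: "{x \<in> A. ?c x = i} = {x \<in> A. c1 x = i}" for i by (rule Collect_cong) (use cA in metis)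
    have sB: "{x \<in> B. ?c x = i} = {x \<in> B. c2 x = i}" for i by (rule Collect_cong) (use cB in metis)
    have comp: "compatible X ks rs c0 ?c"
      unfolding compatible_def set sA sB using m1(2) m2(2) by blast
    have "?c \<in> inv_colourings X (map2 (+) ks rs) p"
    proof (rule inv_colouringsI, unfold len)
      show "?c \<in> X \<rightarrow>\<^sub>E {..<?l}"
        by (rule restrict_PiE_memI) (use PiE_mem[OF m1(1)] PiE_mem[OF m2(1)] AB(1) in auto)
      show "card {x \<in> X. ?c x = i} = map2 (+) ks rs ! i" if i: "i < ?l" for i
      proof -
        have "card {x \<in> X. ?c x = i} = card {x \<in> X. ?c x = i \<and> c0 x = 0} + card {x \<in> X. ?c x = i \<and> c0 x = 1}"
          by (rule card_two_colours[OF X two_colours[OF c0]])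
        then show ?thesis unfolding compatibleD[OF comp i] using i len(3) by simp
      qed
      show "?c (p x) = ?c x" if "x \<in> X" for x
      proof (cases "x \<in> A")
        case True
        then show ?thesis unfolding cA[OF pA[OF True]] cA[OF True] by (rule m1(3))
      next
        case False
        then have x: "x \<in> B" using that AB(1) by blast
        then show ?thesis unfolding cB[OF pB[OF x]] cB[OF x] by (rule m2(3))
      qed
    qed
    then show "(case z of (c1, c2) \<Rightarrow> \<lambda>x\<in>X. if x \<in> A then c1 x else c2 x) \<in>
        {c. c \<in> inv_colourings X (map2 (+) ks rs) p \<and> compatible X ks rs c0 c}"
      unfolding z prod.case using comp by blast
    have "restrict ?c A = c1"
      by (rule PiE_ext[OF restrict_PiE_memI m1(1)]) (use cA PiE_mem[OF m1(1)] in \<open>simp_all only: restrict_apply'\<close>)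
    moreover have "restrict ?c B = c2"
      by (rule PiE_ext[OF restrict_PiE_memI m2(1)]) (use cB PiE_mem[OF m2(1)] in \<open>simp_all only: restrict_apply'\<close>)
    ultimately show "(restrict (case z of (c1, c2) \<Rightarrow> \<lambda>x\<in>X. if x \<in> A then c1 x else c2 x) A,
        restrict (case z of (c1, c2) \<Rightarrow> \<lambda>x\<in>X. if x \<in> A then c1 x else c2 x) B) = z"
      unfolding z prod.case by (simp only:)
  qed
  also have "\<dots> = phi_char A \<Lambda> f p * phi_char B \<Delta> f p"
    unfolding phi_char_def ks rs len sum_product sum.cartesian_product ..
  finally show ?thesis unfolding A_def B_def by (rule sym)
qed

text \<open>All \<open>\<Gamma>\<close> range over the same colourings, since their sizes are those
  of \<open>map2 (+) ks rs\<close>. The sum over \<open>\<Gamma>\<close> can thus be moved inside,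
  where it factorises over the colours and \<open>lr_coeff_sum\<close> evaluates it on each
  class.\<close>

lemma sum_lr_phi_char:
  assumes X: "finite X" and p: "bij_betw p X X" and l: "length \<Delta> = length \<Lambda>"
    and ks: "map sum_list \<Lambda> = ks" and rs: "map sum_list \<Delta> = rs"
  shows "(\<Sum>\<Gamma> | \<Gamma> \<tturnstile> map2 (+) ks rs. of_nat (\<Prod>i<length ks. lr_coeff (\<Lambda> ! i) (\<Delta> ! i) (\<Gamma> ! i)) * phi_char X \<Gamma> f p) =
    (\<Sum>c\<in>inv_colourings X (map2 (+) ks rs) p. tensor_char X c f p *
      (\<Prod>i<length ks. \<Sum>d\<in>inv_colourings {x \<in> X. c x = i} [ks ! i, rs ! i] p.
        specht_char (\<Lambda> ! i) {x \<in> {x \<in> X. c x = i}. d x = 0} p * specht_char (\<Delta> ! i) {x \<in> {x \<in> X. c x = i}. d x = 1} p))"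
proof -
  let ?l = "length ks" and ?ns = "map2 (+) ks rs"
  let ?lr = "\<lambda>i \<gamma>. of_nat (lr_coeff (\<Lambda> ! i) (\<Delta> ! i) \<gamma>) :: complex"
  have len: "length \<Lambda> = ?l" "length \<Delta> = ?l" "length rs = ?l" "length ?ns = ?l" using l ks rs by auto
  have nth: "ks ! i = sum_list (\<Lambda> ! i)" "rs ! i = sum_list (\<Delta> ! i)" "?ns ! i = sum_list (\<Lambda> ! i) + sum_list (\<Delta> ! i)"
    if i: "i < ?l" for i
  proof -
    have "i < length \<Lambda>" "i < length \<Delta>" unfolding len by (rule i)+
    then show k: "ks ! i = sum_list (\<Lambda> ! i)" and r: "rs ! i = sum_list (\<Delta> ! i)"
      unfolding ks[symmetric] rs[symmetric] by (simp_all only: nth_map)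
    show "?ns ! i = sum_list (\<Lambda> ! i) + sum_list (\<Delta> ! i)"
      unfolding k[symmetric] r[symmetric] using i len(3) by simp
  qed
  have "(\<Sum>\<Gamma> | \<Gamma> \<tturnstile> ?ns. of_nat (\<Prod>i<?l. lr_coeff (\<Lambda> ! i) (\<Delta> ! i) (\<Gamma> ! i)) * phi_char X \<Gamma> f p) =
    (\<Sum>\<Gamma> | \<Gamma> \<tturnstile> ?ns. \<Sum>c\<in>inv_colourings X ?ns p. tensor_char X c f p *
       (\<Prod>i<length ?ns. ?lr i (\<Gamma> ! i) * specht_char (\<Gamma> ! i) {x \<in> X. c x = i} p))"
  proof (rule sum.cong[OF refl])
    fix \<Gamma> assume "\<Gamma> \<in> {\<Gamma>. \<Gamma> \<tturnstile> ?ns}"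
    then have \<Gamma>: "length \<Gamma> = length ?ns" "\<And>i. i < length ?ns \<Longrightarrow> sum_list (\<Gamma> ! i) = ?ns ! i"
      unfolding multipartition_of_def partition_of_def mem_Collect_eq by blast+
    have "map sum_list \<Gamma> = ?ns" by (rule nth_equalityI) (use \<Gamma> in simp_all)
    then show "of_nat (\<Prod>i<?l. lr_coeff (\<Lambda> ! i) (\<Delta> ! i) (\<Gamma> ! i)) * phi_char X \<Gamma> f p =
      (\<Sum>c\<in>inv_colourings X ?ns p. tensor_char X c f p *
       (\<Prod>i<length ?ns. ?lr i (\<Gamma> ! i) * specht_char (\<Gamma> ! i) {x \<in> X. c x = i} p))"
      unfolding phi_char_def \<Gamma>(1) len(4) sum_distrib_left prod.distrib of_nat_prod by (simp only: mult_ac)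
  qed
  also have "\<dots> = (\<Sum>c\<in>inv_colourings X ?ns p. tensor_char X c f p *
       (\<Sum>\<Gamma> | \<Gamma> \<tturnstile> ?ns. \<Prod>i<length ?ns. ?lr i (\<Gamma> ! i) * specht_char (\<Gamma> ! i) {x \<in> X. c x = i} p))"
    unfolding sum_distrib_left by (rule sum.swap)
  also have "\<dots> = (\<Sum>c\<in>inv_colourings X ?ns p. tensor_char X c f p *
       (\<Prod>i<length ?ns. \<Sum>\<gamma> | partition_of \<gamma> (?ns ! i). ?lr i \<gamma> * specht_char \<gamma> {x \<in> X. c x = i} p))"
    unfolding sum_multipartitions[where ns = ?ns and h = "\<lambda>i \<gamma>. ?lr i \<gamma> * specht_char \<gamma> {x \<in> X. c x = i} p" for c] ..
  also have "\<dots> = (\<Sum>c\<in>inv_colourings X ?ns p. tensor_char X c f p *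
      (\<Prod>i<?l. \<Sum>d\<in>inv_colourings {x \<in> X. c x = i} [ks ! i, rs ! i] p.
        specht_char (\<Lambda> ! i) {x \<in> {x \<in> X. c x = i}. d x = 0} p * specht_char (\<Delta> ! i) {x \<in> {x \<in> X. c x = i}. d x = 1} p))"
    unfolding len(4)
  proof (rule sum.cong[OF refl], rule arg_cong2[where f = "(*)", OF refl], rule prod.cong[OF refl])
    fix c i assume c: "c \<in> inv_colourings X ?ns p" and "i \<in> {..<?l}"
    then have i: "i < ?l" by simp
    have "finite {x \<in> X. c x = i}" using X by simp
    moreover have "card {x \<in> X. c x = i} = sum_list (\<Lambda> ! i) + sum_list (\<Delta> ! i)"
      using inv_colouringsD(2)[OF c, unfolded len, OF i] unfolding nth(3)[OF i] .
    moreover have "bij_betw p {x \<in> X. c x = i} {x \<in> X. c x = i}"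
      by (rule colour_class_bij[OF p X], rule inv_colouringsD(3)[OF c])
    ultimately show "(\<Sum>\<gamma> | partition_of \<gamma> (?ns ! i). ?lr i \<gamma> * specht_char \<gamma> {x \<in> X. c x = i} p) =
      (\<Sum>d\<in>inv_colourings {x \<in> X. c x = i} [ks ! i, rs ! i] p.
        specht_char (\<Lambda> ! i) {x \<in> {x \<in> X. c x = i}. d x = 0} p * specht_char (\<Delta> ! i) {x \<in> {x \<in> X. c x = i}. d x = 1} p)"
      unfolding nth[OF i] by (rule lr_coeff_sum)
  qed
  finally show ?thesis .
qed

text \<open>Pairs of a splitting \<open>c0\<close> and a compatible colouring \<open>c\<close> are
  counted once with \<open>c0\<close> outside and once with \<open>c\<close> outside; the latter
  order meets the expansion of \<open>sum_lr_phi_char\<close>.\<close>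

lemma sum_phi_char_product:
  assumes X: "finite X" and p: "bij_betw p X X" and l: "length \<Delta> = length \<Lambda>"
    and ks: "map sum_list \<Lambda> = ks" and rs: "map sum_list \<Delta> = rs"
  shows "(\<Sum>c\<in>inv_colourings X [sum_list ks, sum_list rs] p.
      phi_char {x \<in> X. c x = 0} \<Lambda> f p * phi_char {x \<in> X. c x = 1} \<Delta> f p) =
    (\<Sum>\<Gamma> | \<Gamma> \<tturnstile> map2 (+) ks rs. of_nat (\<Prod>i<length ks. lr_coeff (\<Lambda> ! i) (\<Delta> ! i) (\<Gamma> ! i)) * phi_char X \<Gamma> f p)"
proof -
  let ?A = "inv_colourings X [sum_list ks, sum_list rs] p" and ?B = "inv_colourings X (map2 (+) ks rs) p"
  let ?h = "\<lambda>i A B. specht_char (\<Lambda> ! i) A p * specht_char (\<Delta> ! i) B p"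
  let ?g = "\<lambda>c0 c. tensor_char X c f p * (\<Prod>i<length ks. ?h i {x \<in> X. c x = i \<and> c0 x = 0} {x \<in> X. c x = i \<and> c0 x = 1})"
  note pX = bij_betw_mem[OF p]
  have len: "length rs = length ks" using l ks rs by auto
  have "(\<Sum>c\<in>?A. phi_char {x \<in> X. c x = 0} \<Lambda> f p * phi_char {x \<in> X. c x = 1} \<Delta> f p) =
      (\<Sum>c0\<in>?A. \<Sum>c | c \<in> ?B \<and> compatible X ks rs c0 c. ?g c0 c)"
    by (rule sum.cong[OF refl], rule phi_char_product[where p = p, OF X pX l ks rs])
  also have "\<dots> = (\<Sum>c\<in>?B. \<Sum>c0 | c0 \<in> ?A \<and> compatible X ks rs c0 c. ?g c0 c)"
    by (rule sum.swap_restrict) (rule finite_inv_colourings[OF X])+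
  also have "\<dots> = (\<Sum>c\<in>?B. tensor_char X c f p *
      (\<Prod>i<length ks. \<Sum>d\<in>inv_colourings {x \<in> X. c x = i} [ks ! i, rs ! i] p.
        ?h i {x \<in> {x \<in> X. c x = i}. d x = 0} {x \<in> {x \<in> X. c x = i}. d x = 1}))"
  proof (rule sum.cong[OF refl])
    fix c assume c: "c \<in> ?B"
    have "(\<Sum>c0 | c0 \<in> ?A \<and> compatible X ks rs c0 c. ?g c0 c) = tensor_char X c f p *
      (\<Sum>c0 | c0 \<in> ?A \<and> compatible X ks rs c0 c. \<Prod>i<length ks. ?h i {x \<in> X. c x = i \<and> c0 x = 0} {x \<in> X. c x = i \<and> c0 x = 1})"
      by (rule sum_distrib_left[symmetric])
    also have "\<dots> = tensor_char X c f p * (\<Prod>i<length ks. \<Sum>d\<in>inv_colourings {x \<in> X. c x = i} [ks ! i, rs ! i] p.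
        ?h i {x \<in> {x \<in> X. c x = i}. d x = 0} {x \<in> {x \<in> X. c x = i}. d x = 1})"
      by (rule arg_cong2[where f = "(*)", OF refl], rule sum_compatible[where h = ?h and p = p and X = X, OF X pX len c])
    finally show "(\<Sum>c0 | c0 \<in> ?A \<and> compatible X ks rs c0 c. ?g c0 c) = tensor_char X c f p *
      (\<Prod>i<length ks. \<Sum>d\<in>inv_colourings {x \<in> X. c x = i} [ks ! i, rs ! i] p.
        ?h i {x \<in> {x \<in> X. c x = i}. d x = 0} {x \<in> {x \<in> X. c x = i}. d x = 1})" .
  qed
  finally show ?thesis unfolding sum_lr_phi_char[OF X p l ks rs] .
qed

end

lemma sum_list_map2_add:
  fixes xs ys :: "nat list"
  shows "length xs = length ys \<Longrightarrow> sum_list (map2 (+) xs ys) = sum_list xs + sum_list ys"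
  by (induction xs ys rule: list_induct2) simp_all

theorem theorem4p5:
  fixes F :: "('f, 'm) monoid_scheme"
    and U :: "('f, 'u) rep list"
    and ks rs :: "nat list" and k r :: nat
    and \<Lambda> \<Delta> :: "nat list list"
  assumes "group F" and "finite (carrier F)"
    and "irr_list F U"
    and "length ks = length U" and "sum_list ks = k"
    and "length rs = length U" and "sum_list rs = r"
    and "\<Lambda> \<tturnstile> ks" and "\<Delta> \<tturnstile> rs"
  shows "rep_iso (wreath_sym F (k + r))
           (Ind (wreath_sym F (k + r)) (wreath_sub F (k + r) (young [k, r]))
             (pullback (wreath_split k r) (Phi F U \<Lambda> \<boxtimes> Phi F U \<Delta>)))
           (direct_sum {\<Gamma>. \<Gamma> \<tturnstile> map2 (+) ks rs}
             (\<lambda>\<Gamma>. copies (\<Prod>i<length U. lr_coeff (\<Lambda> ! i) (\<Delta> ! i) (\<Gamma> ! i)) (Phi F U \<Gamma>)))"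
proof -
  have U: "representation F (U ! i)" if "i < length U" for i
    using assms(3) that unfolding irr_list_def irreducible_rep_def by blast
  have "\<exists>P b. coords (vspace (U ! i)) P b" if "i < length U" for i
    using fdim_coords[OF repD(1)[OF U[OF that]]] by blast
  \<comment> \<open>The locale takes the coordinates as functions of the index, so they are chosen
    for all \<open>i\<close> at once, first the points and then the dual bases.\<close>
  then have "\<exists>P. \<forall>i. i < length U \<longrightarrow> (\<exists>b. coords (vspace (U ! i)) (P i) b)" by (intro choice) blast
  then obtain P where "\<forall>i. i < length U \<longrightarrow> (\<exists>b. coords (vspace (U ! i)) (P i) b)" by (rule exE)
  then have "\<exists>b. \<forall>i. i < length U \<longrightarrow> coords (vspace (U ! i)) (P i) (b i)" by (intro choice) blast
  then obtain b where Pb: "\<forall>i. i < length U \<longrightarrow> coords (vspace (U ! i)) (P i) (b i)" by (rule exE)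
  interpret wreath_reps F U P b
    by (rule wreath_reps.intro[OF assms(1,2) U Pb[rule_format]])
  let ?G = "wreath_sym F (k + r)" and ?X = "{1..k + r}" and ?ns = "map2 (+) ks rs"
  have mp: "length \<Gamma> = length ns" "map sum_list \<Gamma> = ns" if "\<Gamma> \<tturnstile> ns" for \<Gamma> ns
  proof -
    have \<Gamma>: "length \<Gamma> = length ns" "\<And>i. i < length ns \<Longrightarrow> sum_list (\<Gamma> ! i) = ns ! i"
      using that unfolding multipartition_of_def partition_of_def by blast+
    show "length \<Gamma> = length ns" by (rule \<Gamma>(1))
    show "map sum_list \<Gamma> = ns" by (rule nth_equalityI) (use \<Gamma> in simp_all)
  qed
  have ns: "length ?ns = length U" "sum_list ?ns = k + r"
    using assms(4-7) sum_list_map2_add[of ks rs] by simp_all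
  note \<Lambda> = mp[OF assms(8)] and \<Delta> = mp[OF assms(9)]
  have l: "length \<Lambda> = length U" "length \<Delta> = length U" using \<Lambda>(1) \<Delta>(1) assms(4,6) by simp_all
  have kr: "sum_list (map sum_list \<Lambda>) = k" "sum_list (map sum_list \<Delta>) = r"
    unfolding \<Lambda>(2) \<Delta>(2) by (fact assms)+
  note lhs = ind_Phi_product[OF l kr]
  have Phi_G: "representation ?G (Phi F U \<Gamma>)" "(f, p) \<in> carrier ?G \<Longrightarrow> character (Phi F U \<Gamma>) (f, p) = phi_char ?X \<Gamma> f p"
    if "\<Gamma> \<in> {\<Gamma>. \<Gamma> \<tturnstile> ?ns}" for \<Gamma> f p
  proof -
    have "\<Gamma> \<tturnstile> ?ns" using that by (rule CollectD)
    note \<Gamma> = mp[OF this, unfolded ns(1)]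
    note Phi = Phi[OF \<Gamma>(1), unfolded \<Gamma>(2) ns(2)]
    show "representation ?G (Phi F U \<Gamma>)" by (rule Phi(1))
    show "character (Phi F U \<Gamma>) (f, p) = phi_char ?X \<Gamma> f p" if "(f, p) \<in> carrier ?G" by (rule Phi(2)[OF that])
  qed
  let ?m = "\<lambda>\<Gamma>. \<Prod>i<length U. lr_coeff (\<Lambda> ! i) (\<Delta> ! i) (\<Gamma> ! i)"
  have R: "representation ?G (copies (?m \<Gamma>) (Phi F U \<Gamma>))" if "\<Gamma> \<in> {\<Gamma>. \<Gamma> \<tturnstile> ?ns}" for \<Gamma>
    by (rule copies(1)[OF Phi_G(1)[OF that]])
  note rhs = direct_sum[where R = "\<lambda>\<Gamma>. copies (?m \<Gamma>) (Phi F U \<Gamma>)" and J = "{\<Gamma>. \<Gamma> \<tturnstile> ?ns}", OF finite_multipartitions R]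
  show ?thesis
  proof (rule fin_group.character_eq_imp_rep_iso[OF wreath_sym_fin_group[OF assms(1,2)] lhs(1) rhs(1)])
    fix g assume g: "g \<in> carrier ?G"
    obtain f p where e: "g = (f, p)" by (cases g)
    note fp = g[unfolded e]
    have p: "bij_betw p ?X ?X" using fp unfolding wreath_sym_carrier by (intro permutes_imp_bij) blast
    have "character (direct_sum {\<Gamma>. \<Gamma> \<tturnstile> ?ns} (\<lambda>\<Gamma>. copies (?m \<Gamma>) (Phi F U \<Gamma>))) g =
        (\<Sum>\<Gamma> | \<Gamma> \<tturnstile> ?ns. character (copies (?m \<Gamma>) (Phi F U \<Gamma>)) g)"
      by (rule rhs(2)[OF _ g])
    also have "\<dots> = (\<Sum>\<Gamma> | \<Gamma> \<tturnstile> ?ns. of_nat (\<Prod>i<length ks. lr_coeff (\<Lambda> ! i) (\<Delta> ! i) (\<Gamma> ! i)) * phi_char ?X \<Gamma> f p)"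
    proof (rule sum.cong[OF refl])
      fix \<Gamma> assume \<Gamma>: "\<Gamma> \<in> {\<Gamma>. \<Gamma> \<tturnstile> ?ns}"
      show "character (copies (?m \<Gamma>) (Phi F U \<Gamma>)) g =
          of_nat (\<Prod>i<length ks. lr_coeff (\<Lambda> ! i) (\<Delta> ! i) (\<Gamma> ! i)) * phi_char ?X \<Gamma> f p"
        unfolding copies(2)[OF Phi_G(1)[OF \<Gamma>] g] unfolding e Phi_G(2)[OF \<Gamma> fp] assms(4) ..
    qed
    also have "\<dots> = character (Ind ?G (wreath_sub F (k + r) (young [k, r]))
        (pullback (wreath_split k r) (Phi F U \<Lambda> \<boxtimes> Phi F U \<Delta>))) g"
      unfolding e lhs(2)[OF fp]
      using sum_phi_char_product[where X = ?X, OF finite_atLeastAtMost p _ \<Lambda>(2) \<Delta>(2)] l assms(5,7) by simp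
    finally show "character (Ind ?G (wreath_sub F (k + r) (young [k, r])) (pullback (wreath_split k r) (Phi F U \<Lambda> \<boxtimes> Phi F U \<Delta>))) g =
      character (direct_sum {\<Gamma>. \<Gamma> \<tturnstile> ?ns} (\<lambda>\<Gamma>. copies (?m \<Gamma>) (Phi F U \<Gamma>))) g" by (rule sym)
  qed
qed

end
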